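(* Let $S(t)=(\{T_k\}_{k\ge1},\{\lambda_j\}_{j\ge1},\{p_K\}_{K\ge1})$ be a hierarchical branching process, where $\{T_k\}$ is a sequence of nonnegative numbers, $\{\lambda_j\}$ is a sequence of positive numbers and $\{p_K\}$ is a probability mass function on $\{1,2,\dots\}$. Let $T:=T[S]\in\mathcal{L}$ be the random tree generated by $S(t)$. Then the following statements hold. (1) The combinatorial part of $T$ (i.e. the distribution of $\mathrm{shape}(T)$ on $\mathcal{T}$) is mean self-similar with Tokunaga coefficients $\{T_k\}$. (2) The combinatorial part of $T$ is (combinatorially) self-similar with Tokunaga coefficients $\{T_k\}$ if and only if $p_K=p(1-p)^{K-1}$, $K\ge1$, for some $0<p<1$. (3) The tree $T$ is self-similar (as a tree with edge lengths) with scaling exponent $\zeta>0$ if and only if $$p_K=p(1-p)^{K-1}\quad\text{and}\quad \lambda_j=\gamma\,\zeta^{-j}\qquad (K,j\ge1)$$ for some positive $\gamma$ and $0<p<1$.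
   Context: Trees. $\mathcal{T}$ is the space of finite unlabeled rooted reduced planted binary trees with no planar embedding (the root has degree 1, internal vertices have degree 3, leaves have degree 1), together with the empty tree $\phi$ (a single root vertex, no edges). $\mathcal{L}$ is the space of trees from $\mathcal{T}$ with positive edge lengths, and $\mathrm{shape}:\mathcal{L}\to\mathcal{T}$ forgets the lengths. $\mathcal{T}_{\rm plane},\mathcal{L}_{\rm plane}$ are the corresponding spaces of planar-embedded trees. Pruning $\mathcal{R}$ removes the leaves of a tree together with their parental edges and then performs series reduction (each degree-two vertex is removed by merging its two adjacent edges into one, adding their lengths in the case of edge lengths); $\mathcal{R}(\phi)=\phi$. For planar trees the embedding of the remaining part is unaffected. The Horton-Strahler order is $\mathsf{k}(T)=\min\{k\ge0:\mathcal{R}^k(T)=\phi\}$ (computed from $\mathrm{shape}(T)$), and $\mathcal{H}_K$ is the subspace of trees of order $K$. For a non-root vertex $v$, $T_v$ is the subtree rooted at the parent of $v$ and comprised of $v$ and all its descendants with their parental edges; the order of $v$ (and of its parental edge) is $\mathsf{k}(T_v)$. A (maximal) connected sequence of vertices of the same order together with their parental edges is a branch; its vertex closest to the root is its initial vertex. If $v$ is the initial vertex of a branch of order $K$, $T_v$ is called a complete subtree of order $K$. Hierarchical branching process. $S(t)=(\{T_k\},\{\lambda_j\},\{p_K\})$ is the multi-type continuous-time branching process that starts with a single root branch of order $K$ with probability $p_K$. Independently of the other branches, every branch of order $j$ produces offspring branches of each order $i<j$ with rate $\lambda_jT_{j-i}$, and terminates with rate $\lambda_j$. After termination, a branch of order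 $j\ge2$ splits into two branches of order $j-1$; a branch of order 1 terminates without leaving offspring. The branching history creates the random tree $T[S]\in\mathcal{L}$. Mean self-similarity. Let $\mu$ be a probability measure on $\mathcal{T}$, $p_K=\mu(\mathcal{H}_K)$, $\mu_K=\mu(\cdot\mid\mathcal{H}_K)$, so $\mu=\sum_{K\ge1}p_K\mu_K$ (for a hierarchical branching process $\mu_K$ is the law of $\mathrm{shape}(T[S])$ when the root branch has order $K$), and $\mathsf{E}_K$ the expectation under $\mu_K$. Let $N_k$ be the number of branches of order $k$ and, for $i<j$, $N_{i,j}$ the number of instances when an order-$i$ branch merges with an order-$j$ branch (side branches of order $\{i,j\}$). The Tokunaga coefficients are $T_{i,j}[K]=\mathsf{E}_K(N_{i,j})/\mathsf{E}_K(N_j)$, $1\le i<j\le K$. The measure is mean self-similar with Tokunaga coefficients $\{T_k\}$ if $T_{i,j}[K]=T_{j-i}$ for all $K\ge2$ and $1\le i<j\le K$ (i.e. $T_{i,j}[K]$ is independent of $K$ and depends on $i,j$ only through $j-i$). Combinatorial self-similarity. A measure $\mu$ on $\mathcal{T}$ with $\mu(\phi)=0$ is prune-invariant if, with $\nu=\mu\circ\mathcal{R}^{-1}$, $\nu(\tau\mid\tau\ne\phi)=\mu(\tau)$ for all $\tau\in\mathcal{T}$. For $H\ge K\ge1$ let $\mathrm{subtree}_{K,H}$ be a complete subtree of order $K$ chosen uniformly at random among all complete subtrees of order $K$ of a random tree of order $H$ with law $\mu_H$, and let $\mu_K^H$ be its law on $\mathcal{H}_K$. $\mu$ is coordinated if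 $\mu_K^H(\tau)=\mu_K(\tau)$ for all $H\ge K\ge1$, $\tau\in\mathcal{H}_K$. $\mu$ is (combinatorially) self-similar if it is coordinated and prune-invariant. Labeling. Edges of a tree in $\mathcal{L}$ are labeled in depth-first order (each edge takes the label of its lower, i.e. offspring, vertex) after applying a fixed proper embedding $\mathrm{embed}:\mathcal{L}\to\mathcal{L}_{\rm plane}$, proper meaning $\mathcal{R}(\mathrm{embed}(T))=\mathrm{embed}(\mathcal{R}(T))$ for all $T$. Such an embedding is built inductively on the order: all side branches go to the right; of the two merging complete subtrees $\tau_1\neq\tau_2$ of order $K$ forming a tree of order $K+1$, consider $d_i=\mathcal{R}^k(\tau_i)$ with the largest $k$ such that $d_1\ne d_2$ as combinatorial trees; these differ only in the numbers of order-1 side branches attached to the successive edges of the common tree $d_0=\mathcal{R}^{k+1}(\tau_i)$, and the one whose sequence of numbers has the smaller first non-coinciding entry branches to the right; if the two subtrees have the same shape, the one with the shorter root edge branches to the right. Self-similarity with edge lengths. For $T\in\mathcal{L}$ with edge-length vector $l_T=(l_1,\dots,l_{\#T})$ put $\mathrm{length}(T)=\sum_il_i$ and $x_T=l_T/\mathrm{length}(T)$. For a measure $\eta$ on $\mathcal{L}$ let $\mu$ be the law of $\mathrm{shape}(T)$, $\chi_\tau$ the conditional law of $x_T$ given $\mathrm{shape}(T)=\tau$, and $F_{\tau,\bar x}(\ell)$ the conditional law (density) of $\mathrm{length}(T)$ given $x_T=\bar x$, $\mathrm{shape}(T)=\tau$. Let $\mu_K^H,\chi^H_\tau,F^H_{\tau,\bar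 x}$ be the analogous laws for $\mathrm{subtree}_{K,H}$ (the uniform random complete subtree of order $K=\mathsf{k}(\tau)$ of a random tree conditioned to have order $H$), and let $\Xi_\tau$ and $\Phi_{\tau,\bar x}(\ell)$ be the conditional law of $x_{\mathcal{R}(T)}$ given $\mathrm{shape}(\mathcal{R}(T))=\tau$ and the conditional law (density) of $\mathrm{length}(\mathcal{R}(T))$ given $x_{\mathcal{R}(T)}=\bar x$, $\mathrm{shape}(\mathcal{R}(T))=\tau$. $\eta$ is self-similar with scaling exponent $\zeta>0$ if: (i) $\mu^H_K(\tau)=\mu_K(\tau)$ for all $H\ge K\ge1$, $\tau\in\mathcal{H}_K$; (ii) for all $H\ge K\ge1$, $\tau\in\mathcal{H}_K$: $\chi^H_\tau(\bar x)=\chi_\tau(\bar x)$ $\bar x$-a.s., and for every given $\bar x$, $F^H_{\tau,\bar x}(\ell)=F_{\tau,\bar x}(\ell)$ $\ell$-a.s.; (iii) $\mu(\tau)=\nu(\tau\mid\tau\ne\phi)$ for $\nu=\mu\circ\mathcal{R}^{-1}$; (iv) $\Xi_\tau(\bar x)=\chi_\tau(\bar x)$ and $\Phi_{\tau,\bar x}(\ell)=\zeta^{-1}F_{\tau,\bar x}(\ell/\zeta)$ for every combinatorial tree $\tau$. *)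

theory Defs
  imports "HOL-Probability.Probability" "HOL-Library.Uprod"
begin

section \<open>Trees\<close>

text \<open>
  A vertex of a nonempty planted binary tree other than the root is stored together with the label
  of its parental edge; the two offspring of an internal vertex form an unordered pair. The root is
  the upper end of the topmost edge and is not stored. The empty tree \<open>\<phi>\<close> is \<^const>\<open>None\<close>.
\<close>

datatype 'a utree = ULeaf 'a | UNode 'a "'a utree uprod"

typedef posreal = "{x::real. 0 < x}"
  morphisms real_of_posreal Abs_posreal
  by (rule exI[of _ 1]) simp

setup_lifting type_definition_posreal

lift_definition posreal_add :: "posreal \<Rightarrow> posreal \<Rightarrow> posreal" is "(+)" by simp

type_synonym ctree = "unit utree option"
type_synonym ltree = "posreal utree option"

definition ushape :: "'a utree \<Rightarrow> unit utree" where
  "ushape = map_utree (\<lambda>_. ())"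

definition shape :: "'a utree option \<Rightarrow> ctree" where
  "shape = map_option ushape"

lift_definition sum_uprod :: "'a::comm_monoid_add uprod \<Rightarrow> 'a" is "\<lambda>(x, y). x + y"
  by (auto simp: add.commute)

lemma sum_uprod_Upair [simp]: "sum_uprod (Upair x y) = x + y"
  by transfer simp


subsection \<open>Pruning\<close>

fun map_stem :: "('a \<Rightarrow> 'a) \<Rightarrow> 'a utree \<Rightarrow> 'a utree" where
  "map_stem h (ULeaf a) = ULeaf (h a)"
| "map_stem h (UNode a u) = UNode (h a) u"

text \<open>
  \<open>fuse f a (Upair s t)\<close> is what remains of a vertex with parental edge \<open>a\<close> when \<open>s\<close> and \<open>t\<close> remain
  of its two descendant subtrees. If exactly one of them is nonempty, the vertex has degree two and
  series reduction merges \<open>a\<close> with the edge below it; \<open>f\<close> combines the labels of merged edges.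
\<close>

lift_definition fuse :: "('a \<Rightarrow> 'a \<Rightarrow> 'a) \<Rightarrow> 'a \<Rightarrow> 'a utree option uprod \<Rightarrow> 'a utree option" is
  "\<lambda>f a (s, t). (case s of
      None \<Rightarrow> (case t of None \<Rightarrow> Some (ULeaf a) | Some t' \<Rightarrow> Some (map_stem (f a) t'))
    | Some s' \<Rightarrow> (case t of None \<Rightarrow> Some (map_stem (f a) s') | Some t' \<Rightarrow> Some (UNode a (Upair s' t'))))"
  by (force simp: eq_upair_def split: option.split)

lemma fuse_simps [simp]:
  "fuse f a (Upair None None) = Some (ULeaf a)"
  "fuse f a (Upair None (Some t)) = Some (map_stem (f a) t)"
  "fuse f a (Upair (Some s) None) = Some (map_stem (f a) s)"
  "fuse f a (Upair (Some s) (Some t)) = Some (UNode a (Upair s t))"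
  by (simp_all add: fuse.abs_eq Upair.abs_eq)

primrec prune_with :: "('a \<Rightarrow> 'a \<Rightarrow> 'a) \<Rightarrow> 'a utree \<Rightarrow> 'a utree option" where
  "prune_with f (ULeaf a) = None"
| "prune_with f (UNode a u) = fuse f a (map_uprod (prune_with f) u)"

definition cprune :: "ctree \<Rightarrow> ctree" where
  "cprune t = Option.bind t (prune_with (\<lambda>_ _. ()))"

definition lprune :: "ltree \<Rightarrow> ltree" where
  "lprune t = Option.bind t (prune_with posreal_add)"


subsection \<open>Horton-Strahler order, branches, complete subtrees\<close>

definition hs_order :: "'a utree option \<Rightarrow> nat" where
  "hs_order t = (LEAST k. (cprune ^^ k) (shape t) = None)"

abbreviation uorder :: "'a utree \<Rightarrow> nat" where
  "uorder t \<equiv> hs_order (Some t)"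

text \<open>
  For a nonempty tree, a vertex \<open>v\<close> is represented by the subtree \<open>T\<^sub>v\<close>; it is the initial vertex of a
  branch unless its parent is a non-root vertex of the same order. \<open>lower_tops\<close> collects \<open>T\<^sub>v\<close>, with
  multiplicity, over the initial vertices \<open>v\<close> strictly below the topmost edge.
\<close>

primrec lower_tops :: "'a utree \<Rightarrow> 'a utree multiset" where
  "lower_tops (ULeaf a) = {#}"
| "lower_tops (UNode a u) = sum_uprod (map_uprod
     (\<lambda>s. (if uorder s \<noteq> uorder (UNode a u) then {#s#} else {#}) + lower_tops s) u)"

definition complete_subtrees :: "nat \<Rightarrow> 'a utree option \<Rightarrow> 'a utree option multiset" where
  "complete_subtrees K t = (case t of
      None \<Rightarrow> {#}
    | Some s \<Rightarrow> image_mset Some {#r \<in># {#s#} + lower_tops s. uorder r = K#})"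

definition branches :: "nat \<Rightarrow> 'a utree option \<Rightarrow> nat" where
  "branches k t = size (complete_subtrees k t)"

primrec umerges :: "nat \<Rightarrow> nat \<Rightarrow> 'a utree \<Rightarrow> nat" where
  "umerges i j (ULeaf a) = 0"
| "umerges i j (UNode a u) =
     (if map_uprod uorder u = Upair i j then 1 else 0) + sum_uprod (map_uprod (umerges i j) u)"

definition side_branches :: "nat \<Rightarrow> nat \<Rightarrow> 'a utree option \<Rightarrow> nat" where
  "side_branches i j t = (case t of None \<Rightarrow> 0 | Some s \<Rightarrow> umerges i j s)"


section \<open>Planar embedding and edge labeling\<close>

datatype 'a ptree = PLeaf 'a | PNode 'a "'a ptree" "'a ptree"

fun forget :: "'a ptree \<Rightarrow> 'a utree" where
  "forget (PLeaf a) = ULeaf a"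
| "forget (PNode a l r) = UNode a (Upair (forget l) (forget r))"

fun dfs :: "'a ptree \<Rightarrow> 'a list" where
  "dfs (PLeaf a) = [a]"
| "dfs (PNode a l r) = a # dfs l @ dfs r"

fun pmap_stem :: "('a \<Rightarrow> 'a) \<Rightarrow> 'a ptree \<Rightarrow> 'a ptree" where
  "pmap_stem h (PLeaf a) = PLeaf (h a)"
| "pmap_stem h (PNode a l r) = PNode (h a) l r"

fun pprune_with :: "('a \<Rightarrow> 'a \<Rightarrow> 'a) \<Rightarrow> 'a ptree \<Rightarrow> 'a ptree option" where
  "pprune_with f (PLeaf a) = None"
| "pprune_with f (PNode a l r) = (case pprune_with f l of
      None \<Rightarrow> (case pprune_with f r of
          None \<Rightarrow> Some (PLeaf a)
        | Some r' \<Rightarrow> Some (pmap_stem (f a) r'))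
    | Some l' \<Rightarrow> (case pprune_with f r of
          None \<Rightarrow> Some (pmap_stem (f a) l')
        | Some r' \<Rightarrow> Some (PNode a l' r')))"

text \<open>
  \<open>side_counts d\<close> lists, over the edges of the pruned tree in depth-first order, the numbers of
  order-one side branches of \<open>d\<close> attached to them: starting from labels \<open>0\<close>, every merger of two
  edges removes exactly one point of attachment of such a side branch.
\<close>

definition side_counts :: "'a ptree option \<Rightarrow> nat list" where
  "side_counts d = (case Option.bind d (\<lambda>p. pprune_with (\<lambda>m n. m + n + 1) (map_ptree (\<lambda>_. 0) p)) of
      None \<Rightarrow> [] | Some q \<Rightarrow> dfs q)"

definition pprune_iter :: "nat \<Rightarrow> posreal ptree \<Rightarrow> posreal ptree option" where
  "pprune_iter k p = ((\<lambda>d. Option.bind d (pprune_with posreal_add)) ^^ k) (Some p)"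

abbreviation pshape :: "posreal ptree option \<Rightarrow> ctree" where
  "pshape d \<equiv> shape (map_option forget d)"

abbreviation dfs_lengths :: "posreal ptree \<Rightarrow> real list" where
  "dfs_lengths p \<equiv> map real_of_posreal (dfs p)"

text \<open>
  \<open>goes_right q p\<close>: of two sibling subtrees, already embedded as \<open>p\<close> and \<open>q\<close>, it is \<open>q\<close> that branches
  to the right. The lists compared with \<^const>\<open>ord_class.lexordp\<close> have equal lengths for the
  subtrees to which this is applied. In the last case the first entries are the lengths of the root
  edges; the remaining entries matter only if these coincide, and then make the choice canonical.
\<close>

definition goes_right :: "posreal ptree \<Rightarrow> posreal ptree \<Rightarrow> bool" where
  "goes_right q p \<longleftrightarrow>
     uorder (forget q) < uorder (forget p) \<or>
     (uorder (forget q) = uorder (forget p) \<and>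
      (if ushape (forget q) \<noteq> ushape (forget p)
       then let k = (GREATEST k. pshape (pprune_iter k q) \<noteq> pshape (pprune_iter k p))
            in ord_class.lexordp (side_counts (pprune_iter k q)) (side_counts (pprune_iter k p))
       else ord_class.lexordp (dfs_lengths q) (dfs_lengths p)))"

definition arrange :: "posreal \<Rightarrow> posreal ptree uprod \<Rightarrow> posreal ptree" where
  "arrange a u = (THE r. \<exists>p q. u = Upair p q \<and> (goes_right q p \<or> q = p) \<and> r = PNode a p q)"

primrec embed :: "posreal utree \<Rightarrow> posreal ptree" where
  "embed (ULeaf a) = PLeaf a"
| "embed (UNode a u) = arrange a (map_uprod embed u)"

definition edge_lengths :: "ltree \<Rightarrow> real list" where
  "edge_lengths t = (case t of None \<Rightarrow> [] | Some s \<Rightarrow> dfs_lengths (embed s))"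

definition tree_length :: "ltree \<Rightarrow> real" where
  "tree_length t = sum_list (edge_lengths t)"

definition proportions :: "ltree \<Rightarrow> real list" where
  "proportions t = map (\<lambda>l. l / tree_length t) (edge_lengths t)"


section \<open>Measures on trees\<close>

text \<open>Vectors whose dimension depends on the tree are padded with zeros.\<close>

definition pad :: "real list \<Rightarrow> nat \<Rightarrow> real" where
  "pad xs i = (if i < length xs then xs ! i else 0)"

abbreviation vec_space :: "(nat \<Rightarrow> real) measure" where
  "vec_space \<equiv> \<Pi>\<^sub>M i\<in>UNIV. borel"

text \<open>The \<open>\<sigma>\<close>-algebra on trees with edge lengths generated by the shape and the edge-length vector.\<close>

definition ltree_space :: "ltree measure" where
  "ltree_space = vimage_algebra UNIV (\<lambda>t. (shape t, pad (edge_lengths t)))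
     (count_space UNIV \<Otimes>\<^sub>M vec_space)"

text \<open>
  A probability measure on trees is given by the probabilities \<open>p\<^sub>K\<close> of the orders and by a family
  \<open>M\<close> of its conditional laws \<open>M K\<close> given that the order is \<open>K\<close>. Giving the family explicitly
  also provides the laws \<open>M K\<close> for those \<open>K\<close> with \<open>p\<^sub>K = 0\<close>.
\<close>

definition order_family :: "(nat \<Rightarrow> 'a utree option measure) \<Rightarrow> bool" where
  "order_family M \<longleftrightarrow> (\<forall>K\<ge>1. prob_space (M K) \<and> (AE t in M K. hs_order t = K))"

definition mixture :: "nat pmf \<Rightarrow> (nat \<Rightarrow> 'a measure) \<Rightarrow> 'a measure" where
  "mixture p M = measure_pmf p \<bind> M"

definition shape_law :: "ltree measure \<Rightarrow> ctree measure" where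
  "shape_law \<eta> = distr \<eta> (count_space UNIV) shape"

text \<open>\<open>subtree_law M K H\<close> is the law of a uniform random complete subtree of order \<open>K\<close> of a random
  tree with law \<open>M H\<close>.\<close>

definition subtree_law ::
    "(nat \<Rightarrow> 'a utree option measure) \<Rightarrow> nat \<Rightarrow> nat \<Rightarrow> 'a utree option measure" where
  "subtree_law M K H = M H \<bind>
     (\<lambda>t. distr (measure_pmf (pmf_of_multiset (complete_subtrees K t))) (M H) (\<lambda>s. s))"


subsection \<open>Mean and combinatorial self-similarity\<close>

definition tokunaga :: "(nat \<Rightarrow> ctree measure) \<Rightarrow> nat \<Rightarrow> nat \<Rightarrow> nat \<Rightarrow> real" where
  "tokunaga \<mu> i j K =
     (\<integral>t. real (side_branches i j t) \<partial>\<mu> K) / (\<integral>t. real (branches j t) \<partial>\<mu> K)"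

text \<open>Integrability is required since the Bochner integral of a nonintegrable function is \<open>0\<close>.\<close>

definition mean_self_similar :: "(nat \<Rightarrow> ctree measure) \<Rightarrow> (nat \<Rightarrow> real) \<Rightarrow> bool" where
  "mean_self_similar \<mu> Tk \<longleftrightarrow> order_family \<mu> \<and>
     (\<forall>K i j. 2 \<le> K \<and> 1 \<le> i \<and> i < j \<and> j \<le> K \<longrightarrow>
        integrable (\<mu> K) (\<lambda>t. real (side_branches i j t)) \<and>
        integrable (\<mu> K) (\<lambda>t. real (branches j t)) \<and>
        tokunaga \<mu> i j K = Tk (j - i))"

definition coordinated :: "(nat \<Rightarrow> ctree measure) \<Rightarrow> bool" where
  "coordinated \<mu> \<longleftrightarrow> (\<forall>K H \<tau>. 1 \<le> K \<and> K \<le> H \<and> hs_order \<tau> = K \<longrightarrow>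
     measure (subtree_law \<mu> K H) {\<tau>} = measure (\<mu> K) {\<tau>})"

definition prune_invariant :: "ctree measure \<Rightarrow> bool" where
  "prune_invariant \<mu> \<longleftrightarrow> measure \<mu> {None} = 0 \<and>
     (let \<nu> = distr \<mu> (count_space UNIV) cprune
      in \<forall>\<tau>. \<P>(t in \<nu>. t = \<tau> \<bar> t \<noteq> None) = measure \<mu> {\<tau>})"

definition self_similar :: "nat pmf \<Rightarrow> (nat \<Rightarrow> ctree measure) \<Rightarrow> bool" where
  "self_similar p \<mu> \<longleftrightarrow> order_family \<mu> \<and> coordinated \<mu> \<and> prune_invariant (mixture p \<mu>)"


subsection \<open>Self-similarity of trees with edge lengths\<close>

definition given_shape :: "ltree measure \<Rightarrow> ctree \<Rightarrow> ltree measure" where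
  "given_shape \<eta> \<tau> = uniform_measure \<eta> {t \<in> space \<eta>. shape t = \<tau>}"

definition proportions_law :: "ltree measure \<Rightarrow> ctree \<Rightarrow> (nat \<Rightarrow> real) measure" where
  "proportions_law \<eta> \<tau> = distr (given_shape \<eta> \<tau>) vec_space (\<lambda>t. pad (proportions t))"

text \<open>\<open>F\<close> is a version of the conditional density of the length of the tree given its shape \<open>\<tau>\<close> and
  the vector of proportions.\<close>

definition length_density ::
    "ltree measure \<Rightarrow> ctree \<Rightarrow> ((nat \<Rightarrow> real) \<Rightarrow> real \<Rightarrow> real) \<Rightarrow> bool" where
  "length_density \<eta> \<tau> F \<longleftrightarrow>
     (\<lambda>(x, l). F x l) \<in> borel_measurable (vec_space \<Otimes>\<^sub>M lborel) \<and>
     (\<forall>x l. 0 \<le> F x l) \<and>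
     distr (given_shape \<eta> \<tau>) (vec_space \<Otimes>\<^sub>M lborel) (\<lambda>t. (pad (proportions t), tree_length t)) =
       density (proportions_law \<eta> \<tau> \<Otimes>\<^sub>M lborel) (\<lambda>(x, l). ennreal (F x l))"

text \<open>
  Conditioning on the shape \<open>\<tau>\<close> makes sense only if \<open>\<tau>\<close> has positive probability. Under the
  first and third clauses, \<open>\<tau>\<close> then also has positive probability as the shape of a random complete
  subtree and of the pruned tree. Conditional densities are determined up to null sets of
  proportions, hence the existential quantifiers over their versions.
\<close>

definition length_self_similar :: "nat pmf \<Rightarrow> (nat \<Rightarrow> ltree measure) \<Rightarrow> real \<Rightarrow> bool" where
  "length_self_similar p M \<zeta> \<longleftrightarrow> order_family M \<and>
     (let \<mu> = (\<lambda>K. shape_law (M K));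
          \<eta> = mixture p M;
          \<eta>' = distr \<eta> ltree_space lprune
      in
        (\<forall>K H \<tau>. 1 \<le> K \<and> K \<le> H \<and> hs_order \<tau> = K \<longrightarrow>
           measure (shape_law (subtree_law M K H)) {\<tau>} = measure (\<mu> K) {\<tau>}) \<and>
        (\<forall>K H \<tau>. 1 \<le> K \<and> K \<le> H \<and> hs_order \<tau> = K \<and> measure (\<mu> K) {\<tau>} > 0 \<longrightarrow>
           proportions_law (subtree_law M K H) \<tau> = proportions_law (M K) \<tau> \<and>
           (\<exists>F F'. length_density (M K) \<tau> F \<and> length_density (subtree_law M K H) \<tau> F' \<and>
              (\<forall>x. AE l in lborel. F' x l = F x l))) \<and>
        prune_invariant (shape_law \<eta>) \<and>
        (\<forall>\<tau>. measure (shape_law \<eta>) {\<tau>} > 0 \<longrightarrow>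
           proportions_law \<eta>' \<tau> = proportions_law \<eta> \<tau> \<and>
           (\<exists>F \<Phi>. length_density \<eta> \<tau> F \<and> length_density \<eta>' \<tau> \<Phi> \<and>
              (\<forall>x l. \<Phi> x l = inverse \<zeta> * F x (l / \<zeta>)))))"


section \<open>The hierarchical branching process\<close>

text \<open>
  The Markov branching process is built from independent unit exponential clocks \<open>\<omega> (u, e)\<close>, where
  \<open>u\<close> is the address of an edge, that is, of a piece of a branch between successive events. While a
  branch has order \<open>j\<close>, event \<open>0\<close> is its termination, with rate \<open>\<lambda>\<^sub>j\<close>, and event \<open>i\<close> for \<open>1 \<le> i < j\<close>
  is the production of an offspring branch of order \<open>i\<close>, with rate \<open>\<lambda>\<^sub>j T\<^sub>j\<^sub>-\<^sub>i\<close>. The event whose clock rings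
  first takes place and ends the edge.
\<close>

definition rate :: "(nat \<Rightarrow> real) \<Rightarrow> (nat \<Rightarrow> real) \<Rightarrow> nat \<Rightarrow> nat \<Rightarrow> real" where
  "rate Tk lam j e = (if e = 0 then lam j else lam j * Tk (j - e))"

definition events :: "(nat \<Rightarrow> real) \<Rightarrow> (nat \<Rightarrow> real) \<Rightarrow> nat \<Rightarrow> nat set" where
  "events Tk lam j = {e. (e = 0 \<or> e < j) \<and> rate Tk lam j e > 0}"

type_synonym clocks = "bool list \<times> nat \<Rightarrow> real"

definition ring_time ::
    "(nat \<Rightarrow> real) \<Rightarrow> (nat \<Rightarrow> real) \<Rightarrow> clocks \<Rightarrow> bool list \<Rightarrow> nat \<Rightarrow> nat \<Rightarrow> real" where
  "ring_time Tk lam \<omega> u j e = \<omega> (u, e) / rate Tk lam j e"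

definition first_event ::
    "(nat \<Rightarrow> real) \<Rightarrow> (nat \<Rightarrow> real) \<Rightarrow> clocks \<Rightarrow> bool list \<Rightarrow> nat \<Rightarrow> nat" where
  "first_event Tk lam \<omega> u j = (LEAST e. e \<in> events Tk lam j \<and>
     (\<forall>e'\<in>events Tk lam j. ring_time Tk lam \<omega> u j e \<le> ring_time Tk lam \<omega> u j e'))"

definition waiting_time ::
    "(nat \<Rightarrow> real) \<Rightarrow> (nat \<Rightarrow> real) \<Rightarrow> clocks \<Rightarrow> bool list \<Rightarrow> nat \<Rightarrow> real" where
  "waiting_time Tk lam \<omega> u j = ring_time Tk lam \<omega> u j (first_event Tk lam \<omega> u j)"

text \<open>\<open>grows Tk lam \<omega> u j t\<close>: the branching history that starts with the edge at address \<open>u\<close>, in a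
  branch of order \<open>j\<close>, is finite and creates the tree \<open>t\<close>.\<close>

inductive grows ::
    "(nat \<Rightarrow> real) \<Rightarrow> (nat \<Rightarrow> real) \<Rightarrow> clocks \<Rightarrow> bool list \<Rightarrow> nat \<Rightarrow> posreal utree \<Rightarrow> bool"
  for Tk lam \<omega> where
  terminate:
    "\<lbrakk>j = 1; first_event Tk lam \<omega> u j = 0; real_of_posreal l = waiting_time Tk lam \<omega> u j\<rbrakk>
     \<Longrightarrow> grows Tk lam \<omega> u j (ULeaf l)"
| split:
    "\<lbrakk>j \<ge> 2; first_event Tk lam \<omega> u j = 0; real_of_posreal l = waiting_time Tk lam \<omega> u j;
      grows Tk lam \<omega> (False # u) (j - 1) s; grows Tk lam \<omega> (True # u) (j - 1) t\<rbrakk>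
     \<Longrightarrow> grows Tk lam \<omega> u j (UNode l (Upair s t))"
| offspring:
    "\<lbrakk>first_event Tk lam \<omega> u j = i; 1 \<le> i; i < j;
      real_of_posreal l = waiting_time Tk lam \<omega> u j;
      grows Tk lam \<omega> (False # u) j s; grows Tk lam \<omega> (True # u) i t\<rbrakk>
     \<Longrightarrow> grows Tk lam \<omega> u j (UNode l (Upair s t))"

text \<open>The value \<^const>\<open>None\<close> is taken only on the null event that the history is infinite or some waiting
  time is not positive.\<close>

definition hbp_tree :: "(nat \<Rightarrow> real) \<Rightarrow> (nat \<Rightarrow> real) \<Rightarrow> nat \<Rightarrow> clocks \<Rightarrow> ltree" where
  "hbp_tree Tk lam K \<omega> =
     (if \<exists>t. grows Tk lam \<omega> [] K t then Some (THE t. grows Tk lam \<omega> [] K t) else None)"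

definition clock_space :: "clocks measure" where
  "clock_space = (\<Pi>\<^sub>M c\<in>UNIV. density lborel (exponential_density 1))"

text \<open>The law of the tree \<open>T[S]\<close> given that the root branch has order \<open>K\<close>. The law of \<open>T[S]\<close> itself is
  the mixture of these laws with weights \<open>p\<^sub>K\<close>.\<close>

definition hbp_law :: "(nat \<Rightarrow> real) \<Rightarrow> (nat \<Rightarrow> real) \<Rightarrow> nat \<Rightarrow> ltree measure" where
  "hbp_law Tk lam K = distr clock_space ltree_space (hbp_tree Tk lam K)"

end

theory Submission
  imports Defs
begin

text \<open>
  The history of the process started by a branch of order \<open>j\<close> is almost surely a finite planar tree,
  and its law is determined by conditioning on the first event: the topmost edge is exponential with
  rate \<open>\<lambda>\<^sub>j (1 + T\<^sub>1 + \<dots> + T\<^bsub>j-1\<^esub>)\<close>, and, independently, the event is the termination of the branch or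
  the birth of a side branch of order \<open>i\<close> with probabilities proportional to \<open>1\<close> and \<open>T\<^bsub>j-i\<^esub>\<close>.
  Integrating the numbers of branches and of mergers against this equation gives the Tokunaga
  coefficients. Given the part of the tree above order \<open>K\<close>, every complete subtree of order \<open>K\<close> has
  the law of the whole tree started by a branch of order \<open>K\<close>, with its lengths; this is coordination.

  Pruning joins the edges at the side branches of order one. A geometric sum of independent
  exponential variables is exponential, so the pruned tree solves the equation for the rates
  \<open>\<lambda>\<^bsub>j+1\<^esub>\<close>, the same coefficients and the order reduced by one. Prune invariance therefore
  amounts to \<open>p\<^bsub>K+1\<^esub> / (1 - p\<^sub>1) = p\<^sub>K\<close>.

  Given the shape and the proportions of the edge lengths, the total length has a gamma density, and
  \<open>\<lambda>\<^bsub>j+1\<^esub> = \<lambda>\<^sub>j / \<zeta>\<close> makes pruning act on the lengths as the dilation by \<open>\<zeta>\<close>. Conversely, the mean lengths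
  of the perfect binary trees of all orders, before and after pruning, force this relation.
\<close>

section \<open>Planar representatives\<close>

text \<open>Unordered pairs come without a depth-first list or a left and a right factor, so laws
  are handled on planar trees \<open>ptree\<close> and brought down by \<open>forget\<close>. The
  price lies in the lengths: they are labelled by \<open>embed\<close>, not by the birth order of
  the history, so the embedding must be shown total, proper and measurable. The equation at the
  first event refers back to the same order, because a branch survives the birth of a side branch;
  induction on the order alone does not suffice. Integrals are therefore cut off at a height,
  treated by induction on it and recovered by monotone convergence. The gamma density comes from a
  change of measure: dilating the tree by u changes its law by a density with one factor per edge,
  since waiting times are independent of the kinds of events. Perfect trees serve for the converse
  because they have positive probability in every order, have a single planar form, and their mean
  lengths obey a recursion from which the edge rates can be read off order by order.\<close>

primrec porder :: "'a ptree \<Rightarrow> nat" where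
  "porder (PLeaf a) = 1"
| "porder (PNode a l r) = (if porder l = porder r then Suc (porder l) else max (porder l) (porder r))"

abbreviation plane_shape :: "'a ptree \<Rightarrow> unit ptree" where
  "plane_shape \<equiv> map_ptree (\<lambda>_. ())"

lemma porder_pos [simp]: "0 < porder p"
  by (induction p) auto

lemma porder_neq_0 [simp]: "porder p \<noteq> 0"
  using porder_pos[of p] by linarith

lemma porder_ge_1 [simp]: "Suc 0 \<le> porder p"
  using porder_pos[of p] by linarith

lemma porder_map_ptree [simp]: "porder (map_ptree f p) = porder p"
  by (induction p) auto

lemma plane_shape_unit [simp]: "plane_shape p = p"
  by (induction p) auto

lemma porder_cong: "plane_shape p = plane_shape q \<Longrightarrow> porder p = porder q"
  by (metis porder_map_ptree)

lemma forget_map_ptree: "forget (map_ptree f p) = map_utree f (forget p)"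
  by (induction p) auto

lemma ushape_forget: "ushape (forget p) = forget (plane_shape p)"
  by (simp add: ushape_def forget_map_ptree)

lemma forget_surj: "\<exists>p. t = forget p"
proof (induction t)
  case (ULeaf a)
  show ?case by (rule exI[of _ "PLeaf a"]) simp
next
  case (UNode a u)
  obtain s t where u: "u = Upair s t" by (cases u)
  with UNode obtain p q where "s = forget p" "t = forget q" by (metis set_uprod_simps insertCI)
  with u show ?case by (intro exI[of _ "PNode a p q"]) simp
qed

lemma forget_pmap_stem: "forget (pmap_stem h p) = map_stem h (forget p)"
  by (cases p) auto

lemma porder_pmap_stem [simp]: "porder (pmap_stem h p) = porder p"
  by (cases p) auto

lemma plane_shape_pmap_stem [simp]: "plane_shape (pmap_stem h p) = plane_shape p"
  by (cases p) auto

lemma prune_with_forget: "prune_with f (forget p) = map_option forget (pprune_with f p)"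
  by (induction p) (auto simp: forget_pmap_stem split: option.split)

text \<open>Both cases are proved at once because series reduction at a node depends on which
  children vanish, and a child vanishes exactly when its order is 1. Merging edges leaves orders
  alone.\<close>

lemma pprune_with_porder:
  "case pprune_with f p of None \<Rightarrow> porder p = 1 | Some q \<Rightarrow> porder p = Suc (porder q)"
  by (induction p) (auto split: option.split)

lemma pprune_with_eq_None: "pprune_with f p = None \<longleftrightarrow> porder p = 1"
  using pprune_with_porder[of p f] by (auto split: option.splits)

lemma porder_pprune: "pprune_with f p = Some q \<Longrightarrow> porder p = Suc (porder q)"
  using pprune_with_porder[of p f] by auto

lemma pmap_stem_map_ptree: "(\<And>x. g (h x) = k (g x)) \<Longrightarrow> map_ptree g (pmap_stem h p) = pmap_stem k (map_ptree g p)"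
  by (cases p) auto

lemma pprune_with_map_ptree:
  assumes "\<And>x y. g (f x y) = f' (g x) (g y)"
  shows "pprune_with f' (map_ptree g p) = map_option (map_ptree g) (pprune_with f p)"
proof (induction p)
  case (PNode a l r)
  have *: "map_ptree g (pmap_stem (f a) q) = pmap_stem (f' (g a)) (map_ptree g q)" for q
    by (rule pmap_stem_map_ptree) (simp add: assms)
  show ?case using PNode by (auto simp: * split: option.split)
qed simp

lemma plane_shape_pprune:
  "map_option plane_shape (pprune_with f p) = pprune_with (\<lambda>_ _. ()) (plane_shape p)"
  by (simp add: pprune_with_map_ptree[of "\<lambda>_. ()" f "\<lambda>_ _. ()"])

lemma cprune_shape: "cprune (shape (Some (forget p))) = shape (map_option forget (pprune_with f p))"
  by (simp add: cprune_def shape_def ushape_forget prune_with_forget flip: plane_shape_pprune[of f])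
     (simp add: option.map_comp comp_def ushape_forget)

text \<open>Each pruning lowers the order by exactly one, and the empty tree is a fixed point of
  \<open>cprune\<close>.\<close>

lemma cprune_funpow_eq_None:
  "(cprune ^^ k) (Some (forget (p :: unit ptree))) = None \<longleftrightarrow> porder p \<le> k"
proof (induction k arbitrary: p)
  case 0
  show ?case using porder_pos[of p] by (simp del: porder_pos)
next
  case (Suc k)
  have N: "(cprune ^^ k) None = None" for k
    by (induction k) (simp_all add: cprune_def)
  have *: "cprune (Some (forget p)) = map_option forget (pprune_with (\<lambda>_ _. ()) p)"
    by (simp add: cprune_def prune_with_forget)
  show ?case
  proof (cases "pprune_with (\<lambda>_ _. ()) p")
    case None
    then have "porder p = 1" by (simp add: pprune_with_eq_None)
    with None show ?thesis by (simp add: funpow_Suc_right * N del: funpow.simps)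
  next
    case (Some q)
    then show ?thesis using porder_pprune[OF Some] Suc[of q]
      by (simp add: funpow_Suc_right * del: funpow.simps)
  qed
qed

lemma uorder_forget [simp]: "uorder (forget p) = porder p"
  by (simp add: hs_order_def shape_def ushape_forget cprune_funpow_eq_None Least_equality)

lemma hs_order_None [simp]: "hs_order None = 0"
  by (simp add: hs_order_def shape_def)

text \<open>The descent stops at the first vertex of order K on each path: vertices of order K below
  it continue the same branch, so these are the complete subtrees of order K.\<close>

primrec tops :: "nat \<Rightarrow> 'a ptree \<Rightarrow> 'a ptree multiset" where
  "tops K (PLeaf a) = (if K = 1 then {#PLeaf a#} else {#})"
| "tops K (PNode a l r) =
     (if porder (PNode a l r) = K then {#PNode a l r#} else tops K l + tops K r)"

lemma tops_empty: "porder p < K \<Longrightarrow> tops K p = {#}"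
  by (induction p) (auto split: if_splits)

lemma tops_self: "porder p = K \<Longrightarrow> tops K p = {#p#}"
  by (cases p) auto

lemma tops_nonempty: "1 \<le> K \<Longrightarrow> K \<le> porder p \<Longrightarrow> tops K p \<noteq> {#}"
  by (induction p) (auto simp: max_def split: if_splits)

primrec plower :: "'a ptree \<Rightarrow> 'a ptree multiset" where
  "plower (PLeaf a) = {#}"
| "plower (PNode a l r) =
     (if porder l \<noteq> porder (PNode a l r) then {#l#} else {#}) + plower l +
     ((if porder r \<noteq> porder (PNode a l r) then {#r#} else {#}) + plower r)"

lemma lower_tops_forget: "lower_tops (forget p) = image_mset forget (plower p)"
proof (induction p)
  case (PNode a l r)
  have "uorder (UNode a (Upair (forget l) (forget r))) = porder (PNode a l r)"
    by (simp flip: uorder_forget)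
  then show ?case using PNode by (simp del: porder.simps)
qed simp

text \<open>\<open>plower\<close> lists initial vertices strictly below the top edge, so the vertex
  of the top edge enters separately. If it has order K itself, every vertex of order K below lies on
  its branch and contributes nothing.\<close>

lemma filter_plower:
  "(if porder p = K then {#p#} else {#}) + {#r \<in># plower p. porder r = K#} = tops K p"
proof (induction p)
  case (PNode a l r)
  let ?p = "PNode a l r"
  have IH: "porder q = K \<Longrightarrow> {#r \<in># plower q. porder r = K#} = {#}"
      "porder q \<noteq> K \<Longrightarrow> {#r \<in># plower q. porder r = K#} = tops K q" if "q \<in> {l, r}" for q
    using PNode that by (auto simp: tops_self split: if_splits)
  show ?case
  proof (cases "porder ?p = K")
    case True
    have "{#r \<in># plower q. porder r = K#} = {#}" if "q \<in> {l, r}" for q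
    proof (cases "porder q = K")
      case False
      moreover have "porder q \<le> K" using True that by (auto split: if_splits)
      ultimately show ?thesis using IH(2)[OF that] tops_empty[of q K] by auto
    qed (use IH that in auto)
    then show ?thesis using True by auto
  next
    case False
    then have "tops K ?p = tops K l + tops K r" by (simp del: porder.simps)
    moreover have "{#r \<in># (if porder l \<noteq> porder ?p then {#l#} else {#}) + plower l. porder r = K#} = tops K l"
      using PNode(1) False by (cases "porder l = K") (auto simp del: porder.simps)
    moreover have "{#s \<in># (if porder r \<noteq> porder ?p then {#r#} else {#}) + plower r. porder s = K#} = tops K r"
      using PNode(2) False by (cases "porder r = K") (auto simp del: porder.simps)
    ultimately have "{#r \<in># plower ?p. porder r = K#} = tops K ?p"
      by (simp del: porder.simps)
    then show ?thesis using False by (simp del: porder.simps)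
  qed
qed auto

lemma complete_subtrees_forget:
  "complete_subtrees K (Some (forget p)) = image_mset (\<lambda>q. Some (forget q)) (tops K p)"
proof -
  have "{#r \<in># {#forget p#} + lower_tops (forget p). uorder r = K#} = image_mset forget (tops K p)"
    using arg_cong[OF filter_plower[of p K], of "image_mset forget"]
    by (auto simp: lower_tops_forget filter_mset_image_mset o_def split: if_splits)
  then show ?thesis
    by (simp add: complete_subtrees_def image_mset.compositionality o_def)
qed

primrec pmerges :: "nat \<Rightarrow> nat \<Rightarrow> 'a ptree \<Rightarrow> nat" where
  "pmerges i j (PLeaf a) = 0"
| "pmerges i j (PNode a l r) =
     (if porder l = i \<and> porder r = j \<or> porder l = j \<and> porder r = i then 1 else 0)
     + pmerges i j l + pmerges i j r"

lemma side_branches_forget: "side_branches i j (Some (forget p)) = pmerges i j p"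
proof -
  have "umerges i j (forget p) = pmerges i j p"
    by (induction p) auto
  then show ?thesis by (simp add: side_branches_def)
qed

lemma tops_map_ptree: "tops K (map_ptree f p) = image_mset (map_ptree f) (tops K p)"
  by (induction p) auto

lemma pmerges_map_ptree [simp]: "pmerges i j (map_ptree f p) = pmerges i j p"
  by (induction p) auto

section \<open>The embedding\<close>

lemma length_dfs_map_ptree [simp]: "length (dfs (map_ptree f p)) = length (dfs p)"
  by (induction p) auto

lemma dfs_map_ptree: "dfs (map_ptree f p) = map f (dfs p)"
  by (induction p) auto

lemma dfs_neq_Nil [simp]: "dfs p \<noteq> []"
  by (cases p) auto

lemma dfs_inject:
  "plane_shape p = plane_shape q \<Longrightarrow> dfs p = dfs q \<Longrightarrow> p = q"
proof (induction p arbitrary: q)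
  case (PLeaf a)
  then show ?case by (cases q) auto
next
  case (PNode a l r)
  then obtain b l' r' where q: "q = PNode b l' r'" by (cases q) auto
  from PNode.prems q have "length (dfs l) = length (dfs l')"
    by (metis length_dfs_map_ptree ptree.map(2) ptree.inject(2))
  with PNode q show ?case by auto
qed

definition merge_counts :: "unit ptree \<Rightarrow> nat ptree option" where
  "merge_counts d = pprune_with (\<lambda>m n. m + n + 1) (map_ptree (\<lambda>_. 0) d)"

lemma plane_shape_merge_counts:
  "map_option plane_shape (merge_counts d) = pprune_with (\<lambda>_ _. ()) d"
  by (simp add: merge_counts_def plane_shape_pprune ptree.map_comp o_def ptree.map_ident)

primrec attach :: "nat \<Rightarrow> unit utree \<Rightarrow> unit utree" where
  "attach 0 t = t"
| "attach (Suc n) t = UNode () (Upair (ULeaf ()) (attach n t))"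

text \<open>Inverse of pruning at the level of shapes: a label n puts n leaves back on the edge, and
  a leaf of the pruned tree regains the pair of leaves that pruning removed.\<close>

primrec unprune :: "nat ptree \<Rightarrow> unit utree" where
  "unprune (PLeaf n) = attach n (UNode () (Upair (ULeaf ()) (ULeaf ())))"
| "unprune (PNode n a b) = attach n (UNode () (Upair (unprune a) (unprune b)))"

lemma unprune_pmap_stem: "unprune (pmap_stem (\<lambda>n. 0 + n + 1) q) = UNode () (Upair (ULeaf ()) (unprune q))"
  by (cases q) auto

lemma unprune_merge_counts:
  "case merge_counts d of None \<Rightarrow> forget d = ULeaf () | Some q \<Rightarrow> forget d = unprune q"
proof (induction d)
  case (PNode a l r)
  then show ?case
    using unprune_pmap_stem
    by (auto simp: merge_counts_def split: option.splits)
qed (auto simp: merge_counts_def)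

definition scounts :: "unit ptree option \<Rightarrow> nat list" where
  "scounts d = (case Option.bind d merge_counts of None \<Rightarrow> [] | Some q \<Rightarrow> dfs q)"

lemma side_counts_eq: "side_counts d = scounts (map_option plane_shape d)"
  by (cases d) (auto simp: side_counts_def scounts_def merge_counts_def ptree.map_comp o_def)

text \<open>Counts and planar shape determine the labelled pruned tree, from which
  \<open>unprune\<close> rebuilds the shape. Distinct shapes with the same planar pruning thus have
  distinct counts, so the comparison of siblings cannot tie.\<close>

lemma scounts_inject:
  assumes "pprune_with (\<lambda>_ _. ()) d = pprune_with (\<lambda>_ _. ()) e" "scounts (Some d) = scounts (Some e)"
  shows "forget d = forget e"
proof -
  have "map_option plane_shape (merge_counts d) = map_option plane_shape (merge_counts e)"
    by (simp add: plane_shape_merge_counts assms)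
  then have "merge_counts d = merge_counts e"
    using assms(2) by (auto simp: scounts_def intro: dfs_inject split: option.splits)
  with unprune_merge_counts[of d] unprune_merge_counts[of e] show ?thesis
    by (auto split: option.splits)
qed

section \<open>The comparison of sibling subtrees\<close>

lemma pprune_iter_0 [simp]: "pprune_iter 0 p = Some p"
  by (simp add: pprune_iter_def)

lemma pprune_iter_Suc: "pprune_iter (Suc k) p = Option.bind (pprune_iter k p) (pprune_with posreal_add)"
  by (simp add: pprune_iter_def)

lemma pprune_iter_Suc_Some:
  "pprune_with posreal_add p = Some p' \<Longrightarrow> pprune_iter (Suc k) p = pprune_iter k p'"
  by (simp add: pprune_iter_def funpow_Suc_right del: funpow.simps)

lemma plane_shape_pprune_iter_Suc:
  "map_option plane_shape (pprune_iter (Suc k) p) =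
   Option.bind (map_option plane_shape (pprune_iter k p)) (pprune_with (\<lambda>_ _. ()))"
  by (cases "pprune_iter k p") (auto simp: pprune_iter_Suc plane_shape_pprune)

lemma plane_shape_pprune_iter_cong:
  "plane_shape p = plane_shape q \<Longrightarrow>
   map_option plane_shape (pprune_iter k p) = map_option plane_shape (pprune_iter k q)"
  by (induction k) (auto simp: plane_shape_pprune_iter_Suc)

lemma pshape_eq: "pshape d = map_option forget (map_option plane_shape d)"
  by (cases d) (auto simp: shape_def ushape_forget)

lemma pprune_iter_eq_None: "pprune_iter k p = None \<longleftrightarrow> porder p \<le> k"
proof (induction k arbitrary: p)
  case (Suc k)
  show ?case
  proof (cases "pprune_with posreal_add p")
    case None
    have N: "((\<lambda>d. Option.bind d (pprune_with posreal_add)) ^^ k) None = None" for k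
      by (induction k) auto
    from None have "porder p = 1" by (simp add: pprune_with_eq_None)
    with None show ?thesis unfolding pprune_iter_def
      by (simp add: funpow_Suc_right N del: funpow.simps)
  next
    case (Some q)
    with porder_pprune[OF Some] Suc show ?thesis by (simp add: pprune_iter_Suc_Some)
  qed
qed simp

abbreviation pshapes_differ :: "posreal ptree \<Rightarrow> posreal ptree \<Rightarrow> nat \<Rightarrow> bool" where
  "pshapes_differ q p k \<equiv> pshape (pprune_iter k q) \<noteq> pshape (pprune_iter k p)"

text \<open>Beyond the larger of the two orders both iterates are empty; this bound makes the
  \<open>GREATEST\<close> in \<open>goes_right\<close> meaningful.\<close>

lemma pshapes_differ_bound: "pshapes_differ q p k \<Longrightarrow> k \<le> max (porder p) (porder q)"
  by (rule ccontr) (auto simp: pprune_iter_eq_None[THEN iffD2])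

text \<open>Lengths are consulted only when the two shapes coincide, which the third assumption
  rules out; all else is read off planar shapes.\<close>

lemma goes_right_cong:
  assumes "plane_shape q = plane_shape q'" "plane_shape p = plane_shape p'"
    and "ushape (forget q) \<noteq> ushape (forget p)"
  shows "goes_right q p \<longleftrightarrow> goes_right q' p'"
proof -
  note A = plane_shape_pprune_iter_cong[OF assms(1)] plane_shape_pprune_iter_cong[OF assms(2)]
  from assms(3) have "ushape (forget q') \<noteq> ushape (forget p')"
    by (simp add: ushape_forget assms)
  with assms(3) show ?thesis
    unfolding goes_right_def
    by (simp add: pshape_eq side_counts_eq A porder_cong[OF assms(1)] porder_cong[OF assms(2)])
qed

lemma Greatest_Suc:
  assumes "P (Suc k0)" "\<And>k. P k \<Longrightarrow> k \<le> (b::nat)"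
  shows "(GREATEST k. P k) = Suc (GREATEST k. P (Suc k))"
proof (rule Greatest_equality)
  have b: "\<And>k. P (Suc k) \<Longrightarrow> k \<le> b" using assms(2) by (meson Suc_leD)
  show "P (Suc (GREATEST k. P (Suc k)))"
    using GreatestI_nat[of "\<lambda>k. P (Suc k)", OF assms(1)] b by blast
  fix y assume y: "P y"
  show "y \<le> Suc (GREATEST k. P (Suc k))"
  proof (cases y)
    case (Suc m)
    then show ?thesis using Greatest_le_nat[of "\<lambda>k. P (Suc k)" m b] b y by auto
  qed simp
qed

text \<open>Pruning both trees lowers the last level at which they differ by one and leaves the
  iterates at that level unchanged, so the decision is the same. The assumption on the pruned shapes
  guarantees that the level is at least 1. This is the source of properness.\<close>

lemma goes_right_pprune:
  assumes q: "pprune_with posreal_add q = Some q'" and p: "pprune_with posreal_add p = Some p'"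
    and ne: "ushape (forget q') \<noteq> ushape (forget p')"
  shows "goes_right q p \<longleftrightarrow> goes_right q' p'"
proof -
  have ne': "ushape (forget q) \<noteq> ushape (forget p)"
  proof
    assume "ushape (forget q) = ushape (forget p)"
    then have "cprune (shape (Some (forget q))) = cprune (shape (Some (forget p)))"
      by (simp add: shape_def)
    with q p ne show False
      by (simp add: cprune_shape[of _ posreal_add]) (simp add: shape_def)
  qed
  have "(GREATEST k. pshapes_differ q p k) = Suc (GREATEST k. pshapes_differ q' p' k)"
    using Greatest_Suc[of "pshapes_differ q p" 0, OF _ pshapes_differ_bound] ne
    by (simp add: pprune_iter_Suc_Some[OF q] pprune_iter_Suc_Some[OF p]) (simp add: shape_def)
  then show ?thesis
    unfolding goes_right_def using ne ne' porder_pprune[OF q] porder_pprune[OF p]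
    by (simp add: Let_def pprune_iter_Suc_Some[OF q] pprune_iter_Suc_Some[OF p])
qed

lemma map_ptree_eq_iff_dfs_lengths:
  assumes "plane_shape q = plane_shape p" "q \<noteq> p"
  shows "dfs_lengths q \<noteq> dfs_lengths p"
proof
  assume "dfs_lengths q = dfs_lengths p"
  then have "dfs q = dfs p"
    using inj_map_eq_map[of real_of_posreal] real_of_posreal_inject by (auto simp: inj_def)
  with assms show False using dfs_inject by blast
qed

lemma lexordp_total:
  fixes xs ys :: "'a::linorder list"
  shows "xs \<noteq> ys \<Longrightarrow> ord_class.lexordp ys xs \<longleftrightarrow> \<not> ord_class.lexordp xs ys"
  using lexordp_linear[of xs ys] lexordp_antisym[of xs ys] by auto

text \<open>
  For trees that are equal up to the embedding, totality rests on the fact that the pruned trees at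
  the level where the comparison takes place have the same planar shape.
\<close>

lemma goes_right_total:
  assumes "q \<noteq> p"
    and same: "ushape (forget q) = ushape (forget p) \<Longrightarrow> plane_shape q = plane_shape p"
    and iter: "\<And>k. pshape (pprune_iter (Suc k) q) = pshape (pprune_iter (Suc k) p) \<Longrightarrow>
        map_option plane_shape (pprune_iter (Suc k) q) = map_option plane_shape (pprune_iter (Suc k) p)"
  shows "goes_right p q \<longleftrightarrow> \<not> goes_right q p"
proof (cases "ushape (forget q) = ushape (forget p)")
  case True
  from map_ptree_eq_iff_dfs_lengths[OF same[OF True] assms(1)] True show ?thesis
    by (simp add: goes_right_def lexordp_total[of "dfs_lengths q" "dfs_lengths p"] porder_cong[OF same[OF True]])
next
  case False
  define k where "k = (GREATEST k. pshapes_differ q p k)"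
  have D0: "pshapes_differ q p 0" using False by (simp add: shape_def)
  have Dk: "pshapes_differ q p k" unfolding k_def
    by (rule GreatestI_nat[of "pshapes_differ q p", OF D0 pshapes_differ_bound])
  have "\<not> pshapes_differ q p (Suc k)"
    using Greatest_le_nat[of "pshapes_differ q p" "Suc k", OF _ pshapes_differ_bound]
    by (auto simp: k_def)
  then have S: "map_option plane_shape (pprune_iter (Suc k) q) = map_option plane_shape (pprune_iter (Suc k) p)"
    using iter by blast
  show ?thesis
  proof (cases "porder q = porder p")
    case True
    have "scounts (map_option plane_shape (pprune_iter k q)) \<noteq> scounts (map_option plane_shape (pprune_iter k p))"
    proof
      assume eq: "scounts (map_option plane_shape (pprune_iter k q)) = scounts (map_option plane_shape (pprune_iter k p))"
      have "(pprune_iter k q = None) = (pprune_iter k p = None)"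
        using True by (simp add: pprune_iter_eq_None)
      \<comment> \<open>Equal orders make both iterates vanish at the same levels; as they differ at
        level k, both are present there.\<close>
      with Dk obtain d e where de: "pprune_iter k q = Some d" "pprune_iter k p = Some e"
        by (cases "pprune_iter k q"; cases "pprune_iter k p") auto
      have "forget (plane_shape d) = forget (plane_shape e)"
        using scounts_inject[of "plane_shape d" "plane_shape e"] eq S
        unfolding plane_shape_pprune_iter_Suc de by simp
      with Dk de show False by (simp add: shape_def ushape_forget)
    qed
    note L = lexordp_total[OF this]
    have "(GREATEST k. pshapes_differ p q k) = k"
      unfolding k_def by (rule arg_cong[of _ _ Greatest]) (auto simp: fun_eq_iff)
    with True False L k_def show ?thesis
      by (simp add: goes_right_def Let_def side_counts_eq)
  qed (auto simp: goes_right_def)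
qed

text \<open>Totality leaves exactly one admissible order of two distinct siblings, and equal
  siblings give the same tree in either order, so the description in \<open>arrange\<close>
  denotes.\<close>

lemma arrange_Upair:
  assumes "q \<noteq> p \<Longrightarrow> goes_right p q \<longleftrightarrow> \<not> goes_right q p"
  shows "arrange a (Upair p q) = (if goes_right q p \<or> q = p then PNode a p q else PNode a q p)"
proof (cases "q = p")
  case True
  then show ?thesis unfolding arrange_def by (auto intro!: the_equality)
next
  case False
  then show ?thesis unfolding arrange_def using assms by (auto intro!: the_equality)
qed

text \<open>Measure for the induction that proves \<open>well_embedded\<close>: it decreases both on
  passing to a child and under pruning, and both kinds of smaller tree occur there.\<close>

primrec vertices :: "'a utree \<Rightarrow> nat" where
  "vertices (ULeaf a) = 1"
| "vertices (UNode a u) = Suc (sum_uprod (map_uprod vertices u))"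

lemma vertices_forget: "vertices (forget p) = length (dfs p)"
  by (induction p) auto

lemma vertices_ushape: "vertices (ushape t) = vertices t"
proof -
  obtain p where "t = forget p" using forget_surj by blast
  then show ?thesis by (simp add: ushape_forget vertices_forget)
qed

lemma length_dfs_pmap_stem [simp]: "length (dfs (pmap_stem h p)) = length (dfs p)"
  by (cases p) auto

lemma length_dfs_pprune: "pprune_with f p = Some q \<Longrightarrow> length (dfs q) < length (dfs p)"
proof (induction p arbitrary: q)
  case (PNode a l r)
  show ?case
    using PNode.prems
    by (cases "pprune_with f l"; cases "pprune_with f r") (auto dest!: PNode.IH)
qed simp

lemma vertices_prune: "prune_with f t = Some s \<Longrightarrow> vertices s < vertices t"
  using forget_surj[of t] by (auto simp: prune_with_forget vertices_forget length_dfs_pprune)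

text \<open>The three properties support one another: ordering siblings needs a total comparison,
  which looks at iterated prunings and so needs properness for smaller trees, which in turn needs
  that planar shapes depend on shapes alone. The last clause compares planar shapes only: siblings
  told apart by side counts may have equal shapes after pruning and are then ordered by
  length.\<close>

definition well_embedded :: "posreal utree \<Rightarrow> bool" where
  "well_embedded t \<longleftrightarrow> forget (embed t) = t \<and>
     (\<forall>t'. ushape t' = ushape t \<longrightarrow> plane_shape (embed t') = plane_shape (embed t)) \<and>
     map_option plane_shape (pprune_with posreal_add (embed t)) =
       map_option (\<lambda>s. plane_shape (embed s)) (prune_with posreal_add t)"

lemma well_embeddedD:
  assumes "well_embedded t"
  shows "forget (embed t) = t"
    and "ushape t' = ushape t \<Longrightarrow> plane_shape (embed t') = plane_shape (embed t)"
    and "map_option plane_shape (pprune_with posreal_add (embed t)) =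
       map_option (\<lambda>s. plane_shape (embed s)) (prune_with posreal_add t)"
  using assms unfolding well_embedded_def by blast+

definition prune_iter :: "nat \<Rightarrow> posreal utree \<Rightarrow> posreal utree option" where
  "prune_iter k t = ((\<lambda>d. Option.bind d (prune_with posreal_add)) ^^ k) (Some t)"

lemma prune_iter_Suc: "prune_iter (Suc k) t = Option.bind (prune_iter k t) (prune_with posreal_add)"
  by (simp add: prune_iter_def)

lemma prune_iter_forget: "prune_iter k (forget p) = map_option forget (pprune_iter k p)"
proof (induction k)
  case (Suc k)
  then show ?case by (cases "pprune_iter k p") (auto simp: prune_iter_Suc pprune_iter_Suc prune_with_forget)
qed (simp add: prune_iter_def)

lemma vertices_prune_iter: "prune_iter k t = Some s \<Longrightarrow> vertices s \<le> vertices t"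
proof (induction k arbitrary: s)
  case (Suc k)
  then show ?case by (cases "prune_iter k t") (auto simp: prune_iter_Suc dest!: vertices_prune)
qed (simp add: prune_iter_def)

context
  fixes m :: nat
  assumes IH: "\<And>t. vertices t < m \<Longrightarrow> well_embedded t"
begin

lemma plane_shape_pprune_iter_embed:
  assumes "vertices t < m"
  shows "map_option plane_shape (pprune_iter k (embed t)) =
     map_option (\<lambda>s. plane_shape (embed s)) (prune_iter k t)"
proof (induction k)
  case (Suc k)
  show ?case
  proof (cases "prune_iter k t")
    case None
    with Suc show ?thesis by (simp add: pprune_iter_Suc prune_iter_Suc)
  next
    case (Some s)
    with vertices_prune_iter[OF Some] assms have "well_embedded s" by (intro IH) simp
    then have "pprune_with (\<lambda>_ _. ()) (plane_shape (embed s)) =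
        map_option (\<lambda>s. plane_shape (embed s)) (prune_with posreal_add s)"
      using well_embeddedD(3)[of s] by (simp add: plane_shape_pprune)
    then show ?thesis
      unfolding plane_shape_pprune_iter_Suc Suc.IH by (simp add: Some prune_iter_Suc)
  qed
qed (simp add: prune_iter_def)

lemma goes_right_embed_total:
  assumes "vertices s < m" "vertices t < m" "embed s \<noteq> embed t"
  shows "goes_right (embed t) (embed s) \<longleftrightarrow> \<not> goes_right (embed s) (embed t)"
proof (rule goes_right_total)
  have f: "forget (embed s) = s" "forget (embed t) = t"
    using IH assms by (auto intro!: well_embeddedD(1))
  show "plane_shape (embed s) = plane_shape (embed t)" if "ushape (forget (embed s)) = ushape (forget (embed t))"
    using that IH assms by (intro well_embeddedD(2)) (auto simp: f)
  fix k
  assume "pshape (pprune_iter (Suc k) (embed s)) = pshape (pprune_iter (Suc k) (embed t))"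
  then have *: "shape (prune_iter (Suc k) s) = shape (prune_iter (Suc k) t)"
    by (metis f prune_iter_forget)
  show "map_option plane_shape (pprune_iter (Suc k) (embed s)) = map_option plane_shape (pprune_iter (Suc k) (embed t))"
  proof (cases "prune_iter (Suc k) t")
    case None
    with * show ?thesis by (simp add: plane_shape_pprune_iter_embed assms) (simp add: shape_def)
  next
    case (Some t')
    with * obtain s' where s': "prune_iter (Suc k) s = Some s'" "ushape s' = ushape t'"
      by (auto simp: shape_def)
    have "well_embedded t'" using vertices_prune_iter[OF Some] assms by (intro IH) simp
    with s' Some show ?thesis
      unfolding plane_shape_pprune_iter_embed[OF assms(1)] plane_shape_pprune_iter_embed[OF assms(2)]
      using well_embeddedD(2)[of t' s'] by simp
  qed
qed (use assms in simp)

lemma embed_UNode_aux: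
  assumes "vertices s < m" "vertices t < m"
  shows "embed (UNode a (Upair s t)) =
    (if goes_right (embed t) (embed s) \<or> embed t = embed s then PNode a (embed s) (embed t)
     else PNode a (embed t) (embed s))"
  using arrange_Upair goes_right_embed_total[OF assms(2,1)] by simp

lemma ushape_map_stem: "ushape (map_stem h t) = ushape t"
  by (cases t) (auto simp: ushape_def)

text \<open>If the siblings have the same shape, both orders yield the same planar shape and the
  choice by length is invisible. Otherwise the choice depends on shapes alone, and it survives
  pruning unless the pruned shapes coincide, when again either order will do.\<close>

lemma well_embedded_UNode:
  assumes "vertices s < m" "vertices t < m"
  shows "well_embedded (UNode a (Upair s t))"
proof -
  let ?f = posreal_add
  define p where "p = embed s"
  define q where "q = embed t"
  have W: "well_embedded s" "well_embedded t" using IH assms by auto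
  have f: "forget p = s" "forget q = t"
    using W by (auto simp: p_def q_def intro!: well_embeddedD(1))
  have P: "map_option plane_shape (pprune_with ?f p) = map_option (\<lambda>s. plane_shape (embed s)) (prune_with ?f s)"
    "map_option plane_shape (pprune_with ?f q) = map_option (\<lambda>s. plane_shape (embed s)) (prune_with ?f t)"
    using W by (simp_all add: p_def q_def well_embeddedD(3))
  have E: "embed (UNode a (Upair s t)) = (if goes_right q p \<or> q = p then PNode a p q else PNode a q p)"
    unfolding p_def q_def by (rule embed_UNode_aux[OF assms])
  have "plane_shape (embed t') = plane_shape (embed (UNode a (Upair s t)))"
    if t': "ushape t' = ushape (UNode a (Upair s t))" for t'
  proof -
    obtain b u where u: "t' = UNode b u" using t' by (cases t') (auto simp: ushape_def)
    obtain r1 r2 where r: "u = Upair r1 r2" by (cases u)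
    \<comment> \<open>The pair is unordered, so the shapes of the children may match
      crosswise.\<close>
    obtain s1 s2 where sh: "t' = UNode b (Upair s1 s2)" "ushape s1 = ushape s" "ushape s2 = ushape t"
    proof (cases "ushape r1 = ushape s \<and> ushape r2 = ushape t")
      case True
      with that[of r1 r2] u r show ?thesis by simp
    next
      case False
      with t' have "ushape r2 = ushape s" "ushape r1 = ushape t"
        by (auto simp: u r ushape_def)
      with that[of r2 r1] u r show ?thesis by simp
    qed
    have v: "vertices s1 < m" "vertices s2 < m"
      using assms sh vertices_ushape[of s1] vertices_ushape[of s2] vertices_ushape[of s] vertices_ushape[of t]
      by simp_all
    have ps: "plane_shape (embed s1) = plane_shape p" "plane_shape (embed s2) = plane_shape q"
      unfolding p_def q_def using W sh by (auto intro!: well_embeddedD(2))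
    have f': "forget (embed s1) = s1" "forget (embed s2) = s2"
      using IH v by (auto intro!: well_embeddedD(1))
    have E': "embed t' = (if goes_right (embed s2) (embed s1) \<or> embed s2 = embed s1
        then PNode b (embed s1) (embed s2) else PNode b (embed s2) (embed s1))"
      by (subst sh(1), subst embed_UNode_aux[OF v]) (rule refl)
    show ?thesis
    proof (cases "ushape s = ushape t")
      case True
      have pq: "plane_shape p = plane_shape q"
        unfolding p_def q_def by (rule well_embeddedD(2)[OF W(2) True])
      have "plane_shape (embed (UNode a (Upair s t))) = PNode () (plane_shape q) (plane_shape q)"
        by (subst E) (simp add: pq)
      moreover have "plane_shape (embed t') = PNode () (plane_shape q) (plane_shape q)"
        by (subst E') (simp add: ps pq)
      ultimately show ?thesis by (rule trans[OF _ sym, rotated])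
    next
      case False
      then have "goes_right q p \<longleftrightarrow> goes_right (embed s2) (embed s1)"
        by (intro goes_right_cong) (auto simp: ps f)
      moreover have "q \<noteq> p" "embed s2 \<noteq> embed s1"
        using False f f' sh by auto
      ultimately show ?thesis
        by (subst E, subst E') (simp add: ps)
    qed
  qed
  moreover have "map_option plane_shape (pprune_with ?f (embed (UNode a (Upair s t)))) =
       map_option (\<lambda>s. plane_shape (embed s)) (prune_with ?f (UNode a (Upair s t)))"
  proof -
    have stem: "plane_shape (embed (map_stem h t')) = plane_shape (embed t')" if "vertices t' < m" for h t'
      using IH[OF that] ushape_map_stem[of h t'] by (intro well_embeddedD(2))
    show ?thesis
    proof (cases "prune_with ?f s")
      case None
      then have p: "pprune_with ?f p = None" using P by simp
      show ?thesis
      proof (cases "prune_with ?f t")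
        case N: None
        then have "pprune_with ?f q = None" using P by simp
        with p None N show ?thesis by (simp add: E del: embed.simps) simp
      next
        case (Some t')
        with vertices_prune[OF Some] assms P p None show ?thesis
          by (auto simp: E stem simp del: embed.simps)
      qed
    next
      case s': (Some s')
      then obtain p' where p: "pprune_with ?f p = Some p'" "plane_shape p' = plane_shape (embed s')"
        using P by auto
      have vs: "vertices s' < m" using vertices_prune[OF s'] assms by simp
      show ?thesis
      proof (cases "prune_with ?f t")
        case N: None
        then have "pprune_with ?f q = None" using P by simp
        with p N s' vs show ?thesis by (auto simp: E stem simp del: embed.simps)
      next
        case t': (Some t')
        then obtain q' where q: "pprune_with ?f q = Some q'" "plane_shape q' = plane_shape (embed t')"
          using P by auto
        have vt: "vertices t' < m" using vertices_prune[OF t'] assms by simp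
        have f': "forget p' = s'" "forget q' = t'"
          using s' t' p q by (auto simp: prune_with_forget simp flip: f)
        have fe: "forget (embed s') = s'" "forget (embed t') = t'"
          using IH vs vt by (auto intro!: well_embeddedD(1))
        have L: "map_option plane_shape (pprune_with ?f (embed (UNode a (Upair s t)))) =
            Some (plane_shape (if goes_right q p \<or> q = p then PNode a p' q' else PNode a q' p'))"
          using p q by (simp add: E del: embed.simps)
        have R: "map_option (\<lambda>s. plane_shape (embed s)) (prune_with ?f (UNode a (Upair s t))) =
            Some (plane_shape (embed (UNode a (Upair s' t'))))"
          using s' t' by simp
        have E': "embed (UNode a (Upair s' t')) = (if goes_right (embed t') (embed s') \<or> embed t' = embed s'
            then PNode a (embed s') (embed t') else PNode a (embed t') (embed s'))"
          by (rule embed_UNode_aux[OF vs vt])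
        have "plane_shape (if goes_right q p \<or> q = p then PNode a p' q' else PNode a q' p') =
            plane_shape (embed (UNode a (Upair s' t')))"
        proof (cases "ushape s' = ushape t'")
          case True
          have st: "plane_shape (embed s') = plane_shape (embed t')"
            by (rule well_embeddedD(2)[OF IH[OF vt] True])
          have "plane_shape (if goes_right q p \<or> q = p then PNode a p' q' else PNode a q' p') =
              PNode () (plane_shape (embed t')) (plane_shape (embed t'))"
            by (simp only: p q st ptree.map if_distrib[of plane_shape] if_cancel)
          moreover have "plane_shape (embed (UNode a (Upair s' t'))) =
              PNode () (plane_shape (embed t')) (plane_shape (embed t'))"
            by (simp only: E' st ptree.map if_distrib[of plane_shape] if_cancel)
          ultimately show ?thesis by (rule trans[OF _ sym])
        next
          case False
          then have "goes_right q p \<longleftrightarrow> goes_right q' p'"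
            by (intro goes_right_pprune) (auto simp: p q f')
          also have "\<dots> \<longleftrightarrow> goes_right (embed t') (embed s')"
            using False by (intro goes_right_cong) (auto simp: p q f')
          finally have "goes_right q p \<longleftrightarrow> goes_right (embed t') (embed s')" .
          moreover have "q \<noteq> p" using False q p f' by auto
          moreover have "embed t' \<noteq> embed s'" using False fe by metis
          ultimately show ?thesis by (subst E') (simp add: p q)
        qed
        then show ?thesis unfolding L R by simp
      qed
    qed
  qed
  moreover have "forget (embed (UNode a (Upair s t))) = UNode a (Upair s t)"
    by (subst E) (auto simp: f)
  ultimately show ?thesis
    unfolding well_embedded_def by blast
qed

end

lemma well_embedded: "well_embedded t"
proof (induction "vertices t" arbitrary: t rule: less_induct)
  case less
  show ?case
  proof (cases t)
    case (ULeaf a)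
    have "\<exists>b. t' = ULeaf b" if "ushape t' = ushape (ULeaf a)" for t'
      using that by (cases t') (auto simp: ushape_def)
    then have "plane_shape (embed t') = PLeaf ()" if "ushape t' = ushape (ULeaf a)" for t'
      using that by (metis embed.simps(1) ptree.map(1))
    then show ?thesis
      unfolding well_embedded_def ULeaf by simp
  next
    case (UNode a u)
    obtain r s where u: "u = Upair r s" by (cases u)
    show ?thesis unfolding UNode u
      by (rule well_embedded_UNode[of "vertices t"]) (use less UNode u in auto)
  qed
qed

lemma forget_embed [simp]: "forget (embed t) = t"
  by (rule well_embeddedD(1)[OF well_embedded])

lemma plane_shape_embed_cong: "ushape s = ushape t \<Longrightarrow> plane_shape (embed s) = plane_shape (embed t)"
  by (rule well_embeddedD(2)[OF well_embedded])

lemma embed_forget_PNode: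
  "embed (forget (PNode a l r)) =
    (if goes_right (embed (forget r)) (embed (forget l)) \<or> embed (forget r) = embed (forget l)
     then PNode a (embed (forget l)) (embed (forget r)) else PNode a (embed (forget r)) (embed (forget l)))"
  unfolding forget.simps
  by (rule embed_UNode_aux[of "Suc (max (length (dfs l)) (length (dfs r)))"])
     (auto simp: well_embedded vertices_forget)

section \<open>Measurability on spaces of trees\<close>

instance ptree :: (countable) countable
  by countable_datatype

instance utree :: (countable) countable
proof
  have "surj (forget :: 'a ptree \<Rightarrow> _)"
    using forget_surj by (auto simp: surj_def)
  then have "inj (inv forget :: 'a utree \<Rightarrow> 'a ptree)"
    by (rule surj_imp_inj_inv)
  then show "\<exists>f :: 'a utree \<Rightarrow> nat. inj f"
    by (intro exI[of _ "to_nat \<circ> inv forget"] inj_compose) auto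
qed

text \<open>Total left inverse of \<open>real_of_posreal\<close>; the value 1 off the positive reals
  is a default that makes \<open>leaf\<close> and \<open>node\<close> total functions of a real
  length.\<close>

definition pos :: "real \<Rightarrow> posreal" where
  "pos x = Abs_posreal (if 0 < x then x else 1)"

lemma real_of_posreal_pos: "real_of_posreal (pos x) = (if 0 < x then x else 1)"
  by (auto simp: pos_def Abs_posreal_inverse)

lemma real_of_posreal_gt_0 [simp]: "0 < real_of_posreal a"
  using real_of_posreal[of a] by simp

lemma pos_real_of_posreal [simp]: "pos (real_of_posreal a) = a"
  by (simp add: pos_def real_of_posreal_inverse)

lemma real_of_posreal_add: "real_of_posreal (posreal_add a b) = real_of_posreal a + real_of_posreal b"
  by (rule posreal_add.rep_eq)

text \<open>Unlike in \<open>ltree_space\<close>, the lengths are read in the depth-first order of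
  the given planar tree, without \<open>embed\<close>; \<open>measurable_embed_forget\<close>
  relates the two.\<close>

definition ptree_space :: "posreal ptree measure" where
  "ptree_space = vimage_algebra UNIV (\<lambda>p. (plane_shape p, pad (dfs_lengths p)))
     (count_space UNIV \<Otimes>\<^sub>M vec_space)"

lemma space_ptree_space [simp]: "space ptree_space = UNIV"
  by (simp add: ptree_space_def)

lemma space_ltree_space [simp]: "space ltree_space = UNIV"
  by (simp add: ltree_space_def)

lemma measurable_vec_space_iff:
  "f \<in> measurable M vec_space \<longleftrightarrow> (\<forall>i. (\<lambda>x. f x i) \<in> borel_measurable M)"
proof
  assume "f \<in> measurable M vec_space"
  then show "\<forall>i. (\<lambda>x. f x i) \<in> borel_measurable M"
    by (auto intro: measurable_compose[OF _ measurable_component_singleton])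
next
  assume "\<forall>i. (\<lambda>x. f x i) \<in> borel_measurable M"
  then show "f \<in> measurable M vec_space"
    using measurable_restrict[of UNIV "\<lambda>i x. f x i" M "\<lambda>_. borel"] by (simp add: restrict_UNIV)
qed

lemma measurable_vimage_shape_iff:
  assumes "\<And>x. x \<in> space N \<Longrightarrow> f x \<in> UNIV"
  shows "f \<in> measurable N (vimage_algebra UNIV (\<lambda>p. (a p, pad (b p))) (count_space UNIV \<Otimes>\<^sub>M vec_space)) \<longleftrightarrow>
    (\<lambda>x. a (f x)) \<in> measurable N (count_space UNIV) \<and>
    (\<forall>i. (\<lambda>x. pad (b (f x)) i) \<in> borel_measurable N)" (is "f \<in> measurable N ?V \<longleftrightarrow> _")
proof
  assume f: "f \<in> measurable N ?V"
  have g: "(\<lambda>p. (a p, pad (b p))) \<in> measurable ?V (count_space UNIV \<Otimes>\<^sub>M vec_space)"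
    by (rule measurable_vimage_algebra1) (auto simp: space_pair_measure space_PiM)
  have "(\<lambda>x. (a (f x), pad (b (f x)))) \<in> measurable N (count_space UNIV \<Otimes>\<^sub>M vec_space)"
    by (rule measurable_compose[OF f g])
  then show "(\<lambda>x. a (f x)) \<in> measurable N (count_space UNIV) \<and>
    (\<forall>i. (\<lambda>x. pad (b (f x)) i) \<in> borel_measurable N)"
    unfolding measurable_pair_iff by (simp add: comp_def measurable_vec_space_iff)
next
  assume "(\<lambda>x. a (f x)) \<in> measurable N (count_space UNIV) \<and>
    (\<forall>i. (\<lambda>x. pad (b (f x)) i) \<in> borel_measurable N)"
  then show "f \<in> measurable N ?V"
    by (intro measurable_vimage_algebra2) (auto simp: measurable_pair_iff comp_def measurable_vec_space_iff)
qed

lemma measurable_ptree_space_iff: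
  "f \<in> measurable N ptree_space \<longleftrightarrow>
    (\<lambda>x. plane_shape (f x)) \<in> measurable N (count_space UNIV) \<and>
    (\<forall>i. (\<lambda>x. pad (dfs_lengths (f x)) i) \<in> borel_measurable N)"
  unfolding ptree_space_def by (rule measurable_vimage_shape_iff) simp

lemma measurable_ltree_space_iff:
  "f \<in> measurable N ltree_space \<longleftrightarrow>
    (\<lambda>x. shape (f x)) \<in> measurable N (count_space UNIV) \<and>
    (\<forall>i. (\<lambda>x. pad (edge_lengths (f x)) i) \<in> borel_measurable N)"
  unfolding ltree_space_def by (rule measurable_vimage_shape_iff) simp

lemma measurable_plane_shape [measurable]: "plane_shape \<in> measurable ptree_space (count_space UNIV)"
  and measurable_pad_dfs_lengths: "(\<lambda>p. pad (dfs_lengths p) i) \<in> borel_measurable ptree_space"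
  using measurable_ptree_space_iff[of "\<lambda>x. x" ptree_space] by auto

lemma measurable_shape [measurable]: "shape \<in> measurable ltree_space (count_space UNIV)"
  and measurable_pad_edge_lengths [measurable]: "(\<lambda>t. pad (edge_lengths t) i) \<in> borel_measurable ltree_space"
  using measurable_ltree_space_iff[of "\<lambda>x. x" ltree_space] by auto

text \<open>Such a g factors through the planar shape, a discrete quantity; filling a shape with
  edges of length 1 is a section of \<open>plane_shape\<close>.\<close>

lemma measurable_plane_shape_cong:
  assumes "\<And>p. g p = g (map_ptree (\<lambda>_. pos 1) (plane_shape p))" "range g \<subseteq> space N"
  shows "g \<in> measurable ptree_space N"
proof -
  have "(\<lambda>p. g (map_ptree (\<lambda>_. pos 1) (plane_shape p))) \<in> measurable ptree_space N"
    by (rule measurable_compose[OF measurable_plane_shape]) (use assms(2) in auto)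
  with assms(1)[symmetric] show ?thesis by simp
qed

lemma measurable_pad_dfs_lengths' [measurable (raw)]:
  assumes [measurable]: "f \<in> measurable M ptree_space" "g \<in> measurable M (count_space UNIV)"
  shows "(\<lambda>x. pad (dfs_lengths (f x)) (g x)) \<in> borel_measurable M"
  by (rule measurable_compose_countable[OF _ assms(2)])
     (intro measurable_compose[OF assms(1) measurable_pad_dfs_lengths])

lemma measurable_length_dfs [measurable]: "(\<lambda>p. length (dfs p)) \<in> measurable ptree_space (count_space UNIV)"
  by (rule measurable_plane_shape_cong) auto

lemma measurable_porder [measurable]: "porder \<in> measurable ptree_space (count_space UNIV)"
  by (rule measurable_plane_shape_cong) auto

lemma measurable_ushape_forget [measurable]: "(\<lambda>p. ushape (forget p)) \<in> measurable ptree_space (count_space UNIV)"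
  by (rule measurable_plane_shape_cong) (auto simp: ushape_forget ptree.map_comp o_def)

lemma measurable_size_tops [measurable]: "(\<lambda>p. size (tops K p)) \<in> measurable ptree_space (count_space UNIV)"
  by (rule measurable_plane_shape_cong) (auto simp: tops_map_ptree)

lemma measurable_pmerges [measurable]: "pmerges i j \<in> measurable ptree_space (count_space UNIV)"
  by (rule measurable_plane_shape_cong) auto

section \<open>Measurability of the operations on trees\<close>

abbreviation node :: "real \<Rightarrow> posreal ptree \<Rightarrow> posreal ptree \<Rightarrow> posreal ptree" where
  "node x \<equiv> PNode (pos x)"

abbreviation leaf :: "real \<Rightarrow> posreal ptree" where
  "leaf x \<equiv> PLeaf (pos x)"

lemma measurable_leaf [measurable]: "leaf \<in> measurable borel ptree_space"
proof -
  have "pad [x] i = (if i = 0 then x else 0)" for x i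
    by (cases i) (auto simp: pad_def)
  then show ?thesis
    by (simp add: measurable_ptree_space_iff real_of_posreal_pos)
qed

lemma pad_dfs_lengths_PNode:
  "pad (dfs_lengths (PNode a s t)) i =
    (if i = 0 then real_of_posreal a else if i - 1 < length (dfs s) then pad (dfs_lengths s) (i - 1)
     else pad (dfs_lengths t) (i - 1 - length (dfs s)))"
  by (cases i) (auto simp: pad_def nth_append)

lemma measurable_node [measurable (raw)]:
  assumes [measurable]: "l \<in> borel_measurable M" "s \<in> measurable M ptree_space" "t \<in> measurable M ptree_space"
  shows "(\<lambda>x. node (l x) (s x) (t x)) \<in> measurable M ptree_space"
  unfolding measurable_ptree_space_iff
proof (intro conjI allI)
  show "(\<lambda>x. plane_shape (node (l x) (s x) (t x))) \<in> measurable M (count_space UNIV)"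
    by simp
  show "(\<lambda>x. pad (dfs_lengths (node (l x) (s x) (t x))) i) \<in> borel_measurable M" for i
    unfolding pad_dfs_lengths_PNode real_of_posreal_pos by measurable
qed

fun root_length :: "posreal ptree \<Rightarrow> real" where
  "root_length (PLeaf a) = real_of_posreal a"
| "root_length (PNode a l r) = real_of_posreal a"

fun left_part :: "'a ptree \<Rightarrow> 'a ptree" where
  "left_part (PLeaf a) = PLeaf a"
| "left_part (PNode a l r) = l"

fun right_part :: "'a ptree \<Rightarrow> 'a ptree" where
  "right_part (PLeaf a) = PLeaf a"
| "right_part (PNode a l r) = r"

fun is_leaf :: "'a ptree \<Rightarrow> bool" where
  "is_leaf (PLeaf a) = True"
| "is_leaf (PNode a l r) = False"

lemma measurable_is_leaf [measurable]: "Measurable.pred ptree_space is_leaf"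
proof (rule measurable_plane_shape_cong)
  show "is_leaf p = is_leaf (map_ptree (\<lambda>_. pos 1) (plane_shape p))" for p by (cases p) auto
qed auto

lemma measurable_root_length [measurable]: "root_length \<in> borel_measurable ptree_space"
proof -
  have "root_length p = pad (dfs_lengths p) 0" for p by (cases p) (auto simp: pad_def)
  then have "root_length = (\<lambda>p. pad (dfs_lengths p) 0)" by blast
  then show ?thesis using measurable_pad_dfs_lengths[of 0] by simp
qed

lemma measurable_left_part [measurable]: "left_part \<in> measurable ptree_space ptree_space"
  unfolding measurable_ptree_space_iff
proof (intro conjI allI)
  have n: "(\<lambda>p. length (dfs (left_part p))) \<in> measurable ptree_space (count_space UNIV)"
  proof (rule measurable_plane_shape_cong)
    show "length (dfs (left_part p)) = length (dfs (left_part (map_ptree (\<lambda>_. pos 1) (plane_shape p))))"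
      for p :: "posreal ptree" by (cases p) auto
  qed auto
  note [measurable] = n
  show "(\<lambda>p. plane_shape (left_part p)) \<in> measurable ptree_space (count_space UNIV)"
  proof (rule measurable_plane_shape_cong)
    show "plane_shape (left_part p) = plane_shape (left_part (map_ptree (\<lambda>_. pos 1) (plane_shape p)))"
      for p :: "posreal ptree" by (cases p) (auto simp: ptree.map_comp o_def)
  qed auto
  fix i
  have "pad (dfs_lengths (left_part p)) i =
      (if is_leaf p then pad (dfs_lengths p) i
       else if i < length (dfs (left_part p)) then pad (dfs_lengths p) (Suc i) else 0)" for p
    by (cases p) (auto simp: pad_def nth_append)
  then show "(\<lambda>p. pad (dfs_lengths (left_part p)) i) \<in> borel_measurable ptree_space"
    by simp
qed

lemma measurable_right_part [measurable]: "right_part \<in> measurable ptree_space ptree_space"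
  unfolding measurable_ptree_space_iff
proof (intro conjI allI)
  show "(\<lambda>p. plane_shape (right_part p)) \<in> measurable ptree_space (count_space UNIV)"
  proof (rule measurable_plane_shape_cong)
    show "plane_shape (right_part p) = plane_shape (right_part (map_ptree (\<lambda>_. pos 1) (plane_shape p)))"
      for p :: "posreal ptree" by (cases p) (auto simp: ptree.map_comp o_def)
  qed auto
  fix i
  have "pad (dfs_lengths (right_part p)) i =
      (if is_leaf p then pad (dfs_lengths p) i
       else pad (dfs_lengths p) (i + 1 + length (dfs (left_part p))))" for p
    by (cases p) (auto simp: pad_def nth_append)
  then show "(\<lambda>p. pad (dfs_lengths (right_part p)) i) \<in> borel_measurable ptree_space"
    by simp
qed

text \<open>On the trees of one fixed shape, g is composed of finitely many copies of h; this is
  shown by induction on the shape. There are countably many shapes, so the pieces glue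
  together.\<close>

lemma measurable_rec_ptree:
  assumes leaf: "(\<lambda>x. g (leaf x)) \<in> measurable borel N"
    and h: "(\<lambda>(x, s, t, y, z). h x s t y z) \<in>
      measurable (borel \<Otimes>\<^sub>M ptree_space \<Otimes>\<^sub>M ptree_space \<Otimes>\<^sub>M N \<Otimes>\<^sub>M N) N"
    and node: "\<And>a s t. g (PNode a s t) = h (real_of_posreal a) s t (g s) (g t)"
  shows "g \<in> measurable ptree_space N"
proof -
  let ?R = "\<lambda>d. restrict_space ptree_space {p. plane_shape p = d}"
  have sets: "{p. plane_shape p = d} \<in> sets ptree_space" for d
    using measurable_sets[OF measurable_plane_shape, of "{d}"] by (simp add: vimage_def)
  have R: "g \<in> measurable (?R d) N" for d
  proof (induction d)
    case (PLeaf u)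
    have "(\<lambda>p. g (leaf (root_length p))) \<in> measurable (?R (PLeaf u)) N"
      by (intro measurable_restrict_space1 measurable_compose[OF measurable_root_length leaf])
    moreover have "g (leaf (root_length p)) = g p" if "p \<in> space (?R (PLeaf u))" for p
      using that by (cases p) (auto simp: space_restrict_space)
    ultimately show ?case by (subst measurable_cong[where g="\<lambda>p. g (leaf (root_length p))"]) auto
  next
    case (PNode u d e)
    let ?M = "?R (PNode u d e)"
    have sp: "p \<in> space ?M \<longleftrightarrow> plane_shape p = PNode u d e" for p
      by (auto simp: space_restrict_space)
    have [measurable]: "root_length \<in> borel_measurable ?M"
      "left_part \<in> measurable ?M ptree_space" "right_part \<in> measurable ?M ptree_space"
      by (auto intro!: measurable_restrict_space1)
    have parts: "plane_shape (left_part p) = d \<and> plane_shape (right_part p) = e"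
      if "plane_shape p = PNode u d e" for p :: "posreal ptree"
      using that by (cases p) auto
    have "left_part \<in> measurable ?M (?R d)" "right_part \<in> measurable ?M (?R e)"
      by (rule measurable_restrict_space2, use parts sp in blast, measurable)+
    then have [measurable]: "(\<lambda>p. g (left_part p)) \<in> measurable ?M N" "(\<lambda>p. g (right_part p)) \<in> measurable ?M N"
      using PNode.IH by (auto intro: measurable_compose)
    have "(\<lambda>p. (root_length p, left_part p, right_part p, g (left_part p), g (right_part p))) \<in>
       measurable ?M (borel \<Otimes>\<^sub>M ptree_space \<Otimes>\<^sub>M ptree_space \<Otimes>\<^sub>M N \<Otimes>\<^sub>M N)"
      by measurable
    from measurable_compose[OF this h]
    have "(\<lambda>p. h (root_length p) (left_part p) (right_part p) (g (left_part p)) (g (right_part p))) \<in> measurable ?M N"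
      by simp
    moreover have "h (root_length p) (left_part p) (right_part p) (g (left_part p)) (g (right_part p)) = g p"
      if "p \<in> space ?M" for p
      using that unfolding sp by (cases p) (auto simp: node)
    ultimately show ?case
      by (subst measurable_cong[where g="\<lambda>p. h (root_length p) (left_part p) (right_part p) (g (left_part p)) (g (right_part p))"]) auto
  qed
  show ?thesis
    by (rule measurable_piecewise_restrict[where C="range (\<lambda>d. {p. plane_shape p = d})"])
       (use R sets in auto)
qed

lemma pad_inject: "length xs = length ys \<Longrightarrow> pad xs = pad ys \<Longrightarrow> xs = ys"
proof (rule nth_equalityI)
  fix i assume *: "length xs = length ys" "pad xs = pad ys" "i < length xs"
  from fun_cong[OF *(2), of i] *(1,3) show "xs ! i = ys ! i" by (simp add: pad_def)
qed simp

lemma ptree_eq_iff_pad: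
  "p = q \<longleftrightarrow> plane_shape p = plane_shape q \<and> (\<forall>i. pad (dfs_lengths p) i = pad (dfs_lengths q) i)"
proof
  assume *: "plane_shape p = plane_shape q \<and> (\<forall>i. pad (dfs_lengths p) i = pad (dfs_lengths q) i)"
  then have "length (dfs p) = length (dfs q)" by (metis length_dfs_map_ptree)
  with * have "dfs_lengths p = dfs_lengths q" by (intro pad_inject) auto
  with * show "p = q" using map_ptree_eq_iff_dfs_lengths by blast
qed simp

lemma lexordp_pad:
  assumes "length xs = length ys"
  shows "ord_class.lexordp xs ys \<longleftrightarrow>
    (\<exists>n. n < length xs \<and> (\<forall>i<n. pad xs i = pad ys i) \<and> pad xs n < pad ys n)"
  using assms
proof (induction xs ys rule: list_induct2)
  case (Cons x xs y ys)
  have *: "pad (z # zs) 0 = z" "pad (z # zs) (Suc i) = pad zs i" for z zs i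
    by (auto simp: pad_def)
  have **: "(\<exists>n. n < Suc m \<and> (\<forall>i<n. P i) \<and> Q n) \<longleftrightarrow>
      Q 0 \<or> P 0 \<and> (\<exists>n. n < m \<and> (\<forall>i<n. P (Suc i)) \<and> Q (Suc n))" (is "?L \<longleftrightarrow> ?R") for m P Q
  proof
    assume ?L
    then obtain n where n: "n < Suc m" "\<forall>i<n. P i" "Q n" by blast
    then show ?R by (cases n) auto
  next
    assume ?R
    then show ?L
    proof
      assume "P 0 \<and> (\<exists>n. n < m \<and> (\<forall>i<n. P (Suc i)) \<and> Q (Suc n))"
      then obtain n where "P 0" "n < m" "\<forall>i<n. P (Suc i)" "Q (Suc n)" by blast
      then show ?L by (intro exI[of _ "Suc n"]) (auto simp: less_Suc_eq_0_disj)
    qed auto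
  qed
  show ?case
    unfolding length_Cons ** by (auto simp: * Cons.IH)
qed simp

text \<open>The part of the comparison that sees shapes only, isolated because its arguments range
  over a countable discrete set, which settles measurability.\<close>

definition shape_goes_right :: "unit ptree \<Rightarrow> unit ptree \<Rightarrow> bool" where
  "shape_goes_right d e = goes_right (map_ptree (\<lambda>_. pos 1) d) (map_ptree (\<lambda>_. pos 1) e)"

lemma goes_right_iff:
  "goes_right q p \<longleftrightarrow>
    (if ushape (forget q) \<noteq> ushape (forget p) then shape_goes_right (plane_shape q) (plane_shape p)
     else \<exists>n. n < length (dfs q) \<and> (\<forall>i<n. pad (dfs_lengths q) i = pad (dfs_lengths p) i)
       \<and> pad (dfs_lengths q) n < pad (dfs_lengths p) n)"
proof (cases "ushape (forget q) = ushape (forget p)")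
  case True
  then have "uorder (forget q) = uorder (forget p)" "vertices (forget q) = vertices (forget p)"
    by (simp_all only: hs_order_def shape_def option.map vertices_ushape[symmetric, of "forget _"])
  with True show ?thesis
    by (simp add: goes_right_def lexordp_pad vertices_forget)
next
  case False
  then show ?thesis
    unfolding shape_goes_right_def
    by (subst goes_right_cong[where q'="map_ptree (\<lambda>_. pos 1) (plane_shape q)" and p'="map_ptree (\<lambda>_. pos 1) (plane_shape p)"])
       (auto simp: ptree.map_comp o_def)
qed

lemma measurable_goes_right [measurable (raw)]:
  assumes [measurable]: "f \<in> measurable M ptree_space" "g \<in> measurable M ptree_space"
  shows "Measurable.pred M (\<lambda>x. goes_right (f x) (g x))"
proof -
  have [measurable]: "(\<lambda>x. shape_goes_right (plane_shape (f x)) (plane_shape (g x))) \<in> measurable M (count_space UNIV)"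
    by (rule measurable_compose_countable[of "\<lambda>d x. shape_goes_right d (plane_shape (g x))"]) simp_all
  show ?thesis unfolding goes_right_iff by measurable
qed

lemma measurable_ptree_eq [measurable (raw)]:
  assumes [measurable]: "f \<in> measurable M ptree_space" "g \<in> measurable M ptree_space"
  shows "Measurable.pred M (\<lambda>x. f x = g x)"
  unfolding ptree_eq_iff_pad by measurable

text \<open>Lengths on \<open>ltree_space\<close> are those of the canonical embedding, so this
  carries measurable constructions from planar trees over to trees. The recursion at a node is
  \<open>embed_forget_PNode\<close>.\<close>

lemma measurable_embed_forget [measurable]: "(\<lambda>p. embed (forget p)) \<in> measurable ptree_space ptree_space"
proof (rule measurable_rec_ptree)
  show "(\<lambda>x. embed (forget (leaf x))) \<in> measurable borel ptree_space"
    by simp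
  show "(\<lambda>(x, s, t, y, z). if goes_right z y \<or> z = y then node x y z else node x z y)
    \<in> measurable (borel \<Otimes>\<^sub>M ptree_space \<Otimes>\<^sub>M ptree_space \<Otimes>\<^sub>M ptree_space \<Otimes>\<^sub>M ptree_space) ptree_space"
    by measurable
qed (simp only: embed_forget_PNode pos_real_of_posreal)

lemma edge_lengths_Some: "edge_lengths (Some s) = dfs_lengths (embed s)"
  by (simp add: edge_lengths_def)

lemma measurable_Some_forget [measurable]: "(\<lambda>p. Some (forget p)) \<in> measurable ptree_space ltree_space"
  unfolding measurable_ltree_space_iff
proof (intro conjI allI)
  show "(\<lambda>p. shape (Some (forget p))) \<in> measurable ptree_space (count_space UNIV)"
    unfolding shape_def option.map by measurable
  show "(\<lambda>p. pad (edge_lengths (Some (forget p))) i) \<in> borel_measurable ptree_space" for i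
    unfolding edge_lengths_Some by measurable
qed

text \<open>A measurable choice of a planar representative, used to test measurability on
  \<open>ltree_space\<close> by means of planar trees; the leaf standing for the empty tree is a
  default.\<close>

definition plane_of :: "ltree \<Rightarrow> posreal ptree" where
  "plane_of t = (case t of None \<Rightarrow> leaf 1 | Some s \<Rightarrow> embed s)"

definition embed_shape :: "unit utree \<Rightarrow> unit ptree" where
  "embed_shape \<tau> = plane_shape (embed (map_utree (\<lambda>_. pos 1) \<tau>))"

lemma plane_shape_embed: "plane_shape (embed s) = embed_shape (ushape s)"
  unfolding embed_shape_def
  by (rule plane_shape_embed_cong) (simp add: ushape_def utree.map_comp o_def)

lemma measurable_plane_of [measurable]: "plane_of \<in> measurable ltree_space ptree_space"
  unfolding measurable_ptree_space_iff
proof (intro conjI allI)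
  have "plane_shape (plane_of t) = (case shape t of None \<Rightarrow> PLeaf () | Some \<tau> \<Rightarrow> embed_shape \<tau>)" for t
    by (cases t) (auto simp: plane_of_def shape_def plane_shape_embed)
  then show "(\<lambda>t. plane_shape (plane_of t)) \<in> measurable ltree_space (count_space UNIV)"
    by simp
  fix i
  have "pad (dfs_lengths (plane_of t)) i = (if shape t = None then pad [1] i else pad (edge_lengths t) i)" for t
    by (cases t) (auto simp: plane_of_def shape_def edge_lengths_Some real_of_posreal_pos)
  then show "(\<lambda>t. pad (dfs_lengths (plane_of t)) i) \<in> borel_measurable ltree_space"
    by simp
qed

lemma measurable_ltree_spaceI:
  assumes "(\<lambda>p. g (Some (forget p))) \<in> measurable ptree_space N" "g None \<in> space N"
  shows "g \<in> measurable ltree_space N"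
proof -
  have "g = (\<lambda>t. if shape t = None then g None else g (Some (forget (plane_of t))))"
    by (auto simp: fun_eq_iff plane_of_def shape_def split: option.split)
  moreover have "(\<lambda>t. if shape t = None then g None else g (Some (forget (plane_of t)))) \<in> measurable ltree_space N"
    using assms(2)
    by (intro measurable_If measurable_compose[OF measurable_plane_of assms(1)]) (simp, measurable)
  ultimately show ?thesis by simp
qed

definition extend_stem :: "real \<Rightarrow> posreal ptree \<Rightarrow> posreal ptree" where
  "extend_stem x p = pmap_stem (posreal_add (pos x)) p"

lemma extend_stem_simps [simp]:
  "0 < x \<Longrightarrow> 0 < y \<Longrightarrow> extend_stem x (node y s t) = node (x + y) s t"
  "0 < x \<Longrightarrow> 0 < y \<Longrightarrow> extend_stem x (leaf y) = leaf (x + y)"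
  by (auto simp: extend_stem_def pos_def real_of_posreal_inject[symmetric] real_of_posreal_add Abs_posreal_inverse)

lemma extend_stem_eq:
  "extend_stem x p = (let y = (if 0 < x then x else 1) + root_length p in
    if is_leaf p then leaf y else node y (left_part p) (right_part p))"
  by (cases p)
     (auto simp: extend_stem_def Let_def pos_def real_of_posreal_inject[symmetric] real_of_posreal_add Abs_posreal_inverse add_pos_pos)

lemma measurable_extend_stem [measurable (raw)]:
  assumes [measurable]: "l \<in> borel_measurable M" "f \<in> measurable M ptree_space"
  shows "(\<lambda>x. extend_stem (l x) (f x)) \<in> measurable M ptree_space"
  unfolding extend_stem_eq Let_def by measurable

text \<open>Pruning as a total function. Trees of order one are single leaves and are left unchanged
  as a default, so uses of \<open>pr\<close> treat order one apart.\<close>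

primrec pr :: "posreal ptree \<Rightarrow> posreal ptree" where
  "pr (PLeaf a) = PLeaf a"
| "pr (PNode a l r) =
    (if porder l = 1 then if porder r = 1 then PLeaf a else pmap_stem (posreal_add a) (pr r)
     else if porder r = 1 then pmap_stem (posreal_add a) (pr l) else PNode a (pr l) (pr r))"

lemma pprune_with_eq_pr: "pprune_with posreal_add p = (if porder p = 1 then None else Some (pr p))"
  by (induction p) (auto simp: max_def le_Suc_eq)

lemma measurable_pr [measurable]: "pr \<in> measurable ptree_space ptree_space"
proof (rule measurable_rec_ptree)
  show "(\<lambda>x. pr (leaf x)) \<in> measurable borel ptree_space" by simp
  show "(\<lambda>(x, s, t, y, z).
      if porder s = 1 then if porder t = 1 then leaf x else extend_stem x z
      else if porder t = 1 then extend_stem x y else node x y z)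
    \<in> measurable (borel \<Otimes>\<^sub>M ptree_space \<Otimes>\<^sub>M ptree_space \<Otimes>\<^sub>M ptree_space \<Otimes>\<^sub>M ptree_space) ptree_space"
    by measurable
qed (simp add: extend_stem_def)

lemma lprune_forget: "lprune (Some (forget p)) = (if porder p = 1 then None else Some (forget (pr p)))"
  by (simp add: lprune_def prune_with_forget pprune_with_eq_pr)

lemma measurable_lprune [measurable]: "lprune \<in> measurable ltree_space ltree_space"
proof (rule measurable_ltree_spaceI)
  show "(\<lambda>p. lprune (Some (forget p))) \<in> measurable ptree_space ltree_space"
    unfolding lprune_forget by measurable
qed (simp add: lprune_def)

definition scale :: "real \<Rightarrow> posreal ptree \<Rightarrow> posreal ptree" where
  "scale u = map_ptree (\<lambda>a. pos (u * real_of_posreal a))"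

lemma pad_scale: "0 < u \<Longrightarrow> pad (dfs_lengths (scale u p)) i = u * pad (dfs_lengths p) i"
  by (auto simp: pad_def scale_def dfs_map_ptree real_of_posreal_pos)

lemma measurable_scale [measurable (raw)]:
  assumes [measurable]: "u \<in> borel_measurable M" "f \<in> measurable M ptree_space"
  shows "(\<lambda>x. scale (u x) (f x)) \<in> measurable M ptree_space"
  unfolding measurable_ptree_space_iff
proof (intro conjI allI)
  have "plane_shape (scale (u x) (f x)) = plane_shape (f x)" for x
    by (simp add: scale_def ptree.map_comp o_def)
  then show "(\<lambda>x. plane_shape (scale (u x) (f x))) \<in> measurable M (count_space UNIV)"
    by simp
  have "pad (dfs_lengths (scale (u x) (f x))) i = (if i < length (dfs (f x)) then
      (if 0 < u x * pad (dfs_lengths (f x)) i then u x * pad (dfs_lengths (f x)) i else 1) else 0)" for x i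
    by (auto simp: pad_def scale_def dfs_map_ptree real_of_posreal_pos)
  then show "(\<lambda>x. pad (dfs_lengths (scale (u x) (f x))) i) \<in> borel_measurable M" for i
    by simp
qed

lemma measurable_sum_tops [measurable]:
  assumes [measurable]: "f \<in> borel_measurable ptree_space"
  shows "(\<lambda>p. \<Sum>q\<in>#tops K p. f q :: ennreal) \<in> borel_measurable ptree_space"
proof (rule measurable_rec_ptree)
  show "(\<lambda>x. \<Sum>q\<in>#tops K (leaf x). f q) \<in> borel_measurable borel"
    by (cases "K = 1") simp_all
  have [measurable]: "(\<lambda>(x, s, t, y, z). porder (node x s t)) \<in>
    measurable (borel \<Otimes>\<^sub>M ptree_space \<Otimes>\<^sub>M ptree_space \<Otimes>\<^sub>M borel \<Otimes>\<^sub>M borel) (count_space UNIV)"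
    by measurable
  show "(\<lambda>(x, s, t, y, z). if porder (node x s t) = K then f (node x s t) else y + z :: ennreal)
    \<in> borel_measurable (borel \<Otimes>\<^sub>M ptree_space \<Otimes>\<^sub>M ptree_space \<Otimes>\<^sub>M borel \<Otimes>\<^sub>M borel)"
    by measurable
qed simp

lemma tree_length_eq: "tree_length t = (\<Sum>i<length (edge_lengths t). pad (edge_lengths t) i)"
  by (simp add: tree_length_def sum_list_sum_nth pad_def atLeast0LessThan)

lemma measurable_length_edge_lengths [measurable]:
  "(\<lambda>t. length (edge_lengths t)) \<in> measurable ltree_space (count_space UNIV)"
  by (rule measurable_ltree_spaceI) (simp_all add: edge_lengths_Some)

lemma measurable_tree_length [measurable]: "tree_length \<in> borel_measurable ltree_space"
  unfolding tree_length_eq[abs_def]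
  by (rule measurable_compose_countable[of "\<lambda>n t. \<Sum>i<n. pad (edge_lengths t) i"]) simp_all

lemma measurable_pad_proportions [measurable]: "(\<lambda>t. pad (proportions t)) \<in> measurable ltree_space vec_space"
proof -
  have "pad (proportions t) i = pad (edge_lengths t) i / tree_length t" for t i
    by (simp add: pad_def proportions_def)
  then show ?thesis unfolding measurable_vec_space_iff by simp
qed

section \<open>Uniform choice from a multiset of subtrees\<close>

lemma sum_mset_count:
  fixes f :: "'b \<Rightarrow> ennreal"
  assumes "finite S" "set_mset M \<subseteq> S"
  shows "(\<Sum>x\<in>#M. f x) = (\<Sum>x\<in>S. of_nat (count M x) * f x)"
  using assms(2)
proof (induction M)
  case (add x M)
  have "(\<Sum>y\<in>S. of_nat (count (add_mset x M) y) * f y) =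
      (\<Sum>y\<in>S. of_nat (count M y) * f y + (if y = x then f y else 0))"
    by (intro sum.cong) (auto simp: distrib_right)
  also have "\<dots> = (\<Sum>y\<in>S. of_nat (count M y) * f y) + f x"
    using add.prems assms(1) by (simp add: sum.distrib)
  finally show ?case using add by (simp add: add.commute)
qed simp

lemma nn_integral_pmf_of_multiset:
  assumes "M \<noteq> {#}"
  shows "(\<integral>\<^sup>+x. f x \<partial>measure_pmf (pmf_of_multiset M)) = (\<Sum>x\<in>#M. f x) / of_nat (size M)"
proof -
  have 1: "(\<Sum>x\<in>#M. f x) = (\<Sum>x\<in>set_mset M. of_nat (count M x) * f x)"
    by (rule sum_mset_count) simp_all
  have 2: "ennreal (real (count M x) / real (size M)) = of_nat (count M x) / of_nat (size M)" for x
    unfolding ennreal_of_nat_eq_real_of_nat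
    by (rule divide_ennreal[symmetric]) (use assms in \<open>simp_all add: nonempty_has_size\<close>)
  show ?thesis
    using assms
    by (subst nn_integral_measure_pmf_finite)
       (auto simp: 1 2 divide_ennreal_def sum_distrib_left mult_ac intro!: sum.cong)
qed

lemma emeasure_pmf_of_multiset:
  assumes "space N = UNIV" "A \<in> sets N" "M \<noteq> {#}"
  shows "emeasure (distr (measure_pmf (pmf_of_multiset M)) N (\<lambda>s. s)) A =
    (\<Sum>t\<in>#M. indicator A t) / of_nat (size M)"
proof -
  have "emeasure (distr (measure_pmf (pmf_of_multiset M)) N (\<lambda>s. s)) A =
      (\<integral>\<^sup>+t. indicator A t \<partial>measure_pmf (pmf_of_multiset M))"
    using assms by (simp add: emeasure_distr)
  also have "\<dots> = (\<Sum>t\<in>#M. indicator A t) / of_nat (size M)"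
    by (rule nn_integral_pmf_of_multiset) fact
  finally show ?thesis .
qed

lemma measurable_subtree_kernel:
  "(\<lambda>t. distr (measure_pmf (pmf_of_multiset (complete_subtrees K t))) ltree_space (\<lambda>s. s))
    \<in> measurable ltree_space (subprob_algebra ltree_space)"
proof (rule measurable_ltree_spaceI)
  let ?k = "\<lambda>t. distr (measure_pmf (pmf_of_multiset (complete_subtrees K t))) ltree_space (\<lambda>s. s)"
  have sp: "prob_space (?k t)" for t
    by (rule measure_pmf.prob_space_distr) simp
  then show "?k None \<in> space (subprob_algebra ltree_space)"
    by (simp only: space_subprob_algebra prob_space_imp_subprob_space mem_Collect_eq sets_distr simp_thms)
  show "(\<lambda>p. ?k (Some (forget p))) \<in> measurable ptree_space (subprob_algebra ltree_space)"
  proof (rule measurable_subprob_algebra)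
    show "subprob_space (?k (Some (forget p)))" for p
      using sp by (rule prob_space_imp_subprob_space)
    fix A assume A [measurable]: "A \<in> sets ltree_space"
    \<comment> \<open>\<open>pmf_of_multiset {#}\<close> is some fixed law; it enters when p has no
      complete subtree of order K and, being constant, does not disturb measurability.\<close>
    have eq: "emeasure (?k (Some (forget p))) A =
      (if size (tops K p) = 0 then emeasure (measure_pmf (pmf_of_multiset {#})) A
       else (\<Sum>q\<in>#tops K p. indicator A (Some (forget q))) / of_nat (size (tops K p)))" for p
    proof (cases "tops K p = {#}")
      case True
      then show ?thesis by (simp add: complete_subtrees_forget emeasure_distr)
    next
      case False
      have "emeasure (?k (Some (forget p))) A = (\<Sum>t\<in>#complete_subtrees K (Some (forget p)). indicator A t) /
          of_nat (size (complete_subtrees K (Some (forget p))))"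
        by (rule emeasure_pmf_of_multiset) (use False A in \<open>simp_all add: complete_subtrees_forget\<close>)
      also have "\<dots> = (\<Sum>q\<in>#tops K p. indicator A (Some (forget q))) / of_nat (size (tops K p))"
        by (simp only: complete_subtrees_forget image_mset.compositionality o_def size_image_mset)
      finally show ?thesis using False by simp
    qed
    show "(\<lambda>p. emeasure (?k (Some (forget p))) A) \<in> borel_measurable ptree_space"
      unfolding eq by measurable
  qed simp
qed

section \<open>Exponential clocks\<close>

abbreviation expo :: "real \<Rightarrow> real measure" where
  "expo r \<equiv> density lborel (exponential_density r)"

lemma nn_integral_expo:
  assumes [measurable]: "f \<in> borel_measurable borel" and "0 < r"
  shows "(\<integral>\<^sup>+x. f x \<partial>expo r) = (\<integral>\<^sup>+x. ennreal (r * exp (- r * x)) * indicator {0<..} x * f x \<partial>lborel)"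
  using AE_lborel_singleton[of 0] assms(2)
  by (subst nn_integral_density)
     (auto simp: exponential_density_def mult_ac split: split_indicator intro!: nn_integral_cong_AE)

lemma prob_space_expo: "0 < r \<Longrightarrow> prob_space (expo r)"
  by (rule prob_space_exponential_density)

lemma AE_expo_pos: "0 < r \<Longrightarrow> AE x in expo r. 0 < x"
  using AE_lborel_singleton[of 0]
  by (subst AE_density) (auto simp: exponential_density_def)

lemma emeasure_expo_gt:
  assumes "0 \<le> c" "0 < r"
  shows "emeasure (expo r) {c<..} = ennreal (exp (- c * r))"
proof -
  interpret prob_space "expo r" using assms by (rule_tac prob_space_expo)
  have "distributed (expo r) lborel (\<lambda>x. x) (exponential_density r)"
    by (auto simp: distributed_def distr_id2)
  from exponential_distributedD_gt[OF this assms] have "measure (expo r) {c<..} = exp (- c * r)"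
    by (simp add: greaterThan_def)
  then show ?thesis by (simp add: emeasure_eq_measure)
qed

lemma emeasure_expo_ge:
  assumes "0 \<le> c" "0 < r"
  shows "emeasure (expo r) {c..} = ennreal (exp (- c * r))"
proof -
  have "emeasure (expo r) {c..} = emeasure (expo r) {c<..}"
    by (rule emeasure_eq_AE) (use AE_lborel_singleton[of c] in \<open>auto simp: AE_density\<close>)
  with emeasure_expo_gt[OF assms] show ?thesis by simp
qed

text \<open>Competing exponential clocks: the index that rings first and the time at which it rings
  are independent, index e having weight proportional to \<open>r e\<close> and the time having the
  summed rate. Letting g depend on both expresses the independence.\<close>

lemma race:
  fixes r :: "nat \<Rightarrow> real" and g :: "nat \<Rightarrow> real \<Rightarrow> ennreal"
  assumes V: "finite V" "V \<noteq> {}" and r: "\<And>e. e \<in> V \<Longrightarrow> 0 < r e"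
    and g [measurable]: "\<And>e. g e \<in> borel_measurable borel"
  defines "fe \<equiv> \<lambda>d. LEAST e. e \<in> V \<and> (\<forall>e'\<in>V. d e / r e \<le> d e' / r e')"
  shows "(\<integral>\<^sup>+d. g (fe d) (d (fe d) / r (fe d)) \<partial>(\<Pi>\<^sub>M e\<in>UNIV. expo 1)) =
    (\<Sum>e\<in>V. ennreal (r e / sum r V) * (\<integral>\<^sup>+x. g e x \<partial>expo (sum r V)))"
proof -
  interpret E: product_prob_space "\<lambda>_. expo 1" "UNIV :: nat set"
    by (intro product_prob_spaceI prob_space_expo) simp
  have \<rho>: "0 < sum r V" using V r by (rule_tac sum_pos) auto
  \<comment> \<open>Strict against smaller indices because \<open>LEAST\<close> gives ties to the
    smallest index. The winning events then form an exact partition, and ties need no null-set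
    argument.\<close>
  let ?wins = "\<lambda>e d. \<forall>e'\<in>V - {e}. if e' < e then d e / r e < d e' / r e' else d e / r e \<le> d e' / r e'"
  have fe: "fe d = e \<longleftrightarrow> ?wins e d" if "e \<in> V" for d e
  proof
    have ex: "\<exists>e. e \<in> V \<and> (\<forall>e'\<in>V. d e / r e \<le> d e' / r e')"
      using arg_min_if_finite[OF V, of "\<lambda>e. d e / r e"] by (meson not_less)
    assume "fe d = e"
    then have *: "\<forall>e'\<in>V. d e / r e \<le> d e' / r e'"
      "\<And>e'. e' < e \<Longrightarrow> e' \<in> V \<Longrightarrow> \<exists>e''\<in>V. \<not> d e' / r e' \<le> d e'' / r e''"
      using LeastI_ex[OF ex] not_less_Least unfolding fe_def by blast+
    show "?wins e d"
    proof (intro ballI)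
      fix e' assume "e' \<in> V - {e}"
      then have e': "e' \<in> V" "e' \<noteq> e" by auto
      show "if e' < e then d e / r e < d e' / r e' else d e / r e \<le> d e' / r e'"
      proof (cases "e' < e")
        case True
        with *(2)[of e'] e' obtain e'' where "e'' \<in> V" "d e'' / r e'' < d e' / r e'" by (auto simp: not_le)
        with *(1) True show ?thesis by (auto intro: le_less_trans)
      qed (use *(1) e' in auto)
    qed
  next
    assume w: "?wins e d"
    show "fe d = e"
      unfolding fe_def
    proof (rule Least_equality)
      show "e \<in> V \<and> (\<forall>e'\<in>V. d e / r e \<le> d e' / r e')"
        using that w by (metis DiffI eq_refl less_imp_le singletonD)
      fix y assume y: "y \<in> V \<and> (\<forall>e'\<in>V. d y / r y \<le> d e' / r e')"
      show "e \<le> y"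
      proof (rule ccontr)
        assume "\<not> e \<le> y"
        then have "d e / r e < d y / r y" using w y by (metis DiffI nat_less_le not_le singletonD)
        moreover have "d y / r y \<le> d e / r e" using y that by blast
        ultimately show False by simp
      qed
    qed
  qed
  have feV: "fe d \<in> V" for d
    using LeastI_ex[of "\<lambda>e. e \<in> V \<and> (\<forall>e'\<in>V. d e / r e \<le> d e' / r e')"]
      arg_min_if_finite[OF V, of "\<lambda>e. d e / r e"]
    unfolding fe_def by (meson not_less)
  have wins [measurable]: "Measurable.pred (\<Pi>\<^sub>M e\<in>UNIV. expo 1) (?wins e)" for e
  proof -
    have c: "(\<lambda>d. d i / r j) \<in> borel_measurable (\<Pi>\<^sub>M e\<in>UNIV. expo 1)" for i j
      using measurable_component_singleton[of i UNIV "\<lambda>_. expo 1"] by simp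
    have "Measurable.pred (\<Pi>\<^sub>M e\<in>UNIV. expo 1)
        (\<lambda>d. if e' < e then d e / r e < d e' / r e' else d e / r e \<le> d e' / r e')" for e'
      using borel_measurable_less[OF c c] borel_measurable_le[OF c c]
      by (cases "e' < e") (simp_all add: pred_def)
    then show ?thesis using V(1) by (intro pred_intros_finite) auto
  qed
  have split: "g (fe d) (d (fe d) / r (fe d)) = (\<Sum>e\<in>V. indicator {d. ?wins e d} d * g e (d e / r e))" for d
  proof -
    have "(\<Sum>e\<in>V. indicator {d. ?wins e d} d * g e (d e / r e)) =
        (\<Sum>e\<in>V. if e = fe d then g e (d e / r e) else 0)"
    proof (intro sum.cong refl)
      fix e assume "e \<in> V"
      then have "indicator {d. ?wins e d} d = (if fe d = e then 1 else 0 :: ennreal)"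
        by (simp only: fe indicator_def mem_Collect_eq of_bool_def)
      then show "indicator {d. ?wins e d} d * g e (d e / r e) = (if e = fe d then g e (d e / r e) else 0)"
        by (auto simp del: indicator_simps)
    qed
    also have "\<dots> = g (fe d) (d (fe d) / r (fe d))"
      using V(1) feV by simp
    finally show ?thesis by simp
  qed
  have one: "(\<integral>\<^sup>+d. indicator {d. ?wins e d} d * g e (d e / r e) \<partial>(\<Pi>\<^sub>M e\<in>UNIV. expo 1)) =
      ennreal (r e / sum r V) * (\<integral>\<^sup>+x. g e x \<partial>expo (sum r V))" if e: "e \<in> V" for e
  proof -
    let ?I = "V - {e}"
    let ?ok = "\<lambda>x e' y. if e' < e then x / r e < y / r e' else x / r e \<le> y / r e'"
    have r_e: "0 < r e" using r e by simp
    have insV: "insert e ?I = V" using e by auto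
    have wins_eq: "indicator {d. ?wins e d} d = (\<Prod>e'\<in>?I. indicator {y. ?ok (d e) e' y} (d e') :: ennreal)" for d
    proof (cases "?wins e d")
      case True
      then have "(\<Prod>e'\<in>?I. indicator {y. ?ok (d e) e' y} (d e') :: ennreal) = 1"
        by (intro prod.neutral ballI indicator_simps(1)) blast
      moreover have "indicator {d. ?wins e d} d = (1 :: ennreal)" using True by (intro indicator_simps(1)) blast
      ultimately show ?thesis by simp
    next
      case False
      then obtain e' where e': "e' \<in> ?I" "\<not> ?ok (d e) e' (d e')" by blast
      then have "(\<Prod>e'\<in>?I. indicator {y. ?ok (d e) e' y} (d e') :: ennreal) = 0"
        using V(1) by (intro prod_zero bexI[of _ e'] indicator_simps(2)) auto
      moreover have "indicator {d. ?wins e d} d = (0 :: ennreal)" using False by (intro indicator_simps(2)) blast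
      ultimately show ?thesis by simp
    qed
    \<comment> \<open>Whether e wins is decided by the finitely many clocks in V, which reduces the
      infinite product to a finite one; the clock of e is then kept for the outer integral.\<close>
    define h where "h d = (\<Prod>e'\<in>?I. indicator {y. ?ok (d e) e' y} (d e') :: ennreal) * g e (d e / r e)" for d
    have h_restrict: "h (restrict d V) = h d" for d
      unfolding h_def using e by (intro arg_cong2[where f="(*)"] prod.cong) auto
    have hm [measurable]: "h \<in> borel_measurable (Pi\<^sub>M V (\<lambda>_. expo 1))"
    proof -
      have c: "(\<lambda>d. d i / r i) \<in> borel_measurable (Pi\<^sub>M V (\<lambda>_. expo 1))" if "i \<in> V" for i
        using measurable_component_singleton[OF that, of "\<lambda>_. expo 1"] by simp
      have "(\<lambda>d. indicator {y. ?ok (d e) e' y} (d e') :: ennreal) \<in> borel_measurable (Pi\<^sub>M V (\<lambda>_. expo 1))"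
        if "e' \<in> V" for e'
        using borel_measurable_less[OF c[OF e] c[OF that]] borel_measurable_le[OF c[OF e] c[OF that]]
        by (cases "e' < e") (simp_all add: indicator_def of_bool_def)
      then show ?thesis
        unfolding h_def using e
        by (intro borel_measurable_times_ennreal borel_measurable_prod_ennreal measurable_compose[OF c g]) auto
    qed
    have "(\<integral>\<^sup>+d. indicator {d. ?wins e d} d * g e (d e / r e) \<partial>(\<Pi>\<^sub>M e\<in>UNIV. expo 1)) =
        (\<integral>\<^sup>+d. h (restrict d V) \<partial>(\<Pi>\<^sub>M e\<in>UNIV. expo 1))"
      by (simp only: wins_eq h_restrict) (simp add: h_def)
    also have "\<dots> = (\<integral>\<^sup>+d. h d \<partial>distr (\<Pi>\<^sub>M e\<in>UNIV. expo 1) (Pi\<^sub>M V (\<lambda>_. expo 1)) (\<lambda>d. restrict d V))"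
      by (subst nn_integral_distr) auto
    also have "distr (\<Pi>\<^sub>M e\<in>UNIV. expo 1) (Pi\<^sub>M V (\<lambda>_. expo 1)) (\<lambda>d. restrict d V) = Pi\<^sub>M V (\<lambda>_. expo 1)"
      using V(1) by (intro E.distr_PiM_restrict_finite) auto
    also have "(\<integral>\<^sup>+d. h d \<partial>Pi\<^sub>M V (\<lambda>_. expo 1)) = (\<integral>\<^sup>+d. h d \<partial>Pi\<^sub>M (insert e ?I) (\<lambda>_. expo 1))"
      by (simp only: insV)
    also have "\<dots> = (\<integral>\<^sup>+x. \<integral>\<^sup>+d. h (d(e := x)) \<partial>Pi\<^sub>M ?I (\<lambda>_. expo 1) \<partial>expo 1)"
      by (intro E.product_nn_integral_insert_rev) (use V(1) hm in \<open>simp_all only: insV, auto\<close>)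
    \<comment> \<open>Given that the clock of e shows x, hence rings at \<open>x / r e\<close>, the
      rival e' rings later with probability \<open>exp (- (x / r e * r e'))\<close>; the product
      over the rivals has an exponent linear in x.\<close>
    also have "\<dots> = (\<integral>\<^sup>+x. ennreal (exp (- (sum r ?I / r e) * x)) * g e (x / r e) \<partial>expo 1)"
    proof (rule nn_integral_cong_AE, use AE_expo_pos[of 1] in \<open>rule AE_mp\<close>, simp, rule AE_I2, rule impI)
      fix x :: real assume x: "0 < x"
      have sets: "{y. ?ok x e' y} = (if e' < e then {x / r e * r e'<..} else {x / r e * r e'..})" if "e' \<in> ?I" for e'
        using r[of e'] that by (auto simp: field_simps)
      have "(\<integral>\<^sup>+d. h (d(e := x)) \<partial>Pi\<^sub>M ?I (\<lambda>_. expo 1)) =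
          (\<integral>\<^sup>+d. (\<Prod>e'\<in>?I. indicator {y. ?ok x e' y} (d e')) * g e (x / r e) \<partial>Pi\<^sub>M ?I (\<lambda>_. expo 1))"
        unfolding h_def by (intro nn_integral_cong arg_cong2[where f="(*)"] prod.cong) auto
      also have "\<dots> = (\<integral>\<^sup>+d. (\<Prod>e'\<in>?I. indicator {y. ?ok x e' y} (d e')) \<partial>Pi\<^sub>M ?I (\<lambda>_. expo 1)) * g e (x / r e)"
      proof (intro nn_integral_multc borel_measurable_prod_ennreal)
        fix e' assume "e' \<in> ?I"
        then show "(\<lambda>d. indicator {y. ?ok x e' y} (d e') :: ennreal) \<in> borel_measurable (Pi\<^sub>M ?I (\<lambda>_. expo 1))"
          using sets[of e'] by (intro measurable_compose[OF measurable_component_singleton]) auto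
      qed
      also have "(\<integral>\<^sup>+d. (\<Prod>e'\<in>?I. indicator {y. ?ok x e' y} (d e')) \<partial>Pi\<^sub>M ?I (\<lambda>_. expo 1)) =
          (\<Prod>e'\<in>?I. \<integral>\<^sup>+y. indicator {y. ?ok x e' y} y \<partial>expo 1)"
        using V(1) by (intro E.product_nn_integral_prod) (auto simp: sets)
      also have "\<dots> = (\<Prod>e'\<in>?I. ennreal (exp (- (x / r e * r e'))))"
      proof (intro prod.cong refl)
        fix e' assume e': "e' \<in> ?I"
        have "0 \<le> x / r e * r e'" using r[of e'] r_e x e' by auto
        then show "(\<integral>\<^sup>+y. indicator {y. ?ok x e' y} y \<partial>expo 1) = ennreal (exp (- (x / r e * r e')))"
          unfolding sets[OF e'] by (auto simp: emeasure_expo_gt emeasure_expo_ge)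
      qed
      also have "\<dots> = ennreal (\<Prod>e'\<in>?I. exp (- (x / r e * r e')))"
        by (rule prod_ennreal) simp
      also have "(\<Prod>e'\<in>?I. exp (- (x / r e * r e'))) = exp (- (sum r ?I / r e) * x)"
        using V(1) by (simp add: exp_sum[symmetric] sum_negf sum_distrib_left mult_ac sum_divide_distrib)
      finally show "(\<integral>\<^sup>+d. h (d(e := x)) \<partial>Pi\<^sub>M ?I (\<lambda>_. expo 1)) =
          ennreal (exp (- (sum r ?I / r e) * x)) * g e (x / r e)" .
    qed
    also have "\<dots> = (\<integral>\<^sup>+x. ennreal (exp (- x)) * indicator {0<..} x *
        (ennreal (exp (- (sum r ?I / r e) * x)) * g e (x / r e)) \<partial>lborel)"
      by (subst nn_integral_expo) auto
    \<comment> \<open>Change of variable from the clock reading to the ringing time, after which the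
      exponents add up to the rate \<open>sum r V\<close>.\<close>
    also have "\<dots> = ennreal (r e) * (\<integral>\<^sup>+x. ennreal (exp (- (r e * x))) * indicator {0<..} (r e * x) *
        (ennreal (exp (- (sum r ?I / r e) * (r e * x))) * g e (r e * x / r e)) \<partial>lborel)"
      by (subst nn_integral_real_affine[where c="r e" and t=0]) (use r_e in auto)
    also have "\<dots> = ennreal (r e) * (\<integral>\<^sup>+x. ennreal (1 / sum r V) *
        (ennreal (sum r V * exp (- sum r V * x)) * indicator {0<..} x * g e x) \<partial>lborel)"
    proof (rule arg_cong2[where f="(*)", OF refl], rule nn_integral_cong)
      fix x :: real
      have sV: "sum r V = r e + sum r ?I" using V(1) e by (simp add: sum.remove)
      have "ennreal (exp (- (r e * x))) * ennreal (exp (- (sum r ?I / r e) * (r e * x))) =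
          ennreal (1 / sum r V) * ennreal (sum r V * exp (- sum r V * x))"
      proof -
        have "ennreal (exp (- (r e * x))) * ennreal (exp (- (sum r ?I / r e) * (r e * x))) =
            ennreal (exp (- sum r V * x))"
          unfolding sV using r_e by (simp add: ennreal_mult[symmetric] exp_add[symmetric] algebra_simps)
        moreover have "ennreal (1 / sum r V) * ennreal (sum r V * exp (- sum r V * x)) = ennreal (exp (- sum r V * x))"
          using \<rho> by (simp add: ennreal_mult[symmetric])
        ultimately show ?thesis by simp
      qed
      moreover have "indicator {0<..} (r e * x) = (indicator {0<..} x :: ennreal)"
        using r_e by (auto simp: zero_less_mult_iff split: split_indicator)
      ultimately show "ennreal (exp (- (r e * x))) * indicator {0<..} (r e * x) *
          (ennreal (exp (- (sum r ?I / r e) * (r e * x))) * g e (r e * x / r e)) =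
          ennreal (1 / sum r V) * (ennreal (sum r V * exp (- sum r V * x)) * indicator {0<..} x * g e x)"
        using r_e by (simp add: mult_ac)
    qed
    also have "\<dots> = ennreal (r e) * ennreal (1 / sum r V) * (\<integral>\<^sup>+x. g e x \<partial>expo (sum r V))"
      using \<rho> by (subst nn_integral_cmult) (auto simp: nn_integral_expo mult.assoc)
    also have "ennreal (r e) * ennreal (1 / sum r V) = ennreal (r e / sum r V)"
      using r_e \<rho> by (simp add: ennreal_mult[symmetric])
    finally show ?thesis .
  qed
  have "(\<integral>\<^sup>+d. g (fe d) (d (fe d) / r (fe d)) \<partial>(\<Pi>\<^sub>M e\<in>UNIV. expo 1)) =
     (\<Sum>e\<in>V. \<integral>\<^sup>+d. indicator {d. ?wins e d} d * g e (d e / r e) \<partial>(\<Pi>\<^sub>M e\<in>UNIV. expo 1))"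
    unfolding split
  proof (intro nn_integral_sum borel_measurable_times_ennreal borel_measurable_indicator)
    show "{d. ?wins e d} \<in> sets (\<Pi>\<^sub>M e\<in>UNIV. expo 1)" for e
      using wins[of e] unfolding pred_def by (simp add: space_PiM)
    show "(\<lambda>d. g e (d e / r e)) \<in> borel_measurable (\<Pi>\<^sub>M e\<in>UNIV. expo 1)" for e
      using measurable_component_singleton[of e UNIV "\<lambda>_. expo 1"]
      by (intro measurable_compose[OF _ g]) simp
  qed
  also have "\<dots> = (\<Sum>e\<in>V. ennreal (r e / sum r V) * (\<integral>\<^sup>+x. g e x \<partial>expo (sum r V)))"
    by (intro sum.cong refl one)
  finally show ?thesis .
qed

text \<open>\<open>grows\<close> extends addresses at the head, so the turn taken at the root edge
  is the last entry of an address.\<close>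

definition subclocks :: "bool \<Rightarrow> clocks \<Rightarrow> clocks" where
  "subclocks b \<omega> = (\<lambda>(v, e). \<omega> (v @ [b], e))"

definition root_clocks :: "clocks \<Rightarrow> nat \<Rightarrow> real" where
  "root_clocks \<omega> = (\<lambda>e. \<omega> ([], e))"

definition join_clocks :: "(nat \<Rightarrow> real) \<Rightarrow> clocks \<Rightarrow> clocks \<Rightarrow> clocks" where
  "join_clocks d a b = (\<lambda>(u, e). if u = [] then d e else if last u then b (butlast u, e) else a (butlast u, e))"

lemma join_clocks_simps [simp]:
  "subclocks False (join_clocks d a b) = a" "subclocks True (join_clocks d a b) = b"
  "root_clocks (join_clocks d a b) = d"
  by (auto simp: subclocks_def join_clocks_def root_clocks_def fun_eq_iff)

interpretation clocks: product_prob_space "\<lambda>_ :: bool list \<times> nat. expo 1" UNIV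
  rewrites "Pi\<^sub>M UNIV (\<lambda>_ :: bool list \<times> nat. expo 1) = clock_space"
  by (intro product_prob_spaceI prob_space_expo) (simp_all add: clock_space_def)

abbreviation root_space :: "(nat \<Rightarrow> real) measure" where
  "root_space \<equiv> (\<Pi>\<^sub>M e\<in>UNIV. expo 1)"

lemma space_clock_space [simp]: "space clock_space = UNIV"
  by (simp add: clock_space_def space_PiM)

lemma space_root_space [simp]: "space root_space = UNIV"
  by (simp add: space_PiM)

lemma UNIV_in_sets_clock_space [simp]: "UNIV \<in> sets clock_space"
  using sets.top[of clock_space] by simp

lemma UNIV_in_sets_root_space [simp]: "UNIV \<in> sets root_space"
  using sets.top[of root_space] by (simp only: space_root_space)

lemma measurable_clock:
  "f \<in> measurable M clock_space \<Longrightarrow> (\<lambda>x. f x c) \<in> borel_measurable M"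
proof -
  assume f: "f \<in> measurable M clock_space"
  have "(\<lambda>\<omega>. \<omega> c) \<in> measurable clock_space (expo 1)"
    unfolding clock_space_def by (rule measurable_component_singleton) simp
  from measurable_compose[OF f this] show ?thesis by simp
qed

lemma measurable_clock_spaceI:
  "(\<And>c. (\<lambda>x. f x c) \<in> borel_measurable M) \<Longrightarrow> f \<in> measurable M clock_space"
  using measurable_restrict[of UNIV "\<lambda>c x. f x c" M "\<lambda>_. expo 1"] by (simp add: clock_space_def restrict_UNIV)

lemma measurable_subclocks [measurable]: "subclocks b \<in> measurable clock_space clock_space"
  by (rule measurable_clock_spaceI) (auto simp: subclocks_def case_prod_beta intro!: measurable_clock)

lemma measurable_root_clocks [measurable]: "root_clocks \<in> measurable clock_space root_space"
  supply measurable_clock [measurable (raw)]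
  using measurable_restrict[of UNIV "\<lambda>e \<omega>. \<omega> ([], e)" clock_space "\<lambda>_. expo 1"]
  by (simp add: root_clocks_def[abs_def] restrict_UNIV)

lemma measurable_join_clocks [measurable]:
  "(\<lambda>(d, a, b). join_clocks d a b) \<in> measurable (root_space \<Otimes>\<^sub>M clock_space \<Otimes>\<^sub>M clock_space) clock_space"
proof (rule measurable_clock_spaceI)
  fix c :: "bool list \<times> nat"
  note measurable_clock [measurable (raw)]
  obtain u e where "c = (u, e)" by (cases c)
  moreover have "(\<lambda>d. d e) \<in> borel_measurable root_space"
    using measurable_component_singleton[of e UNIV "\<lambda>_. expo 1"] by simp
  ultimately show "(\<lambda>x. (case x of (d, a, b) \<Rightarrow> join_clocks d a b) c)
      \<in> borel_measurable (root_space \<Otimes>\<^sub>M clock_space \<Otimes>\<^sub>M clock_space)"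
    by (auto simp: join_clocks_def case_prod_beta intro!: measurable_compose[OF measurable_fst])
qed

text \<open>Independence of the root clocks and of the clocks of the two subtrees. It suffices to
  compare finite cylinders, and a finite set J of clocks splits into those at the root, those whose
  address has last entry \<open>False\<close> and those with last entry \<open>True\<close>.\<close>

lemma distr_join_clocks:
  "distr (root_space \<Otimes>\<^sub>M clock_space \<Otimes>\<^sub>M clock_space) clock_space (\<lambda>(d, a, b). join_clocks d a b) = clock_space"
  (is "?D = _")
  unfolding clock_space_def
proof (rule measure_eqI_PiM_infinite[symmetric], simp, simp, unfold clock_space_def[symmetric])
  show "finite_measure clock_space" by unfold_locales
  interpret R: product_prob_space "\<lambda>_ :: nat. expo 1" UNIV
    by (intro product_prob_spaceI prob_space_expo) simp
  interpret CC: pair_prob_space clock_space clock_space ..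
  fix A :: "bool list \<times> nat \<Rightarrow> real set" and J
  assume J: "finite J" and A: "\<And>i. i \<in> J \<Longrightarrow> A i \<in> sets (expo 1)"
  define J0 where "J0 = {e. ([], e) \<in> J}"
  define Jb where "Jb b = {(v, e). (v @ [b], e) \<in> J}" for b
  have fin: "finite J0" "finite (Jb b)" for b
  proof -
    have "J0 = (\<lambda>e. ([], e)) -` J" "Jb b = (\<lambda>(v, e). (v @ [b], e)) -` J"
      by (auto simp: J0_def Jb_def)
    then show "finite J0" "finite (Jb b)"
      using J by (auto intro!: finite_vimageI simp: inj_on_def)
  qed
  have JU: "J = (\<lambda>e. ([], e)) ` J0 \<union> (\<lambda>(v, e). (v @ [False], e)) ` Jb False \<union> (\<lambda>(v, e). (v @ [True], e)) ` Jb True"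
    (is "J = ?a \<union> ?b \<union> ?c")
  proof (intro set_eqI iffI)
    fix c assume c: "c \<in> J"
    obtain u e where ue: "c = (u, e)" by (cases c)
    show "c \<in> ?a \<union> ?b \<union> ?c"
    proof (cases u rule: rev_cases)
      case (snoc v b)
      then show ?thesis using c ue by (cases b) (auto simp: Jb_def image_iff)
    qed (use c ue in \<open>auto simp: J0_def\<close>)
  qed (auto simp: J0_def Jb_def)
  have emb: "prod_emb UNIV (\<lambda>_. expo 1) J (Pi\<^sub>E J A) = {\<omega>. \<forall>c\<in>J. \<omega> c \<in> A c}"
    by (auto simp: prod_emb_def PiE_iff)
  have "emeasure ?D {\<omega>. \<forall>c\<in>J. \<omega> c \<in> A c} =
      emeasure (root_space \<Otimes>\<^sub>M clock_space \<Otimes>\<^sub>M clock_space)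
        ({d. \<forall>e\<in>J0. d e \<in> A ([], e)} \<times> {a. \<forall>c\<in>Jb False. a c \<in> A (fst c @ [False], snd c)} \<times>
         {a. \<forall>c\<in>Jb True. a c \<in> A (fst c @ [True], snd c)})"
  proof (subst emeasure_distr)
    show "{\<omega>. \<forall>c\<in>J. \<omega> c \<in> A c} \<in> sets clock_space"
      using A J by (simp add: emb[symmetric] clock_space_def sets_PiM_I)
    show "emeasure (root_space \<Otimes>\<^sub>M clock_space \<Otimes>\<^sub>M clock_space)
        ((\<lambda>(d, a, b). join_clocks d a b) -` {\<omega>. \<forall>c\<in>J. \<omega> c \<in> A c} \<inter> space (root_space \<Otimes>\<^sub>M clock_space \<Otimes>\<^sub>M clock_space)) =
      emeasure (root_space \<Otimes>\<^sub>M clock_space \<Otimes>\<^sub>M clock_space)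
        ({d. \<forall>e\<in>J0. d e \<in> A ([], e)} \<times> {a. \<forall>c\<in>Jb False. a c \<in> A (fst c @ [False], snd c)} \<times>
         {a. \<forall>c\<in>Jb True. a c \<in> A (fst c @ [True], snd c)})"
      by (rule arg_cong[where f="emeasure _"], subst JU)
         (auto simp: space_pair_measure join_clocks_def ball_Un)
  qed measurable
  also have "\<dots> = emeasure root_space {d. \<forall>e\<in>J0. d e \<in> A ([], e)} *
      (emeasure clock_space {a. \<forall>c\<in>Jb False. a c \<in> A (fst c @ [False], snd c)} *
       emeasure clock_space {a. \<forall>c\<in>Jb True. a c \<in> A (fst c @ [True], snd c)})"
  proof -
    have s0: "{d. \<forall>e\<in>J0. d e \<in> A ([], e)} \<in> sets root_space"
    proof -
      have "{d. \<forall>e\<in>J0. d e \<in> A ([], e)} = prod_emb UNIV (\<lambda>_. expo 1) J0 (\<Pi>\<^sub>E e\<in>J0. A ([], e))"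
        by (auto simp: prod_emb_def PiE_iff)
      then show ?thesis using A fin by (auto simp: J0_def intro!: sets_PiM_I)
    qed
    have sb: "{a. \<forall>c\<in>Jb b. a c \<in> A (fst c @ [b], snd c)} \<in> sets clock_space" for b
    proof -
      have "{a. \<forall>c\<in>Jb b. a c \<in> A (fst c @ [b], snd c)} = prod_emb UNIV (\<lambda>_. expo 1) (Jb b) (\<Pi>\<^sub>E c\<in>Jb b. A (fst c @ [b], snd c))"
        by (force simp: prod_emb_def PiE_iff)
      then show ?thesis using A fin by (auto simp: Jb_def clock_space_def intro!: sets_PiM_I)
    qed
    show ?thesis
      using s0 sb by (subst CC.emeasure_pair_measure_Times; (subst clocks.emeasure_pair_measure_Times)?) auto
  qed
  also have "emeasure root_space {d. \<forall>e\<in>J0. d e \<in> A ([], e)} = (\<Prod>e\<in>J0. emeasure (expo 1) (A ([], e)))"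
    using R.emeasure_PiM_Collect[of J0 "\<lambda>e. A ([], e)"] A fin by (simp add: J0_def)
  also have "emeasure clock_space {a. \<forall>c\<in>Jb False. a c \<in> A (fst c @ [False], snd c)} =
      (\<Prod>c\<in>Jb False. emeasure (expo 1) (A (fst c @ [False], snd c)))"
    using clocks.emeasure_PiM_Collect[of "Jb False" "\<lambda>c. A (fst c @ [False], snd c)"] A fin
    by (auto simp: Jb_def)
  also have "emeasure clock_space {a. \<forall>c\<in>Jb True. a c \<in> A (fst c @ [True], snd c)} =
      (\<Prod>c\<in>Jb True. emeasure (expo 1) (A (fst c @ [True], snd c)))"
    using clocks.emeasure_PiM_Collect[of "Jb True" "\<lambda>c. A (fst c @ [True], snd c)"] A fin
    by (auto simp: Jb_def)
  also have "(\<Prod>e\<in>J0. emeasure (expo 1) (A ([], e))) *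
      ((\<Prod>c\<in>Jb False. emeasure (expo 1) (A (fst c @ [False], snd c))) *
       (\<Prod>c\<in>Jb True. emeasure (expo 1) (A (fst c @ [True], snd c)))) = (\<Prod>c\<in>J. emeasure (expo 1) (A c))"
  proof -
    have "(\<Prod>c\<in>J. emeasure (expo 1) (A c)) = (\<Prod>c\<in>?a. emeasure (expo 1) (A c)) *
        (\<Prod>c\<in>?b. emeasure (expo 1) (A c)) * (\<Prod>c\<in>?c. emeasure (expo 1) (A c))"
      using fin by (subst JU, subst prod.union_disjoint, simp, simp, force, subst prod.union_disjoint) auto
    also have "(\<Prod>c\<in>?a. emeasure (expo 1) (A c)) = (\<Prod>e\<in>J0. emeasure (expo 1) (A ([], e)))"
      by (subst prod.reindex) (auto simp: inj_on_def)
    also have "(\<Prod>c\<in>?b. emeasure (expo 1) (A c)) = (\<Prod>c\<in>Jb False. emeasure (expo 1) (A (fst c @ [False], snd c)))"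
      by (subst prod.reindex) (auto simp: inj_on_def case_prod_beta)
    also have "(\<Prod>c\<in>?c. emeasure (expo 1) (A c)) = (\<Prod>c\<in>Jb True. emeasure (expo 1) (A (fst c @ [True], snd c)))"
      by (subst prod.reindex) (auto simp: inj_on_def case_prod_beta)
    finally show ?thesis by (simp add: mult_ac)
  qed
  also have "\<dots> = emeasure clock_space {\<omega>. \<forall>c\<in>J. \<omega> c \<in> A c}"
    using clocks.emeasure_PiM_Collect[of J A] A J by simp
  finally show "emeasure clock_space (prod_emb UNIV (\<lambda>_. expo 1) J (Pi\<^sub>E J A)) =
      emeasure ?D (prod_emb UNIV (\<lambda>_. expo 1) J (Pi\<^sub>E J A))"
    unfolding emb by simp
qed

lemma nn_integral_clock_space:
  assumes [measurable]: "(\<lambda>(d, a, b). F d a b) \<in> borel_measurable (root_space \<Otimes>\<^sub>M clock_space \<Otimes>\<^sub>M clock_space)"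
  shows "(\<integral>\<^sup>+\<omega>. F (root_clocks \<omega>) (subclocks False \<omega>) (subclocks True \<omega>) \<partial>clock_space) =
    (\<integral>\<^sup>+d. \<integral>\<^sup>+a. \<integral>\<^sup>+b. F d a b \<partial>clock_space \<partial>clock_space \<partial>root_space)"
proof -
  interpret R: product_prob_space "\<lambda>_ :: nat. expo 1" UNIV
    by (intro product_prob_spaceI prob_space_expo) simp
  interpret CC: pair_prob_space clock_space clock_space ..
  have F: "(\<lambda>\<omega>. F (root_clocks \<omega>) (subclocks False \<omega>) (subclocks True \<omega>)) \<in> borel_measurable clock_space"
    using measurable_compose[OF _ assms, of "\<lambda>\<omega>. (root_clocks \<omega>, subclocks False \<omega>, subclocks True \<omega>)" clock_space]
    by simp
  have "(\<integral>\<^sup>+\<omega>. F (root_clocks \<omega>) (subclocks False \<omega>) (subclocks True \<omega>) \<partial>clock_space) =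
     (\<integral>\<^sup>+x. (case x of (d, a, b) \<Rightarrow> F d a b) \<partial>(root_space \<Otimes>\<^sub>M clock_space \<Otimes>\<^sub>M clock_space))"
    using F by (subst distr_join_clocks[symmetric], subst nn_integral_distr)
      (auto simp: space_pair_measure intro!: nn_integral_cong)
  also have "\<dots> = (\<integral>\<^sup>+d. \<integral>\<^sup>+ab. (case ab of (a, b) \<Rightarrow> F d a b) \<partial>(clock_space \<Otimes>\<^sub>M clock_space) \<partial>root_space)"
    using assms by (subst CC.nn_integral_fst[symmetric]) (auto simp: split_beta')
  also have "\<dots> = (\<integral>\<^sup>+d. \<integral>\<^sup>+a. \<integral>\<^sup>+b. F d a b \<partial>clock_space \<partial>clock_space \<partial>root_space)"
    by (intro nn_integral_cong, subst clocks.nn_integral_fst[symmetric]) auto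
  finally show ?thesis .
qed

section \<open>The history of the process\<close>

definition shift :: "bool list \<Rightarrow> clocks \<Rightarrow> clocks" where
  "shift u \<omega> = (\<lambda>(v, e). \<omega> (v @ u, e))"

lemma shift_Nil [simp]: "shift [] \<omega> = \<omega>"
  by (simp add: shift_def)

lemma shift_Cons: "shift (b # u) \<omega> = subclocks b (shift u \<omega>)"
  by (auto simp: shift_def subclocks_def)

lemma first_event_shift: "first_event Tk lam \<omega> u j = first_event Tk lam (shift u \<omega>) [] j"
  by (simp add: first_event_def ring_time_def shift_def)

lemma waiting_time_shift: "waiting_time Tk lam \<omega> u j = waiting_time Tk lam (shift u \<omega>) [] j"
  by (simp add: waiting_time_def ring_time_def first_event_shift[of _ _ \<omega> u]) (simp add: shift_def)

locale hbp =
  fixes Tk lam :: "nat \<Rightarrow> real"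
  assumes Tk: "\<And>k. 1 \<le> k \<Longrightarrow> 0 \<le> Tk k" and lam: "\<And>j. 1 \<le> j \<Longrightarrow> 0 < lam j"
begin

abbreviation fe :: "clocks \<Rightarrow> nat \<Rightarrow> nat" where
  "fe \<omega> j \<equiv> first_event Tk lam \<omega> [] j"

abbreviation wt :: "clocks \<Rightarrow> nat \<Rightarrow> real" where
  "wt \<omega> j \<equiv> waiting_time Tk lam \<omega> [] j"

text \<open>\<open>fin n j \<omega>\<close>: the history has fewer than \<open>n\<close> generations of edges and all its waiting times are
  positive; \<open>hist n j \<omega>\<close> is then its planar tree.\<close>

primrec fin :: "nat \<Rightarrow> nat \<Rightarrow> clocks \<Rightarrow> bool" where
  "fin 0 j \<omega> = False"
| "fin (Suc n) j \<omega> \<longleftrightarrow> 0 < wt \<omega> j \<and>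
    (if fe \<omega> j = 0 then j = 1 \<or> 2 \<le> j \<and> fin n (j - 1) (subclocks False \<omega>) \<and> fin n (j - 1) (subclocks True \<omega>)
     else fe \<omega> j < j \<and> fin n j (subclocks False \<omega>) \<and> fin n (fe \<omega> j) (subclocks True \<omega>))"

primrec hist :: "nat \<Rightarrow> nat \<Rightarrow> clocks \<Rightarrow> posreal ptree" where
  "hist 0 j \<omega> = leaf 1"
| "hist (Suc n) j \<omega> =
    (if fe \<omega> j = 0 then
       if j = 1 then leaf (wt \<omega> j)
       else node (wt \<omega> j) (hist n (j - 1) (subclocks False \<omega>)) (hist n (j - 1) (subclocks True \<omega>))
     else node (wt \<omega> j) (hist n j (subclocks False \<omega>)) (hist n (fe \<omega> j) (subclocks True \<omega>)))"

lemma fin_hist_mono: "fin n j \<omega> \<Longrightarrow> n \<le> m \<Longrightarrow> fin m j \<omega> \<and> hist m j \<omega> = hist n j \<omega>"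
proof (induction n arbitrary: m j \<omega>)
  case (Suc n)
  from \<open>Suc n \<le> m\<close> obtain m' where m: "m = Suc m'" "n \<le> m'" by (cases m) auto
  have IH: "fin m' i \<omega>'" "hist m' i \<omega>' = hist n i \<omega>'" if "fin n i \<omega>'" for i \<omega>'
    using Suc.IH[OF that m(2)] by auto
  from Suc.prems(1) show ?case unfolding m(1) by (auto simp: IH split: if_splits)
qed simp

lemma hist_unique: "fin n j \<omega> \<Longrightarrow> fin m j \<omega> \<Longrightarrow> hist n j \<omega> = hist m j \<omega>"
  using fin_hist_mono[of n j \<omega> m] fin_hist_mono[of m j \<omega> n] by (cases "n \<le> m") auto

text \<open>Histories cut at different generations agree by \<open>hist_unique\<close>; hence
  \<open>grows\<close> determines its tree, and the \<open>THE\<close> in \<open>hbp_tree\<close>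
  denotes.\<close>

lemma grows_imp_fin:
  "grows Tk lam \<omega> u j t \<Longrightarrow> \<exists>n. fin n j (shift u \<omega>) \<and> forget (hist n j (shift u \<omega>)) = t"
proof (induction rule: grows.induct)
  case (terminate j u l)
  from terminate(3)[symmetric] have "0 < waiting_time Tk lam \<omega> u j" "pos (waiting_time Tk lam \<omega> u j) = l" by simp_all
  with terminate show ?case
    by (intro exI[of _ 1]) (simp add: first_event_shift[of _ _ \<omega> u] waiting_time_shift[of _ _ \<omega> u])
next
  case (split j u l s t)
  from split(3)[symmetric] have l: "0 < waiting_time Tk lam \<omega> u j" "pos (waiting_time Tk lam \<omega> u j) = l" by simp_all
  from split(6,7) obtain n m where nm:
    "fin n (j - 1) (subclocks False (shift u \<omega>))" "forget (hist n (j - 1) (subclocks False (shift u \<omega>))) = s"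
    "fin m (j - 1) (subclocks True (shift u \<omega>))" "forget (hist m (j - 1) (subclocks True (shift u \<omega>))) = t"
    by (auto simp: shift_Cons)
  from fin_hist_mono[OF nm(1), of "max n m"] fin_hist_mono[OF nm(3), of "max n m"] nm l split(1,2)
  show ?case
    by (intro exI[of _ "Suc (max n m)"]) (simp add: first_event_shift[of _ _ \<omega> u] waiting_time_shift[of _ _ \<omega> u])
next
  case (offspring u j i l s t)
  from offspring(4)[symmetric] have l: "0 < waiting_time Tk lam \<omega> u j" "pos (waiting_time Tk lam \<omega> u j) = l" by simp_all
  from offspring(7,8) obtain n m where nm:
    "fin n j (subclocks False (shift u \<omega>))" "forget (hist n j (subclocks False (shift u \<omega>))) = s"
    "fin m i (subclocks True (shift u \<omega>))" "forget (hist m i (subclocks True (shift u \<omega>))) = t"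
    by (auto simp: shift_Cons)
  from fin_hist_mono[OF nm(1), of "max n m"] fin_hist_mono[OF nm(3), of "max n m"] nm l offspring(1-3)
  show ?case
    by (intro exI[of _ "Suc (max n m)"]) (auto simp: first_event_shift[of _ _ \<omega> u] waiting_time_shift[of _ _ \<omega> u])
qed

lemma fin_imp_grows: "fin n j (shift u \<omega>) \<Longrightarrow> grows Tk lam \<omega> u j (forget (hist n j (shift u \<omega>)))"
proof (induction n arbitrary: j u)
  case (Suc n)
  let ?w = "shift u \<omega>"
  have l: "real_of_posreal (pos (wt ?w j)) = waiting_time Tk lam \<omega> u j"
    using Suc.prems by (simp add: waiting_time_shift[of _ _ \<omega> u] real_of_posreal_pos)
  have f: "first_event Tk lam \<omega> u j = fe ?w j" by (rule first_event_shift)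
  consider "fe ?w j = 0" "j = 1" | "fe ?w j = 0" "2 \<le> j" "j \<noteq> 1" | "fe ?w j \<noteq> 0" "fe ?w j < j"
    using Suc.prems by (auto split: if_splits)
  then show ?case
  proof cases
    case 1
    then show ?thesis using grows.terminate[OF 1(2) _ l] f by simp
  next
    case 2
    then have "fin n (j - 1) (shift (False # u) \<omega>)" "fin n (j - 1) (shift (True # u) \<omega>)"
      using Suc.prems by (auto simp: shift_Cons)
    from grows.split[OF 2(2) _ l Suc.IH[OF this(1)] Suc.IH[OF this(2)]] 2 f
    show ?thesis by (simp add: shift_Cons)
  next
    case 3
    then have "fin n j (shift (False # u) \<omega>)" "fin n (fe ?w j) (shift (True # u) \<omega>)"
      using Suc.prems by (auto simp: shift_Cons)
    from grows.offspring[OF f _ _ l Suc.IH[OF this(1)] Suc.IH[OF this(2)]] 3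
    show ?thesis by (simp add: shift_Cons)
  qed
qed simp

definition finite_history :: "nat \<Rightarrow> clocks \<Rightarrow> bool" where
  "finite_history j \<omega> \<longleftrightarrow> (\<exists>n. fin n j \<omega>)"

definition history :: "nat \<Rightarrow> clocks \<Rightarrow> posreal ptree" where
  "history j \<omega> = hist (LEAST n. fin n j \<omega>) j \<omega>"

lemma history_eq: "fin n j \<omega> \<Longrightarrow> history j \<omega> = hist n j \<omega>"
  unfolding history_def by (rule hist_unique[OF LeastI])

lemma hbp_tree_eq:
  "hbp_tree Tk lam j \<omega> = (if finite_history j \<omega> then Some (forget (history j \<omega>)) else None)"
proof (cases "finite_history j \<omega>")
  case True
  then obtain n where n: "fin n j \<omega>" by (auto simp: finite_history_def)
  have g: "grows Tk lam \<omega> [] j (forget (history j \<omega>))"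
    using fin_imp_grows[of n j "[]" \<omega>] n by (simp add: history_eq)
  have u: "t = forget (history j \<omega>)" if t: "grows Tk lam \<omega> [] j t" for t
    using grows_imp_fin[OF t] by (auto simp: history_eq)
  have "(THE t. grows Tk lam \<omega> [] j t) = forget (history j \<omega>)"
    using g u by (rule the_equality)
  moreover have "\<exists>t. grows Tk lam \<omega> [] j t" using g by blast
  ultimately show ?thesis using True unfolding hbp_tree_def by (simp only: if_True)
next
  case False
  then have "\<not> grows Tk lam \<omega> [] j t" for t
    using grows_imp_fin[of \<omega> "[]" j t] by (auto simp: finite_history_def)
  with False show ?thesis by (simp add: hbp_tree_def)
qed

lemma finite_history_iff:
  "finite_history j \<omega> \<longleftrightarrow> 0 < wt \<omega> j \<and>
    (if fe \<omega> j = 0 then j = 1 \<or> 2 \<le> j \<and> finite_history (j - 1) (subclocks False \<omega>) \<and> finite_history (j - 1) (subclocks True \<omega>)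
     else fe \<omega> j < j \<and> finite_history j (subclocks False \<omega>) \<and> finite_history (fe \<omega> j) (subclocks True \<omega>))"
  (is "_ \<longleftrightarrow> ?R")
proof
  assume "finite_history j \<omega>"
  then obtain n where n: "fin n j \<omega>" by (auto simp: finite_history_def)
  then obtain m where "n = Suc m" by (cases n) auto
  with n show ?R unfolding finite_history_def by (simp split: if_splits) blast+
next
  have max: "\<exists>n. fin n i \<omega>1 \<and> fin n k \<omega>2" if "fin n i \<omega>1" "fin m k \<omega>2" for n m i k \<omega>1 \<omega>2
    using that fin_hist_mono[of n i \<omega>1 "max n m"] fin_hist_mono[of m k \<omega>2 "max n m"]
    by (intro exI[of _ "max n m"]) auto
  assume R: ?R
  consider "fe \<omega> j = 0" "j = 1" | "fe \<omega> j = 0" "2 \<le> j" "finite_history (j - 1) (subclocks False \<omega>)"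
      "finite_history (j - 1) (subclocks True \<omega>)"
    | "fe \<omega> j \<noteq> 0" "finite_history j (subclocks False \<omega>)" "finite_history (fe \<omega> j) (subclocks True \<omega>)"
    using R by (cases "fe \<omega> j = 0") auto
  then have "\<exists>n. fin (Suc n) j \<omega>"
  proof cases
    case 2
    then obtain n where "fin n (j - 1) (subclocks False \<omega>) \<and> fin n (j - 1) (subclocks True \<omega>)"
      unfolding finite_history_def using max by blast
    with R 2 show ?thesis by (intro exI[of _ n]) simp
  next
    case 3
    then obtain n where "fin n j (subclocks False \<omega>) \<and> fin n (fe \<omega> j) (subclocks True \<omega>)"
      unfolding finite_history_def using max by blast
    with R 3 show ?thesis by (intro exI[of _ n]) simp
  qed (use R in simp)
  then show "finite_history j \<omega>" unfolding finite_history_def by blast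
qed

lemma history_rec:
  assumes "finite_history j \<omega>"
  shows "history j \<omega> = (if fe \<omega> j = 0 then
       if j = 1 then leaf (wt \<omega> j)
       else node (wt \<omega> j) (history (j - 1) (subclocks False \<omega>)) (history (j - 1) (subclocks True \<omega>))
     else node (wt \<omega> j) (history j (subclocks False \<omega>)) (history (fe \<omega> j) (subclocks True \<omega>)))"
proof -
  from assms obtain n where n: "fin n j \<omega>" by (auto simp: finite_history_def)
  then obtain m where m: "n = Suc m" by (cases n) auto
  with n show ?thesis unfolding history_eq[OF n] m by (auto simp: history_eq split: if_splits)
qed

lemma measurable_fe [measurable]: "(\<lambda>\<omega>. fe \<omega> j) \<in> measurable clock_space (count_space UNIV)"
proof -
  have c: "(\<lambda>\<omega>. \<omega> ([], i) / rate Tk lam j k) \<in> borel_measurable clock_space" for i k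
    by (intro borel_measurable_divide measurable_clock) auto
  have "finite (events Tk lam j)" by (auto simp: events_def intro: finite_subset[of _ "{..j}"])
  then show ?thesis
    unfolding first_event_def ring_time_def
    by (intro measurable_Least pred_intros_logic pred_intros_finite)
       (use borel_measurable_le[OF c c] in \<open>simp_all add: pred_def\<close>)
qed

lemma measurable_wt [measurable]: "(\<lambda>\<omega>. wt \<omega> j) \<in> borel_measurable clock_space"
  supply measurable_clock [measurable (raw)]
  unfolding waiting_time_def ring_time_def
  by (rule measurable_compose_countable[OF _ measurable_fe]) measurable

lemma measurable_fin [measurable]: "Measurable.pred clock_space (fin n j)"
proof (induction n arbitrary: j)
  case (Suc n)
  note [measurable] = Suc
  have [measurable]: "Measurable.pred clock_space (\<lambda>\<omega>. fin n (fe \<omega> j) (subclocks True \<omega>))"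
    by (rule measurable_compose_countable[OF _ measurable_fe]) measurable
  have "fin (Suc n) j = (\<lambda>\<omega>. 0 < wt \<omega> j \<and>
    (if fe \<omega> j = 0 then j = 1 \<or> 2 \<le> j \<and> fin n (j - 1) (subclocks False \<omega>) \<and> fin n (j - 1) (subclocks True \<omega>)
     else fe \<omega> j < j \<and> fin n j (subclocks False \<omega>) \<and> fin n (fe \<omega> j) (subclocks True \<omega>)))"
    by (simp add: fun_eq_iff)
  then show ?case by simp
next
  case 0
  have "fin 0 j = (\<lambda>\<omega>. False)" by (simp add: fun_eq_iff)
  then show ?case by simp
qed

lemma measurable_hist [measurable]: "hist n j \<in> measurable clock_space ptree_space"
proof (induction n arbitrary: j)
  case 0
  have "hist 0 j = (\<lambda>\<omega>. leaf 1)" by auto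
  then show ?case by simp
next
  case (Suc n)
  note [measurable] = Suc
  have [measurable]: "(\<lambda>\<omega>. hist n (fe \<omega> j) (subclocks True \<omega>)) \<in> measurable clock_space ptree_space"
    by (rule measurable_compose_countable[OF _ measurable_fe]) measurable
  have "hist (Suc n) j = (\<lambda>\<omega>. if fe \<omega> j = 0 then
       if j = 1 then leaf (wt \<omega> j)
       else node (wt \<omega> j) (hist n (j - 1) (subclocks False \<omega>)) (hist n (j - 1) (subclocks True \<omega>))
     else node (wt \<omega> j) (hist n j (subclocks False \<omega>)) (hist n (fe \<omega> j) (subclocks True \<omega>)))"
    by (simp add: fun_eq_iff)
  then show ?case by simp
qed

lemma measurable_finite_history [measurable]: "Measurable.pred clock_space (finite_history j)"
  unfolding finite_history_def by measurable

lemma measurable_history [measurable]: "history j \<in> measurable clock_space ptree_space"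
  unfolding history_def
  by (rule measurable_compose_countable[of "\<lambda>n. hist n j"]) measurable

lemma measurable_hbp_tree [measurable]: "hbp_tree Tk lam j \<in> measurable clock_space ltree_space"
  unfolding hbp_tree_eq by measurable

text \<open>\<open>lam j * total j\<close> is the sum of the rates of all events of an order j
  branch. The factor \<open>lam j\<close> cancels in \<open>event_prob\<close>, so the kinds of
  events, and with them the shapes, do not feel the rates.\<close>

definition total :: "nat \<Rightarrow> real" where
  "total j = 1 + (\<Sum>e\<in>{1..<j}. Tk (j - e))"

definition event_prob :: "nat \<Rightarrow> nat \<Rightarrow> real" where
  "event_prob j e = (if e = 0 then 1 else Tk (j - e)) / total j"

lemma total_ge_1: "1 \<le> total j"
  unfolding total_def using Tk by (auto intro!: sum_nonneg)

lemma total_pos [simp]: "0 < total j"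
  using total_ge_1[of j] by linarith

lemma event_prob_nonneg: "e < j \<Longrightarrow> 0 \<le> event_prob j e"
  unfolding event_prob_def using Tk[of "j - e"] total_pos[of j] by (intro divide_nonneg_pos) auto

lemma sum_event_prob: "1 \<le> j \<Longrightarrow> (\<Sum>e<j. event_prob j e) = 1"
proof -
  assume j: "1 \<le> j"
  then have "{..<j} = insert 0 {1..<j}" by auto
  then have "(\<Sum>e<j. event_prob j e) = 1 / total j + (\<Sum>e\<in>{1..<j}. Tk (j - e) / total j)"
    by (simp add: event_prob_def)
  also have "\<dots> = 1"
    using total_pos[of j] by (simp add: sum_divide_distrib[symmetric] add_divide_distrib[symmetric] total_def del: total_pos)
  finally show ?thesis .
qed

abbreviation edge_rate :: "nat \<Rightarrow> real" where
  "edge_rate j \<equiv> lam j * total j"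

lemma edge_rate_pos: "1 \<le> j \<Longrightarrow> 0 < edge_rate j"
  using lam by simp

text \<open>\<open>race\<close> applied to the root clocks, with the clocks of the two subtrees
  integrated inside. Events of rate zero are missing from \<open>events\<close> but also have
  \<open>event_prob\<close> zero, so the sum may run over all e < j.\<close>

lemma nn_integral_root:
  fixes H :: "nat \<Rightarrow> real \<Rightarrow> clocks \<Rightarrow> clocks \<Rightarrow> ennreal"
  assumes j: "1 \<le> j"
    and H: "\<And>e. (\<lambda>(x, a, b). H e x a b) \<in> borel_measurable (borel \<Otimes>\<^sub>M clock_space \<Otimes>\<^sub>M clock_space)"
  shows "(\<integral>\<^sup>+\<omega>. H (fe \<omega> j) (wt \<omega> j) (subclocks False \<omega>) (subclocks True \<omega>) \<partial>clock_space) =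
    (\<integral>\<^sup>+x. (\<Sum>e<j. ennreal (event_prob j e) * (\<integral>\<^sup>+a. \<integral>\<^sup>+b. H e x a b \<partial>clock_space \<partial>clock_space)) \<partial>expo (edge_rate j))"
proof -
  define V where "V = events Tk lam j"
  define r where "r = rate Tk lam j"
  define fe' where "fe' d = (LEAST e. e \<in> V \<and> (\<forall>e'\<in>V. d e / r e \<le> d e' / r e'))" for d :: "nat \<Rightarrow> real"
  define g where "g e x = (\<integral>\<^sup>+a. \<integral>\<^sup>+b. H e x a b \<partial>clock_space \<partial>clock_space)" for e x
  note H' = H[unfolded split_beta']
  have gm [measurable]: "g e \<in> borel_measurable borel" for e
  proof -
    have "(\<lambda>y. (fst (fst y), snd (fst y), snd y)) \<in>
        measurable ((borel \<Otimes>\<^sub>M clock_space) \<Otimes>\<^sub>M clock_space) (borel \<Otimes>\<^sub>M clock_space \<Otimes>\<^sub>M clock_space)"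
      by measurable
    from measurable_compose[OF this H'[of e]]
    have "(\<lambda>xa. \<integral>\<^sup>+b. H e (fst xa) (snd xa) b \<partial>clock_space) \<in> borel_measurable (borel \<Otimes>\<^sub>M clock_space)"
      by (intro clocks.borel_measurable_nn_integral) (simp add: split_beta')
    then show ?thesis
      unfolding g_def by (intro clocks.borel_measurable_nn_integral) (simp add: split_beta')
  qed
  have V: "finite V" "0 \<in> V" and r_pos: "\<And>e. e \<in> V \<Longrightarrow> 0 < r e"
    using lam[OF j] by (auto simp: V_def events_def r_def rate_def intro: finite_subset[of _ "{..j}"])
  have Vj: "V \<subseteq> {..<j}" using j by (auto simp: V_def events_def)
  have r0: "r e = 0" if "e < j" "e \<notin> V" for e
  proof (cases "e = 0")
    case True
    with that lam[OF j] show ?thesis by (simp add: V_def events_def rate_def)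
  next
    case False
    have "0 \<le> lam j * Tk (j - e)" using lam[OF j] Tk[of "j - e"] that by simp
    with that False show ?thesis by (auto simp: V_def events_def rate_def r_def)
  qed
  have "sum r V = sum r {..<j}"
    using Vj r0 by (intro sum.mono_neutral_left) auto
  also have "{..<j} = insert 0 {1..<j}" using j by auto
  also have "sum r (insert 0 {1..<j}) = edge_rate j"
    by (simp add: r_def rate_def total_def algebra_simps sum_distrib_left)
  finally have sumr: "sum r V = edge_rate j" .
  have ep: "r e / sum r V = event_prob j e" for e
    using lam[OF j] unfolding sumr by (simp add: event_prob_def r_def rate_def)
  have fe: "fe \<omega> j = fe' (root_clocks \<omega>)" for \<omega>
    by (simp add: first_event_def fe'_def ring_time_def V_def r_def root_clocks_def)
  have wt: "wt \<omega> j = root_clocks \<omega> (fe' (root_clocks \<omega>)) / r (fe' (root_clocks \<omega>))" for \<omega>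
    unfolding waiting_time_def fe by (simp add: ring_time_def r_def root_clocks_def)
  have c [measurable]: "(\<lambda>d. d i) \<in> borel_measurable root_space" for i
    using measurable_component_singleton[of i UNIV "\<lambda>_. expo 1"] by simp
  have c' [measurable]: "(\<lambda>d. d i / r i) \<in> borel_measurable root_space" for i
    by measurable
  have fe'm [measurable]: "fe' \<in> measurable root_space (count_space UNIV)"
    unfolding fe'_def[abs_def]
    by (intro measurable_Least pred_intros_logic pred_intros_finite V(1))
       (use borel_measurable_le[OF c' c'] in \<open>simp_all add: pred_def\<close>)
  have "(\<integral>\<^sup>+\<omega>. H (fe \<omega> j) (wt \<omega> j) (subclocks False \<omega>) (subclocks True \<omega>) \<partial>clock_space) =
     (\<integral>\<^sup>+d. \<integral>\<^sup>+a. \<integral>\<^sup>+b. H (fe' d) (d (fe' d) / r (fe' d)) a b \<partial>clock_space \<partial>clock_space \<partial>root_space)"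
    unfolding fe wt
  proof (rule nn_integral_clock_space)
    have Fm: "(\<lambda>y. H e (fst y e / r e) (fst (snd y)) (snd (snd y))) \<in> borel_measurable (root_space \<Otimes>\<^sub>M clock_space \<Otimes>\<^sub>M clock_space)" for e
    proof -
      have "(\<lambda>y. (fst y e / r e, fst (snd y), snd (snd y))) \<in>
          measurable (root_space \<Otimes>\<^sub>M clock_space \<Otimes>\<^sub>M clock_space) (borel \<Otimes>\<^sub>M clock_space \<Otimes>\<^sub>M clock_space)"
        by (intro measurable_Pair measurable_compose[OF measurable_fst c'] measurable_compose[OF measurable_snd measurable_fst]
            measurable_compose[OF measurable_snd measurable_snd])
      from measurable_compose[OF this H'[of e]] show ?thesis by simp
    qed
    show "(\<lambda>(d, a, b). H (fe' d) (d (fe' d) / r (fe' d)) a b) \<in> borel_measurable (root_space \<Otimes>\<^sub>M clock_space \<Otimes>\<^sub>M clock_space)"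
      unfolding split_beta'
      by (rule measurable_compose_countable[OF Fm]) (rule measurable_compose[OF measurable_fst fe'm])
  qed
  also have "\<dots> = (\<integral>\<^sup>+d. g (fe' d) (d (fe' d) / r (fe' d)) \<partial>root_space)"
    by (simp add: g_def)
  also have "\<dots> = (\<Sum>e\<in>V. ennreal (r e / sum r V) * (\<integral>\<^sup>+x. g e x \<partial>expo (sum r V)))"
    unfolding fe'_def using V r_pos by (intro race gm) auto
  also have "\<dots> = (\<Sum>e<j. ennreal (event_prob j e) * (\<integral>\<^sup>+x. g e x \<partial>expo (edge_rate j)))"
    unfolding ep unfolding sumr
  proof (intro sum.mono_neutral_left ballI)
    show "ennreal (event_prob j e) * (\<integral>\<^sup>+x. g e x \<partial>expo (edge_rate j)) = 0" if "e \<in> {..<j} - V" for e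
      using that r0[of e] ep[of e] by simp
  qed (use Vj in auto)
  also have "\<dots> = (\<integral>\<^sup>+x. (\<Sum>e<j. ennreal (event_prob j e) * g e x) \<partial>expo (edge_rate j))"
    by (simp add: nn_integral_sum nn_integral_cmult)
  finally show ?thesis by (simp add: g_def)
qed

text \<open>Strong induction on the order. Let m be the probability of a finite history from order
  j. Branches of lower order have finite histories almost surely, while after a birth the order j
  branch starts afresh: m = a + (1 - a) m, where a is the probability that the first event is the
  termination. Since a > 0 and m is finite, m = 1.\<close>

lemma AE_finite_history: "1 \<le> j \<Longrightarrow> AE \<omega> in clock_space. finite_history j \<omega>"
proof (induction j rule: less_induct)
  case (less j)
  define m where "m i = emeasure clock_space {\<omega>. finite_history i \<omega>}" for i
  have fm: "{\<omega>. finite_history i \<omega>} \<in> sets clock_space" for i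
    using measurable_finite_history[of i] by (simp add: pred_def)
  have m1: "m i = 1" if "1 \<le> i" "i < j" for i
    using less.IH[OF that(2,1)] clocks.emeasure_eq_1_AE[OF fm[of i]] by (simp add: m_def)
  have ind: "m i = (\<integral>\<^sup>+\<omega>. indicator {\<omega>. finite_history i \<omega>} \<omega> \<partial>clock_space)" for i
    using fm by (simp add: m_def)
  define H where "H e x a b = (if 0 < x \<and>
    (if e = 0 then j = 1 \<or> 2 \<le> j \<and> finite_history (j - 1) a \<and> finite_history (j - 1) b
     else e < j \<and> finite_history j a \<and> finite_history e b) then 1 else 0 :: ennreal)" for e a b and x :: real
  have "m j = (\<integral>\<^sup>+\<omega>. H (fe \<omega> j) (wt \<omega> j) (subclocks False \<omega>) (subclocks True \<omega>) \<partial>clock_space)"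
    unfolding ind indicator_def mem_Collect_eq of_bool_def
    by (intro nn_integral_cong, subst finite_history_iff) (simp only: H_def)
  also have "\<dots> = (\<integral>\<^sup>+x. (\<Sum>e<j. ennreal (event_prob j e) * (\<integral>\<^sup>+a. \<integral>\<^sup>+b. H e x a b \<partial>clock_space \<partial>clock_space)) \<partial>expo (edge_rate j))"
  proof (rule nn_integral_root[OF less.prems])
    show "(\<lambda>(x, a, b). H e x a b) \<in> borel_measurable (borel \<Otimes>\<^sub>M clock_space \<Otimes>\<^sub>M clock_space)" for e
      unfolding H_def by measurable
  qed
  also have "\<dots> = (\<integral>\<^sup>+x. (\<Sum>e<j. ennreal (event_prob j e) * (if e = 0 then 1 else m j)) \<partial>expo (edge_rate j))"
  proof (rule nn_integral_cong_AE, use AE_expo_pos[OF edge_rate_pos[OF less.prems]] in \<open>rule AE_mp\<close>, rule AE_I2, rule impI)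
    fix x :: real assume x: "0 < x"
    show "(\<Sum>e<j. ennreal (event_prob j e) * (\<integral>\<^sup>+a. \<integral>\<^sup>+b. H e x a b \<partial>clock_space \<partial>clock_space)) =
        (\<Sum>e<j. ennreal (event_prob j e) * (if e = 0 then 1 else m j))"
    proof (intro sum.cong refl arg_cong2[where f="(*)"])
      fix e assume e: "e \<in> {..<j}"
      define F where "F i = {\<omega>. finite_history i \<omega>}" for i
      have [measurable]: "F i \<in> sets clock_space" for i using fm by (simp add: F_def)
      have H: "H e x a b = (if e = 0 then if j = 1 then 1 else indicator (F (j - 1)) a * indicator (F (j - 1)) b
          else indicator (F j) a * indicator (F e) b)" for a b
        using x e by (auto simp: H_def F_def split: split_indicator)
      have mF: "m i = emeasure clock_space (F i)" for i by (simp add: m_def F_def)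
      have pint: "(\<integral>\<^sup>+a. \<integral>\<^sup>+b. indicator (F i) a * indicator (F k) b \<partial>clock_space \<partial>clock_space) = m i * m k" for i k
        by (simp add: nn_integral_cmult nn_integral_multc mF)
      consider "e = 0" "j = 1" | "e = 0" "j \<noteq> 1" | "e \<noteq> 0" by blast
      then show "(\<integral>\<^sup>+a. \<integral>\<^sup>+b. H e x a b \<partial>clock_space \<partial>clock_space) = (if e = 0 then 1 else m j)"
      proof cases
        case 1
        then show ?thesis unfolding H using clocks.P.emeasure_space_1 by simp
      next
        case 2
        then have "m (j - 1) = 1" using less.prems by (intro m1) auto
        with 2 show ?thesis unfolding H by (simp add: pint del: One_nat_def)
      next
        case 3
        then show ?thesis unfolding H using e m1[of e] by (simp add: pint)
      qed
    qed
  qed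
  also have "\<dots> = (\<Sum>e<j. ennreal (event_prob j e) * (if e = 0 then 1 else m j))"
    using prob_space.emeasure_space_1[OF prob_space_expo[OF edge_rate_pos[OF less.prems]]] by simp
  finally have eq: "m j = (\<Sum>e<j. ennreal (event_prob j e) * (if e = 0 then 1 else m j))" .
  have "m j \<le> 1" unfolding m_def by (rule clocks.P.measure_le_1)
  then obtain r where r: "m j = ennreal r" "0 \<le> r" by (cases "m j") (auto simp: top_unique)
  have j: "{..<j} = insert 0 {1..<j}" using less.prems by auto
  have S0: "0 \<le> (\<Sum>e\<in>{1..<j}. event_prob j e * r)"
    using r event_prob_nonneg by (intro sum_nonneg) auto
  have "(\<Sum>e\<in>{1..<j}. ennreal (event_prob j e * r)) = ennreal (\<Sum>e\<in>{1..<j}. event_prob j e * r)"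
    using r event_prob_nonneg by (intro sum_ennreal) auto
  moreover have "ennreal r = ennreal (event_prob j 0) + (\<Sum>e\<in>{1..<j}. ennreal (event_prob j e * r))"
    using eq r event_prob_nonneg less.prems unfolding j by (simp add: ennreal_mult)
  ultimately have "ennreal r = ennreal (event_prob j 0 + (\<Sum>e\<in>{1..<j}. event_prob j e * r))"
    using S0 event_prob_nonneg[of 0 j] less.prems by (simp add: ennreal_plus)
  then have "r = event_prob j 0 + (\<Sum>e\<in>{1..<j}. event_prob j e) * r"
    using r event_prob_nonneg less.prems
    by (subst (asm) ennreal_inj) (auto simp: sum_distrib_right intro!: add_nonneg_nonneg sum_nonneg)
  moreover have "event_prob j 0 + (\<Sum>e\<in>{1..<j}. event_prob j e) = 1"
    using sum_event_prob[OF less.prems] unfolding j by simp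
  moreover have "0 < event_prob j 0" by (simp add: event_prob_def)
  ultimately have "event_prob j 0 * (r - 1) = 0"
    by algebra
  with \<open>0 < event_prob j 0\<close> have "r = 1" by simp
  then show ?case
    using r clocks.P.AE_in_set_eq_1[OF fm[of j]] by (simp add: m_def clocks.P.emeasure_eq_measure)
qed

definition tree_law :: "nat \<Rightarrow> posreal ptree measure" where
  "tree_law j = distr clock_space ptree_space (history j)"

end

text \<open>Contribution of the trees whose first event is e at time x, when the subtrees have the
  laws Q. Q is a parameter so that the same equation can be tested on the pruned and on the dilated
  laws.\<close>

definition step :: "(nat \<Rightarrow> posreal ptree measure) \<Rightarrow> nat \<Rightarrow> nat \<Rightarrow> (posreal ptree \<Rightarrow> ennreal) \<Rightarrow> real \<Rightarrow> ennreal" where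
  "step Q j e f x = (if e = 0 then
      if j = 1 then f (leaf x) else \<integral>\<^sup>+s. \<integral>\<^sup>+t. f (node x s t) \<partial>Q (j - 1) \<partial>Q (j - 1)
    else \<integral>\<^sup>+s. \<integral>\<^sup>+t. f (node x s t) \<partial>Q e \<partial>Q j)"

context hbp
begin

lemma prob_space_tree_law: "prob_space (tree_law j)"
  unfolding tree_law_def by (rule clocks.P.prob_space_distr) measurable

lemma sets_tree_law [measurable_cong, simp]: "sets (tree_law j) = sets ptree_space"
  by (simp add: tree_law_def)

lemma nn_integral_tree_law:
  assumes j: "1 \<le> j" and f [measurable]: "f \<in> borel_measurable ptree_space"
  shows "(\<integral>\<^sup>+p. f p \<partial>tree_law j) =
    (\<integral>\<^sup>+x. (\<Sum>e<j. ennreal (event_prob j e) * step tree_law j e f x) \<partial>expo (edge_rate j))"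
proof -
  define H where "H e x a b = (if e = 0 then
      if j = 1 then f (leaf x) else f (node x (history (j - 1) a) (history (j - 1) b))
    else f (node x (history j a) (history e b)))" for e x a b
  have "(\<integral>\<^sup>+p. f p \<partial>tree_law j) = (\<integral>\<^sup>+\<omega>. f (history j \<omega>) \<partial>clock_space)"
    unfolding tree_law_def by (rule nn_integral_distr) measurable
  also have "\<dots> = (\<integral>\<^sup>+\<omega>. H (fe \<omega> j) (wt \<omega> j) (subclocks False \<omega>) (subclocks True \<omega>) \<partial>clock_space)"
    by (rule nn_integral_cong_AE, use AE_finite_history[OF j] in \<open>rule AE_mp\<close>, rule AE_I2)
       (simp add: history_rec H_def)
  also have "\<dots> = (\<integral>\<^sup>+x. (\<Sum>e<j. ennreal (event_prob j e) * (\<integral>\<^sup>+a. \<integral>\<^sup>+b. H e x a b \<partial>clock_space \<partial>clock_space)) \<partial>expo (edge_rate j))"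
  proof (rule nn_integral_root[OF j])
    show "(\<lambda>(x, a, b). H e x a b) \<in> borel_measurable (borel \<Otimes>\<^sub>M clock_space \<Otimes>\<^sub>M clock_space)" for e
      unfolding H_def by measurable
  qed
  also have "\<dots> = (\<integral>\<^sup>+x. (\<Sum>e<j. ennreal (event_prob j e) * step tree_law j e f x) \<partial>expo (edge_rate j))"
  proof (intro nn_integral_cong sum.cong refl arg_cong2[where f="(*)"])
    fix x e
    have *: "(\<integral>\<^sup>+a. \<integral>\<^sup>+b. f (node x (history i a) (history k b)) \<partial>clock_space \<partial>clock_space) =
      (\<integral>\<^sup>+s. \<integral>\<^sup>+t. f (node x s t) \<partial>tree_law k \<partial>tree_law i)" for i k
    proof -
      interpret prob_space "tree_law k" by (rule prob_space_tree_law)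
      have "(\<integral>\<^sup>+s. \<integral>\<^sup>+t. f (node x s t) \<partial>tree_law k \<partial>tree_law i) =
          (\<integral>\<^sup>+a. \<integral>\<^sup>+t. f (node x (history i a) t) \<partial>tree_law k \<partial>clock_space)"
        unfolding tree_law_def[of i] by (subst nn_integral_distr) auto
      also have "\<dots> = (\<integral>\<^sup>+a. \<integral>\<^sup>+b. f (node x (history i a) (history k b)) \<partial>clock_space \<partial>clock_space)"
        unfolding tree_law_def by (intro nn_integral_cong, subst nn_integral_distr) auto
      finally show ?thesis by simp
    qed
    show "(\<integral>\<^sup>+a. \<integral>\<^sup>+b. H e x a b \<partial>clock_space \<partial>clock_space) = step tree_law j e f x"
      using clocks.P.emeasure_space_1 by (simp add: H_def step_def * )
  qed
  finally show ?thesis .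
qed

lemma hbp_law_eq: "1 \<le> j \<Longrightarrow> hbp_law Tk lam j = distr (tree_law j) ltree_space (\<lambda>p. Some (forget p))"
proof -
  assume j: "1 \<le> j"
  have "hbp_law Tk lam j = distr clock_space ltree_space (\<lambda>\<omega>. Some (forget (history j \<omega>)))"
    unfolding hbp_law_def
    by (rule distr_cong_AE) (use AE_finite_history[OF j] in \<open>auto simp: hbp_tree_eq\<close>)
  also have "\<dots> = distr (tree_law j) ltree_space (\<lambda>p. Some (forget p))"
    unfolding tree_law_def by (subst distr_distr) (auto simp: o_def)
  finally show ?thesis .
qed

lemma prob_space_hbp_law: "prob_space (hbp_law Tk lam j)"
  unfolding hbp_law_def by (rule clocks.P.prob_space_distr) measurable

lemma sets_hbp_law [measurable_cong, simp]: "sets (hbp_law Tk lam j) = sets ltree_space"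
  by (simp add: hbp_law_def)

end

section \<open>The law of the history\<close>

primrec height :: "'a ptree \<Rightarrow> nat" where
  "height (PLeaf a) = 0"
| "height (PNode a l r) = Suc (max (height l) (height r))"

lemma height_map_ptree [simp]: "height (map_ptree f p) = height p"
  by (induction p) auto

lemma measurable_height [measurable]: "height \<in> measurable ptree_space (count_space UNIV)"
  by (rule measurable_plane_shape_cong) auto

text \<open>This cutoff factorises over a node and lowers n by one there, which turns the equation
  of the law into a recursion on n. The strict inequality makes the case n = 0 empty.\<close>

definition height_upto :: "nat \<Rightarrow> posreal ptree \<Rightarrow> ennreal" where
  "height_upto n p = (if height p < n then 1 else 0)"

lemma height_upto_le_1: "height_upto n p \<le> 1"
  by (simp add: height_upto_def)

lemma measurable_upto [measurable]: "height_upto n \<in> borel_measurable ptree_space"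
  unfolding height_upto_def by measurable

lemma height_upto_simps [simp]:
  "height_upto 0 p = 0" "height_upto (Suc n) (PLeaf a) = 1" "height_upto (Suc n) (PNode a s t) = height_upto n s * height_upto n t"
  by (auto simp: height_upto_def)

lemma SUP_mult_upto: "(SUP n. c * height_upto n p) = (c :: ennreal)"
proof (rule antisym)
  show "(SUP n. c * height_upto n p) \<le> c"
    by (intro SUP_least) (auto simp: height_upto_def)
  show "c \<le> (SUP n. c * height_upto n p)"
    by (rule SUP_upper2[of "Suc (height p)"]) (auto simp: height_upto_def)
qed

lemma nn_integral_height_upto:
  assumes "sets M = sets ptree_space" "f \<in> borel_measurable ptree_space"
  shows "(\<integral>\<^sup>+p. f p \<partial>M) = (SUP n. \<integral>\<^sup>+p. f p * height_upto n p \<partial>M)"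
proof -
  have "(\<integral>\<^sup>+p. f p \<partial>M) = (\<integral>\<^sup>+p. (SUP n. f p * height_upto n p) \<partial>M)"
    by (simp only: SUP_mult_upto)
  also have "\<dots> = (SUP n. \<integral>\<^sup>+p. f p * height_upto n p \<partial>M)"
  proof (rule nn_integral_monotone_convergence_SUP)
    show "incseq (\<lambda>n p. f p * height_upto n p)"
      by (auto simp: incseq_def le_fun_def height_upto_def)
    show "(\<lambda>p. f p * height_upto n p) \<in> borel_measurable M" for n
      using assms by (simp add: measurable_cong_sets[OF assms(1) refl])
  qed
  finally show ?thesis .
qed

context hbp
begin

sublocale T: prob_space "tree_law j" for j
  by (rule prob_space_tree_law)

lemma space_tree_law [simp]: "space (tree_law j) = UNIV"
  using sets_eq_imp_space_eq[OF sets_tree_law[of j]] by simp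

lemma porder_hist: "fin n j \<omega> \<Longrightarrow> porder (hist n j \<omega>) = j"
  by (induction n arbitrary: j \<omega>) (auto split: if_splits)

lemma AE_porder: "1 \<le> j \<Longrightarrow> AE p in tree_law j. porder p = j"
  unfolding tree_law_def
  by (subst AE_distr_iff, measurable, use AE_finite_history[of j] in \<open>rule_tac AE_mp\<close>, simp, rule AE_I2)
     (auto simp: finite_history_def history_eq porder_hist)

lemma AE_porder_pair:
  fixes P :: "posreal ptree \<Rightarrow> posreal ptree \<Rightarrow> bool"
  assumes "1 \<le> i" "1 \<le> k" "\<And>s t. porder s = i \<Longrightarrow> porder t = k \<Longrightarrow> P s t"
  shows "AE s in tree_law i. AE t in tree_law k. P s t"
proof -
  have "AE s in tree_law i. porder s = i \<longrightarrow> (AE t in tree_law k. P s t)"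
  proof (rule AE_I2, rule impI)
    fix s :: "posreal ptree" assume "porder s = i"
    then have "AE t in tree_law k. porder t = k \<longrightarrow> P s t"
      by (intro AE_I2 impI assms(3))
    with AE_porder[OF assms(2)] show "AE t in tree_law k. P s t" by (rule AE_mp)
  qed
  with AE_porder[OF assms(1)] show ?thesis by (rule AE_mp)
qed

lemma nn_integral_order_cong:
  assumes "1 \<le> j" "\<And>p. porder p = j \<Longrightarrow> f p = g p"
  shows "(\<integral>\<^sup>+p. f p \<partial>tree_law j) = (\<integral>\<^sup>+p. g p \<partial>tree_law j)"
proof (rule nn_integral_cong_AE)
  have "AE p in tree_law j. porder p = j \<longrightarrow> f p = g p"
    using assms(2) by (intro AE_I2 impI)
  with AE_porder[OF assms(1)] show "AE p in tree_law j. f p = g p" by (rule AE_mp)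
qed

text \<open>The equation at the first event with the almost sure facts built in: waiting times are
  positive and each subtree has the order of its root branch. Integrands then need to be evaluated
  in these three situations only.\<close>

lemma nn_integral_tree_law_cong:
  assumes j: "1 \<le> j" and f [measurable]: "f \<in> borel_measurable ptree_space"
    and leaf: "\<And>x. 0 < x \<Longrightarrow> j = 1 \<Longrightarrow> f (leaf x) = A x"
    and split: "\<And>x s t. 0 < x \<Longrightarrow> 2 \<le> j \<Longrightarrow> porder s = j - 1 \<Longrightarrow> porder t = j - 1 \<Longrightarrow> f (node x s t) = B x s t"
    and offspring: "\<And>x e s t. 0 < x \<Longrightarrow> 1 \<le> e \<Longrightarrow> e < j \<Longrightarrow> porder s = j \<Longrightarrow> porder t = e \<Longrightarrow> f (node x s t) = D e x s t"
  shows "(\<integral>\<^sup>+p. f p \<partial>tree_law j) = (\<integral>\<^sup>+x. (\<Sum>e<j. ennreal (event_prob j e) *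
      (if e = 0 then if j = 1 then A x else \<integral>\<^sup>+s. \<integral>\<^sup>+t. B x s t \<partial>tree_law (j - 1) \<partial>tree_law (j - 1)
       else \<integral>\<^sup>+s. \<integral>\<^sup>+t. D e x s t \<partial>tree_law e \<partial>tree_law j)) \<partial>expo (edge_rate j))"
  unfolding nn_integral_tree_law[OF j f]
proof (rule nn_integral_cong_AE, use AE_expo_pos[OF edge_rate_pos[OF j]] in \<open>rule AE_mp\<close>,
    rule AE_I2, rule impI, rule sum.cong[OF refl], rule arg_cong2[where f="(*)", OF refl])
  fix x :: real and e assume x: "0 < x" and e: "e \<in> {..<j}"
  have *: "(\<integral>\<^sup>+s. \<integral>\<^sup>+t. G s t \<partial>tree_law k \<partial>tree_law i) = (\<integral>\<^sup>+s. \<integral>\<^sup>+t. G' s t \<partial>tree_law k \<partial>tree_law i)"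
    if "1 \<le> i" "1 \<le> k" "\<And>s t. porder s = i \<Longrightarrow> porder t = k \<Longrightarrow> G s t = G' s t" for i k G G'
    using AE_porder_pair[of i k "\<lambda>s t. G s t = G' s t"] that
    by (intro nn_integral_cong_AE) (auto elim!: AE_mp intro!: nn_integral_cong_AE)
  consider "e = 0" "j = 1" | "e = 0" "2 \<le> j" | "1 \<le> e" "e < j" using e j by force
  then show "step tree_law j e f x =
      (if e = 0 then if j = 1 then A x else \<integral>\<^sup>+s. \<integral>\<^sup>+t. B x s t \<partial>tree_law (j - 1) \<partial>tree_law (j - 1)
       else \<integral>\<^sup>+s. \<integral>\<^sup>+t. D e x s t \<partial>tree_law e \<partial>tree_law j)"
  proof cases
    case 1
    then show ?thesis using leaf x by (simp add: step_def)
  next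
    case 2
    have "(\<integral>\<^sup>+s. \<integral>\<^sup>+t. f (node x s t) \<partial>tree_law (j - 1) \<partial>tree_law (j - 1)) =
        (\<integral>\<^sup>+s. \<integral>\<^sup>+t. B x s t \<partial>tree_law (j - 1) \<partial>tree_law (j - 1))"
      using 2 split[OF x] by (intro *) auto
    then show ?thesis using 2 by (simp add: step_def)
  next
    case 3
    have "(\<integral>\<^sup>+s. \<integral>\<^sup>+t. f (node x s t) \<partial>tree_law e \<partial>tree_law j) =
        (\<integral>\<^sup>+s. \<integral>\<^sup>+t. D e x s t \<partial>tree_law e \<partial>tree_law j)"
      using 3 offspring[OF x] by (intro *) auto
    then show ?thesis using 3 by (simp add: step_def)
  qed
qed

text \<open>The equation expresses a solution below height n + 1 by its values below height n, so
  two solutions agree on bounded heights and, by monotone convergence, altogether. The equation is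
  asked only for f bounded by 1, which is what the renewal argument for the pruned law
  provides.\<close>

lemma tree_law_unique:
  assumes sets [measurable_cong, simp]: "\<And>j. sets (Q j) = sets ptree_space" and prob: "\<And>j. prob_space (Q j)"
    and eq: "\<And>j f. 1 \<le> j \<Longrightarrow> f \<in> borel_measurable ptree_space \<Longrightarrow> (\<And>p. f p \<le> 1) \<Longrightarrow>
      (\<integral>\<^sup>+p. f p \<partial>Q j) = (\<integral>\<^sup>+x. (\<Sum>e<j. ennreal (event_prob j e) * step Q j e f x) \<partial>expo (edge_rate j))"
    and J: "1 \<le> J"
  shows "Q J = tree_law J"
proof -
  interpret Q: prob_space "Q j" for j by (rule prob)
  have *: "(\<integral>\<^sup>+p. f p * height_upto n p \<partial>Q j) = (\<integral>\<^sup>+p. f p * height_upto n p \<partial>tree_law j)"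
    if "1 \<le> j" "f \<in> borel_measurable ptree_space" "\<And>p. f p \<le> 1" for f n j
    using that
  proof (induction n arbitrary: f j)
    case (Suc n)
    note f [measurable] = Suc.prems(2)
    let ?f = "\<lambda>p. f p * height_upto (Suc n) p"
    have f1: "?f p \<le> 1" for p using Suc.prems(3)[of p] by (auto simp: height_upto_def)
    \<comment> \<open>The inner integral over t is again a measurable function of s bounded by 1, so
      the induction hypothesis applies first to t and then to s.\<close>
    have pair: "(\<integral>\<^sup>+s. \<integral>\<^sup>+t. ?f (node x s t) \<partial>Q k \<partial>Q i) = (\<integral>\<^sup>+s. \<integral>\<^sup>+t. ?f (node x s t) \<partial>tree_law k \<partial>tree_law i)"
      if ik: "1 \<le> i" "1 \<le> k" for x i k
    proof -
      have "(\<integral>\<^sup>+s. \<integral>\<^sup>+t. ?f (node x s t) \<partial>Q k \<partial>Q i) = (\<integral>\<^sup>+s. height_upto n s * (\<integral>\<^sup>+t. f (node x s t) * height_upto n t \<partial>Q k) \<partial>Q i)"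
        by (intro nn_integral_cong, subst nn_integral_cmult[symmetric]) (auto simp: mult_ac)
      also have "\<dots> = (\<integral>\<^sup>+s. height_upto n s * (\<integral>\<^sup>+t. f (node x s t) * height_upto n t \<partial>tree_law k) \<partial>Q i)"
        using ik Suc.prems(3) by (subst Suc.IH) auto
      also have "\<dots> = (\<integral>\<^sup>+s. (\<integral>\<^sup>+t. f (node x s t) * height_upto n t \<partial>tree_law k) * height_upto n s \<partial>Q i)"
        by (simp add: mult_ac)
      also have "\<dots> = (\<integral>\<^sup>+s. (\<integral>\<^sup>+t. f (node x s t) * height_upto n t \<partial>tree_law k) * height_upto n s \<partial>tree_law i)"
      proof (rule Suc.IH[OF ik(1)])
        fix s
        have "(\<integral>\<^sup>+t. f (node x s t) * height_upto n t \<partial>tree_law k) \<le> (\<integral>\<^sup>+t. 1 \<partial>tree_law k)"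
          using Suc.prems(3) height_upto_le_1 by (intro nn_integral_mono) (metis mult_mono mult_1 zero_le)
        then show "(\<integral>\<^sup>+t. f (node x s t) * height_upto n t \<partial>tree_law k) \<le> 1"
          using T.emeasure_space_1[of k] by simp
      qed measurable
      also have "\<dots> = (\<integral>\<^sup>+s. \<integral>\<^sup>+t. ?f (node x s t) \<partial>tree_law k \<partial>tree_law i)"
        by (intro nn_integral_cong, subst nn_integral_multc[symmetric]) (auto simp: mult_ac)
      finally show ?thesis .
    qed
    have "step Q j e ?f x = step tree_law j e ?f x" if "e < j" for e x
      using that Suc.prems(1) pair[of "j - 1" "j - 1" x] pair[of j e x] by (auto simp: step_def)
    then show ?case
      using eq[OF Suc.prems(1) _ f1] nn_integral_tree_law[OF Suc.prems(1), of ?f] by simp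
  qed simp
  show ?thesis
  proof (rule measure_eqI)
    fix A assume "A \<in> sets (Q J)"
    then have A [measurable]: "A \<in> sets ptree_space" by simp
    have "emeasure (Q J) A = (\<integral>\<^sup>+p. indicator A p \<partial>Q J)" by simp
    also have "\<dots> = (SUP n. \<integral>\<^sup>+p. indicator A p * height_upto n p \<partial>Q J)"
      by (rule nn_integral_height_upto) auto
    also have "\<dots> = (SUP n. \<integral>\<^sup>+p. indicator A p * height_upto n p \<partial>tree_law J)"
    proof (rule arg_cong[where f=Sup], rule image_cong[OF refl])
      show "(\<integral>\<^sup>+p. indicator A p * height_upto n p \<partial>Q J) = (\<integral>\<^sup>+p. indicator A p * height_upto n p \<partial>tree_law J)" for n
        by (intro * J) (auto simp: indicator_def)
    qed
    also have "\<dots> = (\<integral>\<^sup>+p. indicator A p \<partial>tree_law J)"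
      by (rule nn_integral_height_upto[symmetric]) auto
    finally show "emeasure (Q J) A = emeasure (tree_law J) A" by simp
  qed simp
qed

end

section \<open>Complete subtrees\<close>

text \<open>Height of the part of the tree formed by the vertices of order above K. Cutting off at
  this height, and not at \<open>height\<close>, leaves the complete subtrees of order K
  intact.\<close>

primrec skeleton_height :: "nat \<Rightarrow> 'a ptree \<Rightarrow> nat" where
  "skeleton_height K (PLeaf a) = 0"
| "skeleton_height K (PNode a l r) = (if porder (PNode a l r) \<le> K then 0
     else Suc (max (skeleton_height K l) (skeleton_height K r)))"

lemma skeleton_height_0: "porder p \<le> K \<Longrightarrow> skeleton_height K p = 0"
  by (cases p) auto

lemma skeleton_height_map_ptree [simp]: "skeleton_height K (map_ptree f p) = skeleton_height K p"
  by (induction p) auto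

lemma measurable_skeleton_height [measurable]: "skeleton_height K \<in> measurable ptree_space (count_space UNIV)"
  by (rule measurable_plane_shape_cong) auto

definition skeleton_upto :: "nat \<Rightarrow> nat \<Rightarrow> posreal ptree \<Rightarrow> ennreal" where
  "skeleton_upto K n p = (if skeleton_height K p < n then 1 else 0)"

lemma measurable_skeleton_upto [measurable]: "skeleton_upto K n \<in> borel_measurable ptree_space"
  unfolding skeleton_upto_def by measurable

context hbp
begin

text \<open>Given the part above order K, each complete subtree hanging from it has law
  \<open>tree_law K\<close>, so the sum over them factors into their number and a common mean. The
  weight h of the number is arbitrary so that, at a node, the number found in the sibling can be
  absorbed into h.\<close>

lemma complete_subtrees_truncated:
  assumes K: "1 \<le> K" and g [measurable]: "g \<in> borel_measurable ptree_space" and j: "1 \<le> j"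
  shows "(\<integral>\<^sup>+p. skeleton_upto K n p * h (size (tops K p)) * (\<Sum>q\<in>#tops K p. g q) \<partial>tree_law j) =
    (\<integral>\<^sup>+p. skeleton_upto K n p * h (size (tops K p)) * of_nat (size (tops K p)) \<partial>tree_law j) * (\<integral>\<^sup>+p. g p \<partial>tree_law K)"
  using j
proof (induction n arbitrary: j h)
  case 0
  then show ?case by (simp add: skeleton_upto_def)
next
  case (Suc n)
  let ?G = "\<integral>\<^sup>+p. g p \<partial>tree_law K"
  let ?N = "\<lambda>p :: posreal ptree. size (tops K p)"
  let ?S = "\<lambda>p. \<Sum>q\<in>#tops K p. g q"
  consider "j < K" | "j = K" | "K < j" by linarith
  then show ?case
  proof cases
    case 1
    have "AE p in tree_law j. tops K p = {#}"
      using AE_porder[OF Suc.prems] by (rule AE_mp) (use 1 in \<open>auto intro!: AE_I2 tops_empty\<close>)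
    then have "(\<integral>\<^sup>+p. skeleton_upto K (Suc n) p * h (?N p) * ?S p \<partial>tree_law j) = 0"
      "(\<integral>\<^sup>+p. skeleton_upto K (Suc n) p * h (?N p) * of_nat (?N p) \<partial>tree_law j) = 0"
      by (auto intro!: nn_integral_zero' elim!: AE_mp)
    then show ?thesis by simp
  next
    case 2
    have AE: "AE p in tree_law j. tops K p = {#p#} \<and> skeleton_upto K (Suc n) p = 1"
      using AE_porder[OF Suc.prems]
      by (rule AE_mp) (use 2 in \<open>auto intro!: AE_I2 tops_self simp: skeleton_upto_def skeleton_height_0\<close>)
    then have "(\<integral>\<^sup>+p. skeleton_upto K (Suc n) p * h (?N p) * ?S p \<partial>tree_law j) = (\<integral>\<^sup>+p. h 1 * g p \<partial>tree_law j)"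
      by (intro nn_integral_cong_AE) (auto elim!: AE_mp)
    moreover have "(\<integral>\<^sup>+p. skeleton_upto K (Suc n) p * h (?N p) * of_nat (?N p) \<partial>tree_law j) = (\<integral>\<^sup>+p. h 1 \<partial>tree_law j)"
      using AE by (intro nn_integral_cong_AE) (auto elim!: AE_mp)
    ultimately show ?thesis
      using 2 T.emeasure_space_1[of j] by (simp add: nn_integral_cmult)
  next
    case 3
    have fst: "(\<integral>\<^sup>+s. skeleton_upto K n s * h (?N s + m) * ?S s \<partial>tree_law i) =
        (\<integral>\<^sup>+s. skeleton_upto K n s * h (?N s + m) * of_nat (?N s) \<partial>tree_law i) * ?G" if "1 \<le> i" for m i
      using Suc.IH[OF that, of "\<lambda>l. h (l + m)"] .
    let ?P = "\<lambda>s t. skeleton_upto K n s * skeleton_upto K n t * h (?N s + ?N t)"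
    have pair: "(\<integral>\<^sup>+s. \<integral>\<^sup>+t. ?P s t * (?S s + ?S t) \<partial>tree_law k \<partial>tree_law i) =
        (\<integral>\<^sup>+s. \<integral>\<^sup>+t. ?P s t * (of_nat (?N s) + of_nat (?N t)) \<partial>tree_law k \<partial>tree_law i) * ?G"
      if ik: "1 \<le> i" "1 \<le> k" for i k
    proof -
      interpret IK: pair_sigma_finite "tree_law i" "tree_law k" ..
      \<comment> \<open>Fubini brings the subtree that carries the sum to the inside, where the
        sibling is a constant.\<close>
      have a: "(\<integral>\<^sup>+s. \<integral>\<^sup>+t. ?P s t * ?S s \<partial>tree_law k \<partial>tree_law i) =
          (\<integral>\<^sup>+s. \<integral>\<^sup>+t. ?P s t * of_nat (?N s) \<partial>tree_law k \<partial>tree_law i) * ?G"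
      proof -
        have "(\<integral>\<^sup>+s. \<integral>\<^sup>+t. ?P s t * ?S s \<partial>tree_law k \<partial>tree_law i) =
            (\<integral>\<^sup>+t. \<integral>\<^sup>+s. ?P s t * ?S s \<partial>tree_law i \<partial>tree_law k)"
          by (rule IK.Fubini'[symmetric]) measurable
        also have "\<dots> = (\<integral>\<^sup>+t. skeleton_upto K n t * (\<integral>\<^sup>+s. skeleton_upto K n s * h (?N s + ?N t) * ?S s \<partial>tree_law i) \<partial>tree_law k)"
          by (intro nn_integral_cong, subst nn_integral_cmult[symmetric]) (auto simp: mult_ac)
        also have "\<dots> = (\<integral>\<^sup>+t. skeleton_upto K n t * (\<integral>\<^sup>+s. skeleton_upto K n s * h (?N s + ?N t) * of_nat (?N s) \<partial>tree_law i) * ?G \<partial>tree_law k)"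
          unfolding fst[OF ik(1)] by (simp add: mult_ac)
        also have "\<dots> = (\<integral>\<^sup>+t. skeleton_upto K n t * (\<integral>\<^sup>+s. skeleton_upto K n s * h (?N s + ?N t) * of_nat (?N s) \<partial>tree_law i) \<partial>tree_law k) * ?G"
          by (rule nn_integral_multc) measurable
        also have "(\<integral>\<^sup>+t. skeleton_upto K n t * (\<integral>\<^sup>+s. skeleton_upto K n s * h (?N s + ?N t) * of_nat (?N s) \<partial>tree_law i) \<partial>tree_law k) =
            (\<integral>\<^sup>+t. \<integral>\<^sup>+s. ?P s t * of_nat (?N s) \<partial>tree_law i \<partial>tree_law k)"
          by (intro nn_integral_cong, subst nn_integral_cmult[symmetric]) (auto simp: mult_ac)
        also have "\<dots> = (\<integral>\<^sup>+s. \<integral>\<^sup>+t. ?P s t * of_nat (?N s) \<partial>tree_law k \<partial>tree_law i)"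
          by (rule IK.Fubini') measurable
        finally show ?thesis .
      qed
      have b: "(\<integral>\<^sup>+s. \<integral>\<^sup>+t. ?P s t * ?S t \<partial>tree_law k \<partial>tree_law i) =
          (\<integral>\<^sup>+s. \<integral>\<^sup>+t. ?P s t * of_nat (?N t) \<partial>tree_law k \<partial>tree_law i) * ?G"
      proof -
        have "(\<integral>\<^sup>+s. \<integral>\<^sup>+t. ?P s t * ?S t \<partial>tree_law k \<partial>tree_law i) =
            (\<integral>\<^sup>+s. skeleton_upto K n s * (\<integral>\<^sup>+t. skeleton_upto K n t * h (?N t + ?N s) * ?S t \<partial>tree_law k) \<partial>tree_law i)"
          by (intro nn_integral_cong, subst nn_integral_cmult[symmetric]) (auto simp: mult_ac add.commute)
        also have "\<dots> = (\<integral>\<^sup>+s. skeleton_upto K n s * (\<integral>\<^sup>+t. skeleton_upto K n t * h (?N t + ?N s) * of_nat (?N t) \<partial>tree_law k) * ?G \<partial>tree_law i)"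
          unfolding fst[OF ik(2)] by (simp add: mult_ac)
        also have "\<dots> = (\<integral>\<^sup>+s. skeleton_upto K n s * (\<integral>\<^sup>+t. skeleton_upto K n t * h (?N t + ?N s) * of_nat (?N t) \<partial>tree_law k) \<partial>tree_law i) * ?G"
          by (rule nn_integral_multc) measurable
        also have "(\<integral>\<^sup>+s. skeleton_upto K n s * (\<integral>\<^sup>+t. skeleton_upto K n t * h (?N t + ?N s) * of_nat (?N t) \<partial>tree_law k) \<partial>tree_law i) =
            (\<integral>\<^sup>+s. \<integral>\<^sup>+t. ?P s t * of_nat (?N t) \<partial>tree_law k \<partial>tree_law i)"
          by (intro nn_integral_cong, subst nn_integral_cmult[symmetric]) (auto simp: mult_ac add.commute)
        finally show ?thesis .
      qed
      have "(\<integral>\<^sup>+s. \<integral>\<^sup>+t. ?P s t * (F s + F' t) \<partial>tree_law k \<partial>tree_law i) =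
          (\<integral>\<^sup>+s. \<integral>\<^sup>+t. ?P s t * F s \<partial>tree_law k \<partial>tree_law i) + (\<integral>\<^sup>+s. \<integral>\<^sup>+t. ?P s t * F' t \<partial>tree_law k \<partial>tree_law i)"
        if [measurable]: "F \<in> borel_measurable ptree_space" "F' \<in> borel_measurable ptree_space" for F F'
        by (simp add: distrib_left nn_integral_add)
      then show ?thesis by (simp add: a b distrib_right)
    qed
    define L where "L i k = (\<integral>\<^sup>+s. \<integral>\<^sup>+t. ?P s t * (?S s + ?S t) \<partial>tree_law k \<partial>tree_law i)" for i k
    define R where "R i k = (\<integral>\<^sup>+s. \<integral>\<^sup>+t. ?P s t * (of_nat (?N s) + of_nat (?N t)) \<partial>tree_law k \<partial>tree_law i)" for i k
    have LR: "L i k = R i k * ?G" if "1 \<le> i" "1 \<le> k" for i k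
      unfolding L_def R_def using that by (rule pair)
    have node: "tops K (node x s t) = tops K s + tops K t"
      "skeleton_upto K (Suc n) (node x s t) = skeleton_upto K n s * skeleton_upto K n t"
      if "porder (node x s t) = j" for x s t
      using that 3 by (auto simp: skeleton_upto_def simp del: porder.simps)
    have "(\<integral>\<^sup>+p. skeleton_upto K (Suc n) p * h (?N p) * ?S p \<partial>tree_law j) =
      (\<integral>\<^sup>+x. (\<Sum>e<j. ennreal (event_prob j e) *
        (if e = 0 then if j = 1 then 0 else L (j - 1) (j - 1) else L j e)) \<partial>expo (edge_rate j))"
      unfolding L_def
      using K 3 by (intro nn_integral_tree_law_cong Suc.prems) (auto simp: node simp del: tops.simps)
    also have "\<dots> = (\<integral>\<^sup>+x. (\<Sum>e<j. ennreal (event_prob j e) *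
        (if e = 0 then if j = 1 then 0 else R (j - 1) (j - 1) else R j e)) * ?G \<partial>expo (edge_rate j))"
      unfolding sum_distrib_right using K 3
      by (intro nn_integral_cong sum.cong refl) (auto simp: LR mult.assoc)
    also have "\<dots> = (\<integral>\<^sup>+x. (\<Sum>e<j. ennreal (event_prob j e) *
        (if e = 0 then if j = 1 then 0 else R (j - 1) (j - 1) else R j e)) \<partial>expo (edge_rate j)) * ?G"
      by (rule nn_integral_multc) simp
    also have "(\<integral>\<^sup>+x. (\<Sum>e<j. ennreal (event_prob j e) *
        (if e = 0 then if j = 1 then 0 else R (j - 1) (j - 1) else R j e)) \<partial>expo (edge_rate j)) =
       (\<integral>\<^sup>+p. skeleton_upto K (Suc n) p * h (?N p) * of_nat (?N p) \<partial>tree_law j)"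
      unfolding R_def
      using K 3 by (intro nn_integral_tree_law_cong[symmetric] Suc.prems) (auto simp: node simp del: tops.simps)
    finally show ?thesis .
  qed
qed

text \<open>Weighting with the inverse number of subtrees turns the sum into the uniform average.
  This number is positive because the order is at least K, so weight times number integrates to
  1.\<close>

lemma nn_integral_uniform_subtree:
  assumes K: "1 \<le> K" "K \<le> j" and g [measurable]: "g \<in> borel_measurable ptree_space"
  shows "(\<integral>\<^sup>+p. (\<Sum>q\<in>#tops K p. g q) / of_nat (size (tops K p)) \<partial>tree_law j) = (\<integral>\<^sup>+p. g p \<partial>tree_law K)"
proof -
  have j: "1 \<le> j" using K by simp
  let ?h = "\<lambda>n. inverse (of_nat n) :: ennreal"
  have sup: "(\<integral>\<^sup>+p. F p \<partial>tree_law j) = (SUP n. \<integral>\<^sup>+p. skeleton_upto K n p * F p \<partial>tree_law j)"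
    if [measurable]: "F \<in> borel_measurable ptree_space" for F
  proof -
    have "(SUP n. skeleton_upto K n p * F p) = F p" for p
    proof (rule antisym)
      show "(SUP n. skeleton_upto K n p * F p) \<le> F p"
        by (intro SUP_least) (auto simp: skeleton_upto_def)
      show "F p \<le> (SUP n. skeleton_upto K n p * F p)"
        by (rule SUP_upper2[of "Suc (skeleton_height K p)"]) (auto simp: skeleton_upto_def)
    qed
    then have "(\<integral>\<^sup>+p. F p \<partial>tree_law j) = (\<integral>\<^sup>+p. (SUP n. skeleton_upto K n p * F p) \<partial>tree_law j)" by simp
    also have "\<dots> = (SUP n. \<integral>\<^sup>+p. skeleton_upto K n p * F p \<partial>tree_law j)"
      by (rule nn_integral_monotone_convergence_SUP) (auto simp: incseq_def le_fun_def skeleton_upto_def)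
    finally show ?thesis .
  qed
  have "(\<integral>\<^sup>+p. ?h (size (tops K p)) * (\<Sum>q\<in>#tops K p. g q) \<partial>tree_law j) =
      (\<integral>\<^sup>+p. ?h (size (tops K p)) * of_nat (size (tops K p)) \<partial>tree_law j) * (\<integral>\<^sup>+p. g p \<partial>tree_law K)"
    by (subst (1 2) sup)
       (simp_all only: mult.assoc[symmetric] complete_subtrees_truncated[OF K(1) g j, where h="?h"] SUP_mult_right_ennreal,
        measurable)
  also have "(\<integral>\<^sup>+p. ?h (size (tops K p)) * of_nat (size (tops K p)) \<partial>tree_law j) = (\<integral>\<^sup>+p. 1 \<partial>tree_law j)"
  proof (rule nn_integral_cong_AE, use AE_porder[OF j] in \<open>rule AE_mp\<close>, intro AE_I2 impI)
    fix p :: "posreal ptree" assume "porder p = j"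
    then have "tops K p \<noteq> {#}" using K by (intro tops_nonempty) auto
    then have "(of_nat (size (tops K p)) :: ennreal) \<noteq> 0" by simp
    then show "?h (size (tops K p)) * of_nat (size (tops K p)) = 1"
      using ennreal_divide_self[of "of_nat (size (tops K p))"]
      by (simp add: divide_ennreal_def mult.commute of_nat_less_top)
  qed
  finally show ?thesis
    using T.emeasure_space_1[of j] by (simp add: divide_ennreal_def mult.commute)
qed

end

section \<open>Expected numbers of branches and mergers\<close>

context hbp
begin

text \<open>Before it terminates, an order j branch bears on average \<open>Tk (j - e)\<close> side
  branches of order e, each contributing \<open>v e + d e\<close>, and it ends in two subtrees
  contributing \<open>v (j - 1)\<close> each.\<close>

lemma additive_expectation:
  fixes \<phi> :: "posreal ptree \<Rightarrow> ennreal" and d :: "nat \<Rightarrow> real"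
  assumes j: "2 \<le> j" and \<phi> [measurable]: "\<phi> \<in> borel_measurable ptree_space"
    and split: "\<And>x s t. porder s = j - 1 \<Longrightarrow> porder t = j - 1 \<Longrightarrow> \<phi> (node x s t) = \<phi> s + \<phi> t"
    and offspring: "\<And>x e s t. 1 \<le> e \<Longrightarrow> e < j \<Longrightarrow> porder s = j \<Longrightarrow> porder t = e \<Longrightarrow> \<phi> (node x s t) = \<phi> s + \<phi> t + ennreal (d e)"
    and v: "\<And>i. 1 \<le> i \<Longrightarrow> i < j \<Longrightarrow> (\<integral>\<^sup>+p. \<phi> p \<partial>tree_law i) = ennreal (v i)" and v0: "\<And>i. 0 \<le> v i"
    and d0: "\<And>e. 0 \<le> d e"
  shows "(\<integral>\<^sup>+p. \<phi> p \<partial>tree_law j) = ennreal (2 * v (j - 1) + (\<Sum>e\<in>{1..<j}. Tk (j - e) * (v e + d e)))"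
proof -
  have j1: "1 \<le> j" using j by simp
  define c where "c = 2 * v (j - 1) + (\<Sum>e\<in>{1..<j}. Tk (j - e) * (v e + d e))"
  have c0: "0 \<le> c" unfolding c_def using v0 d0 Tk by (intro add_nonneg_nonneg mult_nonneg_nonneg sum_nonneg) auto
  have ct0: "0 \<le> c / total j" using c0 total_pos[of j] by (intro divide_nonneg_pos)
  \<comment> \<open>Probability that the first event is a birth, after which the branch starts
    afresh; c is the fixed point of x = c / total j + q x.\<close>
  define q where "q = (\<Sum>e\<in>{1..<j}. Tk (j - e)) / total j"
  have q0: "0 \<le> q" using Tk total_pos[of j] unfolding q_def by (intro divide_nonneg_pos sum_nonneg) auto
  have "(\<Sum>e\<in>{1..<j}. Tk (j - e)) = total j - 1" by (simp add: total_def)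
  then have qt: "q = 1 - 1 / total j"
    using total_pos[of j] unfolding q_def by (simp add: diff_divide_distrib less_imp_neq[symmetric])
  have q1: "c / total j + q * c = c"
    unfolding qt by (simp add: algebra_simps)
  define V where "V = (\<integral>\<^sup>+p. \<phi> p \<partial>tree_law j)"
  have ins: "{..<j} = insert 0 {1..<j}" using j by auto
  have "ennreal (event_prob j 0) * ennreal (2 * v (j - 1)) = ennreal (event_prob j 0 * (2 * v (j - 1)))"
    using event_prob_nonneg[of 0 j] j v0[of "j - 1"] by (intro ennreal_mult[symmetric]) auto
  then have e0: "ennreal (event_prob j 0) * ennreal (2 * v (j - Suc 0)) = ennreal (2 * v (j - Suc 0) / total j)"
    by (simp add: event_prob_def)
  have eval: "(\<Sum>e<j. ennreal (event_prob j e) * (if e = 0 then if j = 1 then 0 else ennreal (2 * v (j - 1)) else W + ennreal (v e + d e))) =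
      ennreal (c / total j) + ennreal q * W" for W
  proof -
    have "(\<Sum>e<j. ennreal (event_prob j e) * (if e = 0 then if j = 1 then 0 else ennreal (2 * v (j - 1)) else W + ennreal (v e + d e))) =
        ennreal (2 * v (j - 1) / total j) + (\<Sum>e\<in>{1..<j}. ennreal (event_prob j e) * W + ennreal (event_prob j e * (v e + d e)))"
    proof -
      let ?X = "\<lambda>e. ennreal (event_prob j e) * (if e = 0 then if j = 1 then 0 else ennreal (2 * v (j - 1)) else W + ennreal (v e + d e))"
      have "(\<Sum>e<j. ?X e) = ?X 0 + (\<Sum>e\<in>{1..<j}. ?X e)" unfolding ins by simp
      also have "?X 0 = ennreal (2 * v (j - 1) / total j)" using j e0 by simp
      also have "(\<Sum>e\<in>{1..<j}. ?X e) = (\<Sum>e\<in>{1..<j}. ennreal (event_prob j e) * W + ennreal (event_prob j e * (v e + d e)))"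
      proof (intro sum.cong refl)
        fix e assume e: "e \<in> {1..<j}"
        have "ennreal (event_prob j e) * ennreal (v e + d e) = ennreal (event_prob j e * (v e + d e))"
          using e event_prob_nonneg[of e j] v0[of e] d0[of e] by (intro ennreal_mult[symmetric]) auto
        with e show "?X e = ennreal (event_prob j e) * W + ennreal (event_prob j e * (v e + d e))"
          by (simp add: distrib_left del: ennreal_plus)
      qed
      finally show ?thesis .
    qed
    also have "\<dots> = ennreal (2 * v (j - 1) / total j) + ((\<Sum>e\<in>{1..<j}. ennreal (event_prob j e)) * W + (\<Sum>e\<in>{1..<j}. ennreal (event_prob j e * (v e + d e))))"
      by (simp add: sum.distrib sum_distrib_right)
    also have "(\<Sum>e\<in>{1..<j}. ennreal (event_prob j e)) = ennreal (\<Sum>e\<in>{1..<j}. event_prob j e)"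
      using event_prob_nonneg by (intro sum_ennreal) auto
    also have "(\<Sum>e\<in>{1..<j}. event_prob j e) = q"
      unfolding q_def sum_divide_distrib by (intro sum.cong) (auto simp: event_prob_def)
    also have "(\<Sum>e\<in>{1..<j}. ennreal (event_prob j e * (v e + d e))) = ennreal (\<Sum>e\<in>{1..<j}. event_prob j e * (v e + d e))"
      using event_prob_nonneg v0 d0 by (intro sum_ennreal mult_nonneg_nonneg) auto
    also have "(\<Sum>e\<in>{1..<j}. event_prob j e * (v e + d e)) = (\<Sum>e\<in>{1..<j}. Tk (j - e) * (v e + d e)) / total j"
      unfolding sum_divide_distrib by (intro sum.cong) (auto simp: event_prob_def)
    also have "ennreal (2 * v (j - 1) / total j) + (ennreal q * W + ennreal ((\<Sum>e\<in>{1..<j}. Tk (j - e) * (v e + d e)) / total j)) =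
        ennreal (c / total j) + ennreal q * W"
    proof -
      have "0 \<le> (\<Sum>e\<in>{1..<j}. Tk (j - e) * (v e + d e)) / total j"
        using Tk v0 d0 total_pos[of j] by (intro divide_nonneg_pos sum_nonneg mult_nonneg_nonneg) auto
      moreover have "0 \<le> 2 * v (j - 1) / total j" using v0 total_pos[of j] by (intro divide_nonneg_pos) auto
      ultimately have "ennreal (2 * v (j - 1) / total j) + ennreal ((\<Sum>e\<in>{1..<j}. Tk (j - e) * (v e + d e)) / total j) = ennreal (c / total j)"
        by (simp add: c_def add_divide_distrib ennreal_plus[symmetric] del: ennreal_plus)
      then show ?thesis by (simp add: add.left_commute add.commute)
    qed
    finally show ?thesis .
  qed
  have pair: "(\<integral>\<^sup>+s. \<integral>\<^sup>+t. F s + F' t + C \<partial>tree_law k \<partial>tree_law i) =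
      (\<integral>\<^sup>+s. F s \<partial>tree_law i) + (\<integral>\<^sup>+t. F' t \<partial>tree_law k) + C"
    if [measurable]: "F \<in> borel_measurable ptree_space" "F' \<in> borel_measurable ptree_space" for F F' C i k
    using T.emeasure_space_1 by (simp add: nn_integral_add add.assoc)
  have one: "emeasure (expo (edge_rate j)) UNIV = 1"
    using prob_space.emeasure_space_1[OF prob_space_expo[OF edge_rate_pos[OF j1]]] by simp
  have vsplit: "(\<integral>\<^sup>+s. \<phi> s \<partial>tree_law (j - 1)) = ennreal (v (j - 1))" using j by (intro v) auto
  have two: "ennreal (v (j - 1)) + ennreal (v (j - 1)) = ennreal (2 * v (j - 1))"
    using ennreal_plus[OF v0[of "j - 1"] v0[of "j - 1"]] by (simp only: mult_2)
  have comb: "(\<Sum>e<j. ennreal (event_prob j e) * (if e = 0 then if j = 1 then 0 else ennreal (v (j - 1)) + ennreal (v (j - 1)) + 0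
        else W + (\<integral>\<^sup>+p. \<phi> p \<partial>tree_law e) + ennreal (d e))) =
      (\<Sum>e<j. ennreal (event_prob j e) * (if e = 0 then if j = 1 then 0 else ennreal (2 * v (j - 1)) else W + ennreal (v e + d e)))" for W
  proof (intro sum.cong refl arg_cong2[where f="(*)"])
    fix e assume "e \<in> {..<j}"
    then show "(if e = 0 then if j = 1 then 0 else ennreal (v (j - 1)) + ennreal (v (j - 1)) + 0
        else W + (\<integral>\<^sup>+p. \<phi> p \<partial>tree_law e) + ennreal (d e)) =
      (if e = 0 then if j = 1 then 0 else ennreal (2 * v (j - 1)) else W + ennreal (v e + d e))"
      using v[of e] v0[of e] d0[of e] two by (auto simp: add.assoc simp del: One_nat_def)
  qed
  have V: "V = ennreal (c / total j) + ennreal q * V"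
  proof -
    have "V = (\<integral>\<^sup>+x. (\<Sum>e<j. ennreal (event_prob j e) *
        (if e = 0 then if j = 1 then 0 else \<integral>\<^sup>+s. \<integral>\<^sup>+t. \<phi> s + \<phi> t + 0 \<partial>tree_law (j - 1) \<partial>tree_law (j - 1)
         else \<integral>\<^sup>+s. \<integral>\<^sup>+t. \<phi> s + \<phi> t + ennreal (d e) \<partial>tree_law e \<partial>tree_law j)) \<partial>expo (edge_rate j))"
      unfolding V_def using j by (intro nn_integral_tree_law_cong \<phi>) (simp_all add: split offspring)
    also have "\<dots> = (\<Sum>e<j. ennreal (event_prob j e) * (if e = 0 then if j = 1 then 0 else ennreal (2 * v (j - 1)) else V + ennreal (v e + d e)))"
      unfolding pair[OF \<phi> \<phi>] vsplit comb V_def[symmetric] using one by simp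
    finally show ?thesis unfolding eval .
  qed
  \<comment> \<open>When q > 0, infinity solves the equation for V too, so finiteness is obtained
    first: the truncated expectations start from 0 and, c being a fixed point of the recursion,
    never exceed it.\<close>
  have bound: "(\<integral>\<^sup>+p. \<phi> p * height_upto n p \<partial>tree_law j) \<le> ennreal c" for n
  proof (induction n)
    case (Suc n)
    let ?\<psi> = "\<lambda>p. \<phi> p * height_upto n p"
    let ?W = "\<integral>\<^sup>+p. ?\<psi> p \<partial>tree_law j"
    have le: "a * (b * c) \<le> a * b" "a * (b * c) \<le> a" if "b \<le> 1" "c \<le> 1" for a b c :: ennreal
      using mult_left_mono[OF mult_left_mono[OF that(2), of b], of a] mult_left_mono[OF that(1), of a] by auto
    have "(\<integral>\<^sup>+p. \<phi> p * height_upto (Suc n) p \<partial>tree_law j) =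
      (\<integral>\<^sup>+x. (\<Sum>e<j. ennreal (event_prob j e) *
        (if e = 0 then if j = 1 then 0 else \<integral>\<^sup>+s. \<integral>\<^sup>+t. (\<phi> s + \<phi> t) * (height_upto n s * height_upto n t) \<partial>tree_law (j - 1) \<partial>tree_law (j - 1)
         else \<integral>\<^sup>+s. \<integral>\<^sup>+t. (\<phi> s + \<phi> t + ennreal (d e)) * (height_upto n s * height_upto n t) \<partial>tree_law e \<partial>tree_law j)) \<partial>expo (edge_rate j))"
      using j by (intro nn_integral_tree_law_cong) (simp_all add: split offspring)
    \<comment> \<open>The truncation is kept on the continuing branch s, where the induction needs
      it; the expectations of the other subtrees are known from v.\<close>
    also have "\<dots> \<le> (\<integral>\<^sup>+x. (\<Sum>e<j. ennreal (event_prob j e) *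
        (if e = 0 then if j = 1 then 0 else \<integral>\<^sup>+s. \<integral>\<^sup>+t. \<phi> s + \<phi> t + 0 \<partial>tree_law (j - 1) \<partial>tree_law (j - 1)
         else \<integral>\<^sup>+s. \<integral>\<^sup>+t. ?\<psi> s + \<phi> t + ennreal (d e) \<partial>tree_law e \<partial>tree_law j)) \<partial>expo (edge_rate j))"
    proof (intro nn_integral_mono sum_mono mult_left_mono zero_le)
      fix x e
      have r1: "(\<integral>\<^sup>+s. \<integral>\<^sup>+t. (\<phi> s + \<phi> t) * (height_upto n s * height_upto n t) \<partial>tree_law (j - 1) \<partial>tree_law (j - 1)) \<le>
          (\<integral>\<^sup>+s. \<integral>\<^sup>+t. \<phi> s + \<phi> t + 0 \<partial>tree_law (j - 1) \<partial>tree_law (j - 1))"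
        unfolding add_0_right by (intro nn_integral_mono le height_upto_le_1)
      have r2: "(\<integral>\<^sup>+s. \<integral>\<^sup>+t. (\<phi> s + \<phi> t + ennreal (d e)) * (height_upto n s * height_upto n t) \<partial>tree_law e \<partial>tree_law j) \<le>
          (\<integral>\<^sup>+s. \<integral>\<^sup>+t. ?\<psi> s + \<phi> t + ennreal (d e) \<partial>tree_law e \<partial>tree_law j)"
        unfolding distrib_right by (intro nn_integral_mono add_mono le height_upto_le_1)
      show "(if e = 0 then if j = 1 then 0 else \<integral>\<^sup>+s. \<integral>\<^sup>+t. (\<phi> s + \<phi> t) * (height_upto n s * height_upto n t) \<partial>tree_law (j - 1) \<partial>tree_law (j - 1)
         else \<integral>\<^sup>+s. \<integral>\<^sup>+t. (\<phi> s + \<phi> t + ennreal (d e)) * (height_upto n s * height_upto n t) \<partial>tree_law e \<partial>tree_law j) \<le>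
        (if e = 0 then if j = 1 then 0 else \<integral>\<^sup>+s. \<integral>\<^sup>+t. \<phi> s + \<phi> t + 0 \<partial>tree_law (j - 1) \<partial>tree_law (j - 1)
         else \<integral>\<^sup>+s. \<integral>\<^sup>+t. ?\<psi> s + \<phi> t + ennreal (d e) \<partial>tree_law e \<partial>tree_law j)"
        using r1 r2 by (cases "e = 0"; cases "j = 1") (simp_all only: if_True if_False order_refl simp_thms)
    qed
    also have "\<dots> = (\<Sum>e<j. ennreal (event_prob j e) * (if e = 0 then if j = 1 then 0 else ennreal (2 * v (j - 1)) else ?W + ennreal (v e + d e)))"
    proof -
      have \<psi>: "?\<psi> \<in> borel_measurable ptree_space" by measurable
      show ?thesis
        unfolding pair[OF \<phi> \<phi>] pair[OF \<psi> \<phi>] vsplit comb using one by simp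
    qed
    also have "\<dots> = ennreal (c / total j) + ennreal q * ?W" by (rule eval)
    also have "\<dots> \<le> ennreal (c / total j) + ennreal q * ennreal c"
      using Suc.IH by (intro add_mono mult_left_mono) auto
    also have "\<dots> = ennreal c"
      using q0 q1 c0 ennreal_plus[OF ct0, of "q * c"] by (simp add: ennreal_mult)
    finally show ?case .
  qed simp
  have "V \<le> ennreal c"
    unfolding V_def by (subst nn_integral_height_upto) (auto intro: SUP_least bound)
  then obtain r where r: "V = ennreal r" "0 \<le> r" by (cases V) (auto simp: top_unique)
  have "ennreal r = ennreal (c / total j + q * r)"
    using V q0 r ennreal_plus[OF ct0, of "q * r"] by (simp add: ennreal_mult)
  then have "r = c / total j + q * r"
    using r q0 ct0 by (subst (asm) ennreal_inj) auto
  then have "r = c"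
  proof -
    have "1 - q = 1 / total j" using qt by simp
    moreover have "(1 - q) * r = c / total j" using \<open>r = c / total j + q * r\<close> by (simp add: algebra_simps)
    ultimately show ?thesis using total_pos[of j] by simp
  qed
  with r show ?thesis by (simp add: V_def c_def)
qed

lemma pmerges_eq_0: "i < k \<Longrightarrow> porder p < k \<Longrightarrow> pmerges i k p = 0"
  by (induction p) (auto split: if_splits)

text \<open>Beyond order k both expectations obey the same homogeneous linear recursion in j, so
  their ratio stays at its value at j = k, where there is one branch of order k and the mean number
  of order i side branches on it is \<open>Tk (k - i)\<close>. The value of b stays
  implicit.\<close>

lemma expected_branches_mergers:
  assumes ik: "1 \<le> i" "i < k" and j: "1 \<le> j"
  shows "\<exists>b\<ge>0. (k \<le> j \<longrightarrow> 0 < b) \<and>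
    (\<integral>\<^sup>+p. of_nat (size (tops k p)) \<partial>tree_law j) = ennreal b \<and>
    (\<integral>\<^sup>+p. of_nat (pmerges i k p) \<partial>tree_law j) = ennreal (Tk (k - i) * b)"
  using j
proof (induction j rule: less_induct)
  case (less j)
  let ?B = "\<lambda>j. \<integral>\<^sup>+p. of_nat (size (tops k p)) \<partial>tree_law j"
  let ?C = "\<lambda>j. \<integral>\<^sup>+p. of_nat (pmerges i k p) \<partial>tree_law j"
  have T0: "0 \<le> Tk (k - i)" using ik Tk by simp
  have one: "(\<integral>\<^sup>+p. 1 \<partial>tree_law j) = 1" using T.emeasure_space_1[of j] by simp
  consider "j < k" | "j = k" | "k < j" by linarith
  then show ?case
  proof cases
    case 1
    have "?B j = (\<integral>\<^sup>+p. 0 \<partial>tree_law j)"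
      by (rule nn_integral_order_cong[OF less.prems]) (simp add: tops_empty 1)
    moreover have "?C j = (\<integral>\<^sup>+p. 0 \<partial>tree_law j)"
      by (rule nn_integral_order_cong[OF less.prems]) (simp add: pmerges_eq_0 ik 1)
    ultimately show ?thesis using 1 by (intro exI[of _ 0]) simp
  next
    case 2
    have "?B j = (\<integral>\<^sup>+p. 1 \<partial>tree_law j)"
      by (rule nn_integral_order_cong[OF less.prems]) (simp add: tops_self 2)
    moreover have "?C j = ennreal (2 * 0 + (\<Sum>e\<in>{1..<j}. Tk (j - e) * (0 + (if e = i then 1 else 0))))"
    proof (rule additive_expectation[where v="\<lambda>_. 0"])
      show "?C l = ennreal 0" if "1 \<le> l" "l < j" for l
        using that(2) 2 ik
        by (subst nn_integral_order_cong[OF that(1), where g="\<lambda>_. 0"]) (simp_all add: pmerges_eq_0)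
    qed (use 2 ik in auto)
    moreover have "(\<Sum>e\<in>{1..<j}. Tk (j - e) * (0 + (if e = i then 1 else 0))) = Tk (k - i)"
    proof -
      have "(\<Sum>e\<in>{1..<j}. Tk (j - e) * (0 + (if e = i then 1 else 0))) = (\<Sum>e\<in>{1..<j}. if e = i then Tk (j - e) else 0)"
        by (intro sum.cong) auto
      also have "\<dots> = Tk (j - i)" using ik 2 by (simp add: sum.delta)
      finally show ?thesis using 2 by simp
    qed
    ultimately show ?thesis using one by (intro exI[of _ 1]) simp
  next
    case 3
    have "\<forall>l\<in>{1..<j}. \<exists>b\<ge>0. (k \<le> l \<longrightarrow> 0 < b) \<and> ?B l = ennreal b \<and> ?C l = ennreal (Tk (k - i) * b)"
      using less.IH by auto
    then obtain b where b: "\<And>l. l \<in> {1..<j} \<Longrightarrow> 0 \<le> b l \<and> (k \<le> l \<longrightarrow> 0 < b l) \<and> ?B l = ennreal (b l) \<and> ?C l = ennreal (Tk (k - i) * b l)"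
      by metis
    \<comment> \<open>Extended by 0, because \<open>additive_expectation\<close> wants nonnegative
      values at every index.\<close>
    define v where "v l = (if l \<in> {1..<j} then b l else 0)" for l
    have v: "0 \<le> v l" "l \<in> {1..<j} \<Longrightarrow> ?B l = ennreal (v l)" "l \<in> {1..<j} \<Longrightarrow> ?C l = ennreal (Tk (k - i) * v l)" for l
      using b[of l] by (auto simp: v_def)
    let ?b = "2 * v (j - 1) + (\<Sum>e\<in>{1..<j}. Tk (j - e) * (v e + 0))"
    have B: "?B j = ennreal ?b"
      using 3 ik v by (intro additive_expectation[where d="\<lambda>_. 0"]) auto
    have "?C j = ennreal (2 * (Tk (k - i) * v (j - 1)) + (\<Sum>e\<in>{1..<j}. Tk (j - e) * (Tk (k - i) * v e + 0)))"
      using 3 ik v T0 by (intro additive_expectation[where d="\<lambda>_. 0"]) auto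
    also have "2 * (Tk (k - i) * v (j - 1)) + (\<Sum>e\<in>{1..<j}. Tk (j - e) * (Tk (k - i) * v e + 0)) = Tk (k - i) * ?b"
      by (simp add: distrib_left sum_distrib_left mult_ac)
    finally have C: "?C j = ennreal (Tk (k - i) * ?b)" .
    have "j - 1 \<in> {1..<j}" "k \<le> j - 1" using 3 ik by auto
    then have "0 < v (j - 1)" using b[of "j - 1"] by (simp add: v_def)
    moreover have "0 \<le> (\<Sum>e\<in>{1..<j}. Tk (j - e) * (v e + 0))"
      using Tk v by (intro sum_nonneg mult_nonneg_nonneg) auto
    ultimately have "0 < ?b" by linarith
    with B C show ?thesis by (intro exI[of _ ?b]) auto
  qed
qed

end

section \<open>The pruned tree\<close>

lemma emeasure_expo_lessThan:
  assumes "0 < z" "0 < r"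
  shows "emeasure (expo r) {..<z} = ennreal (1 - exp (- z * r))"
proof -
  interpret prob_space "expo r" using assms(2) by (rule prob_space_expo)
  have "measure (expo r) {z..} = exp (- z * r)"
    using emeasure_expo_ge[of z r] assms by (simp add: emeasure_eq_measure)
  moreover have "{..<z} = space (expo r) - {z..}" by auto
  ultimately show ?thesis
    using prob_compl[of "{z..}"] by (simp add: emeasure_eq_measure)
qed

text \<open>A geometric sum of independent exponential variables is exponential; this is the corresponding
  renewal equation.\<close>

lemma expo_thinning:
  assumes a: "0 < a" and q: "0 \<le> q" "q < 1" and [measurable]: "\<phi> \<in> borel_measurable borel"
  defines "b \<equiv> a * (1 - q)"
  shows "(\<integral>\<^sup>+x. \<phi> x \<partial>expo b) = (\<integral>\<^sup>+x. ennreal (1 - q) * \<phi> x + ennreal q * (\<integral>\<^sup>+y. \<phi> (x + y) \<partial>expo b) \<partial>expo a)"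
proof -
  have b: "0 < b" using a q by (simp add: b_def)
  let ?g = "\<lambda>r x. ennreal (r * exp (- r * x)) * indicator {0<..} x :: ennreal"
  \<comment> \<open>Convolution of the two exponential densities. The fact \<open>k\<close> says
    that one step of rate a, followed with probability q by a further time of rate b, has rate b in
    total.\<close>
  define k where "k z = (\<integral>\<^sup>+x. ?g a x * ?g b (z - x) \<partial>lborel)" for z
  have k: "ennreal (1 - q) * ?g a z + ennreal q * k z = ?g b z" for z
  proof (cases "0 < z")
    case False
    have "k z = (\<integral>\<^sup>+x. 0 \<partial>(lborel :: real measure))"
      unfolding k_def by (rule nn_integral_cong) (use False in \<open>auto split: split_indicator\<close>)
    then show ?thesis using False by simp
  next
    case z: True
    show ?thesis
    proof (cases "q = 0")
      case True
      then show ?thesis by (simp add: b_def)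
    next
      case False
      then have q0: "0 < q" using q by simp
      have "ennreal q * k z = (\<integral>\<^sup>+x. ennreal q * (?g a x * ?g b (z - x)) \<partial>lborel)"
        unfolding k_def by (intro nn_integral_cmult[symmetric]) measurable
      also have "\<dots> = (\<integral>\<^sup>+x. ennreal (b * exp (- b * z)) * (?g (a * q) x * indicator {..<z} x) \<partial>lborel)"
      proof (intro nn_integral_cong)
        fix x :: real
        \<comment> \<open>Since a - b = a q, the dependence on x is that of an exponential density
          of rate a q. The case q = 0 was set apart because this rate then vanishes.\<close>
        have "q * (a * exp (- a * x) * (b * exp (- b * (z - x)))) = b * exp (- b * z) * (a * q * exp (- (a * q) * x))"
          by (simp add: b_def exp_add[symmetric] algebra_simps exp_diff[symmetric] mult_exp_exp)
        then have "ennreal q * (ennreal (a * exp (- a * x)) * ennreal (b * exp (- b * (z - x)))) =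
            ennreal (b * exp (- b * z)) * ennreal (a * q * exp (- (a * q) * x))"
          using a b q by (simp add: ennreal_mult[symmetric])
        then show "ennreal q * (?g a x * ?g b (z - x)) = ennreal (b * exp (- b * z)) * (?g (a * q) x * indicator {..<z} x)"
          by (auto split: split_indicator simp: mult_ac)
      qed
      also have "\<dots> = ennreal (b * exp (- b * z)) * (\<integral>\<^sup>+x. indicator {..<z} x \<partial>expo (a * q))"
        using a q0 by (subst nn_integral_cmult) (auto simp: nn_integral_expo simp del: nn_integral_indicator)
      also have "\<dots> = ennreal (b * exp (- b * z) * (1 - exp (- z * (a * q))))"
        using emeasure_expo_lessThan[OF z, of "a * q"] a q0 b z by (simp add: ennreal_mult[symmetric])
      finally have "ennreal (1 - q) * ?g a z + ennreal q * k z =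
          ennreal ((1 - q) * (a * exp (- a * z)) + b * exp (- b * z) * (1 - exp (- z * (a * q))))"
        using z a q b by (simp add: ennreal_mult[symmetric] ennreal_plus[symmetric] del: ennreal_plus)
      also have "(1 - q) * (a * exp (- a * z)) + b * exp (- b * z) * (1 - exp (- z * (a * q))) = b * exp (- b * z)"
        by (simp add: b_def algebra_simps exp_add[symmetric] exp_diff[symmetric] mult_exp_exp)
      finally show ?thesis using z by simp
    qed
  qed
  have km [measurable]: "k \<in> borel_measurable borel"
    unfolding k_def by measurable
  have "(\<integral>\<^sup>+x. (\<integral>\<^sup>+y. \<phi> (x + y) \<partial>expo b) \<partial>expo a) =
      (\<integral>\<^sup>+x. ?g a x * (\<integral>\<^sup>+y. ?g b y * \<phi> (x + y) \<partial>lborel) \<partial>lborel)"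
    using a b by (simp add: nn_integral_expo)
  also have "\<dots> = (\<integral>\<^sup>+x. ?g a x * (\<integral>\<^sup>+z. ?g b (z - x) * \<phi> z \<partial>lborel) \<partial>lborel)"
  proof (rule nn_integral_cong, rule arg_cong2[where f="(*)", OF refl])
    show "(\<integral>\<^sup>+y. ?g b y * \<phi> (x + y) \<partial>lborel) = (\<integral>\<^sup>+z. ?g b (z - x) * \<phi> z \<partial>lborel)" for x
      by (subst nn_integral_real_affine[where c=1 and t="-x"]) simp_all
  qed
  also have "\<dots> = (\<integral>\<^sup>+x. (\<integral>\<^sup>+z. ?g a x * ?g b (z - x) * \<phi> z \<partial>lborel) \<partial>lborel)"
    by (intro nn_integral_cong, subst nn_integral_cmult[symmetric]) (auto simp: mult_ac)
  also have "\<dots> = (\<integral>\<^sup>+z. (\<integral>\<^sup>+x. ?g a x * ?g b (z - x) * \<phi> z \<partial>lborel) \<partial>lborel)"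
    by (rule lborel_pair.Fubini') measurable
  also have "\<dots> = (\<integral>\<^sup>+z. k z * \<phi> z \<partial>lborel)"
    unfolding k_def by (intro nn_integral_cong nn_integral_multc) measurable
  finally have 2: "(\<integral>\<^sup>+x. (\<integral>\<^sup>+y. \<phi> (x + y) \<partial>expo b) \<partial>expo a) = (\<integral>\<^sup>+z. k z * \<phi> z \<partial>lborel)" .
  interpret B: prob_space "expo b" using b by (rule prob_space_expo)
  have "(\<integral>\<^sup>+x. ennreal (1 - q) * \<phi> x + ennreal q * (\<integral>\<^sup>+y. \<phi> (x + y) \<partial>expo b) \<partial>expo a) =
      ennreal (1 - q) * (\<integral>\<^sup>+x. \<phi> x \<partial>expo a) + ennreal q * (\<integral>\<^sup>+x. (\<integral>\<^sup>+y. \<phi> (x + y) \<partial>expo b) \<partial>expo a)"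
    by (subst nn_integral_add) (auto simp: nn_integral_cmult)
  also have "\<dots> = ennreal (1 - q) * (\<integral>\<^sup>+x. ?g a x * \<phi> x \<partial>lborel) + ennreal q * (\<integral>\<^sup>+z. k z * \<phi> z \<partial>lborel)"
    unfolding 2 using a by (simp add: nn_integral_expo)
  also have "\<dots> = (\<integral>\<^sup>+z. (ennreal (1 - q) * ?g a z + ennreal q * k z) * \<phi> z \<partial>lborel)"
    by (simp add: distrib_right nn_integral_add nn_integral_cmult[symmetric] mult.assoc)
  also have "\<dots> = (\<integral>\<^sup>+x. \<phi> x \<partial>expo b)"
    unfolding k using b by (simp add: nn_integral_expo)
  finally show ?thesis by simp
qed

context hbp
begin

lemma total_neq_0 [simp]: "total j \<noteq> 0"
  using total_pos[of j] by linarith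

lemma hbp_shift: "hbp Tk (\<lambda>j. lam (Suc j))"
  using Tk lam by unfold_locales auto

lemma total_Suc: "1 \<le> j \<Longrightarrow> total (Suc j) = Tk j + total j"
proof -
  assume j: "1 \<le> j"
  have "(\<Sum>e\<in>{1..<Suc j}. Tk (Suc j - e)) = Tk j + (\<Sum>e\<in>{Suc 1..<Suc j}. Tk (Suc j - e))"
    using j by (subst sum.atLeast_Suc_lessThan) auto
  also have "(\<Sum>e\<in>{Suc 1..<Suc j}. Tk (Suc j - e)) = (\<Sum>e\<in>{1..<j}. Tk (j - e))"
    by (subst sum.atLeast_Suc_lessThan_Suc_shift) (simp add: o_def)
  finally show ?thesis by (simp add: total_def)
qed

lemma pr_node:
  assumes "0 < x"
  shows "porder s = 1 \<Longrightarrow> porder t = 1 \<Longrightarrow> pr (node x s t) = leaf x"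
    and "porder s \<noteq> 1 \<Longrightarrow> porder t = 1 \<Longrightarrow> pr (node x s t) = extend_stem x (pr s)"
    and "porder s \<noteq> 1 \<Longrightarrow> porder t \<noteq> 1 \<Longrightarrow> pr (node x s t) = node x (pr s) (pr t)"
  by (auto simp: extend_stem_def)

text \<open>Merging the edges at the removed side branches of order one makes the law of the pruned tree
  satisfy a renewal equation in the root edge, whose bounded solution is unique.\<close>

lemma distr_pr:
  assumes J: "1 \<le> J"
  shows "distr (tree_law (Suc J)) ptree_space pr = hbp.tree_law Tk (\<lambda>j. lam (Suc j)) J"
proof -
  interpret S: hbp Tk "\<lambda>j. lam (Suc j)" by (rule hbp_shift)
  define Q where "Q j = distr (tree_law (Suc j)) ptree_space pr" for j
  have sets [measurable_cong, simp]: "sets (Q j) = sets ptree_space" for j by (simp add: Q_def)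
  have prob: "prob_space (Q j)" for j unfolding Q_def by (rule T.prob_space_distr) measurable
  interpret Q: prob_space "Q j" for j by (rule prob)
  have Q1: "(\<integral>\<^sup>+p. f p \<partial>Q j) = (\<integral>\<^sup>+p. f (pr p) \<partial>tree_law (Suc j))" if "f \<in> borel_measurable ptree_space" for f j
    unfolding Q_def using that by (subst nn_integral_distr) auto
  have Q2: "(\<integral>\<^sup>+s. \<integral>\<^sup>+t. f (node x s t) \<partial>Q k \<partial>Q i) =
      (\<integral>\<^sup>+s. \<integral>\<^sup>+t. f (node x (pr s) (pr t)) \<partial>tree_law (Suc k) \<partial>tree_law (Suc i))"
    if [measurable]: "f \<in> borel_measurable ptree_space" for f x i k
    by (subst Q1, measurable, intro nn_integral_cong, subst Q1) auto
  have "Q J = S.tree_law J"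
  proof (rule S.tree_law_unique[OF sets prob _ J])
    fix j :: nat and f :: "posreal ptree \<Rightarrow> ennreal"
    assume j: "1 \<le> j" and fm: "f \<in> borel_measurable ptree_space" and f1: "\<And>p. f p \<le> 1"
    define a where "a = edge_rate (Suc j)"
    \<comment> \<open>Probability that the first event is the birth of an order 1 side branch, the
      only event that pruning erases. The joined edge then has rate b = a (1 - q), which is
      \<open>lam (Suc j) * total j\<close>.\<close>
    define q where "q = event_prob (Suc j) 1"
    define b where "b = a * (1 - q)"
    have a: "0 < a" unfolding a_def by (rule edge_rate_pos) simp
    have tS: "total (Suc j) = Tk j + total j" using j by (rule total_Suc)
    have q: "0 \<le> q" "1 - q = total j / total (Suc j)"
      using event_prob_nonneg[of 1 "Suc j"] j total_pos[of "Suc j"]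
      by (auto simp: q_def event_prob_def tS diff_divide_eq_iff divide_diff_eq_iff)
    then have "0 < 1 - q" using total_pos by simp
    then have q1: "q < 1" by simp
    have b: "b = lam (Suc j) * total j"
      using total_pos[of "Suc j"] unfolding b_def q(2) a_def by (simp add: less_imp_neq[symmetric])
    have b0: "0 < b" unfolding b_def using \<open>0 < 1 - q\<close> a by simp
    \<comment> \<open>Given that it is not erased, event e + 1 of an order j + 1 branch becomes
      event e of an order j branch, and termination stays termination.\<close>
    have ep: "event_prob (Suc j) 0 = (1 - q) * event_prob j 0"
      "1 \<le> e \<Longrightarrow> e < j \<Longrightarrow> event_prob (Suc j) (Suc e) = (1 - q) * event_prob j e" for e
      by (auto simp: q(2) event_prob_def)
    \<comment> \<open>A collects the events that survive pruning, G is the integral against the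
      pruned law, and W is the right-hand side of the desired equation. Both G and W will satisfy
      the same renewal equation in the joined root edge.\<close>
    define A where "A f x = (\<Sum>e<j. ennreal (event_prob j e) * step Q j e f x)" for f x
    define G where "G f = (\<integral>\<^sup>+p. f p \<partial>Q j)" for f
    define W where "W f = (\<integral>\<^sup>+x. A f x \<partial>expo b)" for f
    have stepm: "(\<lambda>x. step Q j e f x) \<in> borel_measurable borel" if [measurable]: "f \<in> borel_measurable ptree_space" for f e
      unfolding step_def by measurable
    have Am: "A f \<in> borel_measurable borel" if "f \<in> borel_measurable ptree_space" for f
      unfolding A_def using stepm[OF that] by measurable
    have extm: "(\<lambda>p. f (extend_stem x p)) \<in> borel_measurable ptree_space" if [measurable]: "f \<in> borel_measurable ptree_space" for f x
      by measurable
    have Aext: "A (\<lambda>p. f (extend_stem x p)) y = A f (x + y)" if "0 < x" "0 < y" for f x y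
      unfolding A_def step_def using that by (simp cong: if_cong)
    have Gext: "(\<lambda>x. G (\<lambda>p. f (extend_stem x p))) \<in> borel_measurable borel" if [measurable]: "f \<in> borel_measurable ptree_space" for f
      unfolding G_def by measurable
    have Wrec: "W f = (\<integral>\<^sup>+x. ennreal (1 - q) * A f x + ennreal q * W (\<lambda>p. f (extend_stem x p)) \<partial>expo a)"
      if fm: "f \<in> borel_measurable ptree_space" for f
    proof -
      have "W f = (\<integral>\<^sup>+x. ennreal (1 - q) * A f x + ennreal q * (\<integral>\<^sup>+y. A f (x + y) \<partial>expo b) \<partial>expo a)"
        unfolding W_def b_def by (rule expo_thinning[OF a q(1) q1 Am[OF fm]])
      also have "\<dots> = (\<integral>\<^sup>+x. ennreal (1 - q) * A f x + ennreal q * W (\<lambda>p. f (extend_stem x p)) \<partial>expo a)"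
      proof (rule nn_integral_cong_AE, rule AE_mp[OF AE_expo_pos[OF a]], rule AE_I2, rule impI)
        fix x :: real assume x: "0 < x"
        have "(\<integral>\<^sup>+y. A f (x + y) \<partial>expo b) = W (\<lambda>p. f (extend_stem x p))"
          unfolding W_def
          by (rule nn_integral_cong_AE, rule AE_mp[OF AE_expo_pos[OF b0]], rule AE_I2) (simp add: Aext x)
        then show "ennreal (1 - q) * A f x + ennreal q * (\<integral>\<^sup>+y. A f (x + y) \<partial>expo b) =
            ennreal (1 - q) * A f x + ennreal q * W (\<lambda>p. f (extend_stem x p))" by simp
      qed
      finally show ?thesis .
    qed
    \<comment> \<open>An erased side branch is integrated out with total mass 1, and its point of
      attachment vanishes: the top edge prolongs the stem of the remaining pruned tree.\<close>
    have Grec: "G f = (\<integral>\<^sup>+x. ennreal (1 - q) * A f x + ennreal q * G (\<lambda>p. f (extend_stem x p)) \<partial>expo a)"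
      if fm [measurable]: "f \<in> borel_measurable ptree_space" for f
    proof -
      let ?B = "\<lambda>x s t. if j = 1 then f (leaf x) else f (node x (pr s) (pr t))"
      let ?D = "\<lambda>e x s t. if e = 1 then f (extend_stem x (pr s)) else f (node x (pr s) (pr t))"
      have "G f = (\<integral>\<^sup>+p. f (pr p) \<partial>tree_law (Suc j))" unfolding G_def by (rule Q1[OF fm])
      also have "\<dots> = (\<integral>\<^sup>+x. (\<Sum>e<Suc j. ennreal (event_prob (Suc j) e) *
          (if e = 0 then if Suc j = 1 then 0 else \<integral>\<^sup>+s. \<integral>\<^sup>+t. ?B x s t \<partial>tree_law (Suc j - 1) \<partial>tree_law (Suc j - 1)
           else \<integral>\<^sup>+s. \<integral>\<^sup>+t. ?D e x s t \<partial>tree_law e \<partial>tree_law (Suc j))) \<partial>expo (edge_rate (Suc j)))"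
        using j by (intro nn_integral_tree_law_cong) (auto simp: pr_node simp del: pr.simps porder.simps)
      also have "\<dots> = (\<integral>\<^sup>+x. ennreal (1 - q) * A f x + ennreal q * G (\<lambda>p. f (extend_stem x p)) \<partial>expo a)"
        unfolding a_def
      proof (rule nn_integral_cong)
        fix x :: real
        let ?X = "\<lambda>e. ennreal (event_prob (Suc j) e) *
          (if e = 0 then if Suc j = 1 then 0 else \<integral>\<^sup>+s. \<integral>\<^sup>+t. ?B x s t \<partial>tree_law (Suc j - 1) \<partial>tree_law (Suc j - 1)
           else \<integral>\<^sup>+s. \<integral>\<^sup>+t. ?D e x s t \<partial>tree_law e \<partial>tree_law (Suc j))"
        have ins: "{..<j} = insert 0 {1..<j}" using j by auto
        have "(\<Sum>e<Suc j. ?X e) = ?X 0 + (\<Sum>e<j. ?X (Suc e))" by (rule sum.lessThan_Suc_shift)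
        also have "(\<Sum>e<j. ?X (Suc e)) = ?X 1 + (\<Sum>e\<in>{1..<j}. ?X (Suc e))" unfolding ins by simp
        also have "?X 0 = ennreal (1 - q) * (ennreal (event_prob j 0) * step Q j 0 f x)"
        proof -
          have "(\<integral>\<^sup>+s. \<integral>\<^sup>+t. ?B x s t \<partial>tree_law j \<partial>tree_law j) = step Q j 0 f x"
            using j T.emeasure_space_1[of "Suc 0"] by (simp add: step_def Q2[OF fm])
          then show ?thesis
            using j q1 event_prob_nonneg[of 0 j] by (simp add: ep(1) ennreal_mult mult.assoc)
        qed
        also have "?X 1 = ennreal q * G (\<lambda>p. f (extend_stem x p))"
          using T.emeasure_space_1[of 1] by (simp add: q_def G_def Q1[OF extm[OF fm]])
        also have "(\<Sum>e\<in>{1..<j}. ?X (Suc e)) = (\<Sum>e\<in>{1..<j}. ennreal (1 - q) * (ennreal (event_prob j e) * step Q j e f x))"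
        proof (intro sum.cong refl)
          fix e assume e: "e \<in> {1..<j}"
          have "(\<integral>\<^sup>+s. \<integral>\<^sup>+t. ?D (Suc e) x s t \<partial>tree_law (Suc e) \<partial>tree_law (Suc j)) = step Q j e f x"
            using e by (simp add: step_def Q2[OF fm])
          then show "?X (Suc e) = ennreal (1 - q) * (ennreal (event_prob j e) * step Q j e f x)"
            using e q1 event_prob_nonneg[of e j] by (simp add: ep(2) ennreal_mult mult.assoc)
        qed
        also have "ennreal (1 - q) * (ennreal (event_prob j 0) * step Q j 0 f x) + (ennreal q * G (\<lambda>p. f (extend_stem x p)) +
            (\<Sum>e\<in>{1..<j}. ennreal (1 - q) * (ennreal (event_prob j e) * step Q j e f x))) =
            ennreal (1 - q) * A f x + ennreal q * G (\<lambda>p. f (extend_stem x p))"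
          unfolding A_def ins by (simp add: distrib_left sum_distrib_left add_ac)
        finally show "(\<Sum>e<Suc j. ?X e) = ennreal (1 - q) * A f x + ennreal q * G (\<lambda>p. f (extend_stem x p))" .
      qed
      finally show ?thesis .
    qed
    interpret Ea: prob_space "expo a" using a by (rule prob_space_expo)
    interpret Eb: prob_space "expo b" using b0 by (rule prob_space_expo)
    have step1: "step Q j e f x \<le> 1" if "\<And>p. f p \<le> 1" for f e x
    proof -
      have I: "(\<integral>\<^sup>+t. g t \<partial>Q k) \<le> 1" if "\<And>t. g t \<le> 1" for g k
        using nn_integral_mono[of "Q k" g "\<lambda>_. 1"] that Q.emeasure_space_1[of k] by simp
      show ?thesis unfolding step_def using that by (auto intro!: I)
    qed
    have A1: "A f x \<le> 1" if "\<And>p. f p \<le> 1" for f x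
    proof -
      have "A f x \<le> (\<Sum>e<j. ennreal (event_prob j e))"
        unfolding A_def using mult_left_mono[OF step1[OF that]] by (intro sum_mono) fastforce
      also have "\<dots> = 1"
        using sum_event_prob[OF j] event_prob_nonneg by (subst sum_ennreal) auto
      finally show ?thesis .
    qed
    have W1: "W f \<le> 1" if "\<And>p. f p \<le> 1" for f
      using nn_integral_mono[of "expo b" "A f" "\<lambda>_. 1"] A1[OF that] Eb.emeasure_space_1 by (simp add: W_def)
    have G1: "G f \<le> 1" if "\<And>p. f p \<le> 1" for f
      using nn_integral_mono[of "Q j" f "\<lambda>_. 1"] that Q.emeasure_space_1[of j] by (simp add: G_def)
    have Wext: "(\<lambda>x. W (\<lambda>p. f (extend_stem x p))) \<in> borel_measurable borel" if [measurable]: "f \<in> borel_measurable ptree_space" for f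
      unfolding W_def A_def step_def by measurable
    \<comment> \<open>Iterating the renewal equation n times leaves a remainder with factor
      \<open>q ^ n\<close>, since F is at most 1 on functions bounded by 1; applied in both
      directions, this makes two solutions agree in the limit.\<close>
    have close: "F f \<le> F' f + ennreal (q ^ n)"
      if rec: "\<And>f. f \<in> borel_measurable ptree_space \<Longrightarrow>
          F f = (\<integral>\<^sup>+x. ennreal (1 - q) * A f x + ennreal q * F (\<lambda>p. f (extend_stem x p)) \<partial>expo a)"
        "\<And>f. f \<in> borel_measurable ptree_space \<Longrightarrow>
          F' f = (\<integral>\<^sup>+x. ennreal (1 - q) * A f x + ennreal q * F' (\<lambda>p. f (extend_stem x p)) \<partial>expo a)"
        and m: "\<And>f. f \<in> borel_measurable ptree_space \<Longrightarrow> (\<lambda>x. F' (\<lambda>p. f (extend_stem x p))) \<in> borel_measurable borel"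
        and le: "\<And>f. (\<And>p. f p \<le> 1) \<Longrightarrow> F f \<le> 1"
        and f: "f \<in> borel_measurable ptree_space" "\<And>p. f p \<le> 1" for F F' f n
      using f
    proof (induction n arbitrary: f)
      case 0
      then show ?case using le[OF 0(2)] by (simp add: add_increasing)
    next
      case (Suc n)
      have "F f \<le> (\<integral>\<^sup>+x. (ennreal (1 - q) * A f x + ennreal q * F' (\<lambda>p. f (extend_stem x p))) + ennreal (q ^ Suc n) \<partial>expo a)"
        unfolding rec(1)[OF Suc.prems(1)]
      proof (rule nn_integral_mono)
        fix x
        have "ennreal q * F (\<lambda>p. f (extend_stem x p)) \<le> ennreal q * (F' (\<lambda>p. f (extend_stem x p)) + ennreal (q ^ n))"
          using Suc.prems by (intro mult_left_mono Suc.IH extm) auto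
        also have "\<dots> = ennreal q * F' (\<lambda>p. f (extend_stem x p)) + ennreal (q ^ Suc n)"
          using q by (simp add: distrib_left ennreal_mult)
        finally show "ennreal (1 - q) * A f x + ennreal q * F (\<lambda>p. f (extend_stem x p)) \<le>
            (ennreal (1 - q) * A f x + ennreal q * F' (\<lambda>p. f (extend_stem x p))) + ennreal (q ^ Suc n)"
          by (simp add: add.assoc add_left_mono)
      qed
      also have "\<dots> = F' f + ennreal (q ^ Suc n)"
        using Am[OF Suc.prems(1)] m[OF Suc.prems(1)] Ea.emeasure_space_1
        by (subst nn_integral_add) (simp_all add: rec(2)[OF Suc.prems(1), symmetric])
      finally show ?case .
    qed
    have lim: "x \<le> y" if "\<And>n. x \<le> y + ennreal (q ^ n)" for x y
    proof (rule ennreal_le_epsilon)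
      fix e :: real assume "0 < e"
      then obtain n where "q ^ n < e" using real_arch_pow_inv q1 by blast
      with that[of n] show "x \<le> y + ennreal e"
        by (meson add_left_mono ennreal_leI less_imp_le order_trans)
    qed
    have "G f = W f"
    proof (rule antisym)
      show "G f \<le> W f" by (rule lim, rule close[OF Grec Wrec Wext G1 fm f1])
      show "W f \<le> G f" by (rule lim, rule close[OF Wrec Grec Gext W1 fm f1])
    qed
    then show "(\<integral>\<^sup>+p. f p \<partial>Q j) = (\<integral>\<^sup>+x. (\<Sum>e<j. ennreal (event_prob j e) * step Q j e f x) \<partial>expo (lam (Suc j) * total j))"
      unfolding G_def W_def A_def b .
  qed
  then show ?thesis by (simp add: Q_def)
qed

end

section \<open>Edge lengths given the shape\<close>

text \<open>The factor on the right is the density of the law of \<open>u * X\<close> with respect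
  to the law of X, for X exponential of rate r.\<close>

lemma nn_integral_expo_scale:
  assumes u: "0 < u" and r: "0 < r" and [measurable]: "\<phi> \<in> borel_measurable borel"
  shows "(\<integral>\<^sup>+x. \<phi> (u * x) \<partial>expo r) = (\<integral>\<^sup>+x. ennreal (inverse u * exp (r * x * (1 - 1 / u))) * \<phi> x \<partial>expo r)"
proof -
  have "(\<integral>\<^sup>+x. ennreal (inverse u * exp (r * x * (1 - 1 / u))) * \<phi> x \<partial>expo r) =
      (\<integral>\<^sup>+x. ennreal (r * exp (- r * x)) * indicator {0<..} x * (ennreal (inverse u * exp (r * x * (1 - 1 / u))) * \<phi> x) \<partial>lborel)"
    using r by (subst nn_integral_expo) auto
  also have "\<dots> = ennreal u * (\<integral>\<^sup>+x. ennreal (r * exp (- r * (u * x))) * indicator {0<..} (u * x) *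
      (ennreal (inverse u * exp (r * (u * x) * (1 - 1 / u))) * \<phi> (u * x)) \<partial>lborel)"
    using u by (subst nn_integral_real_affine[where c=u and t=0]) simp_all
  also have "\<dots> = (\<integral>\<^sup>+x. ennreal u * (ennreal (r * exp (- r * (u * x))) * indicator {0<..} (u * x) *
      (ennreal (inverse u * exp (r * (u * x) * (1 - 1 / u))) * \<phi> (u * x))) \<partial>lborel)"
    by (rule nn_integral_cmult[symmetric]) measurable
  also have "\<dots> = (\<integral>\<^sup>+x. ennreal (r * exp (- r * x)) * indicator {0<..} x * \<phi> (u * x) \<partial>lborel)"
  proof (rule nn_integral_cong)
    fix x :: real
    have "exp (- r * (u * x)) * exp (r * (u * x) * (1 - 1 / u)) = exp (- r * x)"
      using u by (simp add: mult_exp_exp field_simps)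
    then have "u * (r * exp (- r * (u * x)) * (inverse u * exp (r * (u * x) * (1 - 1 / u)))) = r * exp (- r * x)"
      using u by (simp add: field_simps)
    then have "ennreal u * (ennreal (r * exp (- r * (u * x))) * ennreal (inverse u * exp (r * (u * x) * (1 - 1 / u)))) =
        ennreal (r * exp (- r * x))"
      using u r by (simp only: ennreal_mult'[symmetric] mult_nonneg_nonneg exp_ge_zero less_imp_le inverse_nonnegative_iff_nonnegative)
    moreover have "indicator {0<..} (u * x) = (indicator {0<..} x :: ennreal)"
      using u by (auto simp: zero_less_mult_iff split: split_indicator)
    moreover have "a * (b * c * (d * e)) = (a * (b * d)) * c * e" for a b c d e :: ennreal by (simp only: mult_ac)
    ultimately show "ennreal u * (ennreal (r * exp (- r * (u * x))) * indicator {0<..} (u * x) *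
      (ennreal (inverse u * exp (r * (u * x) * (1 - 1 / u))) * \<phi> (u * x))) =
      ennreal (r * exp (- r * x)) * indicator {0<..} x * \<phi> (u * x)"
      by (simp only:)
  qed
  also have "\<dots> = (\<integral>\<^sup>+x. \<phi> (u * x) \<partial>expo r)"
    using r by (subst nn_integral_expo) auto
  finally show ?thesis by simp
qed

text \<open>Edge lengths weighted by a function of the order of the edge. Weight 1 gives the total
  length, and \<open>edge_rate\<close> gives the exponent in the joint density of the
  lengths.\<close>

primrec wsum :: "(nat \<Rightarrow> real) \<Rightarrow> posreal ptree \<Rightarrow> real" where
  "wsum w (PLeaf a) = w 1 * real_of_posreal a"
| "wsum w (PNode a l r) = w (porder (PNode a l r)) * real_of_posreal a + wsum w l + wsum w r"

lemma measurable_wsum [measurable]: "wsum w \<in> borel_measurable ptree_space"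
proof (rule measurable_rec_ptree)
  show "(\<lambda>x. wsum w (leaf x)) \<in> borel_measurable borel"
    by (simp add: real_of_posreal_pos)
  have [measurable]: "(\<lambda>(x, s, t, y, z). w (porder (node x s t))) \<in>
    borel_measurable (borel \<Otimes>\<^sub>M ptree_space \<Otimes>\<^sub>M ptree_space \<Otimes>\<^sub>M borel \<Otimes>\<^sub>M borel)"
    unfolding split_beta' by (rule measurable_compose[where N="count_space UNIV"]) measurable
  show "(\<lambda>(x, s, t, y, z). w (porder (node x s t)) * x + y + z) \<in>
    borel_measurable (borel \<Otimes>\<^sub>M ptree_space \<Otimes>\<^sub>M ptree_space \<Otimes>\<^sub>M borel \<Otimes>\<^sub>M borel)"
    by measurable
qed simp

lemma wsum_pos: "(\<And>k. 1 \<le> k \<Longrightarrow> 0 < w k) \<Longrightarrow> 0 < wsum w p"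
  by (induction p) (auto intro!: add_pos_pos mult_pos_pos)

lemma porder_scale [simp]: "porder (scale u p) = porder p"
  by (simp add: scale_def)

lemma plane_shape_scale [simp]: "plane_shape (scale u p) = plane_shape p"
  by (simp add: scale_def ptree.map_comp o_def)

lemma length_dfs_scale [simp]: "length (dfs (scale u p)) = length (dfs p)"
  by (simp add: scale_def)

lemma scale_PNode: "scale u (PNode a s t) = PNode (pos (u * real_of_posreal a)) (scale u s) (scale u t)"
  by (simp add: scale_def)

lemma scale_leaf: "0 < x \<Longrightarrow> scale u (leaf x) = leaf (u * x)"
  by (simp add: scale_def real_of_posreal_pos)

lemma scale_node: "0 < x \<Longrightarrow> scale u (node x s t) = node (u * x) (scale u s) (scale u t)"
  by (simp add: scale_PNode real_of_posreal_pos)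

lemma wsum_scale: "0 < u \<Longrightarrow> wsum w (scale u p) = u * wsum w p"
proof (induction p)
  case (PLeaf a)
  then show ?case by (simp add: scale_def real_of_posreal_pos)
next
  case (PNode a l r)
  then show ?case by (simp add: scale_PNode real_of_posreal_pos distrib_left)
qed

lemma nn_integral_inverse_subst:
  fixes f :: "real \<Rightarrow> ennreal"
  assumes f [measurable]: "f \<in> borel_measurable borel"
  shows "(\<integral>\<^sup>+u. f (1 / u) * ennreal (1 / u\<^sup>2) * indicator {0<..} u \<partial>lborel) = (\<integral>\<^sup>+v. f v * indicator {0<..} v \<partial>lborel)"
proof -
  \<comment> \<open>These intervals are invariant under u -> 1/u and exhaust the positive
    half-line.\<close>
  let ?I = "\<lambda>n. {1 / Suc n..real (Suc n)}"
  have sup: "(\<integral>\<^sup>+v. g v * indicator {0<..} v \<partial>lborel) = (SUP n. \<integral>\<^sup>+v. g v * indicator (?I n) v \<partial>lborel)"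
    if [measurable]: "g \<in> borel_measurable borel" for g :: "real \<Rightarrow> ennreal"
  proof -
    have inc: "incseq (\<lambda>n v. g v * indicator (?I n) v)"
    proof (intro incseq_SucI le_funI mult_left_mono zero_le)
      fix n and v :: real
      have "?I n \<subseteq> ?I (Suc n)" by (auto simp: field_simps intro: order_trans)
      then show "indicator (?I n) v \<le> (indicator (?I (Suc n)) v :: ennreal)" by (auto split: split_indicator)
    qed
    have "(SUP n. g v * indicator (?I n) v) = g v * indicator {0<..} v" for v
    proof (cases "0 < v")
      case False
      then have "v \<notin> ?I n" for n
        using less_le_trans[of 0 "1 / real (Suc n)" v] by auto
      then have "g v * indicator (?I n) v = 0" for n by simp
      then have "(SUP n. g v * indicator (?I n) v) = (SUP n::nat. 0)" by (intro SUP_cong refl)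
      then show ?thesis using False by (simp only: indicator_simps greaterThan_iff not_False_eq_True mult_zero_right) simp
    next
      case True
      obtain n where n: "max v (1 / v) < real n" using reals_Archimedean2 by blast
      then have "v \<in> ?I n" using True by (auto simp: field_simps)
      show ?thesis
      proof (rule antisym)
        show "(SUP n. g v * indicator (?I n) v) \<le> g v * indicator {0<..} v"
          using True by (intro SUP_least) (auto split: split_indicator)
        show "g v * indicator {0<..} v \<le> (SUP n. g v * indicator (?I n) v)"
          using True \<open>v \<in> ?I n\<close> by (intro SUP_upper2[of n]) auto
      qed
    qed
    then have "(\<integral>\<^sup>+v. g v * indicator {0<..} v \<partial>lborel) = (\<integral>\<^sup>+v. (SUP n. g v * indicator (?I n) v) \<partial>lborel)"
      by simp
    also have "\<dots> = (SUP n. \<integral>\<^sup>+v. g v * indicator (?I n) v \<partial>lborel)"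
      using inc by (intro nn_integral_monotone_convergence_SUP) auto
    finally show ?thesis .
  qed
  have "(\<integral>\<^sup>+u. f (1 / u) * ennreal (1 / u\<^sup>2) * indicator (?I n) u \<partial>lborel) = (\<integral>\<^sup>+v. f v * indicator (?I n) v \<partial>lborel)" for n
  proof (cases "n = 0")
    case True
    have z: "(\<integral>\<^sup>+u. g u * indicator {1} u \<partial>lborel) = 0" for g :: "real \<Rightarrow> ennreal"
      using AE_lborel_singleton[of "1::real"] by (intro nn_integral_zero') (auto elim!: AE_mp)
    show ?thesis using True by (simp add: z)
  next
    case False
    \<comment> \<open>Reflection comes first, so that the substituted map - 1 / u is increasing. For
      n = 0 the interval is the single point 1, hence its separate treatment.\<close>
    have "(\<integral>\<^sup>+v. f v * indicator (?I n) v \<partial>lborel) = (\<integral>\<^sup>+y. f (- y) * indicator (?I n) (- y) \<partial>lborel)"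
      by (subst nn_integral_real_affine[where c="-1" and t=0]) simp_all
    also have "\<dots> = (\<integral>\<^sup>+y. f (- y) * indicator {- 1 / (1 / real (Suc n))..- 1 / real (Suc n)} y \<partial>lborel)"
      by (intro nn_integral_cong) (auto split: split_indicator simp: field_simps)
    also have "\<dots> = (\<integral>\<^sup>+u. f (- (- 1 / u)) * ennreal (1 / u\<^sup>2) * indicator (?I n) u \<partial>lborel)"
    proof (rule nn_integral_substitution_aux)
      have pos: "0 < x" if "x \<in> ?I n" for x
        using that less_le_trans[of 0 "1 / real (Suc n)" x] by auto
      show "((\<lambda>u. - 1 / u) has_real_derivative 1 / x\<^sup>2) (at x)" if "x \<in> ?I n" for x
        using pos[OF that] by (auto intro!: derivative_eq_intros simp: power2_eq_square)
      show "continuous_on (?I n) (\<lambda>x. 1 / x\<^sup>2)"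
        by (intro continuous_on_divide continuous_on_const continuous_on_power continuous_on_id ballI)
           (use pos in \<open>metis less_irrefl power_eq_0_iff\<close>)
      show "1 / real (Suc n) < real (Suc n)"
      proof (rule less_trans)
        show "1 < real (Suc n)" using False by simp
        then show "1 / real (Suc n) < 1" by (subst divide_less_eq_1_pos) (simp, simp only:)
      qed
      show "(\<lambda>y. f (- y)) \<in> borel_measurable borel" by measurable
    qed (rule zero_le, rule divide_nonneg_nonneg, simp_all only: zero_le_one zero_le_power2)
    finally show ?thesis by (simp only: minus_divide_left minus_minus)
  qed
  note sub = this
  have "(\<integral>\<^sup>+u. f (1 / u) * ennreal (1 / u\<^sup>2) * indicator {0<..} u \<partial>lborel) =
      (SUP n. \<integral>\<^sup>+u. f (1 / u) * ennreal (1 / u\<^sup>2) * indicator (?I n) u \<partial>lborel)"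
    by (rule sup) measurable
  also have "\<dots> = (SUP n. \<integral>\<^sup>+v. f v * indicator (?I n) v \<partial>lborel)"
    by (simp only: sub)
  also have "\<dots> = (\<integral>\<^sup>+v. f v * indicator {0<..} v \<partial>lborel)"
    by (rule sup[symmetric]) measurable
  finally show ?thesis .
qed

lemma erlang_density_scale:
  "0 < c \<Longrightarrow> erlang_density k (l / c) x = erlang_density k l (x / c) / c"
  by (auto simp: erlang_density_def divide_less_0_iff power_divide)

text \<open>Under v = 1/u the integrand becomes the Erlang density of shape \<open>Suc k\<close> and
  rate r. This total mass is met when the dilation factor is integrated out in
  \<open>nn_integral_dilate\<close>.\<close>

lemma nn_integral_inverse_gamma:
  assumes r: "0 < r"
  shows "(\<integral>\<^sup>+u. ennreal (inverse u ^ Suc k * exp (r * (1 - 1 / u)) * erlang_density k (r / u) u) * indicator {0<..} u \<partial>lborel) = 1"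
proof -
  have "(\<integral>\<^sup>+u. ennreal (inverse u ^ Suc k * exp (r * (1 - 1 / u)) * erlang_density k (r / u) u) * indicator {0<..} u \<partial>lborel) =
      (\<integral>\<^sup>+u. ennreal (erlang_density k r (1 / u)) * ennreal (1 / u\<^sup>2) * indicator {0<..} u \<partial>lborel)"
  proof (rule nn_integral_cong)
    fix u :: real
    show "ennreal (inverse u ^ Suc k * exp (r * (1 - 1 / u)) * erlang_density k (r / u) u) * indicator {0<..} u =
        ennreal (erlang_density k r (1 / u)) * ennreal (1 / u\<^sup>2) * indicator {0<..} u"
    proof (cases "0 < u")
      case True
      have "exp (r * (1 - 1 / u)) * exp (- r) = exp (- (r / u))"
        by (simp add: mult_exp_exp algebra_simps)
      then have e: "exp (r * (1 - 1 / u)) = exp (- (r / u)) * exp r"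
        by (simp add: exp_minus field_simps)
      have "inverse u ^ Suc k * exp (r * (1 - 1 / u)) * erlang_density k (r / u) u = erlang_density k r (1 / u) * (1 / u\<^sup>2)"
        unfolding e using True
        by (simp add: erlang_density_def power_divide power_inverse exp_minus field_simps power2_eq_square)
      then show ?thesis using True r by (simp add: ennreal_mult'[symmetric])
    qed simp
  qed
  also have "\<dots> = (\<integral>\<^sup>+v. ennreal (erlang_density k r v) * indicator {0<..} v \<partial>lborel)"
    by (rule nn_integral_inverse_subst) measurable
  also have "\<dots> = (\<integral>\<^sup>+v. ennreal (erlang_density k r v) \<partial>lborel)"
    by (rule nn_integral_cong_AE, rule AE_mp[OF AE_lborel_singleton[of "0::real"]], rule AE_I2)
       (auto simp: erlang_density_def split: split_indicator)
  also have "\<dots> = 1"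
    using nn_integral_erlang_ith_moment[OF r, of k 0] by simp
  finally show ?thesis .
qed

context hbp
begin

text \<open>Density of the law of the dilated tree with respect to the law of the tree: one factor
  \<open>inverse u * exp (r * x * (1 - 1 / u))\<close> for each edge of length x and rate r.\<close>

definition dilation :: "real \<Rightarrow> posreal ptree \<Rightarrow> ennreal" where
  "dilation u p = ennreal (inverse u ^ length (dfs p) * exp (wsum edge_rate p * (1 - 1 / u)))"

lemma measurable_dilation [measurable]:
  assumes [measurable]: "g \<in> borel_measurable M" "f \<in> measurable M ptree_space"
  shows "(\<lambda>x. dilation (g x) (f x)) \<in> borel_measurable M"
proof -
  have [measurable]: "(\<lambda>x. length (dfs (f x))) \<in> measurable M (count_space UNIV)" by measurable
  have [measurable]: "(\<lambda>x. inverse (g x) ^ length (dfs (f x))) \<in> borel_measurable M"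
    by (rule measurable_compose_countable[of "\<lambda>n x. inverse (g x) ^ n"]) measurable
  show ?thesis unfolding dilation_def by measurable
qed

lemma dilation_node:
  assumes "0 < u" "0 < x"
  shows "dilation u (node x s t) =
    ennreal (inverse u * exp (edge_rate (porder (node x s t)) * x * (1 - 1 / u))) * (dilation u s * dilation u t)"
proof -
  have "inverse u ^ length (dfs (node x s t)) * exp (wsum edge_rate (node x s t) * (1 - 1 / u)) =
      inverse u * exp (edge_rate (porder (node x s t)) * x * (1 - 1 / u)) *
      ((inverse u ^ length (dfs s) * exp (wsum edge_rate s * (1 - 1 / u))) *
       (inverse u ^ length (dfs t) * exp (wsum edge_rate t * (1 - 1 / u))))"
  proof -
    have "wsum edge_rate (node x s t) * c =
        edge_rate (porder (node x s t)) * x * c + (wsum edge_rate s * c + wsum edge_rate t * c)" for c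
      using assms(2) by (simp add: real_of_posreal_pos distrib_right del: porder.simps)
    moreover have "inverse u ^ length (dfs (node x s t)) = inverse u * (inverse u ^ length (dfs s) * inverse u ^ length (dfs t))"
      by (simp add: power_add)
    ultimately show ?thesis by (simp only: exp_add mult_ac)
  qed
  then show ?thesis
    unfolding dilation_def using assms(1) by (simp add: ennreal_mult'[symmetric] del: porder.simps dfs.simps wsum.simps)
qed

text \<open>The kind of event that ends an edge is independent of its length, so the densities of
  the dilated edges multiply along the tree.\<close>

lemma nn_integral_scale:
  assumes u: "0 < u" and j: "1 \<le> j" and f: "f \<in> borel_measurable ptree_space"
  shows "(\<integral>\<^sup>+p. f (scale u p) \<partial>tree_law j) = (\<integral>\<^sup>+p. dilation u p * f p \<partial>tree_law j)"
proof -
  have "(\<integral>\<^sup>+p. f (scale u p) * height_upto n p \<partial>tree_law j) = (\<integral>\<^sup>+p. dilation u p * f p * height_upto n p \<partial>tree_law j)"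
    if "1 \<le> j" "f \<in> borel_measurable ptree_space" for n j f
    using that
  proof (induction n arbitrary: j f)
    case (Suc n)
    note f [measurable] = Suc.prems(2)
    let ?H = "height_upto n"
    let ?c = "\<lambda>x. ennreal (inverse u * exp (edge_rate j * x * (1 - 1 / u)))"
    define P where "P i k y = (\<integral>\<^sup>+s. \<integral>\<^sup>+t. dilation u s * dilation u t * f (node y s t) * (?H s * ?H t) \<partial>tree_law k \<partial>tree_law i)" for i k y
    have [measurable]: "P i k \<in> borel_measurable borel" for i k unfolding P_def by measurable
    have pair: "(\<integral>\<^sup>+s. \<integral>\<^sup>+t. f (node y (scale u s) (scale u t)) * (?H s * ?H t) \<partial>tree_law k \<partial>tree_law i) = P i k y"
      if ik: "1 \<le> i" "1 \<le> k" for i k y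
    proof -
      define \<Psi> where "\<Psi> s = (\<integral>\<^sup>+t. dilation u t * f (node y s t) * ?H t \<partial>tree_law k)" for s
      have [measurable]: "\<Psi> \<in> borel_measurable ptree_space" unfolding \<Psi>_def by measurable
      have "(\<integral>\<^sup>+s. \<integral>\<^sup>+t. f (node y (scale u s) (scale u t)) * (?H s * ?H t) \<partial>tree_law k \<partial>tree_law i) =
          (\<integral>\<^sup>+s. (\<integral>\<^sup>+t. f (node y (scale u s) (scale u t)) * ?H t \<partial>tree_law k) * ?H s \<partial>tree_law i)"
        by (intro nn_integral_cong, subst nn_integral_multc[symmetric]) (auto simp: mult_ac)
      also have "\<dots> = (\<integral>\<^sup>+s. \<Psi> (scale u s) * ?H s \<partial>tree_law i)"
        unfolding \<Psi>_def
      proof (rule nn_integral_cong, rule arg_cong2[where f="(*)", OF _ refl])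
        show "(\<integral>\<^sup>+t. f (node y (scale u s) (scale u t)) * ?H t \<partial>tree_law k) =
            (\<integral>\<^sup>+t. dilation u t * f (node y (scale u s) t) * ?H t \<partial>tree_law k)" for s
          by (rule Suc.IH[OF ik(2)]) measurable
      qed
      also have "\<dots> = (\<integral>\<^sup>+s. dilation u s * \<Psi> s * ?H s \<partial>tree_law i)"
        by (rule Suc.IH[OF ik(1)]) measurable
      also have "\<dots> = P i k y"
        unfolding P_def \<Psi>_def
        by (intro nn_integral_cong, subst nn_integral_cmult[symmetric], measurable, subst nn_integral_multc[symmetric])
           (auto simp: mult_ac)
      finally show ?thesis .
    qed
    define \<phi> where "\<phi> y = (\<Sum>e<j. ennreal (event_prob j e) *
        (if e = 0 then if j = 1 then f (leaf y) else P (j - 1) (j - 1) y else P j e y))" for y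
    have [measurable]: "\<phi> \<in> borel_measurable borel" unfolding \<phi>_def by measurable
    have "(\<integral>\<^sup>+p. f (scale u p) * height_upto (Suc n) p \<partial>tree_law j) = (\<integral>\<^sup>+x. (\<Sum>e<j. ennreal (event_prob j e) *
      (if e = 0 then if j = 1 then f (leaf (u * x)) else \<integral>\<^sup>+s. \<integral>\<^sup>+t. f (node (u * x) (scale u s) (scale u t)) * (?H s * ?H t) \<partial>tree_law (j - 1) \<partial>tree_law (j - 1)
       else \<integral>\<^sup>+s. \<integral>\<^sup>+t. f (node (u * x) (scale u s) (scale u t)) * (?H s * ?H t) \<partial>tree_law e \<partial>tree_law j)) \<partial>expo (edge_rate j))"
      using Suc.prems(1) by (intro nn_integral_tree_law_cong) (simp_all add: scale_leaf scale_node)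
    also have "\<dots> = (\<integral>\<^sup>+x. \<phi> (u * x) \<partial>expo (edge_rate j))"
      unfolding \<phi>_def using Suc.prems(1)
      by (intro nn_integral_cong sum.cong refl) (auto simp: pair)
    also have "\<dots> = (\<integral>\<^sup>+x. ?c x * \<phi> x \<partial>expo (edge_rate j))"
      by (rule nn_integral_expo_scale[OF u edge_rate_pos[OF Suc.prems(1)]]) measurable
    also have "\<dots> = (\<integral>\<^sup>+x. (\<Sum>e<j. ennreal (event_prob j e) *
      (if e = 0 then if j = 1 then ?c x * f (leaf x) else \<integral>\<^sup>+s. \<integral>\<^sup>+t. ?c x * (dilation u s * dilation u t * f (node x s t) * (?H s * ?H t)) \<partial>tree_law (j - 1) \<partial>tree_law (j - 1)
       else \<integral>\<^sup>+s. \<integral>\<^sup>+t. ?c x * (dilation u s * dilation u t * f (node x s t) * (?H s * ?H t)) \<partial>tree_law e \<partial>tree_law j)) \<partial>expo (edge_rate j))"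
      unfolding \<phi>_def sum_distrib_left
    proof (intro nn_integral_cong sum.cong refl)
      fix x e
      have pull: "(\<integral>\<^sup>+s. \<integral>\<^sup>+t. ?c x * (dilation u s * dilation u t * f (node x s t) * (?H s * ?H t)) \<partial>tree_law k \<partial>tree_law i) = ?c x * P i k x" for i k
        unfolding P_def by (simp add: nn_integral_cmult)
      show "?c x * (ennreal (event_prob j e) * (if e = 0 then if j = 1 then f (leaf x) else P (j - 1) (j - 1) x else P j e x)) =
        ennreal (event_prob j e) *
      (if e = 0 then if j = 1 then ?c x * f (leaf x) else \<integral>\<^sup>+s. \<integral>\<^sup>+t. ?c x * (dilation u s * dilation u t * f (node x s t) * (?H s * ?H t)) \<partial>tree_law (j - 1) \<partial>tree_law (j - 1)
       else \<integral>\<^sup>+s. \<integral>\<^sup>+t. ?c x * (dilation u s * dilation u t * f (node x s t) * (?H s * ?H t)) \<partial>tree_law e \<partial>tree_law j)"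
        unfolding pull by (simp add: mult.left_commute)
    qed
    also have "\<dots> = (\<integral>\<^sup>+p. dilation u p * f p * height_upto (Suc n) p \<partial>tree_law j)"
    proof (rule nn_integral_tree_law_cong[symmetric, OF Suc.prems(1)])
      show "dilation u (leaf x) * f (leaf x) * height_upto (Suc n) (leaf x) = ?c x * f (leaf x)" if "0 < x" "j = 1" for x
        using that by (simp add: dilation_def real_of_posreal_pos)
      show "dilation u (node x s t) * f (node x s t) * height_upto (Suc n) (node x s t) =
          ?c x * (dilation u s * dilation u t * f (node x s t) * (?H s * ?H t))"
        if "0 < x" "2 \<le> j" "porder s = j - 1" "porder t = j - 1" for x s t
      proof -
        have "porder (node x s t) = j" using that by auto
        then show ?thesis by (simp only: dilation_node[OF u that(1)] height_upto_simps mult.assoc)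
      qed
      show "dilation u (node x s t) * f (node x s t) * height_upto (Suc n) (node x s t) =
          ?c x * (dilation u s * dilation u t * f (node x s t) * (?H s * ?H t))"
        if "0 < x" "1 \<le> e" "e < j" "porder s = j" "porder t = e" for x e s t
      proof -
        have "porder (node x s t) = j" using that by auto
        then show ?thesis by (simp only: dilation_node[OF u that(1)] height_upto_simps mult.assoc)
      qed
    qed measurable
    finally show ?case .
  qed simp
  then show ?thesis
    using j f by (subst (1 2) nn_integral_height_upto) simp_all
qed

text \<open>Given the directions of the edge-length vector, the total length has a gamma distribution:
  integrate \<open>nn_integral_scale\<close> over the dilation factor.\<close>

lemma nn_integral_dilate:
  assumes j: "1 \<le> j" and f [measurable]: "f \<in> borel_measurable ptree_space"
  shows "(\<integral>\<^sup>+p. f p \<partial>tree_law j) = (\<integral>\<^sup>+p. (\<integral>\<^sup>+u. ennreal (erlang_density (length (dfs p) - 1) (wsum edge_rate p) u) *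
    indicator {0<..} u * f (scale u p) \<partial>lborel) \<partial>tree_law j)"
proof -
  interpret L: pair_sigma_finite "tree_law j" "lborel :: real measure" ..
  let ?r = "wsum edge_rate"
  let ?n = "\<lambda>p :: posreal ptree. length (dfs p) - 1"
  have [measurable]: "(\<lambda>x. erlang_density (?n (F x)) (?r (F x) / G x) (H x)) \<in> borel_measurable M"
    if [measurable]: "F \<in> measurable M ptree_space" "G \<in> borel_measurable M" "H \<in> borel_measurable M"
    for F G H and M :: "'m measure"
    by (rule measurable_compose_countable[of "\<lambda>k x. erlang_density k (?r (F x) / G x) (H x)"])
       (simp_all add: erlang_density_def)
  have [measurable]: "(\<lambda>x. erlang_density (?n (F x)) (?r (F x)) (H x)) \<in> borel_measurable M"
    if [measurable]: "F \<in> measurable M ptree_space" "H \<in> borel_measurable M" for F H and M :: "'m measure"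
    by (rule measurable_compose_countable[of "\<lambda>k x. erlang_density k (?r (F x)) (H x)"])
       (simp_all add: erlang_density_def)
  have "(\<integral>\<^sup>+p. (\<integral>\<^sup>+u. ennreal (erlang_density (?n p) (?r p) u) * indicator {0<..} u * f (scale u p) \<partial>lborel) \<partial>tree_law j) =
      (\<integral>\<^sup>+u. (\<integral>\<^sup>+p. ennreal (erlang_density (?n p) (?r p) u) * indicator {0<..} u * f (scale u p) \<partial>tree_law j) \<partial>lborel)"
    by (rule L.Fubini'[symmetric]) measurable
  also have "\<dots> = (\<integral>\<^sup>+u. (\<integral>\<^sup>+p. dilation u p * ennreal (erlang_density (?n p) (?r p / u) u) * indicator {0<..} u * f p \<partial>tree_law j) \<partial>lborel)"
  proof (rule nn_integral_cong)
    fix u :: real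
    show "(\<integral>\<^sup>+p. ennreal (erlang_density (?n p) (?r p) u) * indicator {0<..} u * f (scale u p) \<partial>tree_law j) =
        (\<integral>\<^sup>+p. dilation u p * ennreal (erlang_density (?n p) (?r p / u) u) * indicator {0<..} u * f p \<partial>tree_law j)"
    proof (cases "0 < u")
      case True
      \<comment> \<open>The Erlang rate has to be read off the dilated tree:
        \<open>wsum edge_rate p\<close> equals
        \<open>wsum edge_rate (scale u p) / u\<close>.\<close>
      have "(\<integral>\<^sup>+p. ennreal (erlang_density (?n (scale u p)) (?r (scale u p) / u) u) * f (scale u p) \<partial>tree_law j) =
        (\<integral>\<^sup>+p. dilation u p * (ennreal (erlang_density (?n p) (?r p / u) u) * f p) \<partial>tree_law j)"
        by (rule nn_integral_scale[OF True j]) measurable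
      then show ?thesis using True by (simp add: wsum_scale mult.assoc)
    qed simp
  qed
  also have "\<dots> = (\<integral>\<^sup>+p. (\<integral>\<^sup>+u. dilation u p * ennreal (erlang_density (?n p) (?r p / u) u) * indicator {0<..} u * f p \<partial>lborel) \<partial>tree_law j)"
    by (rule L.Fubini') measurable
  also have "\<dots> = (\<integral>\<^sup>+p. f p \<partial>tree_law j)"
  proof (intro nn_integral_order_cong[OF j])
    fix p :: "posreal ptree"
    have r: "0 < ?r p" by (rule wsum_pos) (rule edge_rate_pos)
    have n: "length (dfs p) = Suc (?n p)" by (cases p) auto
    have "(\<integral>\<^sup>+u. dilation u p * ennreal (erlang_density (?n p) (?r p / u) u) * indicator {0<..} u * f p \<partial>lborel) =
        (\<integral>\<^sup>+u. ennreal (inverse u ^ Suc (?n p) * exp (?r p * (1 - 1 / u)) * erlang_density (?n p) (?r p / u) u) * indicator {0<..} u * f p \<partial>lborel)"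
      unfolding dilation_def using n r
      by (intro nn_integral_cong) (auto simp: ennreal_mult'[symmetric] split: split_indicator)
    also have "\<dots> = f p"
    proof (subst nn_integral_multc)
      show "(\<lambda>u. ennreal (inverse u ^ Suc (?n p) * exp (?r p * (1 - 1 / u)) * erlang_density (?n p) (?r p / u) u) *
          indicator {0<..} u) \<in> borel_measurable lborel"
        unfolding erlang_density_def by measurable
    qed (use nn_integral_inverse_gamma[OF r, of "?n p"] in simp)
    finally show "(\<integral>\<^sup>+u. dilation u p * ennreal (erlang_density (?n p) (?r p / u) u) * indicator {0<..} u * f p \<partial>lborel) = f p" .
  qed
  finally show ?thesis by simp
qed

end

section \<open>Total length and proportions under dilation\<close>

primrec dfs_orders :: "'a ptree \<Rightarrow> nat list" where
  "dfs_orders (PLeaf a) = [1]"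
| "dfs_orders (PNode a l r) = porder (PNode a l r) # dfs_orders l @ dfs_orders r"

lemma dfs_orders_map_ptree: "dfs_orders (map_ptree f p) = dfs_orders p"
  by (induction p) auto

lemma length_dfs_orders [simp]: "length (dfs_orders p) = length (dfs p)"
  by (induction p) auto

lemma wsum_eq_sum:
  "wsum w p = (\<Sum>i<length (dfs p). w (dfs_orders p ! i) * dfs_lengths p ! i)"
proof -
  have "wsum w p = sum_list (map2 (\<lambda>k x. w k * x) (dfs_orders p) (dfs_lengths p))"
    by (induction p) auto
  then show ?thesis by (simp add: sum_list_sum_nth atLeast0LessThan)
qed

lemma porder_embed_forget [simp]: "porder (embed (forget p)) = porder p"
  using uorder_forget[of "embed (forget p)"] by simp

text \<open>The embedding only permutes siblings, and the order of a vertex is symmetric in its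
  children.\<close>

lemma wsum_embed: "wsum w (embed (forget p)) = wsum w p"
proof (induction p)
  case (PNode a l r)
  have "porder r = porder l" if "embed (forget r) = embed (forget l)"
    using that by (metis porder_embed_forget)
  then show ?case
    by (subst embed_forget_PNode) (auto simp: PNode max.commute)
qed simp

lemma goes_right_scale:
  assumes "0 < u"
  shows "goes_right (scale u q) (scale u p) \<longleftrightarrow> goes_right q p"
  unfolding goes_right_iff using assms by (simp add: pad_scale ushape_forget)

lemma scale_inject:
  assumes "0 < u" "scale u q = scale u p"
  shows "q = p"
proof -
  have "plane_shape q = plane_shape p" by (metis assms(2) plane_shape_scale)
  moreover have "pad (dfs_lengths q) i = pad (dfs_lengths p) i" for i
    using pad_scale[OF assms(1), of q i] pad_scale[OF assms(1), of p i] assms by simp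
  ultimately show ?thesis unfolding ptree_eq_iff_pad by simp
qed

text \<open>Comparing siblings by shape ignores dilation, and comparing lengths lexicographically is
  invariant under a common positive factor. Hence dilation leaves the labelling, and so the
  proportions, unchanged.\<close>

lemma embed_scale: "0 < u \<Longrightarrow> embed (forget (scale u p)) = scale u (embed (forget p))"
proof (induction p)
  case (PLeaf a)
  then show ?case by (simp add: scale_def)
next
  case (PNode a l r)
  have IH: "embed (forget (scale u l)) = scale u (embed (forget l))" "embed (forget (scale u r)) = scale u (embed (forget r))"
    using PNode by auto
  have "(scale u (embed (forget r)) = scale u (embed (forget l))) = (embed (forget r) = embed (forget l))"
    using scale_inject[OF PNode.prems] by auto
  then show ?case
    unfolding scale_PNode by (subst (1 2) embed_forget_PNode) (simp add: IH goes_right_scale[OF PNode.prems] scale_PNode)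
qed

abbreviation tree_of :: "posreal ptree \<Rightarrow> ltree" where
  "tree_of p \<equiv> Some (forget p)"

lemma edge_lengths_scale: "0 < u \<Longrightarrow> edge_lengths (tree_of (scale u p)) = map (\<lambda>x. u * x) (edge_lengths (tree_of p))"
  unfolding edge_lengths_Some by (subst embed_scale, assumption) (auto simp: scale_def dfs_map_ptree real_of_posreal_pos)

lemma tree_length_scale: "0 < u \<Longrightarrow> tree_length (tree_of (scale u p)) = u * tree_length (tree_of p)"
  by (simp add: tree_length_def edge_lengths_scale sum_list_const_mult)

lemma proportions_scale: "0 < u \<Longrightarrow> proportions (tree_of (scale u p)) = proportions (tree_of p)"
  by (simp add: proportions_def edge_lengths_scale tree_length_scale)

lemma shape_tree_of: "shape (tree_of p) = Some (ushape (forget p))"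
  by (simp add: shape_def)

lemma tree_length_tree_of: "tree_length (tree_of p) = wsum (\<lambda>_. 1) p"
proof -
  have "tree_length (tree_of p) = wsum (\<lambda>_. 1) (embed (forget p))"
    by (simp add: tree_length_eq edge_lengths_Some wsum_eq_sum pad_def)
  then show ?thesis by (simp add: wsum_embed)
qed

lemma tree_length_pos: "0 < tree_length (tree_of p)"
  unfolding tree_length_tree_of by (rule wsum_pos) simp

text \<open>The order of the i-th labelled edge is a function of the shape, because the planar shape
  of the embedding is. This lets the conditional density be written in terms of proportions
  alone.\<close>

definition order_list :: "unit utree \<Rightarrow> nat list" where
  "order_list \<tau> = dfs_orders (embed_shape \<tau>)"

lemma dfs_orders_embed: "dfs_orders (embed s) = order_list (ushape s)"
  unfolding order_list_def plane_shape_embed[symmetric] by (simp add: dfs_orders_map_ptree)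

lemma length_order_list:
  fixes p :: "posreal ptree"
  shows "ushape (forget p) = \<tau> \<Longrightarrow> length (order_list \<tau>) = length (dfs p)"
  using dfs_orders_embed[of "forget p"] length_dfs_orders[of "embed (forget p)"]
  by (metis forget_embed vertices_forget)

lemma wsum_proportions:
  assumes "ushape (forget p) = \<tau>"
  shows "(\<Sum>i<length (order_list \<tau>). w (order_list \<tau> ! i) * pad (proportions (tree_of p)) i) = wsum w p / tree_length (tree_of p)"
proof -
  let ?e = "embed (forget p)"
  have o: "order_list \<tau> = dfs_orders ?e" by (simp add: dfs_orders_embed assms)
  have "wsum w p = (\<Sum>i<length (order_list \<tau>). w (order_list \<tau> ! i) * dfs_lengths ?e ! i)"
    using wsum_embed[of w p] wsum_eq_sum[of w ?e] by (simp add: o)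
  then show ?thesis
    by (simp add: sum_divide_distrib o pad_def proportions_def edge_lengths_Some)
qed

text \<open>The density at \<open>l\<close> of the total length, given the proportions \<open>x\<close> of a tree of shape \<open>\<tau>\<close>, when edges
  of order \<open>k\<close> are exponential with rate \<open>w k\<close>; the absolute value makes it a density for all \<open>x\<close>.\<close>

definition gamma_length :: "(nat \<Rightarrow> real) \<Rightarrow> unit utree \<Rightarrow> (nat \<Rightarrow> real) \<Rightarrow> real \<Rightarrow> real" where
  "gamma_length w \<tau> x l = erlang_density (length (order_list \<tau>) - 1)
     \<bar>\<Sum>i<length (order_list \<tau>). w (order_list \<tau> ! i) * x i\<bar> l"

lemma gamma_length_nonneg: "0 \<le> gamma_length w \<tau> x l"
  by (simp add: gamma_length_def)

lemma measurable_gamma_length: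
  "(\<lambda>(x, l). gamma_length w \<tau> x l) \<in> borel_measurable (vec_space \<Otimes>\<^sub>M lborel)"
proof -
  have c [measurable]: "(\<lambda>x. x i) \<in> borel_measurable vec_space" for i
    by (rule measurable_component_singleton) simp
  have [measurable]: "(\<lambda>x. \<Sum>i<length (order_list \<tau>). w (order_list \<tau> ! i) * x i) \<in> borel_measurable vec_space"
    by (intro borel_measurable_sum borel_measurable_times borel_measurable_const c)
  show ?thesis
    unfolding gamma_length_def erlang_density_def split_beta' by measurable
qed

lemma gamma_length_scale:
  assumes "0 < c"
  shows "gamma_length (\<lambda>k. w k / c) \<tau> x l = inverse c * gamma_length w \<tau> x (l / c)"
proof -
  have "(\<Sum>i<length (order_list \<tau>). w (order_list \<tau> ! i) / c * x i) = (\<Sum>i<length (order_list \<tau>). w (order_list \<tau> ! i) * x i) / c"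
    unfolding sum_divide_distrib by (intro sum.cong) auto
  then show ?thesis
    unfolding gamma_length_def
    by (simp only: abs_divide abs_of_pos[OF assms] erlang_density_scale[OF assms]) (simp add: divide_inverse mult.commute)
qed

lemma erlang_density_rescale:
  assumes "0 < c"
  shows "c * erlang_density k (r / c) (c * x) = erlang_density k r x"
  using assms erlang_density_scale[of c k r "c * x"] by simp

context hbp
begin

text \<open>Dilating a tree of length L by u keeps shape and proportions and gives the length L u.
  With l = L u, the Erlang density of u becomes that of l with rate
  \<open>wsum edge_rate p / L\<close>, a function of the proportions by
  \<open>wsum_proportions\<close>.\<close>

lemma nn_integral_gamma_length:
  assumes j: "1 \<le> j" and \<phi>: "(\<lambda>(x, l). \<phi> x l) \<in> borel_measurable (vec_space \<Otimes>\<^sub>M lborel)"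
  shows "(\<integral>\<^sup>+p. indicator {p. ushape (forget p) = \<tau>} p * \<phi> (pad (proportions (tree_of p))) (tree_length (tree_of p)) \<partial>tree_law j) =
    (\<integral>\<^sup>+p. indicator {p. ushape (forget p) = \<tau>} p *
      (\<integral>\<^sup>+l. ennreal (gamma_length edge_rate \<tau> (pad (proportions (tree_of p))) l) * \<phi> (pad (proportions (tree_of p))) l \<partial>lborel) \<partial>tree_law j)"
proof -
  let ?I = "indicator {p. ushape (forget p) = \<tau>} :: posreal ptree \<Rightarrow> ennreal"
  let ?x = "\<lambda>p. pad (proportions (tree_of p))" and ?L = "\<lambda>p. tree_length (tree_of p)"
  have [measurable]: "{p. ushape (forget p) = \<tau>} \<in> sets ptree_space"
    using measurable_sets[OF measurable_ushape_forget, of "{\<tau>}"] by (simp add: vimage_def)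
  have [measurable]: "(\<lambda>p. \<phi> (?x p) (?L p)) \<in> borel_measurable ptree_space"
  proof -
    have "(\<lambda>p. (?x p, ?L p)) \<in> measurable ptree_space (vec_space \<Otimes>\<^sub>M lborel)" by measurable
    from measurable_compose[OF this \<phi>] show ?thesis by simp
  qed
  have \<phi>x [measurable]: "\<phi> x \<in> borel_measurable borel" for x
  proof -
    have "(\<lambda>l. (x, l)) \<in> measurable borel (vec_space \<Otimes>\<^sub>M lborel)"
      by (intro measurable_Pair measurable_const) (auto simp: space_PiM)
    from measurable_compose[OF this \<phi>] show ?thesis by simp
  qed
  have \<gamma>x [measurable]: "gamma_length w \<tau> x \<in> borel_measurable borel" for w x
    unfolding gamma_length_def by simp
  have "(\<integral>\<^sup>+p. ?I p * \<phi> (?x p) (?L p) \<partial>tree_law j) =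
      (\<integral>\<^sup>+p. (\<integral>\<^sup>+u. ennreal (erlang_density (length (dfs p) - 1) (wsum edge_rate p) u) * indicator {0<..} u *
        (?I (scale u p) * \<phi> (?x (scale u p)) (?L (scale u p))) \<partial>lborel) \<partial>tree_law j)"
    by (rule nn_integral_dilate[OF j]) measurable
  also have "\<dots> = (\<integral>\<^sup>+p. ?I p * (\<integral>\<^sup>+l. ennreal (gamma_length edge_rate \<tau> (?x p) l) * \<phi> (?x p) l \<partial>lborel) \<partial>tree_law j)"
  proof (rule nn_integral_cong)
    fix p
    show "(\<integral>\<^sup>+u. ennreal (erlang_density (length (dfs p) - 1) (wsum edge_rate p) u) * indicator {0<..} u *
        (?I (scale u p) * \<phi> (?x (scale u p)) (?L (scale u p))) \<partial>lborel) =
      ?I p * (\<integral>\<^sup>+l. ennreal (gamma_length edge_rate \<tau> (?x p) l) * \<phi> (?x p) l \<partial>lborel)"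
    proof (cases "ushape (forget p) = \<tau>")
      case False
      then have "?I (scale u p) = 0" for u by (simp add: ushape_forget)
      then show ?thesis using False by simp
    next
      case True
      have L: "0 < ?L p" by (rule tree_length_pos)
      have r: "0 < wsum edge_rate p" by (rule wsum_pos) (rule edge_rate_pos)
      have g: "gamma_length edge_rate \<tau> (?x p) l = erlang_density (length (dfs p) - 1) (wsum edge_rate p / ?L p) l" for l
        unfolding gamma_length_def wsum_proportions[OF True, of edge_rate] unfolding length_order_list[OF True]
        using L r by simp
      have "(\<integral>\<^sup>+l. ennreal (gamma_length edge_rate \<tau> (?x p) l) * \<phi> (?x p) l \<partial>lborel) =
          ennreal (?L p) * (\<integral>\<^sup>+u. ennreal (gamma_length edge_rate \<tau> (?x p) (?L p * u)) * \<phi> (?x p) (?L p * u) \<partial>lborel)"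
        by (subst nn_integral_real_affine[where c="?L p" and t=0]) (use L in simp_all)
      also have "\<dots> = (\<integral>\<^sup>+u. ennreal (?L p) * (ennreal (gamma_length edge_rate \<tau> (?x p) (?L p * u)) * \<phi> (?x p) (?L p * u)) \<partial>lborel)"
        by (rule nn_integral_cmult[symmetric]) measurable
      also have "\<dots> = (\<integral>\<^sup>+u. ennreal (erlang_density (length (dfs p) - 1) (wsum edge_rate p) u) * indicator {0<..} u *
        (?I (scale u p) * \<phi> (?x (scale u p)) (?L (scale u p))) \<partial>lborel)"
      proof (rule nn_integral_cong_AE, rule AE_mp[OF AE_lborel_singleton[of "0::real"]], rule AE_I2, rule impI)
        fix u :: real assume u: "u \<noteq> 0"
        have e: "ennreal (?L p) * ennreal (gamma_length edge_rate \<tau> (?x p) (?L p * u)) =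
            ennreal (erlang_density (length (dfs p) - 1) (wsum edge_rate p) u)"
          unfolding g using L r erlang_density_rescale[OF L, of "length (dfs p) - 1" "wsum edge_rate p" u]
          by (simp add: ennreal_mult[symmetric])
        show "ennreal (?L p) * (ennreal (gamma_length edge_rate \<tau> (?x p) (?L p * u)) * \<phi> (?x p) (?L p * u)) =
          ennreal (erlang_density (length (dfs p) - 1) (wsum edge_rate p) u) * indicator {0<..} u *
            (?I (scale u p) * \<phi> (?x (scale u p)) (?L (scale u p)))"
        proof (cases "0 < u")
          case True
          have "?I (scale u p) = 1" using \<open>ushape (forget p) = \<tau>\<close> by (simp add: ushape_forget)
          then show ?thesis
            using True unfolding mult.assoc[symmetric] e
            by (simp add: proportions_scale tree_length_scale mult.commute)
        next
          case False
          then have "erlang_density (length (dfs p) - 1) (wsum edge_rate p) u = 0"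
            using u by (simp add: erlang_density_def)
          with e False show ?thesis unfolding mult.assoc[symmetric] e by simp
        qed
      qed
      finally show ?thesis using True by simp
    qed
  qed
  finally show ?thesis .
qed

end

section \<open>The law of the shape\<close>

primrec perfect :: "nat \<Rightarrow> unit ptree" where
  "perfect 0 = PLeaf ()"
| "perfect (Suc n) = PNode () (perfect n) (perfect n)"

lemma porder_perfect [simp]: "porder (perfect n) = Suc n"
  by (induction n) auto

text \<open>Equal children leave no choice at any node; probabilities of perfect shapes can
  therefore be computed without summing over embeddings.\<close>

lemma forget_eq_perfect: "forget d = forget (perfect n) \<longleftrightarrow> d = perfect n"
proof
  show "d = perfect n" if "forget d = forget (perfect n)"
    using that
  proof (induction n arbitrary: d)
    case 0
    then show ?case by (cases d) auto
  next
    case (Suc n)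
    then show ?case by (cases d) auto
  qed
qed simp

context hbp
begin

text \<open>The law of the planar shape, written with \<open>event_prob\<close> alone. As
  \<open>lam\<close> does not occur, changing the rates keeps the law of the shape.\<close>

primrec shape_prob :: "unit ptree \<Rightarrow> nat \<Rightarrow> ennreal" where
  "shape_prob (PLeaf a) = (\<lambda>j. if j = 1 then 1 else 0)"
| "shape_prob (PNode a l r) = (\<lambda>j. \<Sum>e<j. ennreal (event_prob j e) *
     (if e = 0 then if j = 1 then 0 else shape_prob l (j - 1) * shape_prob r (j - 1)
      else shape_prob l j * shape_prob r e))"

lemma emeasure_expo_UNIV: "1 \<le> j \<Longrightarrow> emeasure (expo (edge_rate j)) UNIV = 1"
  using prob_space.emeasure_space_1[OF prob_space_expo[OF edge_rate_pos[of j]]] by simp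

lemma emeasure_plane_shape:
  "1 \<le> j \<Longrightarrow> emeasure (tree_law j) {p. plane_shape p = d} = shape_prob d j"
proof (induction d arbitrary: j)
  have sets [measurable]: "{p. plane_shape p = d} \<in> sets ptree_space" for d
    using measurable_sets[OF measurable_plane_shape, of "{d}"] by (simp add: vimage_def)
  have I: "emeasure (tree_law j) {p. plane_shape p = d} = (\<integral>\<^sup>+p. indicator {p. plane_shape p = d} p \<partial>tree_law j)" for d j
    by simp
  {
    case (PLeaf a)
    have ep: "event_prob 1 0 = 1" by (simp add: event_prob_def total_def)
    have "emeasure (tree_law j) {p. plane_shape p = PLeaf a} = (\<integral>\<^sup>+x. (\<Sum>e<j. ennreal (event_prob j e) *
      (if e = 0 then if j = 1 then 1 else \<integral>\<^sup>+s. \<integral>\<^sup>+t. 0 \<partial>tree_law (j - 1) \<partial>tree_law (j - 1)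
       else \<integral>\<^sup>+s. \<integral>\<^sup>+t. 0 \<partial>tree_law e \<partial>tree_law j)) \<partial>expo (edge_rate j))"
      unfolding I by (rule nn_integral_tree_law_cong[OF PLeaf]) auto
    also have "\<dots> = (if j = 1 then 1 else 0)"
      using emeasure_expo_UNIV[OF PLeaf] ep by (auto intro!: sum.neutral cong: if_cong)
    finally show ?case by simp
  next
    case (PNode a l r)
    have pair: "(\<integral>\<^sup>+s. \<integral>\<^sup>+t. indicator {p. plane_shape p = l} s * indicator {p. plane_shape p = r} t \<partial>tree_law k \<partial>tree_law i) =
        shape_prob l i * shape_prob r k" if "1 \<le> i" "1 \<le> k" for i k
      using PNode.IH that by (simp add: nn_integral_cmult nn_integral_multc)
    have "emeasure (tree_law j) {p. plane_shape p = PNode a l r} = (\<integral>\<^sup>+x. (\<Sum>e<j. ennreal (event_prob j e) *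
      (if e = 0 then if j = 1 then 0 else
        \<integral>\<^sup>+s. \<integral>\<^sup>+t. indicator {p. plane_shape p = l} s * indicator {p. plane_shape p = r} t \<partial>tree_law (j - 1) \<partial>tree_law (j - 1)
       else \<integral>\<^sup>+s. \<integral>\<^sup>+t. indicator {p. plane_shape p = l} s * indicator {p. plane_shape p = r} t \<partial>tree_law e \<partial>tree_law j)) \<partial>expo (edge_rate j))"
      unfolding I by (rule nn_integral_tree_law_cong[OF PNode.prems]) (auto split: split_indicator)
    also have "\<dots> = (\<integral>\<^sup>+x. shape_prob (PNode a l r) j \<partial>expo (edge_rate j))"
      using PNode.prems by (intro nn_integral_cong) (auto simp: pair intro!: sum.cong)
    also have "\<dots> = shape_prob (PNode a l r) j"
      using emeasure_expo_UNIV[OF PNode.prems] by simp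
    finally show ?case .
  }
qed

text \<open>Applied with the rates \<open>lam (Suc j)\<close> of the pruned process, whose shapes
  thus have the law of the original ones.\<close>

lemma tree_law_shape_cong:
  assumes "hbp Tk lam'" and j: "1 \<le> j" and f: "\<And>p. f p = f (map_ptree (\<lambda>_. pos 1) (plane_shape p))"
  shows "(\<integral>\<^sup>+p. f p \<partial>hbp.tree_law Tk lam' j) = (\<integral>\<^sup>+p. f p \<partial>tree_law j)"
proof -
  interpret S: hbp Tk lam' by fact
  let ?f = "\<lambda>d. f (map_ptree (\<lambda>_. pos 1) d)"
  have "distr (S.tree_law j) (count_space UNIV) plane_shape = distr (tree_law j) (count_space UNIV) plane_shape"
  proof (rule measure_eqI_countable[of _ UNIV])
    show "emeasure (distr (S.tree_law j) (count_space UNIV) plane_shape) {d} = emeasure (distr (tree_law j) (count_space UNIV) plane_shape) {d}" for d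
      using S.emeasure_plane_shape[OF j, of d] emeasure_plane_shape[OF j, of d]
      by (simp add: emeasure_distr vimage_def)
  qed auto
  moreover have "(\<integral>\<^sup>+p. f p \<partial>S.tree_law j) = (\<integral>\<^sup>+d. ?f d \<partial>distr (S.tree_law j) (count_space UNIV) plane_shape)"
    by (subst nn_integral_distr) (auto simp flip: f)
  moreover have "(\<integral>\<^sup>+p. f p \<partial>tree_law j) = (\<integral>\<^sup>+d. ?f d \<partial>distr (tree_law j) (count_space UNIV) plane_shape)"
    by (subst nn_integral_distr) (auto simp flip: f)
  ultimately show ?thesis by simp
qed

text \<open>Mean total length given that the shape is perfect of order n + 1: the mean of the top
  edge plus two copies of the smaller tree. Conditioning leaves the edge exponential because events
  and waiting times are independent.\<close>

primrec perfect_length :: "nat \<Rightarrow> real" where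
  "perfect_length 0 = 1 / edge_rate 1"
| "perfect_length (Suc n) = 1 / edge_rate (Suc (Suc n)) + 2 * perfect_length n"

lemma perfect_length_nonneg: "0 \<le> perfect_length n"
proof (induction n)
  case 0
  show ?case using edge_rate_pos[of 1] by (simp only: perfect_length.simps) (intro divide_nonneg_pos, simp_all)
next
  case (Suc n)
  then show ?case using edge_rate_pos[of "Suc (Suc n)"]
    by (simp only: perfect_length.simps) (intro add_nonneg_nonneg divide_nonneg_pos mult_nonneg_nonneg, simp_all)
qed

lemma nn_integral_expo_id: "0 < r \<Longrightarrow> (\<integral>\<^sup>+x. ennreal x \<partial>expo r) = ennreal (1 / r)"
  using nn_integral_erlang_ith_moment[of r 0 1]
  by (subst nn_integral_density) (auto simp: ennreal_mult'[symmetric] divide_ennreal[symmetric])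

text \<open>Probability and unnormalised mean length are computed side by side; births contribute
  nothing, since a perfect tree has no side branches. Positivity of a permits the later division
  that gives the conditional mean.\<close>

lemma perfect_tree:
  "\<exists>a>0. (\<integral>\<^sup>+p. indicator {p. plane_shape p = perfect n} p \<partial>tree_law (Suc n)) = ennreal a \<and>
    (\<integral>\<^sup>+p. indicator {p. plane_shape p = perfect n} p * ennreal (wsum (\<lambda>_. 1) p) \<partial>tree_law (Suc n)) = ennreal (a * perfect_length n)"
proof (induction n)
  have sets [measurable]: "{p. plane_shape p = d} \<in> sets ptree_space" for d
    using measurable_sets[OF measurable_plane_shape, of "{d}"] by (simp add: vimage_def)
  {
    case 0
    have ep: "event_prob 1 0 = 1" by (simp add: event_prob_def total_def)
    have "(\<integral>\<^sup>+p. indicator {p. plane_shape p = perfect 0} p \<partial>tree_law 1) = 1"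
      using emeasure_plane_shape[of 1 "PLeaf ()"] by simp
    moreover have "(\<integral>\<^sup>+p. indicator {p. plane_shape p = perfect 0} p * ennreal (wsum (\<lambda>_. 1) p) \<partial>tree_law 1) =
        (\<integral>\<^sup>+x. (\<Sum>e<1. ennreal (event_prob 1 e) *
      (if e = 0 then if (1::nat) = 1 then ennreal x else \<integral>\<^sup>+s. \<integral>\<^sup>+t. 0 \<partial>tree_law (1 - 1) \<partial>tree_law (1 - 1)
       else \<integral>\<^sup>+s. \<integral>\<^sup>+t. 0 \<partial>tree_law e \<partial>tree_law 1)) \<partial>expo (edge_rate 1))"
      by (rule nn_integral_tree_law_cong) (auto simp: real_of_posreal_pos)
    moreover have "\<dots> = ennreal (1 / edge_rate 1)"
      using ep nn_integral_expo_id[OF edge_rate_pos[of 1]] by simp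
    ultimately show ?case by (intro exI[of _ 1]) simp
  next
    case (Suc n)
    let ?j = "Suc (Suc n)"
    let ?I = "indicator {p. plane_shape p = perfect n} :: posreal ptree \<Rightarrow> ennreal"
    let ?w = "wsum (\<lambda>_. 1)"
    from Suc obtain a where a: "0 < a" "(\<integral>\<^sup>+p. ?I p \<partial>tree_law (Suc n)) = ennreal a"
      "(\<integral>\<^sup>+p. ?I p * ennreal (?w p) \<partial>tree_law (Suc n)) = ennreal (a * perfect_length n)" by blast
    have w0: "0 \<le> ?w p" for p using wsum_pos[of "\<lambda>_. 1" p] by simp
    define b where "b = event_prob ?j 0 * a * a"
    have b: "0 < b" using a(1) by (simp add: b_def event_prob_def)
    have split: "?I s * ?I t = indicator {p. plane_shape p = perfect (Suc n)} (node x s t)" for x s t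
      by (auto split: split_indicator)
    have off: "indicator {p. plane_shape p = perfect (Suc n)} (node x s t) = (0 :: ennreal)"
      if "porder s = ?j" for x s t
      using that porder_cong[of s "perfect n"] by (auto split: split_indicator simp del: porder_map_ptree dest: arg_cong[of _ _ porder])
    have "(\<integral>\<^sup>+p. indicator {p. plane_shape p = perfect (Suc n)} p \<partial>tree_law ?j) =
       (\<integral>\<^sup>+x. (\<Sum>e<?j. ennreal (event_prob ?j e) *
      (if e = 0 then if ?j = 1 then 0 else \<integral>\<^sup>+s. \<integral>\<^sup>+t. ?I s * ?I t \<partial>tree_law (?j - 1) \<partial>tree_law (?j - 1)
       else \<integral>\<^sup>+s. \<integral>\<^sup>+t. 0 \<partial>tree_law e \<partial>tree_law ?j)) \<partial>expo (edge_rate ?j))"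
    proof (rule nn_integral_tree_law_cong)
      show "indicator {p. plane_shape p = perfect (Suc n)} (node x s t) = ?I s * ?I t" for x s t
        by (rule split[symmetric])
    qed (use off in auto)
    also have "\<dots> = ennreal b"
    proof -
      have "(\<integral>\<^sup>+s. \<integral>\<^sup>+t. ?I s * ?I t \<partial>tree_law (Suc n) \<partial>tree_law (Suc n)) = ennreal a * ennreal a"
        by (simp add: nn_integral_cmult nn_integral_multc a(2)[simplified])
      then show ?thesis
        using a(1) emeasure_expo_UNIV[of ?j] event_prob_nonneg[of 0 ?j]
        by (simp add: sum.lessThan_Suc_shift b_def ennreal_mult mult.assoc del: sum.lessThan_Suc nn_integral_indicator)
    qed
    finally have 1: "(\<integral>\<^sup>+p. indicator {p. plane_shape p = perfect (Suc n)} p \<partial>tree_law ?j) = ennreal b" .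
    have "(\<integral>\<^sup>+p. indicator {p. plane_shape p = perfect (Suc n)} p * ennreal (?w p) \<partial>tree_law ?j) =
       (\<integral>\<^sup>+x. (\<Sum>e<?j. ennreal (event_prob ?j e) *
      (if e = 0 then if ?j = 1 then 0 else \<integral>\<^sup>+s. \<integral>\<^sup>+t. ?I s * ?I t * (ennreal x + ennreal (?w s) + ennreal (?w t)) \<partial>tree_law (?j - 1) \<partial>tree_law (?j - 1)
       else \<integral>\<^sup>+s. \<integral>\<^sup>+t. 0 \<partial>tree_law e \<partial>tree_law ?j)) \<partial>expo (edge_rate ?j))"
    proof (rule nn_integral_tree_law_cong)
      show "indicator {p. plane_shape p = perfect (Suc n)} (node x s t) * ennreal (?w (node x s t)) =
          ?I s * ?I t * (ennreal x + ennreal (?w s) + ennreal (?w t))" if "0 < x" for x s t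
      proof -
        have "ennreal (?w (node x s t)) = ennreal x + ennreal (?w s) + ennreal (?w t)"
          using that w0[of s] w0[of t] by (simp add: real_of_posreal_pos)
        then show ?thesis by (simp only: split[symmetric])
      qed
      show "indicator {p. plane_shape p = perfect (Suc n)} (node x s t) * ennreal (?w (node x s t)) = 0" if "porder s = ?j" for x s t
        by (simp only: off[OF that] mult_zero_left)
    qed auto
    also have "\<dots> = (\<integral>\<^sup>+x. ennreal b * ennreal x + ennreal (b * (2 * perfect_length n)) \<partial>expo (edge_rate ?j))"
    proof (rule nn_integral_cong)
      fix x :: real
      have "(\<integral>\<^sup>+s. \<integral>\<^sup>+t. ?I s * ?I t * (ennreal x + ennreal (?w s) + ennreal (?w t)) \<partial>tree_law (Suc n) \<partial>tree_law (Suc n)) =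
          (\<integral>\<^sup>+s. \<integral>\<^sup>+t. ennreal x * (?I s * ?I t) + (?I s * ennreal (?w s)) * ?I t + ?I s * (?I t * ennreal (?w t)) \<partial>tree_law (Suc n) \<partial>tree_law (Suc n))"
      proof -
        have "a * b * (x + y + z) = x * (a * b) + (a * y) * b + a * (b * z)" for a b x y z :: ennreal
          by (simp only: distrib_left mult_ac)
        then show ?thesis by (simp only:)
      qed
      also have "\<dots> = ennreal x * (ennreal a * ennreal a) + ennreal (a * perfect_length n) * ennreal a + ennreal a * ennreal (a * perfect_length n)"
        by (simp add: nn_integral_add nn_integral_cmult nn_integral_multc a(3) a(2)[simplified])
      finally have e: "(\<integral>\<^sup>+s. \<integral>\<^sup>+t. ?I s * ?I t * (ennreal x + ennreal (?w s) + ennreal (?w t)) \<partial>tree_law (Suc n) \<partial>tree_law (Suc n)) = \<dots>" .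
      have "ennreal (event_prob ?j 0) * (ennreal x * (ennreal a * ennreal a) + ennreal (a * perfect_length n) * ennreal a + ennreal a * ennreal (a * perfect_length n)) =
          ennreal b * ennreal x + ennreal (b * (2 * perfect_length n))"
      proof -
        have "ennreal b = ennreal (event_prob ?j 0) * (ennreal a * ennreal a)"
          using a(1) event_prob_nonneg[of 0 ?j] by (simp add: b_def ennreal_mult mult.assoc)
        moreover have "ennreal (b * (2 * perfect_length n)) = ennreal b * (ennreal (perfect_length n) + ennreal (perfect_length n))"
          using b perfect_length_nonneg[of n] ennreal_plus[OF perfect_length_nonneg[of n] perfect_length_nonneg[of n]]
          by (simp only: ennreal_mult less_imp_le mult_2 add_nonneg_nonneg)
        moreover have "ennreal (a * perfect_length n) = ennreal a * ennreal (perfect_length n)"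
          using a(1) perfect_length_nonneg[of n] by (intro ennreal_mult) auto
        ultimately show ?thesis by (simp only: distrib_left add.assoc mult_ac)
      qed
      then show "(\<Sum>e<?j. ennreal (event_prob ?j e) *
      (if e = 0 then if ?j = 1 then 0 else \<integral>\<^sup>+s. \<integral>\<^sup>+t. ?I s * ?I t * (ennreal x + ennreal (?w s) + ennreal (?w t)) \<partial>tree_law (?j - 1) \<partial>tree_law (?j - 1)
       else \<integral>\<^sup>+s. \<integral>\<^sup>+t. 0 \<partial>tree_law e \<partial>tree_law ?j)) = ennreal b * ennreal x + ennreal (b * (2 * perfect_length n))"
        using e by (simp only: sum.lessThan_Suc_shift) simp
    qed
    also have "\<dots> = ennreal (b * perfect_length (Suc n))"
    proof -
      have R: "0 < edge_rate ?j" by (rule edge_rate_pos) simp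
      have "(\<integral>\<^sup>+x. ennreal b * ennreal x + ennreal (b * (2 * perfect_length n)) \<partial>expo (edge_rate ?j)) =
          ennreal b * ennreal (1 / edge_rate ?j) + ennreal (b * (2 * perfect_length n))"
        using emeasure_expo_UNIV[of ?j] by (simp add: nn_integral_add nn_integral_cmult nn_integral_expo_id[OF R])
      also have "\<dots> = ennreal (b * (1 / edge_rate ?j)) + ennreal (b * (2 * perfect_length n))"
        using b R by (subst ennreal_mult) auto
      also have "\<dots> = ennreal (b * (1 / edge_rate ?j) + b * (2 * perfect_length n))"
        by (rule ennreal_plus[symmetric]) (use b R perfect_length_nonneg[of n] in simp_all)
      finally show ?thesis by (simp only: distrib_left[symmetric] perfect_length.simps)
    qed
    finally show ?case using 1 b by (intro exI[of _ b]) blast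
  }
qed

end

section \<open>Laws of random trees\<close>

lemma shape_tree_of_plane: "shape (tree_of p) = Some (forget (plane_shape p))"
  by (simp add: shape_def ushape_forget)

lemma hs_order_shape: "hs_order (shape t) = hs_order t"
proof -
  have "shape (shape t) = shape t"
    by (cases t) (simp_all add: shape_def ushape_def utree.map_comp o_def)
  then show ?thesis by (simp add: hs_order_def)
qed

lemma ltree_cases: "t = None \<or> (\<exists>p. t = tree_of p)"
  using forget_surj by (cases t) auto

lemma measurable_hs_order [measurable]: "hs_order \<in> measurable ltree_space (count_space UNIV)"
proof -
  have "(\<lambda>t. hs_order (shape t)) \<in> measurable ltree_space (count_space UNIV)" by measurable
  then show ?thesis by (simp add: hs_order_shape)
qed

lemma shape_eq_in_sets [measurable]: "{t. shape t = \<tau>} \<in> sets ltree_space"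
  using measurable_sets[OF measurable_shape, of "{\<tau>}"] by (simp add: vimage_def)

lemma subtree_law_eq:
  assumes "sets (M H) = sets N"
  shows "subtree_law M K H = M H \<bind> (\<lambda>t. distr (measure_pmf (pmf_of_multiset (complete_subtrees K t))) N (\<lambda>s. s))"
proof -
  have "distr P (M H) (\<lambda>s. s) = distr P N (\<lambda>s. s)" for P
    by (rule distr_cong) (use assms in auto)
  then show ?thesis by (simp add: subtree_law_def)
qed

text \<open>A constant factor cancels on conditioning. The factor is the probability of an order: a
  shape fixes the order, so conditioning the mixture on a shape leaves a single component.\<close>

lemma uniform_measure_cong_scaled:
  assumes sets: "sets M = sets N" and A: "A \<in> sets N"
    and eq: "\<And>B. B \<in> sets N \<Longrightarrow> B \<subseteq> A \<Longrightarrow> emeasure M B = ennreal c * emeasure N B"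
    and c: "0 < c" and fin: "emeasure N A \<noteq> \<infinity>"
  shows "uniform_measure M A = uniform_measure N A"
proof (rule measure_eqI)
  fix B assume "B \<in> sets (uniform_measure M A)"
  then have B: "B \<in> sets N" using sets by (simp add: uniform_measure_def)
  have "A \<inter> B \<in> sets N" using A B by auto
  have le: "emeasure N (A \<inter> B) \<le> emeasure N A" using A by (intro emeasure_mono) auto
  obtain b where b: "emeasure N A = ennreal b" "0 \<le> b" using fin by (cases "emeasure N A") auto
  obtain a where a: "emeasure N (A \<inter> B) = ennreal a" "0 \<le> a"
    using le fin by (cases "emeasure N (A \<inter> B)") (auto simp: top_unique)
  have "emeasure M (A \<inter> B) / emeasure M A = emeasure N (A \<inter> B) / emeasure N A"
  proof (cases "b = 0")
    case True
    with le a b have "a = 0" by simp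
    with True a b show ?thesis using eq[OF A] eq[OF \<open>A \<inter> B \<in> sets N\<close>] by simp
  next
    case False
    with a b c show ?thesis using eq[OF A] eq[OF \<open>A \<inter> B \<in> sets N\<close>]
      by (simp add: ennreal_mult[symmetric] divide_ennreal)
  qed
  then show "emeasure (uniform_measure M A) B = emeasure (uniform_measure N A) B"
    using A B sets by simp
qed (use sets in \<open>simp add: uniform_measure_def\<close>)

lemma emeasure_mixture:
  assumes "\<And>K. prob_space (M K)" "\<And>K. sets (M K) = sets N" "A \<in> sets N"
  shows "emeasure (mixture p M) A = (\<integral>\<^sup>+K. emeasure (M K) A \<partial>measure_pmf p)"
  unfolding mixture_def
proof (rule emeasure_bind)
  show "M \<in> measurable (measure_pmf p) (subprob_algebra N)"
    using assms by (auto simp: space_subprob_algebra intro: prob_space_imp_subprob_space)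
qed (use assms in auto)

lemma emeasure_mixture_single:
  assumes M: "\<And>K. prob_space (M K)" "\<And>K. sets (M K) = sets N" "A \<in> sets N"
    and "\<And>K. K \<in> set_pmf p \<Longrightarrow> K \<noteq> K0 \<Longrightarrow> emeasure (M K) A = 0"
  shows "emeasure (mixture p M) A = ennreal (pmf p K0) * emeasure (M K0) A"
proof -
  have "emeasure (mixture p M) A = (\<integral>\<^sup>+K. emeasure (M K0) A * indicator {K0} K \<partial>measure_pmf p)"
    unfolding emeasure_mixture[OF M]
    by (rule nn_integral_cong_AE) (use assms(4) in \<open>auto simp: AE_measure_pmf_iff split: split_indicator\<close>)
  also have "\<dots> = emeasure (M K0) A * emeasure (measure_pmf p) {K0}"
    by (subst nn_integral_cmult) auto
  finally show ?thesis by (simp add: emeasure_pmf_single mult.commute)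
qed

lemma sets_mixture:
  assumes "\<And>K. sets (M K) = sets N"
  shows "sets (mixture p M) = sets N"
  unfolding mixture_def by (rule sets_bind) (use assms in auto)

lemma pmf_geometric_iff:
  fixes p :: "nat pmf"
  assumes "0 \<notin> set_pmf p"
  shows "(\<forall>K\<ge>1. pmf p (Suc K) / (1 - pmf p 1) = pmf p K) \<longleftrightarrow>
    (\<exists>q. 0 < q \<and> q < 1 \<and> (\<forall>K\<ge>1. pmf p K = q * (1 - q) ^ (K - 1)))"
proof
  assume R: "\<forall>K\<ge>1. pmf p (Suc K) / (1 - pmf p 1) = pmf p K"
  define q where "q = pmf p 1"
  have q: "0 \<le> q" "q \<le> 1" by (auto simp: q_def pmf_le_1)
  \<comment> \<open>If q = 1, the quotient at K = 1 is a division by zero with value 0, while the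
    right-hand side is 1.\<close>
  have "q \<noteq> 1" using R[rule_format, of 1] by (auto simp: q_def)
  then have rec: "pmf p (Suc K) = (1 - q) * pmf p K" if "1 \<le> K" for K
    using R[rule_format, OF that] by (simp add: q_def field_simps)
  have geo: "pmf p (Suc K) = q * (1 - q) ^ K" for K
  proof (induction K)
    case (Suc K)
    then show ?case using rec[of "Suc K"] by simp
  qed (simp add: q_def)
  \<comment> \<open>With q = 0 all probabilities would vanish, the one at 0 by the assumption on the
    support.\<close>
  have "q \<noteq> 0"
  proof
    assume "q = 0"
    then have "pmf p K = 0" for K
      using geo[of "K - 1"] assms by (cases K) (auto simp: set_pmf_iff)
    then show False using set_pmf_not_empty[of p] by (auto simp: set_pmf_iff)
  qed
  have "pmf p K = q * (1 - q) ^ (K - 1)" if "1 \<le> K" for K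
    using geo[of "K - 1"] that by simp
  with q \<open>q \<noteq> 0\<close> \<open>q \<noteq> 1\<close> show "\<exists>q. 0 < q \<and> q < 1 \<and> (\<forall>K\<ge>1. pmf p K = q * (1 - q) ^ (K - 1))"
    by (intro exI[of _ q]) auto
next
  assume "\<exists>q. 0 < q \<and> q < 1 \<and> (\<forall>K\<ge>1. pmf p K = q * (1 - q) ^ (K - 1))"
  then obtain q where q: "0 < q" "q < 1" "\<And>K. 1 \<le> K \<Longrightarrow> pmf p K = q * (1 - q) ^ (K - 1)" by blast
  show "\<forall>K\<ge>1. pmf p (Suc K) / (1 - pmf p 1) = pmf p K"
  proof (intro allI impI)
    fix K :: nat assume "1 \<le> K"
    then obtain k where "K = Suc k" by (cases K) auto
    with q(1,2) q(3)[of 1] q(3)[of "Suc k"] q(3)[of "Suc (Suc k)"] show "pmf p (Suc K) / (1 - pmf p 1) = pmf p K"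
      by simp
  qed
qed

context hbp
begin

abbreviation law :: "nat \<Rightarrow> ltree measure" where
  "law \<equiv> hbp_law Tk lam"

lemma space_law [simp]: "space (law j) = UNIV"
  using sets_eq_imp_space_eq[OF sets_hbp_law[of j]] by simp

lemma nn_integral_law:
  assumes "1 \<le> j" "f \<in> borel_measurable ltree_space"
  shows "(\<integral>\<^sup>+t. f t \<partial>law j) = (\<integral>\<^sup>+p. f (tree_of p) \<partial>tree_law j)"
  unfolding hbp_law_eq[OF assms(1)] using assms(2) by (subst nn_integral_distr) auto

lemma emeasure_law:
  assumes "1 \<le> j" and A [measurable]: "A \<in> sets ltree_space"
  shows "emeasure (law j) A = (\<integral>\<^sup>+p. indicator A (tree_of p) \<partial>tree_law j)"
  using nn_integral_law[OF assms(1), of "indicator A"] A by simp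

lemma AE_law_order: "1 \<le> j \<Longrightarrow> AE t in law j. hs_order t = j"
  unfolding hbp_law_eq
  by (subst AE_distr_iff, measurable, rule AE_mp[OF AE_porder], assumption, rule AE_I2) simp

lemma emeasure_law_order_0:
  assumes "1 \<le> j" "A \<in> sets ltree_space" "\<And>t. t \<in> A \<Longrightarrow> hs_order t \<noteq> j"
  shows "emeasure (law j) A = 0"
proof -
  have "emeasure (law j) A = (\<integral>\<^sup>+p. indicator A (tree_of p) \<partial>tree_law j)"
    using assms(1,2) by (rule emeasure_law)
  also have "\<dots> = (\<integral>\<^sup>+p. 0 \<partial>tree_law j)"
    by (rule nn_integral_order_cong[OF assms(1)]) (use assms(3) in \<open>force split: split_indicator\<close>)
  finally show ?thesis by simp
qed

lemma shape_law_law: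
  "1 \<le> j \<Longrightarrow> shape_law (law j) = distr (tree_law j) (count_space UNIV) (\<lambda>p. Some (forget (plane_shape p)))"
  unfolding shape_law_def hbp_law_eq by (subst distr_distr) (auto simp: o_def shape_tree_of_plane)

lemma prob_space_shape_law: "prob_space (shape_law (law j))"
  unfolding shape_law_def by (rule prob_space.prob_space_distr[OF prob_space_hbp_law]) simp

lemma order_family_law: "order_family law"
  unfolding order_family_def using prob_space_hbp_law AE_law_order by auto

lemma order_family_shape_law: "order_family (\<lambda>K. shape_law (law K))"
  unfolding order_family_def
proof (intro allI impI conjI prob_space_shape_law)
  fix K :: nat assume "1 \<le> K"
  from AE_law_order[OF this] show "AE t in shape_law (law K). hs_order t = K"
    unfolding shape_law_def by (subst AE_distr_iff) (auto simp: hs_order_shape)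
qed

lemma integral_shape_law:
  fixes F :: "ctree \<Rightarrow> nat" and N :: "posreal ptree \<Rightarrow> nat"
  assumes "1 \<le> j" "\<And>p. F (Some (forget (plane_shape p))) = N p"
    and "(\<integral>\<^sup>+p. of_nat (N p) \<partial>tree_law j) = ennreal b" "0 \<le> b"
  shows "integrable (shape_law (law j)) (\<lambda>t. real (F t))" "(\<integral>t. real (F t) \<partial>shape_law (law j)) = b"
proof -
  have "(\<integral>\<^sup>+t. ennreal (real (F t)) \<partial>shape_law (law j)) = ennreal b"
    unfolding shape_law_law[OF assms(1)] using assms(3)
    by (subst nn_integral_distr) (auto simp: assms(2) ennreal_of_nat_eq_real_of_nat)
  then have "integrable (shape_law (law j)) (\<lambda>t. real (F t)) \<and> (\<integral>t. real (F t) \<partial>shape_law (law j)) = b"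
    using assms(4) by (subst nn_integral_eq_integrable[symmetric]) (auto simp: shape_law_def)
  then show "integrable (shape_law (law j)) (\<lambda>t. real (F t))" "(\<integral>t. real (F t) \<partial>shape_law (law j)) = b"
    by auto
qed

lemma mean_self_similar_law: "mean_self_similar (\<lambda>K. shape_law (law K)) Tk"
  unfolding mean_self_similar_def
proof (intro conjI order_family_shape_law allI impI)
  fix K i j :: nat assume *: "2 \<le> K \<and> 1 \<le> i \<and> i < j \<and> j \<le> K"
  then have K: "1 \<le> K" and ij: "1 \<le> i" "i < j" by auto
  from expected_branches_mergers[OF ij K] * obtain b where b: "0 < b"
    "(\<integral>\<^sup>+p. of_nat (size (tops j p)) \<partial>tree_law K) = ennreal b"
    "(\<integral>\<^sup>+p. of_nat (pmerges i j p) \<partial>tree_law K) = ennreal (Tk (j - i) * b)" by auto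
  have B: "branches j (Some (forget (plane_shape p))) = size (tops j p)" for p :: "posreal ptree"
    by (simp add: branches_def complete_subtrees_forget tops_map_ptree)
  have S: "side_branches i j (Some (forget (plane_shape p))) = pmerges i j p" for p :: "posreal ptree"
    by (simp add: side_branches_forget)
  have T0: "0 \<le> Tk (j - i) * b" using Tk[of "j - i"] ij b by simp
  note IB = integral_shape_law[OF K B b(2) less_imp_le[OF b(1)]]
  note IS = integral_shape_law[OF K S b(3) T0]
  show "integrable (shape_law (law K)) (\<lambda>t. real (side_branches i j t))" by (rule IS)
  show "integrable (shape_law (law K)) (\<lambda>t. real (branches j t))" by (rule IB)
  show "tokunaga (\<lambda>K. shape_law (law K)) i j K = Tk (j - i)"
    unfolding tokunaga_def IB IS using b(1) by simp
qed

text \<open>The uniform choice averages an indicator over the complete subtrees, so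
  \<open>nn_integral_uniform_subtree\<close> applies. The equality is one of laws with edge lengths
  and hence covers shapes, proportions and densities of the length at once.\<close>

lemma subtree_law_law:
  assumes K: "1 \<le> K" "K \<le> H"
  shows "subtree_law law K H = law K"
proof (rule measure_eqI)
  have H: "1 \<le> H" using K by simp
  let ?k = "\<lambda>t. distr (measure_pmf (pmf_of_multiset (complete_subtrees K t))) ltree_space (\<lambda>s. s)"
  have eq: "subtree_law law K H = law H \<bind> ?k" by (rule subtree_law_eq) simp
  have k: "?k \<in> measurable (law H) (subprob_algebra ltree_space)"
    using measurable_subtree_kernel by simp
  show sets: "sets (subtree_law law K H) = sets (law K)"
    unfolding eq by (subst sets_bind[where N=ltree_space]) auto
  fix A assume "A \<in> sets (subtree_law law K H)"
  then have A [measurable]: "A \<in> sets ltree_space" using sets by simp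
  have "emeasure (subtree_law law K H) A = (\<integral>\<^sup>+t. emeasure (?k t) A \<partial>law H)"
    unfolding eq by (rule emeasure_bind[OF _ k A]) simp
  also have "\<dots> = (\<integral>\<^sup>+p. emeasure (?k (tree_of p)) A \<partial>tree_law H)"
    by (rule nn_integral_law[OF H measurable_emeasure_kernel[OF measurable_subtree_kernel A]])
  also have "\<dots> = (\<integral>\<^sup>+p. (\<Sum>q\<in>#tops K p. indicator A (tree_of q)) / of_nat (size (tops K p)) \<partial>tree_law H)"
  proof (rule nn_integral_order_cong[OF H])
    fix p :: "posreal ptree" assume "porder p = H"
    then have ne: "complete_subtrees K (tree_of p) \<noteq> {#}"
      using K tops_nonempty[of K p] by (simp add: complete_subtrees_forget)
    show "emeasure (?k (tree_of p)) A = (\<Sum>q\<in>#tops K p. indicator A (tree_of q)) / of_nat (size (tops K p))"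
      unfolding emeasure_pmf_of_multiset[OF space_ltree_space A ne]
      by (simp only: complete_subtrees_forget image_mset.compositionality o_def size_image_mset)
  qed
  also have "\<dots> = (\<integral>\<^sup>+p. indicator A (tree_of p) \<partial>tree_law K)"
    by (rule nn_integral_uniform_subtree[OF K]) measurable
  also have "\<dots> = emeasure (law K) A" using K by (simp add: emeasure_law)
  finally show "emeasure (subtree_law law K H) A = emeasure (law K) A" .
qed

text \<open>The complete subtrees are taken of the shape here; on planar representatives they are
  the shapes of the complete subtrees of the tree, so the computation with lengths repeats for an
  event on shapes.\<close>

lemma coordinated_law: "coordinated (\<lambda>K. shape_law (law K))"
  unfolding coordinated_def
proof (intro allI impI)
  fix K H :: nat and \<tau> :: ctree assume *: "1 \<le> K \<and> K \<le> H \<and> hs_order \<tau> = K"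
  then have K: "1 \<le> K" "K \<le> H" and H: "1 \<le> H" by auto
  let ?\<mu> = "\<lambda>K. shape_law (law K)"
  let ?k = "\<lambda>t. distr (measure_pmf (pmf_of_multiset (complete_subtrees K t))) (count_space UNIV) (\<lambda>s. s)"
  have eq: "subtree_law ?\<mu> K H = ?\<mu> H \<bind> ?k" by (rule subtree_law_eq) (simp add: shape_law_def)
  have k: "?k \<in> measurable (?\<mu> H) (subprob_algebra (count_space UNIV))"
    by (subst measurable_cong_sets[of _ "count_space UNIV" _ _, OF _ refl])
       (auto simp: shape_law_def space_subprob_algebra
         intro!: prob_space_imp_subprob_space measure_pmf.prob_space_distr)
  have "emeasure (subtree_law ?\<mu> K H) {\<tau>} = (\<integral>\<^sup>+t. emeasure (?k t) {\<tau>} \<partial>?\<mu> H)"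
    unfolding eq by (rule emeasure_bind[OF _ k]) (auto simp: shape_law_def)
  also have "\<dots> = (\<integral>\<^sup>+p. emeasure (?k (Some (forget (plane_shape p)))) {\<tau>} \<partial>tree_law H)"
    unfolding shape_law_law[OF H] by (subst nn_integral_distr) auto
  also have "\<dots> = (\<integral>\<^sup>+p. (\<Sum>q\<in>#tops K p. indicator {\<tau>} (Some (forget (plane_shape q)))) / of_nat (size (tops K p)) \<partial>tree_law H)"
  proof (rule nn_integral_order_cong[OF H])
    fix p :: "posreal ptree" assume "porder p = H"
    then have ne: "complete_subtrees K (Some (forget (plane_shape p))) \<noteq> {#}"
      using K tops_nonempty[of K p] by (simp add: complete_subtrees_forget tops_map_ptree)
    show "emeasure (?k (Some (forget (plane_shape p)))) {\<tau>} = (\<Sum>q\<in>#tops K p. indicator {\<tau>} (Some (forget (plane_shape q)))) / of_nat (size (tops K p))"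
      by (subst emeasure_pmf_of_multiset[OF _ _ ne])
         (simp_all only: complete_subtrees_forget tops_map_ptree image_mset.compositionality o_def size_image_mset
            space_count_space sets_count_space Pow_UNIV UNIV_I)
  qed
  also have "\<dots> = (\<integral>\<^sup>+p. indicator {\<tau>} (Some (forget (plane_shape p))) \<partial>tree_law K)"
    by (rule nn_integral_uniform_subtree[OF K]) measurable
  also have "\<dots> = (\<integral>\<^sup>+t. indicator {\<tau>} t \<partial>?\<mu> K)"
    unfolding shape_law_law[OF K(1)] by (subst nn_integral_distr) auto
  also have "\<dots> = emeasure (?\<mu> K) {\<tau>}"
    by (simp add: shape_law_def)
  finally show "measure (subtree_law ?\<mu> K H) {\<tau>} = measure (?\<mu> K) {\<tau>}"
    by (simp add: measure_def)
qed

end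

section \<open>The mixture over the orders and its pruning\<close>

locale hbp_mixture = hbp +
  fixes p :: "nat pmf"
  assumes p0: "0 \<notin> set_pmf p"
begin

text \<open>The process whose rates are shifted by one order; by \<open>distr_pr\<close> its trees
  have the law of the pruned ones.\<close>

sublocale S: hbp Tk "\<lambda>j. lam (Suc j)"
  by (rule hbp_shift)

definition mix :: "ltree measure" where
  "mix = mixture p law"

definition pruned :: "ltree measure" where
  "pruned = distr mix ltree_space lprune"

lemma sets_mix [measurable_cong, simp]: "sets mix = sets ltree_space"
  unfolding mix_def by (rule sets_mixture) simp

lemma space_mix [simp]: "space mix = UNIV"
  using sets_eq_imp_space_eq[OF sets_mix] by simp

lemma sets_pruned [measurable_cong, simp]: "sets pruned = sets ltree_space"
  by (simp add: pruned_def)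

lemma space_pruned [simp]: "space pruned = UNIV"
  by (simp add: pruned_def)

text \<open>The empty tree may belong to A, as every component of order at least 1 gives it measure
  zero; this admits events such as the emptiness of the pruned tree.\<close>

lemma emeasure_mix:
  assumes "1 \<le> K" "A \<in> sets ltree_space" "\<And>t. t \<in> A \<Longrightarrow> hs_order t \<noteq> 0 \<Longrightarrow> hs_order t = K"
  shows "emeasure mix A = ennreal (pmf p K) * emeasure (law K) A"
  unfolding mix_def
proof (rule emeasure_mixture_single[where N=ltree_space])
  fix k assume k: "k \<in> set_pmf p" "k \<noteq> K"
  then have "1 \<le> k" using p0 by (cases k) auto
  then show "emeasure (law k) A = 0"
    using assms k by (intro emeasure_law_order_0) force+
qed (use assms prob_space_hbp_law in auto)

lemma prob_space_mix: "prob_space mix"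
proof
  have "emeasure mix UNIV = (\<integral>\<^sup>+K. emeasure (law K) UNIV \<partial>measure_pmf p)"
    unfolding mix_def by (rule emeasure_mixture[where N=ltree_space])
      (use sets.top[of ltree_space] in \<open>auto intro: prob_space_hbp_law\<close>)
  then show "emeasure mix (space mix) = 1"
    using prob_space.emeasure_space_1[OF prob_space_hbp_law] by simp
qed

text \<open>Only trees of order K + 1 prune to order K, which picks the weight
  \<open>pmf p (Suc K)\<close>; given that order, the pruned tree follows the shifted
  process.\<close>

lemma emeasure_pruned:
  assumes K: "1 \<le> K" and A [measurable]: "A \<in> sets ltree_space" and o: "\<And>t. t \<in> A \<Longrightarrow> hs_order t = K"
  shows "emeasure pruned A = ennreal (pmf p (Suc K)) * emeasure (S.law K) A"
proof -
  have m: "lprune -` A \<in> sets ltree_space"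
    using measurable_sets[OF measurable_lprune A] by simp
  have "emeasure pruned A = emeasure mix (lprune -` A)"
    unfolding pruned_def by (subst emeasure_distr) auto
  also have "\<dots> = ennreal (pmf p (Suc K)) * emeasure (law (Suc K)) (lprune -` A)"
  proof (rule emeasure_mix[OF _ m])
    fix t assume t: "t \<in> lprune -` A" "hs_order t \<noteq> 0"
    then obtain q where q: "t = tree_of q" using ltree_cases[of t] by auto
    have "porder q \<noteq> 1" using t o[of None] K by (auto simp: q lprune_forget)
    then have "pprune_with posreal_add q = Some (pr q)" by (simp add: pprune_with_eq_pr)
    from porder_pprune[OF this] show "hs_order t = Suc K"
      using t o[of "tree_of (pr q)"] \<open>porder q \<noteq> 1\<close> by (simp add: q lprune_forget)
  qed simp
  also have "emeasure (law (Suc K)) (lprune -` A) = emeasure (S.law K) A"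
  proof -
    have "emeasure (law (Suc K)) (lprune -` A) = (\<integral>\<^sup>+q. indicator A (lprune (tree_of q)) \<partial>tree_law (Suc K))"
      using m by (subst emeasure_law) (simp_all add: indicator_vimage[of lprune A, unfolded comp_def, symmetric] indicator_def)
    also have "\<dots> = (\<integral>\<^sup>+q. indicator A (tree_of (pr q)) \<partial>tree_law (Suc K))"
      by (rule nn_integral_order_cong) (use K in \<open>auto simp: lprune_forget\<close>)
    also have "\<dots> = (\<integral>\<^sup>+q. indicator A (tree_of q) \<partial>distr (tree_law (Suc K)) ptree_space pr)"
      by (subst nn_integral_distr) auto
    also have "\<dots> = emeasure (S.law K) A"
      unfolding distr_pr[OF K] by (rule S.emeasure_law[OF K A, symmetric])
    finally show ?thesis .
  qed
  finally show ?thesis .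
qed

lemma emeasure_S_law_shape:
  "1 \<le> K \<Longrightarrow> emeasure (S.law K) {t. shape t = \<tau>} = emeasure (law K) {t. shape t = \<tau>}"
  using tree_law_shape_cong[OF hbp_shift, of K "\<lambda>p. indicator {t. shape t = \<tau>} (tree_of p)"]
  by (simp add: emeasure_law S.emeasure_law indicator_def shape_tree_of_plane ptree.map_comp o_def)

lemma shape_law_mix: "shape_law mix = mixture p (\<lambda>K. shape_law (law K))"
  unfolding shape_law_def mix_def mixture_def
  by (rule distr_bind[where K=ltree_space])
     (auto simp: space_subprob_algebra intro!: prob_space_imp_subprob_space prob_space_hbp_law)

lemma measure_shape_mix:
  assumes "1 \<le> K" "hs_order \<tau> = K"
  shows "measure mix {t. shape t = \<tau>} = pmf p K * measure (law K) {t. shape t = \<tau>}"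
proof -
  have "emeasure mix {t. shape t = \<tau>} = ennreal (pmf p K) * emeasure (law K) {t. shape t = \<tau>}"
    by (rule emeasure_mix[OF assms(1) shape_eq_in_sets]) (metis mem_Collect_eq hs_order_shape assms(2))
  then show ?thesis by (simp add: measure_def enn2real_mult)
qed

lemma perfect_shape_pos: "0 < measure (law (Suc n)) {t. shape t = Some (forget (perfect n))}"
proof -
  interpret P: prob_space "law (Suc n)" by (rule prob_space_hbp_law)
  from perfect_tree[of n] obtain a where a: "0 < a"
    "(\<integral>\<^sup>+p. indicator {p. plane_shape p = perfect n} p \<partial>tree_law (Suc n)) = ennreal a" by blast
  have "emeasure (law (Suc n)) {t. shape t = Some (forget (perfect n))} =
      (\<integral>\<^sup>+p. indicator {p. plane_shape p = perfect n} p \<partial>tree_law (Suc n))"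
    by (subst emeasure_law)
       (auto simp: shape_tree_of_plane forget_eq_perfect simp del: nn_integral_indicator intro!: nn_integral_cong split: split_indicator)
  then show ?thesis using a by (simp add: P.emeasure_eq_measure)
qed

text \<open>Given order K, shapes have the same law before and after pruning, so only the weights of
  the orders have to match. Cancelling the common factor takes a shape of positive probability in
  every order, and the perfect one provides it.\<close>

lemma prune_invariant_iff:
  "prune_invariant (shape_law mix) \<longleftrightarrow> (\<forall>K\<ge>1. pmf p (Suc K) / (1 - pmf p 1) = pmf p K)"
proof -
  interpret mix: prob_space mix by (rule prob_space_mix)
  define \<nu> where "\<nu> = distr (shape_law mix) (count_space UNIV) cprune"
  have cp: "cprune (shape t) = shape (lprune t)" for t
    using ltree_cases[of t]
    by (auto simp: cprune_shape[of _ posreal_add] lprune_def prune_with_forget) (simp add: cprune_def shape_def)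
  have \<nu>: "measure \<nu> A = measure mix {t. shape (lprune t) \<in> A}" for A
  proof -
    have m: "(\<lambda>t. shape (lprune t)) \<in> measurable mix (count_space UNIV)" by measurable
    have "\<nu> = distr mix (count_space UNIV) (\<lambda>t. shape (lprune t))"
      unfolding \<nu>_def shape_law_def by (subst distr_distr) (auto simp: o_def cp)
    then show ?thesis using m by (simp add: measure_distr vimage_def)
  qed
  have sh: "measure (shape_law mix) {\<tau>} = measure mix {t. shape t = \<tau>}" for \<tau>
    unfolding shape_law_def by (subst measure_distr) (auto simp: vimage_def)
  have none: "measure mix {t. shape t = None} = 0"
  proof -
    have "emeasure mix {t. shape t = None} = ennreal (pmf p 1) * emeasure (law 1) {t. shape t = None}"
      by (rule emeasure_mix[OF _ shape_eq_in_sets]) (auto simp: shape_def)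
    also have "emeasure (law 1) {t. shape t = None} = 0"
      by (rule emeasure_law_order_0[OF _ shape_eq_in_sets]) (auto simp: shape_def)
    finally show ?thesis by (simp add: measure_def)
  qed
  have nn: "measure \<nu> {t. t \<noteq> None} = 1 - pmf p 1"
  proof -
    have m: "{t. lprune t = None} \<in> sets ltree_space"
    proof -
      have "{t. lprune t = None} = {t. shape (lprune t) = None}" by (auto simp: shape_def)
      moreover have f: "(\<lambda>t. shape (lprune t)) \<in> measurable ltree_space (count_space UNIV)" by measurable
      ultimately show ?thesis using measurable_sets[OF f, of "{None}"] by (simp add: vimage_def)
    qed
    interpret P: prob_space "law 1" by (rule prob_space_hbp_law)
    have "emeasure mix {t. lprune t = None} = ennreal (pmf p 1) * emeasure (law 1) {t. lprune t = None}"
    proof (rule emeasure_mix[OF _ m])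
      fix t assume t: "t \<in> {t. lprune t = None}" "hs_order t \<noteq> 0"
      then obtain q where q: "t = tree_of q" using ltree_cases[of t] by auto
      then show "hs_order t = 1" using t by (auto simp: lprune_forget split: if_splits)
    qed simp
    also have "emeasure (law 1) {t. lprune t = None} = 1"
    proof -
      have "emeasure (law 1) {t. lprune t = None} = (\<integral>\<^sup>+q. indicator {t. lprune t = None} (tree_of q) \<partial>tree_law 1)"
        by (rule emeasure_law[OF _ m]) simp
      also have "\<dots> = (\<integral>\<^sup>+q. 1 \<partial>tree_law 1)"
        by (rule nn_integral_order_cong) (auto simp: lprune_forget)
      finally show ?thesis using T.emeasure_space_1[of 1] by simp
    qed
    finally have "measure mix {t. lprune t = None} = pmf p 1" by (simp add: measure_def)
    moreover have "{t. shape (lprune t) \<in> {t. t \<noteq> None}} = space mix - {t. lprune t = None}"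
      by (auto simp: shape_def)
    ultimately show ?thesis unfolding \<nu> using mix.prob_compl[of "{t. lprune t = None}"] m by simp
  qed
  have some: "measure \<nu> {\<tau>} = pmf p (Suc K) * measure (law K) {t. shape t = \<tau>}" if "1 \<le> K" "hs_order \<tau> = K" for K \<tau>
  proof -
    have "measure \<nu> {\<tau>} = measure pruned {t. shape t = \<tau>}"
      unfolding \<nu> pruned_def by (subst measure_distr) (auto simp: vimage_def)
    moreover have "emeasure pruned {t. shape t = \<tau>} = ennreal (pmf p (Suc K)) * emeasure (S.law K) {t. shape t = \<tau>}"
      by (rule emeasure_pruned[OF that(1) shape_eq_in_sets]) (metis mem_Collect_eq hs_order_shape that(2))
    ultimately show ?thesis
      by (simp add: measure_def enn2real_mult emeasure_S_law_shape[OF that(1)])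
  qed
  have cond: "\<P>(t in \<nu>. t = \<tau> \<bar> t \<noteq> None) = measure \<nu> {\<tau>} / (1 - pmf p 1)" if "\<tau> \<noteq> None" for \<tau>
  proof -
    have "{t \<in> space \<nu>. t = \<tau> \<and> t \<noteq> None} = {\<tau>}" "{t \<in> space \<nu>. t \<noteq> None} = {t. t \<noteq> None}"
      using that by (auto simp: \<nu>_def)
    then show ?thesis by (simp only: cond_prob_def nn)
  qed
  have cond0: "\<P>(t in \<nu>. t = None \<bar> t \<noteq> None) = 0"
  proof -
    have "{t \<in> space \<nu>. t = None \<and> t \<noteq> None} = {}" by auto
    then show ?thesis by (simp only: cond_prob_def measure_empty div_0)
  qed
  have order_Some: "1 \<le> hs_order (Some \<sigma>)" for \<sigma> :: "unit utree"
    using forget_surj[of \<sigma>] by auto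
  have "prune_invariant (shape_law mix) \<longleftrightarrow> (\<forall>\<tau>. \<P>(t in \<nu>. t = \<tau> \<bar> t \<noteq> None) = measure mix {t. shape t = \<tau>})"
    unfolding prune_invariant_def Let_def \<nu>_def[symmetric] sh using none by simp
  also have "\<dots> \<longleftrightarrow> (\<forall>\<sigma>. pmf p (Suc (hs_order (Some \<sigma>))) * measure (law (hs_order (Some \<sigma>))) {t. shape t = Some \<sigma>} / (1 - pmf p 1) =
      pmf p (hs_order (Some \<sigma>)) * measure (law (hs_order (Some \<sigma>))) {t. shape t = Some \<sigma>})" (is "_ \<longleftrightarrow> (\<forall>\<sigma>. ?E \<sigma>)")
  proof -
    have "(\<P>(t in \<nu>. t = Some \<sigma> \<bar> t \<noteq> None) = measure mix {t. shape t = Some \<sigma>}) = ?E \<sigma>" for \<sigma>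
      using cond[of "Some \<sigma>"] some[OF order_Some refl, of \<sigma>] measure_shape_mix[OF order_Some refl, of \<sigma>] by simp
    moreover have "\<P>(t in \<nu>. t = None \<bar> t \<noteq> None) = measure mix {t. shape t = None}"
      using cond0 none by simp
    ultimately show ?thesis by (metis option.exhaust)
  qed
  also have "\<dots> \<longleftrightarrow> (\<forall>K\<ge>1. pmf p (Suc K) / (1 - pmf p 1) = pmf p K)"
  proof
    assume E: "\<forall>\<sigma>. ?E \<sigma>"
    show "\<forall>K\<ge>1. pmf p (Suc K) / (1 - pmf p 1) = pmf p K"
    proof (intro allI impI)
      fix K :: nat assume "1 \<le> K"
      then obtain n where K: "K = Suc n" by (cases K) auto
      have "hs_order (Some (forget (perfect n))) = Suc n" by simp
      with E[rule_format, of "forget (perfect n)"]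
      have "pmf p (Suc K) / (1 - pmf p 1) * measure (law K) {t. shape t = Some (forget (perfect n))} =
          pmf p K * measure (law K) {t. shape t = Some (forget (perfect n))}"
        unfolding K by simp
      with perfect_shape_pos[of n] show "pmf p (Suc K) / (1 - pmf p 1) = pmf p K"
        unfolding K by (simp only: mult_cancel_right) linarith
    qed
  next
    assume R: "\<forall>K\<ge>1. pmf p (Suc K) / (1 - pmf p 1) = pmf p K"
    show "\<forall>\<sigma>. ?E \<sigma>"
    proof
      fix \<sigma>
      from R[rule_format, OF order_Some[of \<sigma>]] show "?E \<sigma>"
        by (metis times_divide_eq_left)
    qed
  qed
  finally show ?thesis .
qed

lemma self_similar_iff:
  "self_similar p (\<lambda>K. shape_law (law K)) \<longleftrightarrow> (\<forall>K\<ge>1. pmf p (Suc K) / (1 - pmf p 1) = pmf p K)"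
  unfolding self_similar_def shape_law_mix[symmetric] prune_invariant_iff
  by (simp only: order_family_shape_law coordinated_law simp_thms)

lemma given_shape_mix:
  assumes K: "1 \<le> K" "hs_order \<tau> = K" and p: "0 < pmf p K"
  shows "given_shape mix \<tau> = given_shape (law K) \<tau>"
proof -
  interpret P: prob_space "law K" by (rule prob_space_hbp_law)
  have order: "hs_order t = K" if "t \<in> B" "B \<subseteq> {t. shape t = \<tau>}" for t B
  proof -
    from that have "shape t = \<tau>" by blast
    then show ?thesis using hs_order_shape[of t] K(2) by simp
  qed
  have "uniform_measure mix {t. shape t = \<tau>} = uniform_measure (law K) {t. shape t = \<tau>}"
  proof (rule uniform_measure_cong_scaled[OF _ _ _ p])
    show "emeasure mix B = ennreal (pmf p K) * emeasure (law K) B"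
      if "B \<in> sets (law K)" "B \<subseteq> {t. shape t = \<tau>}" for B
      by (rule emeasure_mix[OF K(1)]) (use that in simp, use order that(2) in blast)
  qed simp_all
  then show ?thesis by (simp add: given_shape_def)
qed

lemma given_shape_pruned:
  assumes K: "1 \<le> K" "hs_order \<tau> = K" and p: "0 < pmf p (Suc K)"
  shows "given_shape pruned \<tau> = given_shape (S.law K) \<tau>"
proof -
  interpret P: prob_space "S.law K" by (rule S.prob_space_hbp_law)
  have order: "hs_order t = K" if "t \<in> B" "B \<subseteq> {t. shape t = \<tau>}" for t B
  proof -
    from that have "shape t = \<tau>" by blast
    then show ?thesis using hs_order_shape[of t] K(2) by simp
  qed
  have "uniform_measure pruned {t. shape t = \<tau>} = uniform_measure (S.law K) {t. shape t = \<tau>}"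
  proof (rule uniform_measure_cong_scaled[OF _ _ _ p])
    show "emeasure pruned B = ennreal (pmf p (Suc K)) * emeasure (S.law K) B"
      if "B \<in> sets (S.law K)" "B \<subseteq> {t. shape t = \<tau>}" for B
      by (rule emeasure_pruned[OF K(1)]) (use that in simp, use order that(2) in blast)
  qed simp_all
  then show ?thesis by (simp add: given_shape_def)
qed

end

lemma length_density_cong:
  assumes "given_shape \<eta> \<tau> = given_shape \<eta>' \<tau>"
  shows "proportions_law \<eta> \<tau> = proportions_law \<eta>' \<tau>" "length_density \<eta> \<tau> F \<longleftrightarrow> length_density \<eta>' \<tau> F"
  using assms by (simp_all add: proportions_law_def length_density_def)

lemma dfs_orders_pos: "k \<in> set (dfs_orders d) \<Longrightarrow> 1 \<le> k"
  by (induction d) (auto simp del: porder.simps)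

lemma gamma_length_cong:
  assumes "\<And>k. 1 \<le> k \<Longrightarrow> w k = w' k"
  shows "gamma_length w \<tau> = gamma_length w' \<tau>"
proof -
  have "w (order_list \<tau> ! i) = w' (order_list \<tau> ! i)" if "i < length (order_list \<tau>)" for i
    by (rule assms, rule dfs_orders_pos[of _ "embed_shape \<tau>"]) (use that in \<open>simp add: order_list_def nth_mem\<close>)
  then have "(\<Sum>i<length (order_list \<tau>). w (order_list \<tau> ! i) * x i) =
      (\<Sum>i<length (order_list \<tau>). w' (order_list \<tau> ! i) * x i)" for x :: "nat \<Rightarrow> real"
    by (intro sum.cong refl) simp
  then show ?thesis unfolding gamma_length_def by (intro ext) simp
qed

context hbp
begin

lemma sets_given_shape [measurable_cong, simp]: "sets (given_shape (law j) \<tau>) = sets ltree_space"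
  by (simp add: given_shape_def uniform_measure_def)

lemma nn_integral_given_shape:
  assumes j: "1 \<le> j" and f [measurable]: "f \<in> borel_measurable ltree_space"
  shows "(\<integral>\<^sup>+t. f t \<partial>given_shape (law j) (Some \<sigma>)) =
    (\<integral>\<^sup>+p. indicator {p. ushape (forget p) = \<sigma>} p * f (tree_of p) \<partial>tree_law j) / emeasure (law j) {t. shape t = Some \<sigma>}"
proof -
  have "(\<integral>\<^sup>+t. f t \<partial>given_shape (law j) (Some \<sigma>)) =
      (\<integral>\<^sup>+t. f t * indicator {t. shape t = Some \<sigma>} t \<partial>law j) / emeasure (law j) {t. shape t = Some \<sigma>}"
    unfolding given_shape_def by (subst nn_integral_uniform_measure) simp_all
  also have "(\<integral>\<^sup>+t. f t * indicator {t. shape t = Some \<sigma>} t \<partial>law j) =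
      (\<integral>\<^sup>+p. f (tree_of p) * indicator {t. shape t = Some \<sigma>} (tree_of p) \<partial>tree_law j)"
    by (rule nn_integral_law[OF j]) measurable
  also have "\<dots> = (\<integral>\<^sup>+p. indicator {p. ushape (forget p) = \<sigma>} p * f (tree_of p) \<partial>tree_law j)"
    by (intro nn_integral_cong) (auto simp: shape_tree_of split: split_indicator)
  finally show ?thesis .
qed

text \<open>Testing \<open>nn_integral_gamma_length\<close> on indicators of sets of pairs
  identifies the joint law of proportions and length; dividing by the probability of the shape
  conditions both sides alike.\<close>

lemma length_density_law:
  assumes j: "1 \<le> j"
  shows "length_density (law j) (Some \<sigma>) (gamma_length edge_rate \<sigma>)"
  unfolding length_density_def
proof (intro conjI allI measurable_gamma_length gamma_length_nonneg measure_eqI)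
  let ?G = "given_shape (law j) (Some \<sigma>)"
  let ?F = "gamma_length edge_rate \<sigma>"
  let ?P = "proportions_law (law j) (Some \<sigma>)"
  have Fm: "(\<lambda>(x, l). ennreal (?F x l)) \<in> borel_measurable (vec_space \<Otimes>\<^sub>M lborel)"
    using measurable_gamma_length[of edge_rate \<sigma>] by (simp add: split_beta')
  have setsP [measurable_cong]: "sets ?P = sets vec_space" by (simp add: proportions_law_def)
  have setsP2: "sets (?P \<Otimes>\<^sub>M lborel) = sets (vec_space \<Otimes>\<^sub>M lborel)"
    by (rule sets_pair_measure_cong) (simp_all add: setsP)
  show "sets (distr ?G (vec_space \<Otimes>\<^sub>M lborel) (\<lambda>t. (pad (proportions t), tree_length t))) =
      sets (density (?P \<Otimes>\<^sub>M lborel) (\<lambda>(x, l). ennreal (?F x l)))"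
    by (simp only: sets_distr sets_density setsP2)
  fix A assume "A \<in> sets (distr ?G (vec_space \<Otimes>\<^sub>M lborel) (\<lambda>t. (pad (proportions t), tree_length t)))"
  then have A: "A \<in> sets (vec_space \<Otimes>\<^sub>M lborel)" by simp
  have Ai: "(\<lambda>(x, l). indicator A (x, l) :: ennreal) \<in> borel_measurable (vec_space \<Otimes>\<^sub>M lborel)"
    using A by (simp add: split_beta')
  have m: "(\<lambda>t. (pad (proportions t), tree_length t)) \<in> measurable ltree_space (vec_space \<Otimes>\<^sub>M lborel)" by measurable
  have inner: "(\<lambda>x. \<integral>\<^sup>+l. ennreal (?F x l) * indicator A (x, l) \<partial>lborel) \<in> borel_measurable vec_space"
    using Fm A by (intro lborel.borel_measurable_nn_integral) (simp add: split_beta')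
  have "emeasure (distr ?G (vec_space \<Otimes>\<^sub>M lborel) (\<lambda>t. (pad (proportions t), tree_length t))) A =
      (\<integral>\<^sup>+t. indicator A (pad (proportions t), tree_length t) \<partial>?G)"
    using m A by (subst nn_integral_indicator[symmetric], simp, subst nn_integral_distr) simp_all
  also have "\<dots> = (\<integral>\<^sup>+p. indicator {p. ushape (forget p) = \<sigma>} p * indicator A (pad (proportions (tree_of p)), tree_length (tree_of p)) \<partial>tree_law j)
      / emeasure (law j) {t. shape t = Some \<sigma>}"
    by (rule nn_integral_given_shape[OF j]) (use measurable_compose[OF m, of "indicator A"] A in simp)
  also have "(\<integral>\<^sup>+p. indicator {p. ushape (forget p) = \<sigma>} p * indicator A (pad (proportions (tree_of p)), tree_length (tree_of p)) \<partial>tree_law j) =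
      (\<integral>\<^sup>+p. indicator {p. ushape (forget p) = \<sigma>} p *
        (\<integral>\<^sup>+l. ennreal (?F (pad (proportions (tree_of p))) l) * indicator A (pad (proportions (tree_of p)), l) \<partial>lborel) \<partial>tree_law j)"
    by (rule nn_integral_gamma_length[OF j Ai])
  also have "\<dots> / emeasure (law j) {t. shape t = Some \<sigma>} =
      (\<integral>\<^sup>+t. (\<integral>\<^sup>+l. ennreal (?F (pad (proportions t)) l) * indicator A (pad (proportions t), l) \<partial>lborel) \<partial>?G)"
    by (rule nn_integral_given_shape[OF j, symmetric]) (rule measurable_compose[OF measurable_pad_proportions inner])
  also have "\<dots> = (\<integral>\<^sup>+x. (\<integral>\<^sup>+l. ennreal (?F x l) * indicator A (x, l) \<partial>lborel) \<partial>?P)"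
    unfolding proportions_law_def using inner by (subst nn_integral_distr) simp_all
  also have "\<dots> = (\<integral>\<^sup>+y. (case y of (x, l) \<Rightarrow> ennreal (?F x l)) * indicator A y \<partial>(?P \<Otimes>\<^sub>M lborel))"
    using Fm A by (subst lborel.nn_integral_fst[symmetric]) (simp_all add: measurable_cong_sets[OF setsP2 refl])
  also have "\<dots> = emeasure (density (?P \<Otimes>\<^sub>M lborel) (\<lambda>(x, l). ennreal (?F x l))) A"
    using Fm A by (subst emeasure_density) (simp_all add: setsP2 measurable_cong_sets[OF setsP2 refl])
  finally show "emeasure (distr ?G (vec_space \<Otimes>\<^sub>M lborel) (\<lambda>t. (pad (proportions t), tree_length t))) A =
      emeasure (density (?P \<Otimes>\<^sub>M lborel) (\<lambda>(x, l). ennreal (?F x l))) A" .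
qed

lemma mean_length_perfect:
  "(\<integral>\<^sup>+t. ennreal (tree_length t) \<partial>given_shape (law (Suc n)) (Some (forget (perfect n)))) = ennreal (perfect_length n)"
proof -
  have I: "indicator {p. ushape (forget p) = forget (perfect n)} p = (indicator {p. plane_shape p = perfect n} p :: ennreal)"
    for p :: "posreal ptree" by (simp add: indicator_def ushape_forget forget_eq_perfect)
  from perfect_tree[of n] obtain a where a: "0 < a"
    "(\<integral>\<^sup>+p. indicator {p. plane_shape p = perfect n} p \<partial>tree_law (Suc n)) = ennreal a"
    "(\<integral>\<^sup>+p. indicator {p. plane_shape p = perfect n} p * ennreal (wsum (\<lambda>_. 1) p) \<partial>tree_law (Suc n)) = ennreal (a * perfect_length n)"
    by blast
  have "emeasure (law (Suc n)) {t. shape t = Some (forget (perfect n))} =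
      (\<integral>\<^sup>+p. indicator {p. plane_shape p = perfect n} p \<partial>tree_law (Suc n))"
    by (subst emeasure_law)
       (auto simp: shape_tree_of_plane forget_eq_perfect simp del: nn_integral_indicator intro!: nn_integral_cong split: split_indicator)
  then have e: "emeasure (law (Suc n)) {t. shape t = Some (forget (perfect n))} = ennreal a" using a by simp
  show ?thesis
    by (subst nn_integral_given_shape, simp, measurable)
       (use a(1) perfect_length_nonneg[of n] in \<open>simp add: I e tree_length_tree_of a(3) divide_ennreal\<close>)
qed

end

text \<open>Every version of the density gives the same mean length once integrated over the
  proportions, so the converse direction can work with whatever versions its hypothesis
  supplies.\<close>

lemma nn_integral_length_density:
  assumes "length_density \<eta> \<tau> F" and m: "sets (given_shape \<eta> \<tau>) = sets ltree_space"
  shows "(\<integral>\<^sup>+t. ennreal (tree_length t) \<partial>given_shape \<eta> \<tau>) =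
    (\<integral>\<^sup>+x. (\<integral>\<^sup>+l. ennreal (F x l) * ennreal l \<partial>lborel) \<partial>proportions_law \<eta> \<tau>)"
proof -
  let ?P = "proportions_law \<eta> \<tau>"
  have Fm: "(\<lambda>(x, l). ennreal (F x l)) \<in> borel_measurable (vec_space \<Otimes>\<^sub>M lborel)"
    using assms(1) by (auto simp: length_density_def split_beta')
  have setsP2: "sets (?P \<Otimes>\<^sub>M lborel) = sets (vec_space \<Otimes>\<^sub>M lborel)"
    by (rule sets_pair_measure_cong) (simp_all add: proportions_law_def)
  have mm: "(\<lambda>t. (pad (proportions t), tree_length t)) \<in> measurable (given_shape \<eta> \<tau>) (vec_space \<Otimes>\<^sub>M lborel)"
    unfolding measurable_cong_sets[OF m refl] by measurable
  have "(\<integral>\<^sup>+t. ennreal (tree_length t) \<partial>given_shape \<eta> \<tau>) =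
      (\<integral>\<^sup>+y. ennreal (snd y) \<partial>distr (given_shape \<eta> \<tau>) (vec_space \<Otimes>\<^sub>M lborel) (\<lambda>t. (pad (proportions t), tree_length t)))"
    using mm by (subst nn_integral_distr) simp_all
  also have "\<dots> = (\<integral>\<^sup>+y. ennreal (snd y) \<partial>density (?P \<Otimes>\<^sub>M lborel) (\<lambda>(x, l). ennreal (F x l)))"
    using assms(1) by (simp add: length_density_def)
  also have "\<dots> = (\<integral>\<^sup>+y. (case y of (x, l) \<Rightarrow> ennreal (F x l)) * ennreal (snd y) \<partial>(?P \<Otimes>\<^sub>M lborel))"
    using Fm by (subst nn_integral_density) (simp_all add: measurable_cong_sets[OF setsP2 refl])
  also have "\<dots> = (\<integral>\<^sup>+x. (\<integral>\<^sup>+l. ennreal (F x l) * ennreal l \<partial>lborel) \<partial>?P)"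
    using Fm by (subst lborel.nn_integral_fst[symmetric]) (simp_all add: measurable_cong_sets[OF setsP2 refl])
  finally show ?thesis .
qed

lemma nn_integral_expo_rescale:
  assumes u: "0 < u" and r: "0 < r" and [measurable]: "\<phi> \<in> borel_measurable borel"
  shows "(\<integral>\<^sup>+x. \<phi> (u * x) \<partial>expo r) = (\<integral>\<^sup>+x. \<phi> x \<partial>expo (r / u))"
proof -
  have "(\<integral>\<^sup>+x. \<phi> x \<partial>expo (r / u)) = (\<integral>\<^sup>+x. ennreal (r / u * exp (- (r / u) * x)) * indicator {0<..} x * \<phi> x \<partial>lborel)"
    using u r by (subst nn_integral_expo) auto
  also have "\<dots> = ennreal u * (\<integral>\<^sup>+x. ennreal (r / u * exp (- (r / u) * (u * x))) * indicator {0<..} (u * x) * \<phi> (u * x) \<partial>lborel)"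
    using u by (subst nn_integral_real_affine[where c=u and t=0]) simp_all
  also have "\<dots> = (\<integral>\<^sup>+x. ennreal u * (ennreal (r / u * exp (- (r / u) * (u * x))) * indicator {0<..} (u * x) * \<phi> (u * x)) \<partial>lborel)"
    by (rule nn_integral_cmult[symmetric]) measurable
  also have "\<dots> = (\<integral>\<^sup>+x. ennreal (r * exp (- r * x)) * indicator {0<..} x * \<phi> (u * x) \<partial>lborel)"
  proof (rule nn_integral_cong)
    fix x :: real
    have "ennreal u * ennreal (r / u * exp (- (r / u) * (u * x))) = ennreal (r * exp (- r * x))"
      using u r by (simp add: ennreal_mult'[symmetric])
    moreover have "indicator {0<..} (u * x) = (indicator {0<..} x :: ennreal)"
      using u by (auto simp: zero_less_mult_iff split: split_indicator)
    ultimately show "ennreal u * (ennreal (r / u * exp (- (r / u) * (u * x))) * indicator {0<..} (u * x) * \<phi> (u * x)) =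
        ennreal (r * exp (- r * x)) * indicator {0<..} x * \<phi> (u * x)"
      by (simp only: mult.assoc[symmetric])
  qed
  also have "\<dots> = (\<integral>\<^sup>+x. \<phi> (u * x) \<partial>expo r)"
    using r by (subst nn_integral_expo) auto
  finally show ?thesis by simp
qed

context hbp
begin

text \<open>Dilating by c divides every exponential rate by c and keeps the events, so the dilated
  laws solve the equation for the rates \<open>lam j / c\<close>; uniqueness identifies
  them.\<close>

lemma distr_scale:
  assumes S: "hbp Tk lam'" and c: "0 < c" and rate: "\<And>j. 1 \<le> j \<Longrightarrow> lam' j = lam j / c" and J: "1 \<le> J"
  shows "distr (tree_law J) ptree_space (scale c) = hbp.tree_law Tk lam' J"
proof -
  interpret S: hbp Tk lam' by fact
  have sc [measurable]: "scale c \<in> measurable ptree_space ptree_space" by measurable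
  show ?thesis
  proof (rule S.tree_law_unique[OF _ _ _ J, of "\<lambda>j. distr (tree_law j) ptree_space (scale c)"])
    show "prob_space (distr (tree_law j) ptree_space (scale c))" for j
      by (rule T.prob_space_distr) measurable
    fix j :: nat and f :: "posreal ptree \<Rightarrow> ennreal"
    assume j: "1 \<le> j" and f [measurable]: "f \<in> borel_measurable ptree_space"
    let ?Q = "\<lambda>j. distr (tree_law j) ptree_space (scale c)"
    define \<phi> where "\<phi> x = (\<Sum>e<j. ennreal (event_prob j e) * step ?Q j e f x)" for x
    have dd: "(\<integral>\<^sup>+s. \<integral>\<^sup>+t. f (node x s t) \<partial>?Q k \<partial>?Q i) = (\<integral>\<^sup>+s. \<integral>\<^sup>+t. f (node x (scale c s) (scale c t)) \<partial>tree_law k \<partial>tree_law i)" for x i k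
    proof -
      interpret Q: prob_space "?Q k" by (rule T.prob_space_distr) measurable
      have "(\<integral>\<^sup>+s. \<integral>\<^sup>+t. f (node x s t) \<partial>?Q k \<partial>?Q i) = (\<integral>\<^sup>+s. \<integral>\<^sup>+t. f (node x (scale c s) t) \<partial>?Q k \<partial>tree_law i)"
        by (subst nn_integral_distr[of "scale c" "tree_law i"]) measurable
      also have "\<dots> = (\<integral>\<^sup>+s. \<integral>\<^sup>+t. f (node x (scale c s) (scale c t)) \<partial>tree_law k \<partial>tree_law i)"
        by (intro nn_integral_cong, subst nn_integral_distr) measurable
      finally show ?thesis .
    qed
    have stepQ: "step ?Q j e f x = (if e = 0 then if j = 1 then f (leaf x)
         else \<integral>\<^sup>+s. \<integral>\<^sup>+t. f (node x (scale c s) (scale c t)) \<partial>tree_law (j - 1) \<partial>tree_law (j - 1)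
       else \<integral>\<^sup>+s. \<integral>\<^sup>+t. f (node x (scale c s) (scale c t)) \<partial>tree_law e \<partial>tree_law j)" for e x
      by (simp only: step_def dd)
    have \<phi>m: "\<phi> \<in> borel_measurable borel"
      unfolding \<phi>_def stepQ by measurable
    have "(\<integral>\<^sup>+p. f p \<partial>?Q j) = (\<integral>\<^sup>+p. f (scale c p) \<partial>tree_law j)"
      by (rule nn_integral_distr) measurable
    also have "\<dots> = (\<integral>\<^sup>+x. \<phi> (c * x) \<partial>expo (edge_rate j))"
      unfolding \<phi>_def stepQ
      by (rule nn_integral_tree_law_cong[OF j]) (measurable, simp_all add: scale_leaf scale_node)
    also have "\<dots> = (\<integral>\<^sup>+x. \<phi> x \<partial>expo (edge_rate j / c))"
      by (rule nn_integral_expo_rescale[OF c edge_rate_pos[OF j] \<phi>m])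
    also have "edge_rate j / c = lam' j * total j" using rate[OF j] by simp
    finally show "(\<integral>\<^sup>+p. f p \<partial>?Q j) = (\<integral>\<^sup>+x. (\<Sum>e<j. ennreal (event_prob j e) * step ?Q j e f x) \<partial>expo (lam' j * total j))"
      by (simp only: \<phi>_def)
  qed simp
qed

end

context hbp_mixture
begin

section \<open>The two directions of self-similarity with edge lengths\<close>

lemma length_self_similar_if:
  assumes \<zeta>: "0 < \<zeta>" and geo: "\<exists>q. 0 < q \<and> q < 1 \<and> (\<forall>K\<ge>1. pmf p K = q * (1 - q) ^ (K - 1))"
    and rate: "\<And>j. 1 \<le> j \<Longrightarrow> lam (Suc j) = lam j / \<zeta>"
  shows "length_self_similar p law \<zeta>"
proof -
  from geo obtain q where q: "0 < q" "q < 1" "\<And>K. 1 \<le> K \<Longrightarrow> pmf p K = q * (1 - q) ^ (K - 1)" by blast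
  have pK: "0 < pmf p K" if "1 \<le> K" for K using q(1,2) q(3)[OF that] by simp
  have inv: "prune_invariant (shape_law mix)"
    unfolding prune_invariant_iff pmf_geometric_iff[OF p0] by (rule geo)
  have order_Some: "\<exists>\<sigma>. \<tau> = Some \<sigma>" if "1 \<le> K" "hs_order \<tau> = K" for K and \<tau> :: ctree
    using that by (cases \<tau>) auto
  \<comment> \<open>By the relation between the rates, the shifted process is the original one
    dilated by \<zeta>, and neither shape nor proportions notice a dilation.\<close>
  have scaled: "proportions_law (S.law K) (Some \<sigma>) = proportions_law (law K) (Some \<sigma>)" if K: "1 \<le> K" for K \<sigma>
  proof (rule measure_eqI)
    fix A assume "A \<in> sets (proportions_law (S.law K) (Some \<sigma>))"
    then have A: "A \<in> sets vec_space" by (simp add: proportions_law_def)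
    have Am: "(\<lambda>t. indicator A (pad (proportions t)) :: ennreal) \<in> borel_measurable ltree_space"
      using measurable_compose[OF measurable_pad_proportions, of "indicator A"] A by simp
    let ?I = "indicator {p. ushape (forget p) = \<sigma>} :: posreal ptree \<Rightarrow> ennreal"
    have Im: "?I \<in> borel_measurable ptree_space"
      using measurable_sets[OF measurable_ushape_forget, of "{\<sigma>}"] by (simp add: vimage_def)
    have em: "emeasure (distr G vec_space (\<lambda>t. pad (proportions t))) A = (\<integral>\<^sup>+t. indicator A (pad (proportions t)) \<partial>G)"
      if "sets G = sets ltree_space" for G
    proof -
      have "(\<lambda>t. pad (proportions t)) \<in> measurable G vec_space"
        unfolding measurable_cong_sets[OF that refl] by measurable
      then show ?thesis using A by (subst nn_integral_indicator[symmetric], simp, subst nn_integral_distr) simp_all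
    qed
    have "emeasure (proportions_law (S.law K) (Some \<sigma>)) A =
        (\<integral>\<^sup>+p. ?I p * indicator A (pad (proportions (tree_of p))) \<partial>S.tree_law K) / emeasure (S.law K) {t. shape t = Some \<sigma>}"
      unfolding proportions_law_def em[OF S.sets_given_shape] by (rule S.nn_integral_given_shape[OF K Am])
    also have "(\<integral>\<^sup>+p. ?I p * indicator A (pad (proportions (tree_of p))) \<partial>S.tree_law K) =
        (\<integral>\<^sup>+p. ?I (scale \<zeta> p) * indicator A (pad (proportions (tree_of (scale \<zeta> p)))) \<partial>tree_law K)"
    proof -
      have S: "S.tree_law K = distr (tree_law K) ptree_space (scale \<zeta>)"
        using distr_scale[OF hbp_shift \<zeta> rate K] by simp
      have g: "(\<lambda>p. ?I p * indicator A (pad (proportions (tree_of p)))) \<in> borel_measurable ptree_space"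
        by (rule borel_measurable_times_ennreal[OF Im measurable_compose[OF measurable_Some_forget Am]])
      have sc: "scale \<zeta> \<in> measurable (tree_law K) ptree_space" by measurable
      show ?thesis
        unfolding S by (rule nn_integral_distr[OF sc]) (simp add: g)
    qed
    also have "\<dots> = (\<integral>\<^sup>+p. ?I p * indicator A (pad (proportions (tree_of p))) \<partial>tree_law K)"
      by (simp add: proportions_scale[OF \<zeta>] indicator_def ushape_forget)
    also have "emeasure (S.law K) {t. shape t = Some \<sigma>} = emeasure (law K) {t. shape t = Some \<sigma>}"
      by (rule emeasure_S_law_shape[OF K])
    also have "(\<integral>\<^sup>+p. ?I p * indicator A (pad (proportions (tree_of p))) \<partial>tree_law K) / emeasure (law K) {t. shape t = Some \<sigma>} =
        emeasure (proportions_law (law K) (Some \<sigma>)) A"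
      unfolding proportions_law_def em[OF sets_given_shape] by (rule nn_integral_given_shape[OF K Am, symmetric])
    finally show "emeasure (proportions_law (S.law K) (Some \<sigma>)) A = emeasure (proportions_law (law K) (Some \<sigma>)) A" .
  qed (simp add: proportions_law_def)
  show ?thesis
    unfolding length_self_similar_def Let_def mix_def[symmetric] pruned_def[symmetric]
  proof (intro conjI order_family_law inv allI impI)
    fix K H :: nat and \<tau> :: ctree
    assume *: "1 \<le> K \<and> K \<le> H \<and> hs_order \<tau> = K"
    show "measure (shape_law (subtree_law law K H)) {\<tau>} = measure (shape_law (law K)) {\<tau>}"
      using * by (simp add: subtree_law_law)
  next
    fix K H :: nat and \<tau> :: ctree
    assume *: "1 \<le> K \<and> K \<le> H \<and> hs_order \<tau> = K \<and> 0 < measure (shape_law (law K)) {\<tau>}"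
    show "proportions_law (subtree_law law K H) \<tau> = proportions_law (law K) \<tau>"
      using * by (simp add: subtree_law_law)
    obtain \<sigma> where \<sigma>: "\<tau> = Some \<sigma>" using order_Some * by blast
    show "\<exists>F F'. length_density (law K) \<tau> F \<and> length_density (subtree_law law K H) \<tau> F' \<and> (\<forall>x. AE l in lborel. F' x l = F x l)"
      using * length_density_law[of K \<sigma>] unfolding \<sigma>
      by (intro exI[of _ "gamma_length edge_rate \<sigma>"]) (simp add: subtree_law_law)
  next
    fix \<tau> assume pos: "0 < measure (shape_law mix) {\<tau>}"
    have "\<tau> \<noteq> None"
    proof
      assume "\<tau> = None"
      with pos inv show False by (simp add: prune_invariant_def)
    qed
    then obtain \<sigma> where \<sigma>: "\<tau> = Some \<sigma>" by auto
    define K where "K = hs_order \<tau>"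
    have K: "1 \<le> K" "hs_order \<tau> = K" using forget_surj[of \<sigma>] by (auto simp: K_def \<sigma>)
    note gm = given_shape_mix[OF K pK[OF K(1)]]
    have gp: "given_shape pruned \<tau> = given_shape (S.law K) \<tau>"
      by (rule given_shape_pruned[OF K pK]) simp
    show "proportions_law pruned \<tau> = proportions_law mix \<tau>"
      using scaled[OF K(1), of \<sigma>] length_density_cong(1)[OF gm] length_density_cong(1)[OF gp] by (simp add: \<sigma>)
    \<comment> \<open>The relation between the rates is given from order 1 on, which suffices
      because no edge has order 0.\<close>
    have w: "gamma_length (\<lambda>j. lam (Suc j) * total j) \<sigma> = gamma_length (\<lambda>j. edge_rate j / \<zeta>) \<sigma>"
      by (rule gamma_length_cong) (simp add: rate)
    show "\<exists>F \<Phi>. length_density mix \<tau> F \<and> length_density pruned \<tau> \<Phi> \<and> (\<forall>x l. \<Phi> x l = inverse \<zeta> * F x (l / \<zeta>))"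
    proof (intro exI conjI allI)
      show "length_density mix \<tau> (gamma_length edge_rate \<sigma>)"
        unfolding length_density_cong(2)[OF gm] unfolding \<sigma> by (rule length_density_law[OF K(1)])
      show "length_density pruned \<tau> (gamma_length (\<lambda>j. edge_rate j / \<zeta>) \<sigma>)"
        unfolding length_density_cong(2)[OF gp] w[symmetric] unfolding \<sigma> by (rule S.length_density_law[OF K(1)])
      show "gamma_length (\<lambda>j. edge_rate j / \<zeta>) \<sigma> x l = inverse \<zeta> * gamma_length edge_rate \<sigma> x (l / \<zeta>)" for x l
        by (rule gamma_length_scale[OF \<zeta>])
    qed
  qed
qed

lemma length_self_similarD:
  assumes \<zeta>: "0 < \<zeta>" and ss: "length_self_similar p law \<zeta>"
  shows "\<exists>q. 0 < q \<and> q < 1 \<and> (\<forall>K\<ge>1. pmf p K = q * (1 - q) ^ (K - 1))"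
    and "1 \<le> j \<Longrightarrow> lam (Suc j) = lam j / \<zeta>"
proof -
  have inv: "prune_invariant (shape_law mix)"
    using ss unfolding length_self_similar_def Let_def mix_def by blast
  then show geo: "\<exists>q. 0 < q \<and> q < 1 \<and> (\<forall>K\<ge>1. pmf p K = q * (1 - q) ^ (K - 1))"
    unfolding prune_invariant_iff pmf_geometric_iff[OF p0] .
  then obtain q where q: "0 < q" "q < 1" "\<And>K. 1 \<le> K \<Longrightarrow> pmf p K = q * (1 - q) ^ (K - 1)" by blast
  have pK: "0 < pmf p K" if "1 \<le> K" for K using q(1,2) q(3)[OF that] by simp
  \<comment> \<open>Means are taken in the relation between the two densities. Under the
    substitution of \<zeta> l for l, the factor 1/\<zeta> of the density cancels against the
    Jacobian, and the length itself yields the remaining \<zeta>.\<close>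
  have S: "S.perfect_length n = \<zeta> * perfect_length n" for n
  proof -
    let ?\<tau> = "Some (forget (perfect n)) :: ctree"
    have K: "1 \<le> Suc n" "hs_order ?\<tau> = Suc n" by simp_all
    note gm = given_shape_mix[OF K pK[OF K(1)]]
    have gp: "given_shape pruned ?\<tau> = given_shape (S.law (Suc n)) ?\<tau>"
      by (rule given_shape_pruned[OF K pK]) simp
    have "measure (shape_law mix) {?\<tau>} = measure mix {t. shape t = ?\<tau>}"
      unfolding shape_law_def by (subst measure_distr) (auto simp: vimage_def)
    also have "\<dots> > 0"
      unfolding measure_shape_mix[OF K] using pK[OF K(1)] perfect_shape_pos[of n] by simp
    finally have "0 < measure (shape_law mix) {?\<tau>}" .
    with ss obtain F \<Phi> where F: "proportions_law pruned ?\<tau> = proportions_law mix ?\<tau>" "length_density mix ?\<tau> F"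
      "length_density pruned ?\<tau> \<Phi>" "\<And>x l. \<Phi> x l = inverse \<zeta> * F x (l / \<zeta>)"
      unfolding length_self_similar_def Let_def mix_def[symmetric] pruned_def[symmetric] by blast
    have Fm: "(\<lambda>(x, l). F x l) \<in> borel_measurable (vec_space \<Otimes>\<^sub>M lborel)" and F0: "0 \<le> F x l" for x l
      using F(2) by (auto simp: length_density_def)
    have Fx: "F x \<in> borel_measurable borel" for x
    proof -
      have "(\<lambda>l. (x, l)) \<in> measurable borel (vec_space \<Otimes>\<^sub>M lborel)"
        by (intro measurable_Pair measurable_const) (auto simp: space_PiM)
      from measurable_compose[OF this Fm] show ?thesis by simp
    qed
    have Fm': "(\<lambda>x. \<integral>\<^sup>+l. ennreal (F x l) * ennreal l \<partial>lborel) \<in> borel_measurable (proportions_law mix ?\<tau>)"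
    proof -
      have "(\<lambda>x. \<integral>\<^sup>+l. ennreal (F x l) * ennreal l \<partial>lborel) \<in> borel_measurable vec_space"
        using Fm by (intro lborel.borel_measurable_nn_integral) (simp add: split_beta')
      then show ?thesis by (simp add: proportions_law_def)
    qed
    have "ennreal (S.perfect_length n) = (\<integral>\<^sup>+t. ennreal (tree_length t) \<partial>given_shape pruned ?\<tau>)"
      unfolding gp by (rule S.mean_length_perfect[symmetric])
    also have "\<dots> = (\<integral>\<^sup>+x. (\<integral>\<^sup>+l. ennreal (\<Phi> x l) * ennreal l \<partial>lborel) \<partial>proportions_law mix ?\<tau>)"
      using nn_integral_length_density[OF F(3)] by (simp add: gp F(1))
    also have "\<dots> = (\<integral>\<^sup>+x. ennreal \<zeta> * (\<integral>\<^sup>+l. ennreal (F x l) * ennreal l \<partial>lborel) \<partial>proportions_law mix ?\<tau>)"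
    proof (rule nn_integral_cong)
      fix x
      have [measurable]: "F x \<in> borel_measurable borel" by (rule Fx)
      have "(\<integral>\<^sup>+l. ennreal (\<Phi> x l) * ennreal l \<partial>lborel) = (\<integral>\<^sup>+l. ennreal (inverse \<zeta> * F x (l / \<zeta>)) * ennreal l \<partial>lborel)"
        by (simp only: F(4))
      also have "\<dots> = ennreal \<zeta> * (\<integral>\<^sup>+l. ennreal (inverse \<zeta> * F x (\<zeta> * l / \<zeta>)) * ennreal (\<zeta> * l) \<partial>lborel)"
        using \<zeta> by (subst nn_integral_real_affine[where c=\<zeta> and t=0]) simp_all
      also have "(\<integral>\<^sup>+l. ennreal (inverse \<zeta> * F x (\<zeta> * l / \<zeta>)) * ennreal (\<zeta> * l) \<partial>lborel) = (\<integral>\<^sup>+l. ennreal (F x l) * ennreal l \<partial>lborel)"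
      proof (rule nn_integral_cong)
        fix l :: real
        \<comment> \<open>At negative l the truncation in \<open>ennreal\<close> makes both sides
          0.\<close>
        have "ennreal (inverse \<zeta> * F x l) * ennreal (\<zeta> * l) = ennreal (F x l) * ennreal l"
        proof (cases "0 \<le> l")
          case True
          then show ?thesis using \<zeta> F0[of x l] by (simp add: ennreal_mult[symmetric])
        next
          case False
          then have "\<zeta> * l \<le> 0" using \<zeta> by (simp add: mult_nonneg_nonpos)
          with False show ?thesis by (simp add: ennreal_neg)
        qed
        then show "ennreal (inverse \<zeta> * F x (\<zeta> * l / \<zeta>)) * ennreal (\<zeta> * l) = ennreal (F x l) * ennreal l"
          using \<zeta> by simp
      qed
      finally show "(\<integral>\<^sup>+l. ennreal (\<Phi> x l) * ennreal l \<partial>lborel) = ennreal \<zeta> * (\<integral>\<^sup>+l. ennreal (F x l) * ennreal l \<partial>lborel)" .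
    qed
    also have "\<dots> = ennreal \<zeta> * (\<integral>\<^sup>+x. (\<integral>\<^sup>+l. ennreal (F x l) * ennreal l \<partial>lborel) \<partial>proportions_law mix ?\<tau>)"
      by (rule nn_integral_cmult[OF Fm'])
    also have "(\<integral>\<^sup>+x. (\<integral>\<^sup>+l. ennreal (F x l) * ennreal l \<partial>lborel) \<partial>proportions_law mix ?\<tau>) =
        (\<integral>\<^sup>+t. ennreal (tree_length t) \<partial>given_shape mix ?\<tau>)"
      using nn_integral_length_density[OF F(2)] by (simp add: gm)
    also have "\<dots> = ennreal (perfect_length n)"
      unfolding gm by (rule mean_length_perfect)
    finally show ?thesis
      using \<zeta> perfect_length_nonneg[of n] S.perfect_length_nonneg[of n] by (simp add: ennreal_mult[symmetric])
  qed
  show "lam (Suc j) = lam j / \<zeta>" if j: "1 \<le> j"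
  proof -
    \<comment> \<open>\<open>perfect_length\<close> at n + 1 minus twice its value at n is the mean
      of an edge of order n + 2, which isolates one rate; \<open>total j\<close> is common to both
      processes and cancels below.\<close>
    have "1 / (lam (Suc j) * total j) = \<zeta> * (1 / (lam j * total j))"
    proof (cases "j = 1")
      case True
      then show ?thesis using S[of 0] by simp
    next
      case False
      then obtain n where "j = Suc (Suc n)" using j by (metis One_nat_def not0_implies_Suc not_one_le_zero)
      then show ?thesis using S[of n] S[of "Suc n"] by (simp add: distrib_left)
    qed
    then show ?thesis using lam[OF j] lam[of "Suc j"] \<zeta> total_neq_0[of j] by (simp add: field_simps)
  qed
qed

end

text \<open>The constant is \<gamma> = \<open>lam 1 * \<zeta>\<close>, the value that the formula
  forces at j = 1.\<close>

lemma geometric_rate_iff: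
  fixes lam :: "nat \<Rightarrow> real"
  assumes "\<And>j. 1 \<le> j \<Longrightarrow> 0 < lam j" "0 < \<zeta>"
  shows "(\<forall>j\<ge>1. lam (Suc j) = lam j / \<zeta>) \<longleftrightarrow> (\<exists>\<gamma>>0. \<forall>j\<ge>1. lam j = \<gamma> * \<zeta> powi (- int j))"
proof
  have power: "\<zeta> powi (- int (Suc j)) = \<zeta> powi (- int j) / \<zeta>" for j
    unfolding power_int_minus power_int_of_nat power_Suc by (simp add: divide_inverse)
  {
    assume R: "\<forall>j\<ge>1. lam (Suc j) = lam j / \<zeta>"
    have "lam (Suc k) = lam 1 * \<zeta> * \<zeta> powi (- int (Suc k))" for k
    proof (induction k)
      case 0
      then show ?case unfolding power using assms(2) by simp
    next
      case (Suc k)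
      have "lam (Suc (Suc k)) = lam (Suc k) / \<zeta>" using R by simp
      also have "\<dots> = lam 1 * \<zeta> * (\<zeta> powi (- int (Suc k)) / \<zeta>)"
        unfolding Suc by (rule times_divide_eq_right[symmetric])
      finally show ?case unfolding power[of "Suc k"] .
    qed
    then have "lam j = lam 1 * \<zeta> * \<zeta> powi (- int j)" if "1 \<le> j" for j
      by (metis that Suc_le_D One_nat_def)
    moreover have "0 < lam 1 * \<zeta>" using assms by simp
    ultimately show "\<exists>\<gamma>>0. \<forall>j\<ge>1. lam j = \<gamma> * \<zeta> powi (- int j)" by blast
  }
  assume "\<exists>\<gamma>>0. \<forall>j\<ge>1. lam j = \<gamma> * \<zeta> powi (- int j)"
  then obtain \<gamma> where \<gamma>: "\<And>j. 1 \<le> j \<Longrightarrow> lam j = \<gamma> * \<zeta> powi (- int j)" by blast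
  have "lam (Suc j) = lam j / \<zeta>" if "1 \<le> j" for j
    unfolding \<gamma>[OF that] \<gamma>[of "Suc j", OF le_SucI[OF that]] power by simp
  then show "\<forall>j\<ge>1. lam (Suc j) = lam j / \<zeta>" by blast
qed

theorem theorem4:
  fixes Tk lam :: "nat \<Rightarrow> real" and p :: "nat pmf"
  assumes "\<And>k. k \<ge> 1 \<Longrightarrow> Tk k \<ge> 0"
    and "\<And>j. j \<ge> 1 \<Longrightarrow> lam j > 0"
    and "0 \<notin> set_pmf p"
  shows "mean_self_similar (\<lambda>K. shape_law (hbp_law Tk lam K)) Tk
    \<and> (self_similar p (\<lambda>K. shape_law (hbp_law Tk lam K)) \<and>
         mean_self_similar (\<lambda>K. shape_law (hbp_law Tk lam K)) Tk \<longleftrightarrow>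
       (\<exists>q. 0 < q \<and> q < 1 \<and> (\<forall>K\<ge>1. pmf p K = q * (1 - q) ^ (K - 1))))
    \<and> (\<forall>\<zeta>>0. length_self_similar p (hbp_law Tk lam) \<zeta> \<longleftrightarrow>
         (\<exists>q \<gamma>. 0 < q \<and> q < 1 \<and> \<gamma> > 0 \<and>
           (\<forall>K\<ge>1. pmf p K = q * (1 - q) ^ (K - 1)) \<and>
           (\<forall>j\<ge>1. lam j = \<gamma> * \<zeta> powi (- int j))))"
proof (intro conjI allI impI)
  interpret hbp_mixture Tk lam p
    using assms by unfold_locales auto
  show "mean_self_similar (\<lambda>K. shape_law (hbp_law Tk lam K)) Tk"
    by (rule mean_self_similar_law)
  then show "self_similar p (\<lambda>K. shape_law (hbp_law Tk lam K)) \<and>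
         mean_self_similar (\<lambda>K. shape_law (hbp_law Tk lam K)) Tk \<longleftrightarrow>
       (\<exists>q. 0 < q \<and> q < 1 \<and> (\<forall>K\<ge>1. pmf p K = q * (1 - q) ^ (K - 1)))"
    unfolding self_similar_iff pmf_geometric_iff[OF assms(3)] by blast
  fix \<zeta> :: real assume \<zeta>: "0 < \<zeta>"
  have iff: "length_self_similar p (hbp_law Tk lam) \<zeta> \<longleftrightarrow>
      (\<exists>q. 0 < q \<and> q < 1 \<and> (\<forall>K\<ge>1. pmf p K = q * (1 - q) ^ (K - 1))) \<and> (\<forall>j\<ge>1. lam (Suc j) = lam j / \<zeta>)"
    using length_self_similar_if[OF \<zeta>] length_self_similarD[OF \<zeta>] by blast
  have rate: "(\<forall>j\<ge>1. lam (Suc j) = lam j / \<zeta>) \<longleftrightarrow> (\<exists>\<gamma>>0. \<forall>j\<ge>1. lam j = \<gamma> * \<zeta> powi (- int j))"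
    by (rule geometric_rate_iff[OF assms(2) \<zeta>])
  have swap: "((\<exists>q. 0 < q \<and> q < 1 \<and> P q) \<and> (\<exists>\<gamma>>0. Q \<gamma>)) \<longleftrightarrow> (\<exists>q \<gamma>. 0 < q \<and> q < 1 \<and> \<gamma> > 0 \<and> P q \<and> Q \<gamma>)"
    for P Q :: "real \<Rightarrow> bool"
    by blast
  show "length_self_similar p (hbp_law Tk lam) \<zeta> \<longleftrightarrow>
         (\<exists>q \<gamma>. 0 < q \<and> q < 1 \<and> \<gamma> > 0 \<and>
           (\<forall>K\<ge>1. pmf p K = q * (1 - q) ^ (K - 1)) \<and>
           (\<forall>j\<ge>1. lam j = \<gamma> * \<zeta> powi (- int j)))"
    unfolding iff rate by (rule swap)
qed

end
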